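(* Let $C$ be an infinite cyclic group, $M$ a $\mathbb{Z}[C]$-module, $Q=M\rtimes C$, and let $1\to N\to G\to Q\to 1$ be a stem-extension of $Q$. Then there exists a map $\alpha_3':H_3(Q)\to H_2(Q)$, given as a composition $$H_3(Q)\to H_1(C,\Lambda^2(M))\hookrightarrow\Lambda^2(M)\twoheadrightarrow\Lambda^2(M)_C\hookrightarrow H_2(Q)$$ for some homomorphism $H_3(Q)\to H_1(C,\Lambda^2(M))$, such that the following square is commutative: $$\begin{array}{ccc}H_3(Q)&\xrightarrow{\ \alpha_3'\ }&H_2(Q)\\ {\scriptstyle\delta}\downarrow&&\downarrow{\scriptstyle\beta}\\ G_{ab}\otimes N&\longrightarrow&N\end{array}$$ where the lower horizontal map is the projection $G_{ab}\otimes N\to C\otimes N=N$.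
   Context: Homology is with integral coefficients unless indicated. A stem-extension is a central extension $1\to N\to G\to Q\to1$ with $N\subseteq[G,G]$; then $G_{ab}=Q_{ab}$ and there is a natural exact sequence (Eckmann–Hilton–Stammbach) $$H_3(G)\to H_3(Q)\xrightarrow{\delta}G_{ab}\otimes N\to H_2(G)\to H_2(Q)\xrightarrow{\beta}N\to0,$$ where $\beta$ is the map of the five-term exact sequence and $\delta$ is described as follows. Present the extension as $1\to S/R\to F/R\to F/S\to1$ with $F$ free and $R\subset S$ normal subgroups of $F$, $[F,S]\subseteq R$. Then $\delta$ is induced by the natural epimorphism $S_{ab}\to S/R$: $$H_3(Q)=H_1(F/S,S_{ab})\to H_1(F/S,S/R)=Q_{ab}\otimes N=G_{ab}\otimes N.$$ In the composition defining $\alpha_3'$: $C$ acts diagonally on $\Lambda^2(M)=H_2(M)$; $H_1(C,\Lambda^2(M))\hookrightarrow\Lambda^2(M)$ is the identification of $H_1$ of the infinite cyclic group $C$ with the invariants $\Lambda^2(M)^C$; $\Lambda^2(M)\twoheadrightarrow\Lambda^2(M)_C$ is the projection to coinvariants; $\Lambda^2(M)_C=H_2(M)_C\hookrightarrow H_2(Q)$ is induced by $M\hookrightarrow Q$. The projection $G_{ab}\otimes N\to C\otimes N$ is induced by $G\to Q\to C$, and $C\otimes N=N$ via a fixed generator $t$ of $C$. *)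

theory Defs
  imports "HOL-Algebra.Free_Abelian_Groups"
begin

text \<open>
  Abelian groups, in particular all coefficient modules and homology groups, are written
  multiplicatively, as HOL-Algebra groups.
\<close>

section \<open>Quotients, abelianization, free groups\<close>

text \<open>
  The map \<open>A Mod J \<rightarrow> B Mod K\<close> induced by a homomorphism \<open>f\<close> with \<open>f ` J \<subseteq> K\<close>, and the map
  \<open>A Mod J \<rightarrow> B\<close> induced by a homomorphism that is trivial on \<open>J\<close>.
\<close>

definition quot_map :: "'b monoid \<Rightarrow> 'b set \<Rightarrow> ('a \<Rightarrow> 'b) \<Rightarrow> 'a set \<Rightarrow> 'b set" where
  "quot_map B K f X = K <#>\<^bsub>B\<^esub> (f ` X)"

definition quot_lift :: "('a \<Rightarrow> 'b) \<Rightarrow> 'a set \<Rightarrow> 'b" where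
  "quot_lift f X = the_elem (f ` X)"

definition abelianization :: "'g monoid \<Rightarrow> 'g set monoid" where
  "abelianization G = G Mod derived G (carrier G)"

definition abelianization_map :: "'h monoid \<Rightarrow> ('g \<Rightarrow> 'h) \<Rightarrow> 'g set \<Rightarrow> 'h set" where
  "abelianization_map H f = quot_map H (derived H (carrier H)) f"

text \<open>The letter \<open>(x, True)\<close> stands for \<open>x\<close> and \<open>(x, False)\<close> for its inverse.\<close>

fun eval_word :: "'f monoid \<Rightarrow> ('f \<times> bool) list \<Rightarrow> 'f" where
  "eval_word F [] = \<one>\<^bsub>F\<^esub>"
| "eval_word F ((x, b) # w) = (if b then x else inv\<^bsub>F\<^esub> x) \<otimes>\<^bsub>F\<^esub> eval_word F w"

definition reduced_word :: "('f \<times> bool) list \<Rightarrow> bool" where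
  "reduced_word w \<longleftrightarrow>
     (\<forall>i. Suc i < length w \<longrightarrow> fst (w ! i) = fst (w ! Suc i) \<longrightarrow> snd (w ! i) = snd (w ! Suc i))"

definition free_group :: "'f monoid \<Rightarrow> bool" where
  "free_group F \<longleftrightarrow> group F \<and>
     (\<exists>X \<subseteq> carrier F. generate F X = carrier F \<and>
        (\<forall>w. w \<noteq> [] \<and> reduced_word w \<and> fst ` set w \<subseteq> X \<longrightarrow> eval_word F w \<noteq> \<one>\<^bsub>F\<^esub>))"

definition infinite_cyclic :: "'c monoid \<Rightarrow> 'c \<Rightarrow> bool" where
  "infinite_cyclic C t \<longleftrightarrow>
     group C \<and> infinite (carrier C) \<and> t \<in> carrier C \<and> generate C {t} = carrier C"

section \<open>Modules over group rings\<close>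

text \<open>A \<open>\<int>[Q]\<close>-module is an abelian group with a left action of \<open>Q\<close> by endomorphisms.\<close>

locale group_module =
  Q: group Q + A: comm_group A for Q :: "'q monoid" and A :: "'a monoid" +
  fixes act :: "'q \<Rightarrow> 'a \<Rightarrow> 'a"
  assumes act_hom: "q \<in> carrier Q \<Longrightarrow> act q \<in> hom A A"
    and act_one: "a \<in> carrier A \<Longrightarrow> act \<one>\<^bsub>Q\<^esub> a = a"
    and act_mult: "\<lbrakk>q \<in> carrier Q; r \<in> carrier Q; a \<in> carrier A\<rbrakk>
                    \<Longrightarrow> act (q \<otimes>\<^bsub>Q\<^esub> r) a = act q (act r a)"

definition trivial_act :: "'q \<Rightarrow> 'a \<Rightarrow> 'a" where
  "trivial_act q a = a"

definition invariants :: "'q monoid \<Rightarrow> 'a monoid \<Rightarrow> ('q \<Rightarrow> 'a \<Rightarrow> 'a) \<Rightarrow> 'a set" where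
  "invariants Q A act = {a \<in> carrier A. \<forall>q \<in> carrier Q. act q a = a}"

text \<open>Coinvariants are taken with respect to a set \<open>S\<close> of acting elements.\<close>

definition coinvariants_kernel :: "'q set \<Rightarrow> 'a monoid \<Rightarrow> ('q \<Rightarrow> 'a \<Rightarrow> 'a) \<Rightarrow> 'a set" where
  "coinvariants_kernel S A act =
     generate A {act q a \<otimes>\<^bsub>A\<^esub> inv\<^bsub>A\<^esub> a | q a. q \<in> S \<and> a \<in> carrier A}"

definition coinvariants :: "'q set \<Rightarrow> 'a monoid \<Rightarrow> ('q \<Rightarrow> 'a \<Rightarrow> 'a) \<Rightarrow> 'a set monoid" where
  "coinvariants S A act = A Mod coinvariants_kernel S A act"

definition to_coinvariants :: "'q set \<Rightarrow> 'a monoid \<Rightarrow> ('q \<Rightarrow> 'a \<Rightarrow> 'a) \<Rightarrow> 'a \<Rightarrow> 'a set" where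
  "to_coinvariants S A act a = coinvariants_kernel S A act #>\<^bsub>A\<^esub> a"

text \<open>The group law of \<open>M \<rtimes> C\<close> is \<open>(m, c) (n, d) = (m + c n, c d)\<close>.\<close>

definition semidirect_product ::
    "'m monoid \<Rightarrow> 'c monoid \<Rightarrow> ('c \<Rightarrow> 'm \<Rightarrow> 'm) \<Rightarrow> ('m \<times> 'c) monoid" where
  "semidirect_product M C act =
     \<lparr>carrier = carrier M \<times> carrier C,
      monoid.mult = (\<lambda>(m, c) (n, d). (m \<otimes>\<^bsub>M\<^esub> act c n, c \<otimes>\<^bsub>C\<^esub> d)),
      one = (\<one>\<^bsub>M\<^esub>, \<one>\<^bsub>C\<^esub>)\<rparr>"

section \<open>Tensor products and exterior squares of abelian groups\<close>

text \<open>The extension of \<open>f\<close>, given on a basis, to a homomorphism from a free abelian group to \<open>H\<close>.\<close>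

definition free_extend :: "'h monoid \<Rightarrow> ('x \<Rightarrow> 'h) \<Rightarrow> ('x \<Rightarrow>\<^sub>0 int) \<Rightarrow> 'h" where
  "free_extend H f c =
     finprod H (\<lambda>x. f x [^]\<^bsub>H\<^esub> Poly_Mapping.lookup c x) (Poly_Mapping.keys c)"

definition bilinear_relations :: "'a monoid \<Rightarrow> 'b monoid \<Rightarrow> (('a \<times> 'b) \<Rightarrow>\<^sub>0 int) set" where
  "bilinear_relations A B =
     {frag_of (a \<otimes>\<^bsub>A\<^esub> a', b) - frag_of (a, b) - frag_of (a', b) | a a' b.
        a \<in> carrier A \<and> a' \<in> carrier A \<and> b \<in> carrier B} \<union>
     {frag_of (a, b \<otimes>\<^bsub>B\<^esub> b') - frag_of (a, b) - frag_of (a, b') | a b b'.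
        a \<in> carrier A \<and> b \<in> carrier B \<and> b' \<in> carrier B}"

definition tensor_kernel :: "'a monoid \<Rightarrow> 'b monoid \<Rightarrow> (('a \<times> 'b) \<Rightarrow>\<^sub>0 int) set" where
  "tensor_kernel A B =
     generate (free_Abelian_group (carrier A \<times> carrier B)) (bilinear_relations A B)"

definition tensor :: "'a monoid \<Rightarrow> 'b monoid \<Rightarrow> (('a \<times> 'b) \<Rightarrow>\<^sub>0 int) set monoid" where
  "tensor A B = free_Abelian_group (carrier A \<times> carrier B) Mod tensor_kernel A B"

definition pure_tensor ::
    "'a monoid \<Rightarrow> 'b monoid \<Rightarrow> 'a \<Rightarrow> 'b \<Rightarrow> (('a \<times> 'b) \<Rightarrow>\<^sub>0 int) set" where
  "pure_tensor A B a b =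
     tensor_kernel A B #>\<^bsub>free_Abelian_group (carrier A \<times> carrier B)\<^esub> frag_of (a, b)"

text \<open>The homomorphism \<open>A \<otimes> B \<rightarrow> H\<close> induced by a bilinear map \<open>A \<times> B \<rightarrow> H\<close>.\<close>

definition tensor_lift ::
    "'h monoid \<Rightarrow> ('a \<Rightarrow> 'b \<Rightarrow> 'h) \<Rightarrow> (('a \<times> 'b) \<Rightarrow>\<^sub>0 int) set \<Rightarrow> 'h" where
  "tensor_lift H \<phi> = quot_lift (free_extend H (\<lambda>(a, b). \<phi> a b))"

definition tensor_map ::
    "'a' monoid \<Rightarrow> 'b' monoid \<Rightarrow> ('a \<Rightarrow> 'a') \<Rightarrow> ('b \<Rightarrow> 'b') \<Rightarrow>
     (('a \<times> 'b) \<Rightarrow>\<^sub>0 int) set \<Rightarrow> (('a' \<times> 'b') \<Rightarrow>\<^sub>0 int) set" where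
  "tensor_map A' B' f g =
     tensor_lift (tensor A' B') (\<lambda>a b. pure_tensor A' B' (f a) (g b))"

definition ext_square_kernel :: "'m monoid \<Rightarrow> (('m \<times> 'm) \<Rightarrow>\<^sub>0 int) set" where
  "ext_square_kernel M =
     generate (free_Abelian_group (carrier M \<times> carrier M))
       (bilinear_relations M M \<union> {frag_of (m, m) | m. m \<in> carrier M})"

definition ext_square :: "'m monoid \<Rightarrow> (('m \<times> 'm) \<Rightarrow>\<^sub>0 int) set monoid" where
  "ext_square M = free_Abelian_group (carrier M \<times> carrier M) Mod ext_square_kernel M"

definition ext_square_act ::
    "'m monoid \<Rightarrow> ('c \<Rightarrow> 'm \<Rightarrow> 'm) \<Rightarrow> 'c \<Rightarrow>
     (('m \<times> 'm) \<Rightarrow>\<^sub>0 int) set \<Rightarrow> (('m \<times> 'm) \<Rightarrow>\<^sub>0 int) set" where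
  "ext_square_act M act c =
     quot_map (free_Abelian_group (carrier M \<times> carrier M)) (ext_square_kernel M)
       (frag_extend (\<lambda>(m, n). frag_of (act c m, act c n)))"

section \<open>Group homology\<close>

text \<open>
  Homology of \<open>Q\<close> with coefficients in a \<open>\<int>[Q]\<close>-module \<open>A\<close> is computed from the inhomogeneous bar
  complex: a chain of degree \<open>n\<close> is a finitely supported function \<open>Q^n \<rightarrow> A\<close>, and
  \<open>bar_single Q A n a [x\<^sub>1, \<dots>, x\<^sub>n]\<close> is the generator usually written \<open>a [x\<^sub>1|\<dots>|x\<^sub>n]\<close>. The left module
  \<open>A\<close> is regarded as a right module through inverses, so that
  \<open>\<partial>(a [x\<^sub>1|\<dots>|x\<^sub>n]) = x\<^sub>1\<inverse>a [x\<^sub>2|\<dots>|x\<^sub>n] +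
    (\<Sum>i=1..n-1. (-1)^i a [x\<^sub>1|\<dots>|x\<^sub>ix\<^sub>i\<^sub>+\<^sub>1|\<dots>|x\<^sub>n]) + (-1)^n a [x\<^sub>1|\<dots>|x\<^sub>n\<^sub>-\<^sub>1]\<close>.
\<close>

definition cube :: "'q monoid \<Rightarrow> nat \<Rightarrow> 'q list set" where
  "cube Q n = {xs. length xs = n \<and> set xs \<subseteq> carrier Q}"

definition bar_group :: "'q monoid \<Rightarrow> 'a monoid \<Rightarrow> nat \<Rightarrow> ('q list \<Rightarrow> 'a) monoid" where
  "bar_group Q A n = sum_group (cube Q n) (\<lambda>_. A)"

definition bar_single :: "'q monoid \<Rightarrow> 'a monoid \<Rightarrow> nat \<Rightarrow> 'a \<Rightarrow> 'q list \<Rightarrow> 'q list \<Rightarrow> 'a" where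
  "bar_single Q A n a xs = (\<lambda>ys \<in> cube Q n. if ys = xs then a else \<one>\<^bsub>A\<^esub>)"

text \<open>Here \<open>i\<close> counts positions from 1, as in the formula above.\<close>

definition merge_at :: "'q monoid \<Rightarrow> nat \<Rightarrow> 'q list \<Rightarrow> 'q list" where
  "merge_at Q i xs = take (i - 1) xs @ (xs ! (i - 1) \<otimes>\<^bsub>Q\<^esub> xs ! i) # drop (i + 1) xs"

text \<open>\<open>bar_boundary Q A act n\<close> is the boundary map from degree \<open>n + 1\<close> to degree \<open>n\<close>.\<close>

definition bar_boundary_single ::
    "'q monoid \<Rightarrow> 'a monoid \<Rightarrow> ('q \<Rightarrow> 'a \<Rightarrow> 'a) \<Rightarrow> nat \<Rightarrow> 'a \<Rightarrow> 'q list \<Rightarrow> 'q list \<Rightarrow> 'a" where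
  "bar_boundary_single Q A act n a xs =
     bar_single Q A n (act (inv\<^bsub>Q\<^esub> (hd xs)) a) (tl xs)
     \<otimes>\<^bsub>bar_group Q A n\<^esub>
       finprod (bar_group Q A n)
         (\<lambda>i. bar_single Q A n (a [^]\<^bsub>A\<^esub> ((-1) ^ i :: int)) (merge_at Q i xs)) {1..n}
     \<otimes>\<^bsub>bar_group Q A n\<^esub>
       bar_single Q A n (a [^]\<^bsub>A\<^esub> ((-1) ^ Suc n :: int)) (butlast xs)"

definition bar_boundary ::
    "'q monoid \<Rightarrow> 'a monoid \<Rightarrow> ('q \<Rightarrow> 'a \<Rightarrow> 'a) \<Rightarrow> nat \<Rightarrow> ('q list \<Rightarrow> 'a) \<Rightarrow> 'q list \<Rightarrow> 'a" where
  "bar_boundary Q A act n c =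
     gfinprod (bar_group Q A n) (\<lambda>xs. bar_boundary_single Q A act n (c xs) xs) (cube Q (Suc n))"

definition cycles ::
    "'q monoid \<Rightarrow> 'a monoid \<Rightarrow> ('q \<Rightarrow> 'a \<Rightarrow> 'a) \<Rightarrow> nat \<Rightarrow> ('q list \<Rightarrow> 'a) set" where
  "cycles Q A act n =
     (case n of 0 \<Rightarrow> carrier (bar_group Q A 0)
      | Suc m \<Rightarrow> kernel (bar_group Q A (Suc m)) (bar_group Q A m) (bar_boundary Q A act m))"

definition boundaries ::
    "'q monoid \<Rightarrow> 'a monoid \<Rightarrow> ('q \<Rightarrow> 'a \<Rightarrow> 'a) \<Rightarrow> nat \<Rightarrow> ('q list \<Rightarrow> 'a) set" where
  "boundaries Q A act n = bar_boundary Q A act n ` carrier (bar_group Q A (Suc n))"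

definition homology ::
    "'q monoid \<Rightarrow> 'a monoid \<Rightarrow> ('q \<Rightarrow> 'a \<Rightarrow> 'a) \<Rightarrow> nat \<Rightarrow> ('q list \<Rightarrow> 'a) set monoid" where
  "homology Q A act n =
     ((bar_group Q A n)\<lparr>carrier := cycles Q A act n\<rparr>) Mod boundaries Q A act n"

definition homology_class ::
    "'q monoid \<Rightarrow> 'a monoid \<Rightarrow> ('q \<Rightarrow> 'a \<Rightarrow> 'a) \<Rightarrow> nat \<Rightarrow> ('q list \<Rightarrow> 'a) \<Rightarrow> ('q list \<Rightarrow> 'a) set" where
  "homology_class Q A act n z = boundaries Q A act n #>\<^bsub>bar_group Q A n\<^esub> z"

abbreviation integral_homology :: "'q monoid \<Rightarrow> nat \<Rightarrow> ('q list \<Rightarrow> int) set monoid" where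
  "integral_homology Q n \<equiv> homology Q integer_group trivial_act n"

text \<open>Functoriality in the coefficients, for an equivariant homomorphism \<open>f\<close> into \<open>B\<close>.\<close>

definition coeff_chain_map ::
    "'q monoid \<Rightarrow> ('a \<Rightarrow> 'b) \<Rightarrow> nat \<Rightarrow> ('q list \<Rightarrow> 'a) \<Rightarrow> 'q list \<Rightarrow> 'b" where
  "coeff_chain_map Q f n c = (\<lambda>xs \<in> cube Q n. f (c xs))"

definition coeff_homology_map ::
    "'q monoid \<Rightarrow> 'b monoid \<Rightarrow> ('q \<Rightarrow> 'b \<Rightarrow> 'b) \<Rightarrow> ('a \<Rightarrow> 'b) \<Rightarrow> nat \<Rightarrow>
     ('q list \<Rightarrow> 'a) set \<Rightarrow> ('q list \<Rightarrow> 'b) set" where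
  "coeff_homology_map Q B actB f n =
     quot_map (bar_group Q B n) (boundaries Q B actB n) (coeff_chain_map Q f n)"

text \<open>Functoriality of integral homology in the group, for a homomorphism \<open>f\<close> from \<open>P\<close> to \<open>Q\<close>.\<close>

definition integral_chain_map ::
    "'p monoid \<Rightarrow> 'q monoid \<Rightarrow> ('p \<Rightarrow> 'q) \<Rightarrow> nat \<Rightarrow> ('p list \<Rightarrow> int) \<Rightarrow> 'q list \<Rightarrow> int" where
  "integral_chain_map P Q f n c =
     gfinprod (bar_group Q integer_group n)
       (\<lambda>xs. bar_single Q integer_group n (c xs) (map f xs)) (cube P n)"

definition integral_homology_map ::
    "'p monoid \<Rightarrow> 'q monoid \<Rightarrow> ('p \<Rightarrow> 'q) \<Rightarrow> nat \<Rightarrow> ('p list \<Rightarrow> int) set \<Rightarrow> ('q list \<Rightarrow> int) set" where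
  "integral_homology_map P Q f n =
     quot_map (bar_group Q integer_group n) (boundaries Q integer_group trivial_act n)
       (integral_chain_map P Q f n)"

text \<open>
  The connecting homomorphism from degree \<open>n + 1\<close> to degree \<open>n\<close> of a short exact sequence of
  \<open>\<int>[Q]\<close>-modules, given by \<open>i\<close> from \<open>A\<close> to \<open>B\<close> and \<open>p\<close> from \<open>B\<close> to the quotient module: the set on the
  right-hand side consists of all \<open>w\<close> obtained from a homology class \<open>Z\<close> by the snake lemma, and these
  form exactly one homology class. As \<open>i\<close> is injective and equivariant, every such \<open>w\<close> is a cycle, and
  the action on \<open>A\<close> need not be passed as an argument.
\<close>

definition connecting ::
    "'q monoid \<Rightarrow> 'a monoid \<Rightarrow> ('a \<Rightarrow> 'b) \<Rightarrow> 'b monoid \<Rightarrow> ('q \<Rightarrow> 'b \<Rightarrow> 'b) \<Rightarrow> ('b \<Rightarrow> 'd) \<Rightarrow> nat \<Rightarrow>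
     ('q list \<Rightarrow> 'd) set \<Rightarrow> ('q list \<Rightarrow> 'a) set" where
  "connecting Q A i B actB p n Z =
     {w \<in> carrier (bar_group Q A n).
        \<exists>y \<in> carrier (bar_group Q B (Suc n)).
          coeff_chain_map Q p (Suc n) y \<in> Z \<and>
          coeff_chain_map Q i n w = bar_boundary Q B actB n y}"

section \<open>The relation module sequence and dimension shifting\<close>

text \<open>The group ring \<open>\<int>[G]\<close> is the free abelian group on the carrier of \<open>G\<close>.\<close>

definition group_ring_act :: "'g monoid \<Rightarrow> 'g \<Rightarrow> ('g \<Rightarrow>\<^sub>0 int) \<Rightarrow> ('g \<Rightarrow>\<^sub>0 int)" where
  "group_ring_act G g = frag_extend (\<lambda>x. frag_of (g \<otimes>\<^bsub>G\<^esub> x))"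

definition augmentation :: "('g \<Rightarrow>\<^sub>0 int) \<Rightarrow> int" where
  "augmentation c = (\<Sum>x \<in> Poly_Mapping.keys c. Poly_Mapping.lookup c x)"

definition augmentation_ideal :: "'g monoid \<Rightarrow> ('g \<Rightarrow>\<^sub>0 int) monoid" where
  "augmentation_ideal G =
     (free_Abelian_group (carrier G))
       \<lparr>carrier := {c \<in> carrier (free_Abelian_group (carrier G)). augmentation c = 0}\<rparr>"

text \<open>
  For a surjective homomorphism \<open>\<pi>\<close> from \<open>E\<close> to \<open>Q\<close> with kernel \<open>K\<close>, the relation module sequence is
  the exact sequence of \<open>\<int>[Q]\<close>-modules
  \<open>0 \<rightarrow> K\<^sub>a\<^sub>b \<rightarrow> \<int>[Q] \<otimes>\<^bsub>E\<^esub> I(E) \<rightarrow> I(Q) \<rightarrow> 0\<close>, where \<open>I\<close> is the augmentation ideal and the first map sends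
  the class of \<open>k\<close> to \<open>1 \<otimes> (k - 1)\<close>. The middle term is realized as \<open>I(E)\<^sub>K = \<int> \<otimes>\<^bsub>K\<^esub> I(E)\<close>, the
  coinvariants of \<open>I(E)\<close> under left multiplication by \<open>K\<close>. An element \<open>q\<close> of \<open>Q\<close> acts on \<open>K\<^sub>a\<^sub>b\<close> by
  conjugation with any preimage, and on the middle term by left multiplication by any preimage; the
  latter is written by letting all preimages act on all representatives of a coset at once.
\<close>

definition ext_kernel :: "'g monoid \<Rightarrow> 'q monoid \<Rightarrow> ('g \<Rightarrow> 'q) \<Rightarrow> 'g monoid" where
  "ext_kernel G Q \<pi> = G\<lparr>carrier := kernel G Q \<pi>\<rparr>"

definition relation_module :: "'e monoid \<Rightarrow> 'q monoid \<Rightarrow> ('e \<Rightarrow> 'q) \<Rightarrow> 'e set monoid" where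
  "relation_module E Q \<pi> = abelianization (ext_kernel E Q \<pi>)"

definition induced_aug_ideal :: "'e monoid \<Rightarrow> 'q monoid \<Rightarrow> ('e \<Rightarrow> 'q) \<Rightarrow> ('e \<Rightarrow>\<^sub>0 int) set monoid" where
  "induced_aug_ideal E Q \<pi> =
     coinvariants (kernel E Q \<pi>) (augmentation_ideal E) (group_ring_act E)"

definition induced_aug_ideal_act ::
    "'e monoid \<Rightarrow> ('e \<Rightarrow> 'q) \<Rightarrow> 'q \<Rightarrow> ('e \<Rightarrow>\<^sub>0 int) set \<Rightarrow> ('e \<Rightarrow>\<^sub>0 int) set" where
  "induced_aug_ideal_act E \<pi> q X =
     {group_ring_act E e x | e x. e \<in> carrier E \<and> \<pi> e = q \<and> x \<in> X}"

definition relation_module_incl ::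
    "'e monoid \<Rightarrow> 'q monoid \<Rightarrow> ('e \<Rightarrow> 'q) \<Rightarrow> 'e set \<Rightarrow> ('e \<Rightarrow>\<^sub>0 int) set" where
  "relation_module_incl E Q \<pi> =
     quot_map (augmentation_ideal E)
       (coinvariants_kernel (kernel E Q \<pi>) (augmentation_ideal E) (group_ring_act E))
       (\<lambda>k. frag_of k - frag_of \<one>\<^bsub>E\<^esub>)"

definition induced_aug_ideal_proj :: "('e \<Rightarrow> 'q) \<Rightarrow> ('e \<Rightarrow>\<^sub>0 int) set \<Rightarrow> ('q \<Rightarrow>\<^sub>0 int)" where
  "induced_aug_ideal_proj \<pi> = quot_lift (frag_extend (\<lambda>e. frag_of (\<pi> e)))"

text \<open>
  The composite of connecting homomorphisms \<open>H\<^bsub>n+2\<^esub>(Q) \<rightarrow> H\<^bsub>n+1\<^esub>(Q, I(Q)) \<rightarrow> H\<^bsub>n\<^esub>(Q, K\<^sub>a\<^sub>b)\<close> belonging to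
  \<open>0 \<rightarrow> I(Q) \<rightarrow> \<int>[Q] \<rightarrow> \<int> \<rightarrow> 0\<close> and to the relation module sequence. If \<open>E\<close> is free and \<open>n \<ge> 1\<close>, it is
  an isomorphism, since then \<open>\<int>[Q] \<otimes>\<^bsub>E\<^esub> I(E)\<close> is a free \<open>\<int>[Q]\<close>-module.
\<close>

definition dimension_shift ::
    "'e monoid \<Rightarrow> 'q monoid \<Rightarrow> ('e \<Rightarrow> 'q) \<Rightarrow> nat \<Rightarrow> ('q list \<Rightarrow> int) set \<Rightarrow> ('q list \<Rightarrow> 'e set) set" where
  "dimension_shift E Q \<pi> n =
     connecting Q (relation_module E Q \<pi>) (relation_module_incl E Q \<pi>)
       (induced_aug_ideal E Q \<pi>) (induced_aug_ideal_act E \<pi>) (induced_aug_ideal_proj \<pi>) n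
     \<circ> connecting Q (augmentation_ideal Q) (\<lambda>x. x)
       (free_Abelian_group (carrier Q)) (group_ring_act Q) augmentation (Suc n)"

section \<open>Stem-extensions and the maps \<open>\<delta>\<close> and \<open>\<beta>\<close>\<close>

definition stem_extension :: "'g monoid \<Rightarrow> 'q monoid \<Rightarrow> ('g \<Rightarrow> 'q) \<Rightarrow> bool" where
  "stem_extension G Q \<pi> \<longleftrightarrow>
     group G \<and> group Q \<and> \<pi> \<in> epi G Q \<and>
     (\<forall>n \<in> kernel G Q \<pi>. \<forall>g \<in> carrier G. n \<otimes>\<^bsub>G\<^esub> g = g \<otimes>\<^bsub>G\<^esub> n) \<and>
     kernel G Q \<pi> \<subseteq> derived G (carrier G)"

text \<open>For trivial coefficients: \<open>H\<^sub>0(Q, N) = N\<close>, and \<open>H\<^sub>1(Q, N) = Q\<^sub>a\<^sub>b \<otimes> N\<close> via \<open>n [x] \<mapsto> x \<otimes> n\<close>.\<close>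

definition H0_trivial :: "('q list \<Rightarrow> 'n) set \<Rightarrow> 'n" where
  "H0_trivial = quot_lift (\<lambda>c. c [])"

definition H1_trivial ::
    "'q monoid \<Rightarrow> 'n monoid \<Rightarrow> ('q list \<Rightarrow> 'n) set \<Rightarrow> (('q set \<times> 'n) \<Rightarrow>\<^sub>0 int) set" where
  "H1_trivial Q N =
     quot_lift (\<lambda>c. gfinprod (tensor (abelianization Q) N)
       (\<lambda>x. pure_tensor (abelianization Q) N (derived Q (carrier Q) #>\<^bsub>Q\<^esub> x) (c [x])) (carrier Q))"

text \<open>
  The five-term sequence arises from the relation module sequence of \<open>\<pi>\<close> itself; as \<open>N\<close> is central,
  \<open>H\<^sub>0(Q, N\<^sub>a\<^sub>b) = N\<close>.
\<close>

definition beta_map :: "'g monoid \<Rightarrow> 'q monoid \<Rightarrow> ('g \<Rightarrow> 'q) \<Rightarrow> ('q list \<Rightarrow> int) set \<Rightarrow> 'g" where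
  "beta_map G Q \<pi> =
     H0_trivial
     \<circ> coeff_homology_map Q (ext_kernel G Q \<pi>) trivial_act (quot_lift (\<lambda>n. n)) 0
     \<circ> dimension_shift G Q \<pi> 0"

text \<open>
  The presentation is given by an epimorphism \<open>p\<close> from \<open>F\<close> to \<open>G\<close>. Then \<open>R\<close> is the kernel of \<open>p\<close> and
  \<open>S\<close> is the kernel of \<open>\<pi> \<circ> p\<close>; the identifications \<open>F/S = Q\<close> and \<open>S/R = N\<close> are induced by
  \<open>\<pi> \<circ> p\<close> and \<open>p\<close>, so that the natural epimorphism from \<open>S\<^sub>a\<^sub>b\<close> to \<open>S/R = N\<close> is induced by \<open>p\<close>.
\<close>

definition delta_map ::
    "'f monoid \<Rightarrow> ('f \<Rightarrow> 'g) \<Rightarrow> 'g monoid \<Rightarrow> 'q monoid \<Rightarrow> ('g \<Rightarrow> 'q) \<Rightarrow>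
     ('q list \<Rightarrow> int) set \<Rightarrow> (('g set \<times> 'g) \<Rightarrow>\<^sub>0 int) set" where
  "delta_map F p G Q \<pi> =
     inv_into (carrier (tensor (abelianization G) (ext_kernel G Q \<pi>)))
       (tensor_map (abelianization Q) (ext_kernel G Q \<pi>) (abelianization_map Q \<pi>) (\<lambda>n. n))
     \<circ> H1_trivial Q (ext_kernel G Q \<pi>)
     \<circ> coeff_homology_map Q (ext_kernel G Q \<pi>) trivial_act (quot_lift p) 1
     \<circ> dimension_shift F Q (\<pi> \<circ> p) 1"

text \<open>
  The projection \<open>G\<^sub>a\<^sub>b \<otimes> N \<rightarrow> C \<otimes> N = N\<close> for a homomorphism \<open>\<gamma>\<close> from \<open>G\<close> to \<open>C\<close>; the identification
  on the right is \<open>t\<^sup>k \<otimes> n \<mapsto> n\<^sup>k\<close>.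
\<close>

definition cyclic_log :: "'c monoid \<Rightarrow> 'c \<Rightarrow> 'c \<Rightarrow> int" where
  "cyclic_log C t c = (THE k. t [^]\<^bsub>C\<^esub> k = c)"

definition tensor_proj ::
    "'c monoid \<Rightarrow> 'c \<Rightarrow> ('g \<Rightarrow> 'c) \<Rightarrow> 'n monoid \<Rightarrow> (('g set \<times> 'n) \<Rightarrow>\<^sub>0 int) set \<Rightarrow> 'n" where
  "tensor_proj C t \<gamma> N =
     tensor_lift N (\<lambda>c n. n [^]\<^bsub>N\<^esub> cyclic_log C t c)
     \<circ> tensor_map C N (quot_lift \<gamma>) (\<lambda>n. n)"

section \<open>The constituents of \<open>\<alpha>\<^sub>3'\<close>\<close>

text \<open>
  For an infinite cyclic group \<open>C\<close> generated by \<open>t\<close>, the invariants of \<open>A\<close> are identified with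
  \<open>H\<^sub>1(C, A)\<close> by \<open>a \<mapsto> a [t]\<close>; the following is the inverse of this identification.
\<close>

definition H1_cyclic_to_invariants ::
    "'c monoid \<Rightarrow> 'c \<Rightarrow> 'a monoid \<Rightarrow> ('c \<Rightarrow> 'a \<Rightarrow> 'a) \<Rightarrow> ('c list \<Rightarrow> 'a) set \<Rightarrow> 'a" where
  "H1_cyclic_to_invariants C t A act =
     inv_into (invariants C A act) (\<lambda>a. homology_class C A act 1 (bar_single C A 1 a [t]))"

text \<open>
  The identification of the exterior square with the second homology of an abelian group is the
  Pontryagin product, \<open>m \<and> n \<mapsto> [m|n] - [n|m]\<close>.
\<close>

definition ext_square_to_H2 ::
    "'m monoid \<Rightarrow> (('m \<times> 'm) \<Rightarrow>\<^sub>0 int) set \<Rightarrow> ('m list \<Rightarrow> int) set" where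
  "ext_square_to_H2 M =
     quot_lift (free_extend (integral_homology M 2) (\<lambda>(m, n).
       homology_class M integer_group trivial_act 2
         (bar_single M integer_group 2 1 [m, n]
          \<otimes>\<^bsub>bar_group M integer_group 2\<^esub> bar_single M integer_group 2 (-1) [n, m])))"

text \<open>The composite \<open>\<Lambda>\<^sup>2(M)\<^sub>C = H\<^sub>2(M)\<^sub>C \<rightarrow> H\<^sub>2(M \<rtimes> C)\<close>.\<close>

definition coinvariants_to_H2 ::
    "'m monoid \<Rightarrow> 'c monoid \<Rightarrow> ('c \<Rightarrow> 'm \<Rightarrow> 'm) \<Rightarrow>
     (('m \<times> 'm) \<Rightarrow>\<^sub>0 int) set set \<Rightarrow> (('m \<times> 'c) list \<Rightarrow> int) set" where
  "coinvariants_to_H2 M C act =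
     quot_lift (integral_homology_map M (semidirect_product M C act) (\<lambda>m. (m, \<one>\<^bsub>C\<^esub>)) 2)
     \<circ> quot_map (integral_homology M 2)
         (coinvariants_kernel (carrier C) (integral_homology M 2)
            (\<lambda>c. integral_homology_map M M (act c) 2))
         (ext_square_to_H2 M)"

end

theory Submission
  imports Defs "HOL-Algebra.Multiplicative_Group"
begin

text \<open>
  Let \<open>\<tau>\<close> be the projection of \<open>Q\<close> onto \<open>C = \<int>\<close>, and let \<open>c\<close> be a cocycle of a section of \<open>G \<rightarrow> Q\<close>.
  Both \<open>\<beta>\<close> and \<open>\<delta>\<close> are cap products with the class of \<open>c\<close>, from \<open>H\<^sub>2(Q)\<close> to \<open>H\<^sub>0(Q, N) = N\<close> and from
  \<open>H\<^sub>3(Q)\<close> to \<open>H\<^sub>1(Q, N) = Q\<^sub>a\<^sub>b \<otimes> N\<close>: they evaluate \<open>c\<close> on the first two letters of a word (inverted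
  and in reverse order, by the conventions of the bar complex) and keep the rest. The projection of
  \<open>Q\<^sub>a\<^sub>b \<otimes> N\<close> to \<open>N\<close> evaluates \<open>\<tau>\<close> on the letter that is left. So the composite through \<open>\<delta>\<close> evaluates
  \<open>c\<close> on the first two letters and \<open>\<tau>\<close> on the third, and this is also what one obtains by first
  capping with \<open>\<tau>\<close>, which sends \<open>[x|y|w]\<close> to \<open>\<tau>(w) [x|y]\<close>, and then applying \<open>\<beta>\<close>. With \<open>\<alpha>\<^sub>3'\<close> equal
  to the cap product with \<open>\<tau>\<close>, the square commutes on the level of cycles (\<open>beta_cap\<close>).

  The comparison needs formulas for \<open>\<beta>\<close> and \<open>\<delta>\<close>, which are defined by dimension shifting along two
  different epimorphisms onto \<open>Q\<close>. A section yields an additive map from the middle term of the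
  relation module sequence to \<open>N\<close>, which extends the one from the relation module; it fails to be
  equivariant exactly by the cocycle, and the snake lemma turns this failure into the value of the
  connecting homomorphisms (\<open>dimension_shift_value\<close>). The value depends only on the induced section
  of \<open>G \<rightarrow> Q\<close>, and one section can be used for both maps.

  It remains to factor the cap product with \<open>\<tau>\<close>. In the Wang sequence of \<open>Q = M \<rtimes> C\<close>,
  \<open>H\<^sub>3(Q) \<rightarrow> H\<^sub>2(M) \<rightarrow> H\<^sub>2(M) \<rightarrow> H\<^sub>2(Q)\<close> with \<open>t - 1\<close> in the middle, the first map takes values in the
  invariants \<open>H\<^sub>2(M)\<^sup>C\<close> (\<open>wang_invariant\<close>). Its composite with \<open>H\<^sub>2(M) \<rightarrow> H\<^sub>2(Q)\<close> is the cap product with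
  \<open>\<tau>\<close>, by a prism homotopy that pushes simplices of \<open>Q\<close> into \<open>M\<close> (\<open>cap_wang\<close>). The map from \<open>H\<^sub>2(M)\<close>
  to \<open>H\<^sub>2(Q)\<close> factors through the coinvariants because \<open>t\<close> acts on \<open>Q\<close> by an inner automorphism
  (\<open>incM_T_homologous\<close>).

  Finally \<open>H\<^sub>2(M)\<close> is \<open>\<Lambda>\<^sup>2(M)\<close> (\<open>ext_square_to_H2_iso\<close>), which is proved by mapping chains into
  abelian extensions given by symmetric cocycles, and \<open>H\<^sub>1(C, A)\<close> contains the invariants of \<open>A\<close> by
  way of \<open>a \<mapsto> a [t]\<close>, with Fox derivatives of the powers of \<open>t\<close> giving a left inverse
  (\<open>H1_cyclic_to_invariants_eq\<close>).
\<close>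

section \<open>Quotients and free abelian groups\<close>

lemma quot_lift_eq:
  assumes "X \<noteq> {}" and "\<And>x. x \<in> X \<Longrightarrow> f x = v"
  shows "quot_lift f X = v"
proof -
  have "f ` X = {v}" using assms by auto
  then show ?thesis by (simp add: quot_lift_def)
qed

lemma rcos_update_carrier [simp]: "H #>\<^bsub>A\<lparr>carrier := S\<rparr>\<^esub> a = H #>\<^bsub>A\<^esub> a"
  by (simp add: r_coset_def)

lemma set_mult_update_carrier [simp]: "H <#>\<^bsub>A\<lparr>carrier := S\<rparr>\<^esub> K = H <#>\<^bsub>A\<^esub> K"
  by (simp add: set_mult_def)

lemma carrier_Mod: "carrier (A Mod H) = (\<lambda>a. H #>\<^bsub>A\<^esub> a) ` carrier A"
  by (auto simp: FactGroup_def RCOSETS_def)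

lemma (in group) rcos_eq_iff:
  assumes "subgroup H G" "a \<in> carrier G" "b \<in> carrier G"
  shows "H #> a = H #> b \<longleftrightarrow> a \<otimes> inv b \<in> H"
proof
  assume "H #> a = H #> b"
  then have "H #> (a \<otimes> inv b) = H"
    using assms by (intro coset_mult_inv2) (auto simp: subgroup.subset)
  then show "a \<otimes> inv b \<in> H"
    using coset_join1[of H "a \<otimes> inv b"] assms by simp
next
  assume "a \<otimes> inv b \<in> H"
  then have "H #> (a \<otimes> inv b) = H"
    using coset_join2[of "a \<otimes> inv b" H] assms by simp
  then show "H #> a = H #> b"
    using assms by (intro coset_mult_inv1) (auto simp: subgroup.subset)
qed

lemma (in group) quot_lift_rcos:
  assumes "group B" "f \<in> hom G B" "subgroup H G" "\<And>x. x \<in> H \<Longrightarrow> f x = \<one>\<^bsub>B\<^esub>" "a \<in> carrier G"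
  shows "quot_lift f (H #> a) = f a"
proof (rule quot_lift_eq)
  interpret B: group B by fact
  show "H #> a \<noteq> {}" using rcos_self[OF assms(5,3)] by blast
  fix x assume "x \<in> H #> a"
  then obtain h where h: "h \<in> H" "x = h \<otimes> a" by (auto simp: r_coset_def)
  have "h \<in> carrier G" using subgroup.mem_carrier[OF assms(3)] h by blast
  moreover have "f a \<in> carrier B" using hom_in_carrier[OF assms(2,5)] .
  ultimately show "f x = f a"
    using h assms by (simp add: hom_mult[OF assms(2)])
qed

lemma (in group) quot_map_rcos:
  assumes "group B" "f \<in> hom G B" "subgroup H G" "subgroup K B" "f ` H \<subseteq> K" "a \<in> carrier G"
  shows "quot_map B K f (H #> a) = K #>\<^bsub>B\<^esub> f a"
proof -
  interpret B: group B by fact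
  interpret K: subgroup K B by fact
  have H: "h \<in> carrier G" if "h \<in> H" for h using subgroup.mem_carrier[OF assms(3)] that by blast
  have fa: "f a \<in> carrier B" using hom_in_carrier[OF assms(2,6)] .
  show ?thesis
    unfolding quot_map_def
  proof safe
    fix y assume "y \<in> K <#>\<^bsub>B\<^esub> f ` (H #> a)"
    then obtain k h where k: "k \<in> K" and h: "h \<in> H" and y: "y = k \<otimes>\<^bsub>B\<^esub> f (h \<otimes> a)"
      by (auto simp: set_mult_def r_coset_def)
    have fh: "f h \<in> K" using assms(5) h by blast
    then have "y = (k \<otimes>\<^bsub>B\<^esub> f h) \<otimes>\<^bsub>B\<^esub> f a"
      using y k h H fa assms(2,6) by (simp add: hom_mult[OF assms(2)] B.m_assoc)
    then show "y \<in> K #>\<^bsub>B\<^esub> f a" using k fh by (auto simp: r_coset_def)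
  next
    fix y assume "y \<in> K #>\<^bsub>B\<^esub> f a"
    then obtain k where k: "k \<in> K" "y = k \<otimes>\<^bsub>B\<^esub> f a" by (auto simp: r_coset_def)
    moreover have "a \<in> H #> a" using rcos_self[OF assms(6,3)] .
    ultimately show "y \<in> K <#>\<^bsub>B\<^esub> f ` (H #> a)" by (auto simp: set_mult_def)
  qed
qed

lemma (in comm_group) subgroup_normal: "subgroup H G \<Longrightarrow> H \<lhd> G"
  using normal_iff_subgroup by blast

lemma (in group) Mod_mult:
  assumes "H \<lhd> G" "a \<in> carrier G" "b \<in> carrier G"
  shows "(H #> a) \<otimes>\<^bsub>G Mod H\<^esub> (H #> b) = H #> (a \<otimes> b)"
  using assms by (simp add: FactGroup_def normal.rcos_sum)

lemma (in group) rcos_hom_Mod: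
  assumes "H \<lhd> G" shows "(\<lambda>a. H #> a) \<in> hom G (G Mod H)"
  using Mod_mult[OF assms] by (intro homI) (auto simp: carrier_Mod simp del: mult_FactGroup)

lemma (in group) quot_lift_hom:
  assumes B: "group B" "f \<in> hom G B" and H: "H \<lhd> G" "\<And>x. x \<in> H \<Longrightarrow> f x = \<one>\<^bsub>B\<^esub>"
  shows "quot_lift f \<in> hom (G Mod H) B"
proof -
  have sub: "subgroup H G" using H normal_imp_subgroup by blast
  note q = quot_lift_rcos[OF B sub H(2)]
  show ?thesis
  proof (rule homI)
    fix X assume "X \<in> carrier (G Mod H)"
    then show "quot_lift f X \<in> carrier B" using q hom_in_carrier[OF B(2)] by (auto simp: carrier_Mod)
  next
    fix X Y assume "X \<in> carrier (G Mod H)" "Y \<in> carrier (G Mod H)"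
    then obtain a b where "a \<in> carrier G" "X = H #> a" "b \<in> carrier G" "Y = H #> b"
      by (auto simp: carrier_Mod)
    then show "quot_lift f (X \<otimes>\<^bsub>G Mod H\<^esub> Y) = quot_lift f X \<otimes>\<^bsub>B\<^esub> quot_lift f Y"
      using q by (simp add: Mod_mult[OF H(1)] hom_mult[OF B(2)] del: mult_FactGroup)
  qed
qed

lemma (in group) subgroup_kernel_condition:
  assumes "group B" "f \<in> hom G B" "subgroup K B"
  shows "subgroup {x \<in> carrier G. f x \<in> K} G"
proof -
  interpret f: group_hom G B f using assms by (simp add: group_hom_def group_hom_axioms_def group_axioms)
  interpret K: subgroup K B by fact
  show ?thesis
    by unfold_locales (use assms in \<open>auto simp: hom_mult\<close>)
qed

lemma (in group) hom_generate_subset: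
  assumes B: "group B" "f \<in> hom G B" "subgroup K B" and S: "S \<subseteq> carrier G" "f ` S \<subseteq> K"
  shows "f ` generate G S \<subseteq> K"
proof -
  have "generate G S \<subseteq> {x \<in> carrier G. f x \<in> K}"
    by (rule generate_subgroup_incl[OF _ subgroup_kernel_condition[OF B]]) (use S in auto)
  then show ?thesis by auto
qed

lemma (in group) hom_generate_one:
  assumes B: "group B" "f \<in> hom G B" and S: "S \<subseteq> carrier G" "\<And>x. x \<in> S \<Longrightarrow> f x = \<one>\<^bsub>B\<^esub>"
    and x: "x \<in> generate G S"
  shows "f x = \<one>\<^bsub>B\<^esub>"
proof -
  interpret B: group B by fact
  have "f ` generate G S \<subseteq> {\<one>\<^bsub>B\<^esub>}"
    by (rule hom_generate_subset) (use assms B.triv_subgroup in auto)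
  then show ?thesis using x by blast
qed

lemma hom_product:
  assumes H: "comm_group H" and f: "f \<in> hom A H" and g: "g \<in> hom A H"
  shows "(\<lambda>x. f x \<otimes>\<^bsub>H\<^esub> g x) \<in> hom A H"
proof -
  interpret H: comm_group H by fact
  show ?thesis
    using hom_in_carrier[OF f] hom_in_carrier[OF g] hom_mult[OF f] hom_mult[OF g]
    by (intro homI) (simp_all add: H.m_ac)
qed

lemma keys_addI: "Poly_Mapping.keys a \<subseteq> S \<Longrightarrow> Poly_Mapping.keys b \<subseteq> S \<Longrightarrow> Poly_Mapping.keys (a + b) \<subseteq> S"
  using keys_add[of a b] by blast

lemma keys_diffI: "Poly_Mapping.keys a \<subseteq> S \<Longrightarrow> Poly_Mapping.keys b \<subseteq> S \<Longrightarrow> Poly_Mapping.keys (a - b) \<subseteq> S"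
  using keys_diff[of a b] by blast

lemma keys_cmulI: "Poly_Mapping.keys a \<subseteq> S \<Longrightarrow> Poly_Mapping.keys (frag_cmul k a) \<subseteq> S"
  using keys_cmul[of k a] by blast

lemma keys_extendI:
  "Poly_Mapping.keys c \<subseteq> S \<Longrightarrow> (\<And>x. x \<in> S \<Longrightarrow> Poly_Mapping.keys (f x) \<subseteq> T)
   \<Longrightarrow> Poly_Mapping.keys (frag_extend f c) \<subseteq> T"
  using keys_frag_extend[of f c] by blast

lemma frag_extend_hom:
  assumes "\<And>x. x \<in> S \<Longrightarrow> Poly_Mapping.keys (f x) \<subseteq> T"
  shows "frag_extend f \<in> hom (free_Abelian_group S) (free_Abelian_group T)"
proof (rule homI)
  fix c assume "c \<in> carrier (free_Abelian_group S)"
  then show "frag_extend f c \<in> carrier (free_Abelian_group T)"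
    using keys_extendI[of c S f T] assms by simp
qed (simp add: frag_extend_add)

lemma frag_extend_cong_basis:
  assumes "Poly_Mapping.keys c \<subseteq> S"
    and "\<And>x. x \<in> S \<Longrightarrow> f (frag_of x) = g (frag_of x)"
    and "\<And>a b. f (a - b) = f a - (f b :: 'b::ab_group_add)" "\<And>a b. g (a - b) = g a - g b"
  shows "f c = g c"
  using assms(1)
proof (induction c rule: frag_induction)
  case zero
  show ?case using assms(3)[of 0 0] assms(4)[of 0 0] by simp
qed (use assms in auto)

lemma free_extend_hom:
  assumes H: "comm_group H" and f: "\<And>x. x \<in> S \<Longrightarrow> f x \<in> carrier H"
  shows "free_extend H f \<in> hom (free_Abelian_group S) H"
proof -
  interpret comm_group H by fact
  define h where "h = (\<lambda>c. gfinprod H (\<lambda>x. f x [^]\<^bsub>H\<^esub> (poly_mapping.lookup c x :: int)) S)"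
  have fin: "finite {x \<in> S. f x [^]\<^bsub>H\<^esub> (poly_mapping.lookup c x :: int) \<noteq> \<one>\<^bsub>H\<^esub>}" for c
    by (rule finite_subset[OF _ finite_keys[of c]]) (auto simp: in_keys_iff)
  have h: "free_extend H f c = h c" if "Poly_Mapping.keys c \<subseteq> S" for c
  proof -
    have "h c = gfinprod H (\<lambda>x. f x [^]\<^bsub>H\<^esub> poly_mapping.lookup c x) (Poly_Mapping.keys c)"
      unfolding h_def using that f
      by (intro gfinprod_mono_neutral_cong_right) (auto simp: in_keys_iff)
    also have "\<dots> = free_extend H f c"
      unfolding free_extend_def using that f
      by (intro gfinprod_eq_finprod) auto
    finally show ?thesis by simp
  qed
  show ?thesis
  proof (rule homI)
    fix c assume "c \<in> carrier (free_Abelian_group S)"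
    then show "free_extend H f c \<in> carrier H"
      using f by (auto simp: h h_def intro!: gfinprod_closed)
  next
    fix a b assume "a \<in> carrier (free_Abelian_group S)" "b \<in> carrier (free_Abelian_group S)"
    then have k: "Poly_Mapping.keys a \<subseteq> S" "Poly_Mapping.keys b \<subseteq> S" by auto
    then have "Poly_Mapping.keys (a + b) \<subseteq> S" by (rule keys_addI)
    then show "free_extend H f (a \<otimes>\<^bsub>free_Abelian_group S\<^esub> b) = free_extend H f a \<otimes>\<^bsub>H\<^esub> free_extend H f b"
      using k f unfolding mult_free_Abelian_group
      by (simp add: h h_def fin gfinprod_distrib Pi_iff lookup_add int_pow_mult cong: gfinprod_cong)
  qed
qed

lemma free_extend_of:
  assumes "comm_group H" "f x \<in> carrier H"
  shows "free_extend H f (frag_of x) = f x"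
proof -
  interpret comm_group H by fact
  show ?thesis using assms by (simp add: free_extend_def)
qed

lemma free_hom_zero: "group H \<Longrightarrow> f \<in> hom (free_Abelian_group S) H \<Longrightarrow> f 0 = \<one>\<^bsub>H\<^esub>"
  using hom_one[of f "free_Abelian_group S" H] by simp

lemma free_hom_add:
  "f \<in> hom (free_Abelian_group S) H \<Longrightarrow> Poly_Mapping.keys a \<subseteq> S \<Longrightarrow> Poly_Mapping.keys b \<subseteq> S
   \<Longrightarrow> f (a + b) = f a \<otimes>\<^bsub>H\<^esub> f b"
  using hom_mult[of f "free_Abelian_group S" H a b] by simp

lemma free_hom_closed:
  "f \<in> hom (free_Abelian_group S) H \<Longrightarrow> Poly_Mapping.keys a \<subseteq> S \<Longrightarrow> f a \<in> carrier H"
  using hom_in_carrier[of f "free_Abelian_group S" H a] by simp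

lemma free_hom_minus:
  assumes "group H" "f \<in> hom (free_Abelian_group S) H" "Poly_Mapping.keys a \<subseteq> S"
  shows "f (- a) = inv\<^bsub>H\<^esub> f a"
proof -
  interpret f: group_hom "free_Abelian_group S" H f
    using assms by (simp add: group_hom_def group_hom_axioms_def)
  show ?thesis using f.hom_inv[of a] assms by simp
qed

lemma free_hom_diff:
  assumes "group H" "f \<in> hom (free_Abelian_group S) H" "Poly_Mapping.keys a \<subseteq> S" "Poly_Mapping.keys b \<subseteq> S"
  shows "f (a - b) = f a \<otimes>\<^bsub>H\<^esub> inv\<^bsub>H\<^esub> f b"
  using free_hom_add[OF assms(2,3), of "-b"] free_hom_minus[OF assms(1,2,4)] assms by simp

lemma free_hom_cmul:
  assumes "group H" "f \<in> hom (free_Abelian_group S) H" "Poly_Mapping.keys a \<subseteq> S"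
  shows "f (frag_cmul k a) = f a [^]\<^bsub>H\<^esub> k"
proof -
  interpret f: group_hom "free_Abelian_group S" H f
    using assms by (simp add: group_hom_def group_hom_axioms_def)
  show ?thesis using f.hom_int_pow[of a k] assms by simp
qed

lemma free_hom_eqI:
  assumes H: "group H" and f: "f \<in> hom (free_Abelian_group S) H" and g: "g \<in> hom (free_Abelian_group S) H"
    and eq: "\<And>x. x \<in> S \<Longrightarrow> f (frag_of x) = g (frag_of x)" and c: "Poly_Mapping.keys c \<subseteq> S"
  shows "f c = g c"
  using c
  by (rule free_Abelian_group_induct)
    (simp_all add: eq free_hom_zero[OF H f] free_hom_zero[OF H g] free_hom_diff[OF H f] free_hom_diff[OF H g])

lemma subgroup_free_Abelian_groupI:
  assumes "K \<subseteq> {c. Poly_Mapping.keys c \<subseteq> S}" "0 \<in> K" "\<And>a b. a \<in> K \<Longrightarrow> b \<in> K \<Longrightarrow> a + b \<in> K"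
    "\<And>a. a \<in> K \<Longrightarrow> - a \<in> K"
  shows "subgroup K (free_Abelian_group S)"
  using assms by unfold_locales (auto simp: subset_iff)


section \<open>The bar complex\<close>

text \<open>
  The faces of \<open>[x|y\<^sub>1|\<dots>|y\<^sub>n]\<close> other than the first, with their signs. Recursion on the word makes it
  possible to prove \<open>\<partial>\<partial> = 0\<close> by induction, without double sums over positions.
\<close>

fun inner_faces :: "'q monoid \<Rightarrow> 'q \<Rightarrow> 'q list \<Rightarrow> ('q list \<Rightarrow>\<^sub>0 int)" where
  "inner_faces Q x [] = - frag_of []"
| "inner_faces Q x (y # ys) =
     - frag_of ((x \<otimes>\<^bsub>Q\<^esub> y) # ys) - frag_extend (\<lambda>zs. frag_of (x # zs)) (inner_faces Q y ys)"

lemma cube_Nil [simp]: "cube Q 0 = {[]}"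
  by (auto simp: cube_def)

lemma Cons_in_cube [simp]: "x # xs \<in> cube Q (Suc n) \<longleftrightarrow> x \<in> carrier Q \<and> xs \<in> cube Q n"
  by (auto simp: cube_def)

lemma Nil_in_cube [simp]: "[] \<in> cube Q n \<longleftrightarrow> n = 0"
  by (auto simp: cube_def)

lemma cube_SucE:
  assumes "xs \<in> cube Q (Suc n)"
  obtains y ys where "xs = y # ys" "y \<in> carrier Q" "ys \<in> cube Q n"
  using assms by (cases xs) (auto simp: cube_def)

lemma inner_faces_keys:
  fixes Q :: "'q monoid"
  assumes "group Q" "x \<in> carrier Q" "ys \<in> cube Q n"
  shows "Poly_Mapping.keys (inner_faces Q x ys) \<subseteq> cube Q n"
proof -
  interpret Q: group Q by fact
  show ?thesis using assms(2,3)
  proof (induction n arbitrary: x ys)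
    case 0 then show ?case by simp
  next
    case (Suc n)
    from Suc.prems(2) obtain y ys' where ys: "ys = y # ys'" "y \<in> carrier Q" "ys' \<in> cube Q n"
      by (rule cube_SucE)
    have "Poly_Mapping.keys (frag_extend (\<lambda>zs. frag_of (x # zs)) (inner_faces Q y ys')) \<subseteq> cube Q (Suc n)"
      using Suc.prems(1) by (intro keys_extendI[OF Suc.IH[OF ys(2,3)]]) simp
    then show ?case using Suc.prems(1) ys
      by (simp only: ys(1) inner_faces.simps, intro keys_diffI) simp_all
  qed
qed

text \<open>
  The face formula by positions: merging at a position beyond the first is merging in the tail, so
  the alternating sum satisfies the recursion of \<open>inner_faces\<close>.
\<close>

lemma inner_faces_eq_sum:
  assumes "length ys = n"
  shows "(\<Sum>i = 1..n. frag_cmul ((-1) ^ i) (frag_of (merge_at Q i (x # ys))))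
          + frag_cmul ((-1) ^ Suc n) (frag_of (butlast (x # ys))) = inner_faces Q x ys"
  using assms
proof (induction ys arbitrary: x n)
  case Nil then show ?case by simp
next
  case (Cons y ys)
  then obtain m where n: "n = Suc m" "length ys = m" by auto
  let ?c = "frag_extend (\<lambda>zs. frag_of (x # zs))"
  have merge: "frag_of (merge_at Q (Suc i) (x # y # ys)) = ?c (frag_of (merge_at Q i (y # ys)))"
    if "i \<in> {1..m}" for i
    using that by (cases i) (auto simp: merge_at_def)
  have "(\<Sum>i = 1..n. frag_cmul ((-1) ^ i) (frag_of (merge_at Q i (x # y # ys))))
      = frag_cmul (-1) (frag_of (merge_at Q 1 (x # y # ys)))
        + (\<Sum>i = Suc 1..Suc m. frag_cmul ((-1) ^ i) (frag_of (merge_at Q i (x # y # ys))))"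
    by (simp add: n sum.atLeast_Suc_atMost)
  also have "(\<Sum>i = Suc 1..Suc m. frag_cmul ((-1) ^ i) (frag_of (merge_at Q i (x # y # ys))))
      = (\<Sum>i = 1..m. frag_cmul ((-1) ^ Suc i) (frag_of (merge_at Q (Suc i) (x # y # ys))))"
    by (rule sum.shift_bounds_cl_Suc_ivl)
  also have "\<dots> = (\<Sum>i = 1..m. - ?c (frag_cmul ((-1) ^ i) (frag_of (merge_at Q i (y # ys)))))"
    by (rule sum.cong) (auto simp: merge frag_extend_cmul)
  also have "\<dots> = - ?c (\<Sum>i = 1..m. frag_cmul ((-1) ^ i) (frag_of (merge_at Q i (y # ys))))"
    by (simp add: frag_extend_sum sum_negf)
  also have "frag_of (merge_at Q 1 (x # y # ys)) = frag_of ((x \<otimes>\<^bsub>Q\<^esub> y) # ys)"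
    by (simp add: merge_at_def)
  finally have sum: "(\<Sum>i = 1..n. frag_cmul ((-1) ^ i) (frag_of (merge_at Q i (x # y # ys))))
      = - frag_of ((x \<otimes>\<^bsub>Q\<^esub> y) # ys)
        - ?c (\<Sum>i = 1..m. frag_cmul ((-1) ^ i) (frag_of (merge_at Q i (y # ys))))"
    by simp
  have last: "frag_cmul ((-1) ^ Suc n) (frag_of (butlast (x # y # ys)))
      = - ?c (frag_cmul ((-1) ^ Suc m) (frag_of (butlast (y # ys))))"
    by (simp add: n frag_extend_cmul)
  have "(\<Sum>i = 1..n. frag_cmul ((-1) ^ i) (frag_of (merge_at Q i (x # y # ys))))
        + frag_cmul ((-1) ^ Suc n) (frag_of (butlast (x # y # ys)))
      = - frag_of ((x \<otimes>\<^bsub>Q\<^esub> y) # ys)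
        - ?c ((\<Sum>i = 1..m. frag_cmul ((-1) ^ i) (frag_of (merge_at Q i (y # ys))))
              + frag_cmul ((-1) ^ Suc m) (frag_of (butlast (y # ys))))"
    unfolding sum last frag_extend_add by simp
  also have "\<dots> = inner_faces Q x (y # ys)"
    unfolding Cons.IH[OF n(2)] by simp
  finally show ?case .
qed

text \<open>
  The part of \<open>\<partial>\<partial> = 0\<close> in which no first face occurs: the right-hand side is balanced by the inner
  faces of the face \<open>[xy|\<dots>]\<close> that merges the first two letters of \<open>[x|y|\<dots>]\<close>.
\<close>

lemma inner_faces_inner_faces:
  fixes Q :: "'q monoid"
  assumes "group Q" "x \<in> carrier Q" "y \<in> carrier Q" "ys \<in> cube Q n"
  shows "frag_extend (inner_faces Q x) (inner_faces Q y ys) = - inner_faces Q (x \<otimes>\<^bsub>Q\<^esub> y) ys"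
proof -
  interpret Q: group Q by fact
  show ?thesis using assms(2-4)
  proof (induction n arbitrary: x y ys)
    case 0 then show ?case by (simp add: frag_extend_minus)
  next
    case (Suc n)
    from Suc.prems(3) obtain z zs where ys: "ys = z # zs" "z \<in> carrier Q" "zs \<in> cube Q n"
      by (rule cube_SucE)
    let ?c = "\<lambda>x. frag_extend (\<lambda>ws. frag_of (x # ws))"
    let ?e = "inner_faces Q z zs"
    have split: "frag_extend (inner_faces Q x) (?c y c) = - ?c (x \<otimes>\<^bsub>Q\<^esub> y) c - ?c x (frag_extend (inner_faces Q y) c)"
      for c
      by (rule frag_extend_cong_basis[of c UNIV]) (auto simp: frag_extend_diff frag_extend_minus)
    show ?case
      using Suc.IH[of y z zs] Suc.prems ys
      by (simp add: frag_extend_diff frag_extend_minus split Q.m_assoc)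
  qed
qed

text \<open>
  The boundary of the bar complex with trivial integral coefficients. Integral chains are handled
  as elements of free abelian groups, whose additive notation lets the simplifier cancel signed sums
  of faces.
\<close>

definition bd :: "'q monoid \<Rightarrow> ('q list \<Rightarrow>\<^sub>0 int) \<Rightarrow> ('q list \<Rightarrow>\<^sub>0 int)" where
  "bd Q = frag_extend (\<lambda>xs. frag_of (tl xs) + inner_faces Q (hd xs) (tl xs))"

lemma bd_Cons: "bd Q (frag_of (x # xs)) = frag_of xs + inner_faces Q x xs"
  by (simp add: bd_def)

lemma bd_diff: "bd Q (a - b) = bd Q a - bd Q b"
  by (simp add: bd_def frag_extend_diff)

lemma bd_add: "bd Q (a + b) = bd Q a + bd Q b"
  by (simp add: bd_def frag_extend_add)

lemma bd_minus: "bd Q (- a) = - bd Q a"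
  by (simp add: bd_def frag_extend_minus)

lemma bd_zero [simp]: "bd Q 0 = 0"
  by (simp add: bd_def)

lemma bd_cmul: "bd Q (frag_cmul k a) = frag_cmul k (bd Q a)"
  by (simp add: bd_def frag_extend_cmul)

definition free_chains :: "'q monoid \<Rightarrow> nat \<Rightarrow> ('q list \<Rightarrow>\<^sub>0 int) set" where
  "free_chains Q n = {c. Poly_Mapping.keys c \<subseteq> cube Q n}"

lemma free_chains_diff: "a \<in> free_chains Q n \<Longrightarrow> b \<in> free_chains Q n \<Longrightarrow> a - b \<in> free_chains Q n"
  and free_chains_add: "a \<in> free_chains Q n \<Longrightarrow> b \<in> free_chains Q n \<Longrightarrow> a + b \<in> free_chains Q n"
  and free_chains_minus: "a \<in> free_chains Q n \<Longrightarrow> - a \<in> free_chains Q n"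
  and free_chains_zero: "0 \<in> free_chains Q n"
  and free_chains_of: "xs \<in> cube Q n \<Longrightarrow> frag_of xs \<in> free_chains Q n"
  by (auto simp: free_chains_def keys_diffI keys_addI)

lemma bd_closed:
  assumes "group Q" "c \<in> free_chains Q (Suc n)" shows "bd Q c \<in> free_chains Q n"
proof -
  have "Poly_Mapping.keys (bd Q c) \<subseteq> cube Q n"
    unfolding bd_def
  proof (rule keys_extendI)
    show "Poly_Mapping.keys c \<subseteq> cube Q (Suc n)" using assms by (simp add: free_chains_def)
    fix xs assume "xs \<in> cube Q (Suc n)"
    then obtain y ys where ys: "xs = y # ys" "y \<in> carrier Q" "ys \<in> cube Q n" by (rule cube_SucE)
    show "Poly_Mapping.keys (frag_of (tl xs) + inner_faces Q (hd xs) (tl xs)) \<subseteq> cube Q n"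
      using inner_faces_keys[OF assms(1) ys(2,3)] ys by (intro keys_addI) auto
  qed
  then show ?thesis by (simp add: free_chains_def)
qed

subsection \<open>Chains with coefficients\<close>

text \<open>The chain \<open>a \<otimes> c\<close>, for a coefficient \<open>a\<close> and an integral chain \<open>c\<close>.\<close>

definition chain_of :: "'q monoid \<Rightarrow> 'a monoid \<Rightarrow> nat \<Rightarrow> 'a \<Rightarrow> ('q list \<Rightarrow>\<^sub>0 int) \<Rightarrow> ('q list \<Rightarrow> 'a)" where
  "chain_of Q A n a c = (\<lambda>xs \<in> cube Q n. a [^]\<^bsub>A\<^esub> poly_mapping.lookup c xs)"

lemma comm_group_bar_group:
  assumes "comm_group A" shows "comm_group (bar_group Q A n)"
proof -
  interpret A: comm_group A by fact
  have "group (bar_group Q A n)" by (simp add: bar_group_def A.is_group)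
  then show ?thesis
  proof (rule group.group_comm_groupI)
    fix x y assume "x \<in> carrier (bar_group Q A n)" "y \<in> carrier (bar_group Q A n)"
    then show "x \<otimes>\<^bsub>bar_group Q A n\<^esub> y = y \<otimes>\<^bsub>bar_group Q A n\<^esub> x"
      by (auto simp: bar_group_def carrier_sum_group A.is_group A.m_comm PiE_iff intro!: restrict_ext)
  qed
qed

lemma bar_carrier_iff:
  assumes "group A"
  shows "c \<in> carrier (bar_group Q A n) \<longleftrightarrow>
    c \<in> extensional (cube Q n) \<and> (\<forall>xs\<in>cube Q n. c xs \<in> carrier A) \<and> finite {xs \<in> cube Q n. c xs \<noteq> \<one>\<^bsub>A\<^esub>}"
  using assms by (auto simp: bar_group_def carrier_sum_group PiE_iff)

lemma bar_one: "\<one>\<^bsub>bar_group Q A n\<^esub> = (\<lambda>xs\<in>cube Q n. \<one>\<^bsub>A\<^esub>)"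
  by (simp add: bar_group_def)

lemma bar_mult: "x \<otimes>\<^bsub>bar_group Q A n\<^esub> y = (\<lambda>xs\<in>cube Q n. x xs \<otimes>\<^bsub>A\<^esub> y xs)"
  by (simp add: bar_group_def)

lemma bar_inv:
  assumes "group A" "x \<in> carrier (bar_group Q A n)"
  shows "inv\<^bsub>bar_group Q A n\<^esub> x = (\<lambda>xs\<in>cube Q n. inv\<^bsub>A\<^esub> x xs)"
  using assms by (simp add: bar_group_def)

lemma bar_single_eq_chain_of:
  assumes "group A" "a \<in> carrier A" shows "bar_single Q A n a xs = chain_of Q A n a (frag_of xs)"
proof -
  interpret group A by fact
  show ?thesis using assms by (auto simp: bar_single_def chain_of_def intro!: restrict_ext)
qed

lemma chain_of_closed:
  assumes "group A" "a \<in> carrier A" shows "chain_of Q A n a c \<in> carrier (bar_group Q A n)"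
proof -
  interpret group A by fact
  have "{xs \<in> cube Q n. chain_of Q A n a c xs \<noteq> \<one>\<^bsub>A\<^esub>} \<subseteq> Poly_Mapping.keys c"
    by (auto simp: chain_of_def in_keys_iff)
  then have "finite {xs \<in> cube Q n. chain_of Q A n a c xs \<noteq> \<one>\<^bsub>A\<^esub>}"
    using finite_keys finite_subset by blast
  then show ?thesis using assms by (auto simp: bar_carrier_iff chain_of_def)
qed

lemma bar_single_closed:
  assumes "group A" "a \<in> carrier A" shows "bar_single Q A n a xs \<in> carrier (bar_group Q A n)"
  using assms by (simp add: bar_single_eq_chain_of chain_of_closed)

lemma chain_of_add:
  assumes "group A" "a \<in> carrier A"
  shows "chain_of Q A n a (c + d) = chain_of Q A n a c \<otimes>\<^bsub>bar_group Q A n\<^esub> chain_of Q A n a d"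
proof -
  interpret group A by fact
  show ?thesis using assms by (auto simp: bar_mult chain_of_def lookup_add int_pow_mult intro!: restrict_ext)
qed

lemma chain_of_zero: "group A \<Longrightarrow> chain_of Q A n a 0 = \<one>\<^bsub>bar_group Q A n\<^esub>"
  by (auto simp: bar_one chain_of_def int_pow_def intro!: restrict_ext)

lemma chain_of_hom:
  assumes "comm_group A" "a \<in> carrier A"
  shows "chain_of Q A n a \<in> hom (free_Abelian_group S) (bar_group Q A n)"
proof -
  interpret A: comm_group A by fact
  show ?thesis
    using assms by (intro homI) (auto simp: chain_of_closed chain_of_add A.is_group)
qed

lemma chain_of_hom_coeff:
  assumes "comm_group A"
  shows "(\<lambda>a. chain_of Q A n a c) \<in> hom A (bar_group Q A n)"
proof -
  interpret A: comm_group A by fact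
  show ?thesis
  proof (rule homI)
    fix a assume "a \<in> carrier A"
    then show "chain_of Q A n a c \<in> carrier (bar_group Q A n)" by (rule chain_of_closed[OF A.is_group])
  qed (auto simp: bar_mult chain_of_def A.int_pow_distrib intro!: restrict_ext)
qed

lemma bar_single_hom:
  assumes "comm_group A"
  shows "(\<lambda>a. bar_single Q A n a xs) \<in> hom A (bar_group Q A n)"
proof -
  interpret A: comm_group A by fact
  show ?thesis
  proof (rule homI)
    fix a assume "a \<in> carrier A"
    then show "bar_single Q A n a xs \<in> carrier (bar_group Q A n)" by (rule bar_single_closed[OF A.is_group])
  qed (auto simp: bar_mult bar_single_def intro!: restrict_ext)
qed

lemma bar_chain_induct [consumes 2, case_names one step]:
  assumes A: "comm_group A" and c: "c \<in> carrier (bar_group Q A n)"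
    and one: "P \<one>\<^bsub>bar_group Q A n\<^esub>"
    and step: "\<And>a xs c. a \<in> carrier A \<Longrightarrow> xs \<in> cube Q n \<Longrightarrow> c \<in> carrier (bar_group Q A n) \<Longrightarrow> P c
       \<Longrightarrow> P (bar_single Q A n a xs \<otimes>\<^bsub>bar_group Q A n\<^esub> c)"
  shows "P c"
proof -
  interpret A: comm_group A by fact
  let ?supp = "\<lambda>c. {xs \<in> cube Q n. c xs \<noteq> \<one>\<^bsub>A\<^esub>}"
  have "finite T \<Longrightarrow> ?supp c = T \<Longrightarrow> c \<in> carrier (bar_group Q A n) \<Longrightarrow> P c" for T c
  proof (induction T arbitrary: c rule: finite_induct)
    case empty
    then have "c = \<one>\<^bsub>bar_group Q A n\<^esub>"
      by (intro extensionalityI[of _ "cube Q n"]) (auto simp: bar_carrier_iff A.is_group bar_one)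
    then show ?case using one by simp
  next
    case (insert xs T)
    have xs: "xs \<in> cube Q n" using insert by auto
    let ?c = "c(xs := \<one>\<^bsub>A\<^esub>)"
    have supp: "?supp ?c = T" using insert xs by auto
    have cc: "?c \<in> carrier (bar_group Q A n)"
      using insert xs supp by (auto simp: bar_carrier_iff A.is_group extensional_def)
    have "c xs \<in> carrier A" using insert xs by (auto simp: bar_carrier_iff A.is_group)
    then have "P (bar_single Q A n (c xs) xs \<otimes>\<^bsub>bar_group Q A n\<^esub> ?c)"
      by (rule step[OF _ xs cc insert.IH[OF supp cc]])
    also have "bar_single Q A n (c xs) xs \<otimes>\<^bsub>bar_group Q A n\<^esub> ?c = c"
      using insert.prems by (intro extensionalityI[of _ "cube Q n"])
        (auto simp: bar_carrier_iff A.is_group bar_mult bar_single_def)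
    finally show ?case .
  qed
  moreover have "finite (?supp c)" using c by (auto simp: bar_carrier_iff A.is_group)
  ultimately show ?thesis using c by blast
qed

lemma bar_hom_eqI:
  assumes A: "comm_group A" and H: "group H"
    and f: "f \<in> hom (bar_group Q A n) H" and g: "g \<in> hom (bar_group Q A n) H"
    and eq: "\<And>a xs. a \<in> carrier A \<Longrightarrow> xs \<in> cube Q n \<Longrightarrow> f (bar_single Q A n a xs) = g (bar_single Q A n a xs)"
    and c: "c \<in> carrier (bar_group Q A n)"
  shows "f c = g c"
  using A c
proof (induction rule: bar_chain_induct)
  case one
  interpret B: comm_group "bar_group Q A n" by (rule comm_group_bar_group[OF A])
  show ?case using hom_one[OF f B.is_group H] hom_one[OF g B.is_group H] by simp
next
  case (step a xs c)
  then show ?case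
    using bar_single_closed[of A a Q n xs] eq A
    by (simp add: hom_mult[OF f] hom_mult[OF g] comm_group.axioms(2))
qed

text \<open>
  The boundary, the maps induced by group homomorphisms and the evaluations below are all given by
  one homomorphism from the coefficients for every word.
\<close>

lemma bar_extend_hom:
  assumes "group A" "comm_group H" "\<And>xs. xs \<in> cube Q n \<Longrightarrow> (\<lambda>a. f a xs) \<in> hom A H"
  shows "(\<lambda>c. gfinprod H (\<lambda>xs. f (c xs) xs) (cube Q n)) \<in> hom (bar_group Q A n) H"
proof -
  interpret H: comm_group H by fact
  show ?thesis
    unfolding bar_group_def using H.hom_group_sum[of "cube Q n" "\<lambda>xs a. f a xs" "\<lambda>_. A"] assms by simp
qed

lemma bar_extend_single:
  assumes "group A" "comm_group H" "\<And>xs. xs \<in> cube Q n \<Longrightarrow> (\<lambda>a. f a xs) \<in> hom A H"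
    and "a \<in> carrier A" "xs \<in> cube Q n"
  shows "gfinprod H (\<lambda>ys. f (bar_single Q A n a xs ys) ys) (cube Q n) = f a xs"
proof -
  interpret H: comm_group H by fact
  interpret A: group A by fact
  have one: "f \<one>\<^bsub>A\<^esub> ys = \<one>\<^bsub>H\<^esub>" if "ys \<in> cube Q n" for ys
    using hom_one[OF assms(3)[OF that]] by (simp add: A.is_group)
  have closed: "f b ys \<in> carrier H" if "ys \<in> cube Q n" "b \<in> carrier A" for b ys
    using hom_in_carrier[OF assms(3)[OF that(1)] that(2)] .
  have "gfinprod H (\<lambda>ys. f (bar_single Q A n a xs ys) ys) (cube Q n)
      = gfinprod H (\<lambda>ys. f (bar_single Q A n a xs ys) ys) {xs}"
    by (rule H.gfinprod_mono_neutral_cong_right) (use assms(4,5) one closed in \<open>auto simp: bar_single_def\<close>)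
  also have "\<dots> = f a xs"
    using assms(4,5) closed by (simp add: bar_single_def)
  finally show ?thesis .
qed

context group_module
begin

lemma comm_group_A: "comm_group A" ..

lemma group_A: "group A" ..

lemma comm_group_bar: "comm_group (bar_group Q A n)"
  by (rule comm_group_bar_group) (rule comm_group_A)

lemma act_closed: "q \<in> carrier Q \<Longrightarrow> a \<in> carrier A \<Longrightarrow> act q a \<in> carrier A"
  using act_hom hom_in_carrier by metis

lemma boundary_single_eq:
  assumes "a \<in> carrier A" "x \<in> carrier Q" "xs \<in> cube Q n"
  shows "bar_boundary_single Q A act n a (x # xs) =
    bar_single Q A n (act (inv\<^bsub>Q\<^esub> x) a) xs \<otimes>\<^bsub>bar_group Q A n\<^esub> chain_of Q A n a (inner_faces Q x xs)"
proof -
  interpret B: comm_group "bar_group Q A n" by (rule comm_group_bar)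
  have len: "length xs = n" using assms by (simp add: cube_def)
  let ?c = "chain_of Q A n a"
  note h = chain_of_hom[OF comm_group_A assms(1), of Q n UNIV]
  have single: "bar_single Q A n (a [^]\<^bsub>A\<^esub> k) ys = ?c (frag_cmul k (frag_of ys))" for k :: int and ys
    using assms(1) by (auto simp: bar_single_def chain_of_def intro!: restrict_ext)
  have prod: "finprod (bar_group Q A n) (\<lambda>i. ?c (g i)) I = ?c (\<Sum>i\<in>I. g i)" if "finite I" for g :: "nat \<Rightarrow> _" and I
    using that
  proof (induction I rule: finite_induct)
    case empty then show ?case by (simp add: chain_of_zero group_A)
  next
    case (insert i I)
    then show ?case using assms(1) by (simp add: chain_of_add chain_of_closed group_A Pi_iff)
  qed
  have cl: "?c d \<in> carrier (bar_group Q A n)" for d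
    using assms(1) by (simp add: chain_of_closed group_A)
  have cl': "bar_single Q A n (act (inv\<^bsub>Q\<^esub> x) a) xs \<in> carrier (bar_group Q A n)"
    using assms by (simp add: bar_single_closed group_A act_closed)
  have "bar_boundary_single Q A act n a (x # xs) =
    bar_single Q A n (act (inv\<^bsub>Q\<^esub> x) a) xs \<otimes>\<^bsub>bar_group Q A n\<^esub>
      ?c ((\<Sum>i = 1..n. frag_cmul ((-1) ^ i) (frag_of (merge_at Q i (x # xs))))
          + frag_cmul ((-1) ^ Suc n) (frag_of (butlast (x # xs))))"
    unfolding bar_boundary_single_def single
    using assms(1) cl cl' by (simp only: prod[OF finite_atLeastAtMost] chain_of_add group_A B.m_assoc list.sel)
  then show ?thesis by (simp only: inner_faces_eq_sum[OF len])
qed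

lemma boundary_single_hom:
  assumes "xs \<in> cube Q (Suc n)"
  shows "(\<lambda>a. bar_boundary_single Q A act n a xs) \<in> hom A (bar_group Q A n)"
proof -
  interpret B: comm_group "bar_group Q A n" by (rule comm_group_bar)
  obtain y ys where ys: "xs = y # ys" "y \<in> carrier Q" "ys \<in> cube Q n" using assms by (rule cube_SucE)
  have h1: "(\<lambda>a. bar_single Q A n (act (inv\<^bsub>Q\<^esub> y) a) ys) \<in> hom A (bar_group Q A n)"
    using hom_compose[OF act_hom[of "inv\<^bsub>Q\<^esub> y"] bar_single_hom[OF comm_group_A, of Q n ys]] ys(2) by (simp add: o_def)
  note h2 = chain_of_hom_coeff[OF comm_group_A, of Q n "inner_faces Q y ys"]
  show ?thesis
    using hom_mult[OF h1] hom_in_carrier[OF h1] hom_mult[OF h2] hom_in_carrier[OF h2] ys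
    by (intro homI) (simp_all add: boundary_single_eq B.m_ac)
qed

lemma boundary_hom: "bar_boundary Q A act n \<in> hom (bar_group Q A (Suc n)) (bar_group Q A n)"
  unfolding bar_boundary_def[abs_def]
  using group_A comm_group_bar by (rule bar_extend_hom) (rule boundary_single_hom)

lemma boundary_single:
  assumes "a \<in> carrier A" "x \<in> carrier Q" "xs \<in> cube Q n"
  shows "bar_boundary Q A act n (bar_single Q A (Suc n) a (x # xs)) =
    bar_single Q A n (act (inv\<^bsub>Q\<^esub> x) a) xs \<otimes>\<^bsub>bar_group Q A n\<^esub> chain_of Q A n a (inner_faces Q x xs)"
proof -
  have "bar_boundary Q A act n (bar_single Q A (Suc n) a (x # xs)) = bar_boundary_single Q A act n a (x # xs)"
    unfolding bar_boundary_def
    using assms by (intro bar_extend_single[OF group_A comm_group_bar boundary_single_hom]) simp_all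
  then show ?thesis by (simp add: boundary_single_eq assms)
qed

lemma boundary_closed:
  "c \<in> carrier (bar_group Q A (Suc n)) \<Longrightarrow> bar_boundary Q A act n c \<in> carrier (bar_group Q A n)"
  using boundary_hom hom_in_carrier by metis

lemma subgroup_boundaries: "subgroup (boundaries Q A act n) (bar_group Q A n)"
proof -
  interpret f: group_hom "bar_group Q A (Suc n)" "bar_group Q A n" "bar_boundary Q A act n"
    using boundary_hom comm_group_bar by (simp add: group_hom_def group_hom_axioms_def comm_group.axioms(2))
  show ?thesis unfolding boundaries_def by (rule f.img_is_subgroup)
qed

lemma boundary_chain_of_Cons:
  assumes "a \<in> carrier A" "x \<in> carrier Q" "c \<in> free_chains Q n"
  shows "bar_boundary Q A act n (chain_of Q A (Suc n) a (frag_extend (\<lambda>xs. frag_of (x # xs)) c)) =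
    chain_of Q A n (act (inv\<^bsub>Q\<^esub> x) a) c \<otimes>\<^bsub>bar_group Q A n\<^esub>
      chain_of Q A n a (frag_extend (inner_faces Q x) c)"
proof -
  interpret B: comm_group "bar_group Q A n" by (rule comm_group_bar)
  have ia: "act (inv\<^bsub>Q\<^esub> x) a \<in> carrier A" using assms by (simp add: act_closed)
  have c: "Poly_Mapping.keys c \<subseteq> cube Q n" using assms by (simp add: free_chains_def)
  have 1: "frag_extend (\<lambda>xs. frag_of (x # xs)) \<in> hom (free_Abelian_group (cube Q n)) (free_Abelian_group (cube Q (Suc n)))"
    by (rule frag_extend_hom) (use assms in auto)
  have 2: "frag_extend (inner_faces Q x) \<in> hom (free_Abelian_group (cube Q n)) (free_Abelian_group (cube Q n))"
    by (rule frag_extend_hom) (rule inner_faces_keys[OF Q.is_group assms(2)])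
  have L: "(bar_boundary Q A act n \<circ> (chain_of Q A (Suc n) a \<circ> frag_extend (\<lambda>xs. frag_of (x # xs))))
     \<in> hom (free_Abelian_group (cube Q n)) (bar_group Q A n)"
    by (intro hom_compose[OF hom_compose[OF 1 chain_of_hom[OF comm_group_A assms(1)]] boundary_hom])
  have R: "(\<lambda>c. chain_of Q A n (act (inv\<^bsub>Q\<^esub> x) a) c \<otimes>\<^bsub>bar_group Q A n\<^esub>
      chain_of Q A n a (frag_extend (inner_faces Q x) c)) \<in> hom (free_Abelian_group (cube Q n)) (bar_group Q A n)"
    using hom_product[OF comm_group_bar chain_of_hom[OF comm_group_A ia]
        hom_compose[OF 2 chain_of_hom[OF comm_group_A assms(1)]]] by simp
  have "(bar_boundary Q A act n \<circ> (chain_of Q A (Suc n) a \<circ> frag_extend (\<lambda>xs. frag_of (x # xs)))) c =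
    chain_of Q A n (act (inv\<^bsub>Q\<^esub> x) a) c \<otimes>\<^bsub>bar_group Q A n\<^esub>
      chain_of Q A n a (frag_extend (inner_faces Q x) c)"
    by (rule free_hom_eqI[OF B.is_group L R _ c])
      (use assms ia boundary_single in \<open>simp add: bar_single_eq_chain_of[OF group_A, symmetric]\<close>)
  then show ?thesis by simp
qed

text \<open>
  On \<open>a [x|y|\<dots>]\<close> the terms in which both \<open>x\<close> and \<open>y\<close> have been removed cancel by the
  multiplicativity of the action, those in which only \<open>x\<close> has been removed occur twice with opposite
  signs, and the inner faces of inner faces cancel by \<open>inner_faces_inner_faces\<close>.
\<close>

lemma boundary_boundary:
  assumes "c \<in> carrier (bar_group Q A (Suc (Suc n)))"
  shows "bar_boundary Q A act n (bar_boundary Q A act (Suc n) c) = \<one>\<^bsub>bar_group Q A n\<^esub>"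
proof -
  interpret B: comm_group "bar_group Q A n" by (rule comm_group_bar)
  interpret B1: comm_group "bar_group Q A (Suc n)" by (rule comm_group_bar)
  have h: "bar_boundary Q A act n \<circ> bar_boundary Q A act (Suc n) \<in> hom (bar_group Q A (Suc (Suc n))) (bar_group Q A n)"
    by (rule hom_compose[OF boundary_hom boundary_hom])
  have "(bar_boundary Q A act n \<circ> bar_boundary Q A act (Suc n)) c = (\<lambda>_. \<one>\<^bsub>bar_group Q A n\<^esub>) c"
  proof (rule bar_hom_eqI[OF comm_group_A B.is_group h _ _ assms])
    fix a xs assume a: "a \<in> carrier A" and "xs \<in> cube Q (Suc (Suc n))"
    then obtain x y zs where xs: "xs = x # y # zs" and Q: "x \<in> carrier Q" "y \<in> carrier Q" "zs \<in> cube Q n"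
      by (metis cube_SucE)
    let ?d = "bar_boundary Q A act n"
    let ?e = "inner_faces Q y zs"
    have a': "act (inv\<^bsub>Q\<^esub> x) a \<in> carrier A" "act (inv\<^bsub>Q\<^esub> y) (act (inv\<^bsub>Q\<^esub> x) a) \<in> carrier A"
      using a Q by (simp_all add: act_closed)
    have e: "?e \<in> free_chains Q n" using inner_faces_keys[OF Q.is_group Q(2,3)] by (simp add: free_chains_def)
    let ?k = "frag_extend (\<lambda>xs. frag_of (x # xs)) ?e"
    let ?s = "\<lambda>b. bar_single Q A n b zs" and ?ch = "chain_of Q A n"
    let ?b = "act (inv\<^bsub>Q\<^esub> x) a"
    have m1: "?ch a (inner_faces Q (x \<otimes>\<^bsub>Q\<^esub> y) zs) \<otimes>\<^bsub>bar_group Q A n\<^esub> ?ch a (frag_extend (inner_faces Q x) ?e) = \<one>\<^bsub>bar_group Q A n\<^esub>"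
      using a Q by (simp add: inner_faces_inner_faces chain_of_add[OF group_A, symmetric] chain_of_zero[OF group_A])
    have act2: "act (inv\<^bsub>Q\<^esub> (x \<otimes>\<^bsub>Q\<^esub> y)) a = act (inv\<^bsub>Q\<^esub> y) ?b"
      using a Q by (simp add: Q.inv_mult_group act_mult)
    have "?d (bar_boundary Q A act (Suc n) (bar_single Q A (Suc (Suc n)) a xs))
      = ?d (bar_single Q A (Suc n) ?b (y # zs) \<otimes>\<^bsub>bar_group Q A (Suc n)\<^esub>
             chain_of Q A (Suc n) a (- frag_of ((x \<otimes>\<^bsub>Q\<^esub> y) # zs) - ?k))"
      using a Q by (simp add: xs boundary_single)
    also have "chain_of Q A (Suc n) a (- frag_of ((x \<otimes>\<^bsub>Q\<^esub> y) # zs) - ?k)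
       = inv\<^bsub>bar_group Q A (Suc n)\<^esub> (bar_single Q A (Suc n) a ((x \<otimes>\<^bsub>Q\<^esub> y) # zs) \<otimes>\<^bsub>bar_group Q A (Suc n)\<^esub> chain_of Q A (Suc n) a ?k)"
      using a free_hom_minus[OF B1.is_group chain_of_hom[OF comm_group_A a, of Q "Suc n" UNIV], of "frag_of ((x \<otimes>\<^bsub>Q\<^esub> y) # zs) + ?k"]
      by (simp add: bar_single_eq_chain_of group_A chain_of_add)
    also have "?d (bar_single Q A (Suc n) ?b (y # zs) \<otimes>\<^bsub>bar_group Q A (Suc n)\<^esub> \<dots>)
       = ?d (bar_single Q A (Suc n) ?b (y # zs)) \<otimes>\<^bsub>bar_group Q A n\<^esub>
          inv\<^bsub>bar_group Q A n\<^esub> (?d (bar_single Q A (Suc n) a ((x \<otimes>\<^bsub>Q\<^esub> y) # zs)) \<otimes>\<^bsub>bar_group Q A n\<^esub> ?d (chain_of Q A (Suc n) a ?k))"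
    proof -
      interpret f: group_hom "bar_group Q A (Suc n)" "bar_group Q A n" ?d
        using boundary_hom by (simp add: group_hom_def group_hom_axioms_def B.is_group B1.is_group)
      show ?thesis using a a' by (simp add: bar_single_closed chain_of_closed group_A)
    qed
    also have "\<dots> = (?s (act (inv\<^bsub>Q\<^esub> y) ?b) \<otimes>\<^bsub>bar_group Q A n\<^esub> ?ch ?b ?e) \<otimes>\<^bsub>bar_group Q A n\<^esub>
        inv\<^bsub>bar_group Q A n\<^esub> ((?s (act (inv\<^bsub>Q\<^esub> y) ?b) \<otimes>\<^bsub>bar_group Q A n\<^esub> ?ch a (inner_faces Q (x \<otimes>\<^bsub>Q\<^esub> y) zs))
          \<otimes>\<^bsub>bar_group Q A n\<^esub> (?ch ?b ?e \<otimes>\<^bsub>bar_group Q A n\<^esub> ?ch a (frag_extend (inner_faces Q x) ?e)))"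
      using a a' Q e by (simp add: boundary_single boundary_chain_of_Cons act2)
    also have "(?s (act (inv\<^bsub>Q\<^esub> y) ?b) \<otimes>\<^bsub>bar_group Q A n\<^esub> ?ch a (inner_faces Q (x \<otimes>\<^bsub>Q\<^esub> y) zs))
          \<otimes>\<^bsub>bar_group Q A n\<^esub> (?ch ?b ?e \<otimes>\<^bsub>bar_group Q A n\<^esub> ?ch a (frag_extend (inner_faces Q x) ?e))
       = (?s (act (inv\<^bsub>Q\<^esub> y) ?b) \<otimes>\<^bsub>bar_group Q A n\<^esub> ?ch ?b ?e) \<otimes>\<^bsub>bar_group Q A n\<^esub>
         (?ch a (inner_faces Q (x \<otimes>\<^bsub>Q\<^esub> y) zs) \<otimes>\<^bsub>bar_group Q A n\<^esub> ?ch a (frag_extend (inner_faces Q x) ?e))"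
      using a a' by (simp add: bar_single_closed chain_of_closed group_A B.m_ac)
    also have "\<dots> = ?s (act (inv\<^bsub>Q\<^esub> y) ?b) \<otimes>\<^bsub>bar_group Q A n\<^esub> ?ch ?b ?e"
      using a a' m1 by (simp add: bar_single_closed chain_of_closed group_A)
    finally show "(?d \<circ> bar_boundary Q A act (Suc n)) (bar_single Q A (Suc (Suc n)) a xs) = \<one>\<^bsub>bar_group Q A n\<^esub>"
      using a a' by (simp add: bar_single_closed chain_of_closed group_A)
  qed (auto intro!: homI)
  then show ?thesis by simp
qed

lemma boundary_chain_of_trivial:
  assumes "a \<in> carrier A" "\<And>q. q \<in> carrier Q \<Longrightarrow> act q a = a" "c \<in> free_chains Q (Suc n)"
  shows "bar_boundary Q A act n (chain_of Q A (Suc n) a c) = chain_of Q A n a (bd Q c)"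
proof -
  interpret B: comm_group "bar_group Q A n" by (rule comm_group_bar)
  have c: "Poly_Mapping.keys c \<subseteq> cube Q (Suc n)" using assms by (simp add: free_chains_def)
  have "bd Q \<in> hom (free_Abelian_group (cube Q (Suc n))) (free_Abelian_group (cube Q n))"
    using bd_closed[OF Q.is_group] by (intro homI) (auto simp: bd_add free_chains_def)
  then have R: "chain_of Q A n a \<circ> bd Q \<in> hom (free_Abelian_group (cube Q (Suc n))) (bar_group Q A n)"
    by (rule hom_compose) (rule chain_of_hom[OF comm_group_A assms(1)])
  have L: "bar_boundary Q A act n \<circ> chain_of Q A (Suc n) a \<in> hom (free_Abelian_group (cube Q (Suc n))) (bar_group Q A n)"
    by (rule hom_compose[OF chain_of_hom[OF comm_group_A assms(1)] boundary_hom])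
  have "(bar_boundary Q A act n \<circ> chain_of Q A (Suc n) a) c = (chain_of Q A n a \<circ> bd Q) c"
  proof (rule free_hom_eqI[OF B.is_group L R _ c])
    fix xs assume "xs \<in> cube Q (Suc n)"
    then obtain y ys where ys: "xs = y # ys" "y \<in> carrier Q" "ys \<in> cube Q n" by (rule cube_SucE)
    show "(bar_boundary Q A act n \<circ> chain_of Q A (Suc n) a) (frag_of xs) = (chain_of Q A n a \<circ> bd Q) (frag_of xs)"
      using assms(1,2) ys boundary_single[of a y ys n]
      by (simp add: bar_single_eq_chain_of[OF group_A assms(1)] bd_Cons chain_of_add[OF group_A])
  qed
  then show ?thesis by simp
qed

end

lemma group_module_trivial:
  assumes "group Q" "comm_group A" shows "group_module Q A trivial_act"
proof -
  interpret Q: group Q by fact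
  interpret A: comm_group A by fact
  show ?thesis by unfold_locales (auto simp: trivial_act_def hom_def)
qed


subsection \<open>Homology groups\<close>

context group_module
begin

lemma subgroup_cycles: "subgroup (cycles Q A act (Suc n)) (bar_group Q A (Suc n))"
proof -
  interpret f: group_hom "bar_group Q A (Suc n)" "bar_group Q A n" "bar_boundary Q A act n"
    using boundary_hom comm_group_bar by (simp add: group_hom_def group_hom_axioms_def comm_group.axioms(2))
  show ?thesis by (simp add: cycles_def f.subgroup_kernel)
qed

lemma boundaries_subset_cycles: "boundaries Q A act (Suc n) \<subseteq> cycles Q A act (Suc n)"
  using boundary_boundary boundary_closed by (auto simp: boundaries_def cycles_def kernel_def)

lemma comm_group_cycles: "comm_group ((bar_group Q A (Suc n))\<lparr>carrier := cycles Q A act (Suc n)\<rparr>)"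
proof -
  interpret B: comm_group "bar_group Q A (Suc n)" by (rule comm_group_bar)
  interpret Z: subgroup "cycles Q A act (Suc n)" "bar_group Q A (Suc n)" by (rule subgroup_cycles)
  show ?thesis
    by (rule group.group_comm_groupI[OF Z.subgroup_is_group[OF B.is_group]]) (simp add: B.m_comm Z.mem_carrier)
qed

lemma subgroup_boundaries_cycles:
  "subgroup (boundaries Q A act (Suc n)) ((bar_group Q A (Suc n))\<lparr>carrier := cycles Q A act (Suc n)\<rparr>)"
  using group.subgroup_incl[OF comm_group.axioms(2)[OF comm_group_bar] subgroup_boundaries subgroup_cycles
      boundaries_subset_cycles] .

lemma comm_group_homology: "comm_group (homology Q A act (Suc n))"
  unfolding homology_def
  using comm_group.abelian_FactGroup[OF comm_group_cycles subgroup_boundaries_cycles] .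

lemma carrier_homology:
  "carrier (homology Q A act n) = homology_class Q A act n ` cycles Q A act n"
  by (auto simp: homology_def carrier_Mod homology_class_def)

lemma homology_class_mult:
  assumes "z \<in> carrier (bar_group Q A n)" "w \<in> carrier (bar_group Q A n)"
  shows "homology_class Q A act n z \<otimes>\<^bsub>homology Q A act n\<^esub> homology_class Q A act n w
    = homology_class Q A act n (z \<otimes>\<^bsub>bar_group Q A n\<^esub> w)"
proof -
  interpret B: comm_group "bar_group Q A n" by (rule comm_group_bar)
  show ?thesis
    using B.Mod_mult[OF B.subgroup_normal[OF subgroup_boundaries] assms]
    by (simp add: homology_def homology_class_def)
qed

lemma homology_class_eq_iff:
  assumes "z \<in> carrier (bar_group Q A n)" "w \<in> carrier (bar_group Q A n)"
  shows "homology_class Q A act n z = homology_class Q A act n w \<longleftrightarrow>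
    z \<otimes>\<^bsub>bar_group Q A n\<^esub> inv\<^bsub>bar_group Q A n\<^esub> w \<in> boundaries Q A act n"
proof -
  interpret B: comm_group "bar_group Q A n" by (rule comm_group_bar)
  show ?thesis unfolding homology_class_def by (rule B.rcos_eq_iff[OF subgroup_boundaries assms])
qed

end

subsection \<open>Integral homology through free abelian groups\<close>

text \<open>
  The functions of finite support that form the integral bar complex correspond to elements of the
  free abelian groups on the words, and \<open>cls\<close> is the homology class of such an element.
\<close>

definition int_chain :: "'q monoid \<Rightarrow> nat \<Rightarrow> ('q list \<Rightarrow>\<^sub>0 int) \<Rightarrow> ('q list \<Rightarrow> int)" where
  "int_chain Q n c = chain_of Q integer_group n 1 c"

definition free_cycles :: "'q monoid \<Rightarrow> nat \<Rightarrow> ('q list \<Rightarrow>\<^sub>0 int) set" where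
  "free_cycles Q n = {c \<in> free_chains Q n. bd Q c = 0}"

definition free_boundaries :: "'q monoid \<Rightarrow> nat \<Rightarrow> ('q list \<Rightarrow>\<^sub>0 int) set" where
  "free_boundaries Q n = bd Q ` free_chains Q (Suc n)"

definition cls :: "'q monoid \<Rightarrow> nat \<Rightarrow> ('q list \<Rightarrow>\<^sub>0 int) \<Rightarrow> ('q list \<Rightarrow> int) set" where
  "cls Q n c = homology_class Q integer_group trivial_act n (int_chain Q n c)"

declare abelian_integer_group [simp]

lemma int_chain_eq: "int_chain Q n c = (\<lambda>xs\<in>cube Q n. poly_mapping.lookup c xs)"
  by (simp add: int_chain_def chain_of_def)

lemma int_chain_closed: "int_chain Q n c \<in> carrier (bar_group Q integer_group n)"
  by (simp add: int_chain_def chain_of_closed)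

lemma int_chain_add:
  "int_chain Q n (c + d) = int_chain Q n c \<otimes>\<^bsub>bar_group Q integer_group n\<^esub> int_chain Q n d"
  by (auto simp: int_chain_eq bar_mult lookup_add intro!: restrict_ext)

lemma int_chain_diff:
  "int_chain Q n (c - d) =
    int_chain Q n c \<otimes>\<^bsub>bar_group Q integer_group n\<^esub> inv\<^bsub>bar_group Q integer_group n\<^esub> int_chain Q n d"
  using int_chain_closed[of Q n d]
  by (auto simp: bar_inv) (auto simp: int_chain_eq bar_mult lookup_minus intro!: restrict_ext)

lemma int_chain_inject:
  assumes "c \<in> free_chains Q n" "d \<in> free_chains Q n" "int_chain Q n c = int_chain Q n d"
  shows "c = d"
proof (rule poly_mapping_eqI)
  fix xs
  show "poly_mapping.lookup c xs = poly_mapping.lookup d xs"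
  proof (cases "xs \<in> cube Q n")
    case True
    then show ?thesis using fun_cong[OF assms(3), of xs] by (simp add: int_chain_eq)
  next
    case False
    then have "xs \<notin> Poly_Mapping.keys c" "xs \<notin> Poly_Mapping.keys d"
      using assms by (auto simp: free_chains_def)
    then show ?thesis by (simp add: in_keys_iff)
  qed
qed

lemma int_chain_surj:
  assumes "w \<in> carrier (bar_group Q integer_group n)"
  obtains c where "c \<in> free_chains Q n" "w = int_chain Q n c"
proof -
  let ?f = "\<lambda>xs. if xs \<in> cube Q n then w xs else 0"
  have fin: "finite {xs. ?f xs \<noteq> 0}"
  proof -
    have "{xs. ?f xs \<noteq> 0} = {xs \<in> cube Q n. w xs \<noteq> \<one>\<^bsub>integer_group\<^esub>}" by auto
    then show ?thesis using assms by (simp add: bar_carrier_iff)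
  qed
  let ?c = "Abs_poly_mapping ?f"
  have look: "poly_mapping.lookup ?c = ?f" by (rule lookup_Abs_poly_mapping[OF fin])
  show ?thesis
  proof
    show "?c \<in> free_chains Q n" by (auto simp: free_chains_def in_keys_iff look split: if_splits)
    show "w = int_chain Q n ?c"
      using assms by (intro extensionalityI[of _ "cube Q n"]) (auto simp: bar_carrier_iff int_chain_eq look)
  qed
qed

lemma int_chain_bd:
  assumes "group Q" "c \<in> free_chains Q (Suc n)"
  shows "bar_boundary Q integer_group trivial_act n (int_chain Q (Suc n) c) = int_chain Q n (bd Q c)"
  unfolding int_chain_def
  by (rule group_module.boundary_chain_of_trivial[OF group_module_trivial])
    (use assms in \<open>auto simp: trivial_act_def\<close>)

lemma int_chain_in_boundaries_iff:
  assumes "group Q" "c \<in> free_chains Q n"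
  shows "int_chain Q n c \<in> boundaries Q integer_group trivial_act n \<longleftrightarrow> c \<in> free_boundaries Q n"
proof
  assume "int_chain Q n c \<in> boundaries Q integer_group trivial_act n"
  then obtain u where u: "u \<in> carrier (bar_group Q integer_group (Suc n))"
    "int_chain Q n c = bar_boundary Q integer_group trivial_act n u" by (auto simp: boundaries_def)
  from u(1) obtain d where d: "d \<in> free_chains Q (Suc n)" "u = int_chain Q (Suc n) d" by (rule int_chain_surj)
  have "c = bd Q d"
    using u d assms by (intro int_chain_inject[of _ Q n]) (simp_all add: int_chain_bd bd_closed)
  then show "c \<in> free_boundaries Q n" using d by (auto simp: free_boundaries_def)
next
  assume "c \<in> free_boundaries Q n"
  then obtain d where d: "d \<in> free_chains Q (Suc n)" "c = bd Q d" by (auto simp: free_boundaries_def)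
  then have "int_chain Q n c = bar_boundary Q integer_group trivial_act n (int_chain Q (Suc n) d)"
    using assms by (simp add: int_chain_bd)
  then show "int_chain Q n c \<in> boundaries Q integer_group trivial_act n"
    using int_chain_closed by (auto simp: boundaries_def)
qed

lemma int_chain_in_cycles_iff:
  assumes "group Q" "c \<in> free_chains Q (Suc n)"
  shows "int_chain Q (Suc n) c \<in> cycles Q integer_group trivial_act (Suc n) \<longleftrightarrow> c \<in> free_cycles Q (Suc n)"
proof -
  have zero: "int_chain Q n 0 = \<one>\<^bsub>bar_group Q integer_group n\<^esub>" by (simp add: int_chain_eq bar_one)
  have "int_chain Q n (bd Q c) = \<one>\<^bsub>bar_group Q integer_group n\<^esub> \<longleftrightarrow> bd Q c = 0"
    using int_chain_inject[OF bd_closed[OF assms] free_chains_zero] zero by auto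
  then show ?thesis using assms by (simp add: cycles_def kernel_def int_chain_closed int_chain_bd free_cycles_def)
qed

lemma carrier_integral_homology:
  assumes "group Q"
  shows "carrier (integral_homology Q (Suc n)) = cls Q (Suc n) ` free_cycles Q (Suc n)"
proof -
  have "cycles Q integer_group trivial_act (Suc n) = int_chain Q (Suc n) ` free_cycles Q (Suc n)" (is "?L = ?R")
  proof
    show "?L \<subseteq> ?R"
    proof
      fix w assume w: "w \<in> ?L"
      then have "w \<in> carrier (bar_group Q integer_group (Suc n))" by (simp add: cycles_def kernel_def)
      then obtain c where "c \<in> free_chains Q (Suc n)" "w = int_chain Q (Suc n) c" by (rule int_chain_surj)
      then show "w \<in> ?R" using w assms by (auto simp: int_chain_in_cycles_iff)
    qed
    show "?R \<subseteq> ?L" using assms by (auto simp: int_chain_in_cycles_iff free_cycles_def)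
  qed
  moreover have "group_module Q integer_group trivial_act"
    using assms by (intro group_module_trivial) auto
  ultimately show ?thesis
    by (simp add: group_module.carrier_homology cls_def[abs_def] image_image)
qed

lemma cls_mult:
  assumes "group Q" "c \<in> free_chains Q n" "d \<in> free_chains Q n"
  shows "cls Q n c \<otimes>\<^bsub>integral_homology Q n\<^esub> cls Q n d = cls Q n (c + d)"
proof -
  have "group_module Q integer_group trivial_act"
    using assms by (intro group_module_trivial) auto
  then show ?thesis
    by (simp add: cls_def group_module.homology_class_mult int_chain_closed int_chain_add)
qed

lemma cls_eq_iff:
  assumes "group Q" "c \<in> free_chains Q n" "d \<in> free_chains Q n"
  shows "cls Q n c = cls Q n d \<longleftrightarrow> c - d \<in> free_boundaries Q n"
proof -
  have "group_module Q integer_group trivial_act"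
    using assms by (intro group_module_trivial) auto
  then show ?thesis using assms
    by (simp add: cls_def group_module.homology_class_eq_iff int_chain_closed int_chain_diff[symmetric]
        int_chain_in_boundaries_iff free_chains_diff)
qed

lemma mem_cls_iff:
  assumes "group Q" "c \<in> free_chains Q n"
  shows "w \<in> cls Q n c \<longleftrightarrow> (\<exists>d\<in>free_chains Q n. w = int_chain Q n d \<and> d - c \<in> free_boundaries Q n)"
proof
  assume "w \<in> cls Q n c"
  then obtain u where u: "u \<in> boundaries Q integer_group trivial_act n"
    "w = u \<otimes>\<^bsub>bar_group Q integer_group n\<^esub> int_chain Q n c"
    by (auto simp: cls_def homology_class_def r_coset_def)
  then obtain v where v: "v \<in> carrier (bar_group Q integer_group (Suc n))"
    "u = bar_boundary Q integer_group trivial_act n v" by (auto simp: boundaries_def)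
  then obtain d where d: "d \<in> free_chains Q (Suc n)" "v = int_chain Q (Suc n) d" by (metis int_chain_surj)
  then have "w = int_chain Q n (bd Q d + c)" using u v assms by (simp add: int_chain_bd int_chain_add)
  then show "\<exists>d\<in>free_chains Q n. w = int_chain Q n d \<and> d - c \<in> free_boundaries Q n"
    using d assms bd_closed[OF assms(1) d(1)]
    by (intro bexI[of _ "bd Q d + c"]) (auto simp: free_boundaries_def free_chains_add)
next
  assume "\<exists>d\<in>free_chains Q n. w = int_chain Q n d \<and> d - c \<in> free_boundaries Q n"
  then obtain d where d: "d \<in> free_chains Q n" "w = int_chain Q n d" "d - c \<in> free_boundaries Q n" by blast
  have "int_chain Q n (d - c) \<in> boundaries Q integer_group trivial_act n"
    using d assms by (simp add: int_chain_in_boundaries_iff free_chains_diff)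
  moreover have "w = int_chain Q n (d - c) \<otimes>\<^bsub>bar_group Q integer_group n\<^esub> int_chain Q n c"
    using d by (simp add: int_chain_add[symmetric])
  ultimately show "w \<in> cls Q n c" by (auto simp: cls_def homology_class_def r_coset_def)
qed

lemma comm_group_integral_homology: "group Q \<Longrightarrow> comm_group (integral_homology Q (Suc n))"
  by (rule group_module.comm_group_homology[OF group_module_trivial]) auto

lemma free_boundaries_zero: "0 \<in> free_boundaries Q n"
  and free_boundaries_add: "a \<in> free_boundaries Q n \<Longrightarrow> b \<in> free_boundaries Q n \<Longrightarrow> a + b \<in> free_boundaries Q n"
  and free_boundaries_minus: "a \<in> free_boundaries Q n \<Longrightarrow> - a \<in> free_boundaries Q n"
  and bd_in_free_boundaries: "u \<in> free_chains Q (Suc n) \<Longrightarrow> bd Q u \<in> free_boundaries Q n"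
proof -
  show "0 \<in> free_boundaries Q n"
    unfolding free_boundaries_def using free_chains_zero by (intro image_eqI[of _ _ 0]) auto
  show "a \<in> free_boundaries Q n \<Longrightarrow> b \<in> free_boundaries Q n \<Longrightarrow> a + b \<in> free_boundaries Q n"
    unfolding free_boundaries_def by (clarsimp simp: bd_add[symmetric] free_chains_add)
  show "a \<in> free_boundaries Q n \<Longrightarrow> - a \<in> free_boundaries Q n"
    unfolding free_boundaries_def by (clarsimp simp: bd_minus[symmetric] free_chains_minus)
  show "u \<in> free_chains Q (Suc n) \<Longrightarrow> bd Q u \<in> free_boundaries Q n" by (simp add: free_boundaries_def)
qed

lemma free_boundaries_subset: "group Q \<Longrightarrow> free_boundaries Q n \<subseteq> free_chains Q n"
  by (auto simp: free_boundaries_def bd_closed)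

lemma free_cycles_chains: "c \<in> free_cycles Q n \<Longrightarrow> c \<in> free_chains Q n"
  and free_cycles_add: "c \<in> free_cycles Q n \<Longrightarrow> d \<in> free_cycles Q n \<Longrightarrow> c + d \<in> free_cycles Q n"
  by (auto simp: free_cycles_def bd_add free_chains_add)

text \<open>
  A map on cycles that is additive and constant on homology classes is all that is needed to define
  a homomorphism on homology.
\<close>

lemma integral_homology_hom_exists:
  assumes Q: "group Q"
    and closed: "\<And>c. c \<in> free_cycles Q (Suc n) \<Longrightarrow> \<phi> c \<in> carrier H"
    and add: "\<And>c d. c \<in> free_cycles Q (Suc n) \<Longrightarrow> d \<in> free_cycles Q (Suc n) \<Longrightarrow> \<phi> (c + d) = \<phi> c \<otimes>\<^bsub>H\<^esub> \<phi> d"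
    and wd: "\<And>c d. c \<in> free_cycles Q (Suc n) \<Longrightarrow> d \<in> free_cycles Q (Suc n) \<Longrightarrow> c - d \<in> free_boundaries Q (Suc n)
       \<Longrightarrow> \<phi> c = \<phi> d"
  obtains h where "h \<in> hom (integral_homology Q (Suc n)) H"
    "\<And>c. c \<in> free_cycles Q (Suc n) \<Longrightarrow> h (cls Q (Suc n) c) = \<phi> c"
proof
  define h where "h Z = \<phi> (SOME c. c \<in> free_cycles Q (Suc n) \<and> cls Q (Suc n) c = Z)" for Z
  show h: "h (cls Q (Suc n) c) = \<phi> c" if c: "c \<in> free_cycles Q (Suc n)" for c
  proof -
    define d where "d = (SOME d. d \<in> free_cycles Q (Suc n) \<and> cls Q (Suc n) d = cls Q (Suc n) c)"
    have d: "d \<in> free_cycles Q (Suc n)" "cls Q (Suc n) d = cls Q (Suc n) c"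
      using someI[of "\<lambda>d. d \<in> free_cycles Q (Suc n) \<and> cls Q (Suc n) d = cls Q (Suc n) c" c] c
      unfolding d_def by auto
    then show ?thesis
      using c wd[of d c] cls_eq_iff[OF Q, of d "Suc n" c] by (simp add: h_def d_def free_cycles_chains)
  qed
  show "h \<in> hom (integral_homology Q (Suc n)) H"
    using h closed add by (intro homI)
      (auto simp: carrier_integral_homology[OF Q] cls_mult[OF Q] free_cycles_chains free_cycles_add)
qed

definition map_words :: "('p \<Rightarrow> 'q) \<Rightarrow> ('p list \<Rightarrow>\<^sub>0 int) \<Rightarrow> ('q list \<Rightarrow>\<^sub>0 int)" where
  "map_words f = frag_extend (\<lambda>xs. frag_of (map f xs))"

lemma map_words_of [simp]: "map_words f (frag_of xs) = frag_of (map f xs)"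
  by (simp add: map_words_def)

lemma map_words_diff: "map_words f (a - b) = map_words f a - map_words f b"
  and map_words_add: "map_words f (a + b) = map_words f a + map_words f b"
  and map_words_minus: "map_words f (- a) = - map_words f a"
  and map_words_zero [simp]: "map_words f 0 = 0"
  by (simp_all add: map_words_def frag_extend_diff frag_extend_add frag_extend_minus)

lemma map_cube: "f \<in> carrier P \<rightarrow> carrier Q \<Longrightarrow> xs \<in> cube P n \<Longrightarrow> map f xs \<in> cube Q n"
  by (auto simp: cube_def)

lemma map_words_closed:
  assumes "f \<in> carrier P \<rightarrow> carrier Q" "c \<in> free_chains P n"
  shows "map_words f c \<in> free_chains Q n"
  using assms keys_extendI[of c "cube P n" "\<lambda>xs. frag_of (map f xs)" "cube Q n"] map_cube[OF assms(1)]
  by (auto simp: map_words_def free_chains_def)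

lemma map_words_bd:
  assumes f: "f \<in> hom P Q" and P: "group P" and c: "c \<in> free_chains P (Suc n)"
  shows "map_words f (bd P c) = bd Q (map_words f c)"
proof -
  interpret P: group P by fact
  have inner: "map_words f (inner_faces P x ys) = inner_faces Q (f x) (map f ys)"
    if "x \<in> carrier P" "set ys \<subseteq> carrier P" for x ys
    using that
  proof (induction ys arbitrary: x)
    case Nil then show ?case by (simp add: map_words_minus)
  next
    case (Cons y ys)
    have "map_words f (frag_extend (\<lambda>zs. frag_of (x # zs)) c)
        = frag_extend (\<lambda>zs. frag_of (f x # zs)) (map_words f c)" for c
      by (rule frag_extend_cong_basis[of c UNIV]) (auto simp: frag_extend_diff map_words_diff)
    then show ?case using Cons by (simp add: map_words_minus map_words_diff hom_mult[OF f])
  qed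
  have "Poly_Mapping.keys c \<subseteq> cube P (Suc n)" using c by (simp add: free_chains_def)
  then show ?thesis
  proof (rule frag_extend_cong_basis)
    fix xs assume "xs \<in> cube P (Suc n)"
    then obtain y ys where ys: "xs = y # ys" "y \<in> carrier P" "ys \<in> cube P n" by (rule cube_SucE)
    then show "map_words f (bd P (frag_of xs)) = bd Q (map_words f (frag_of xs))"
      by (simp add: bd_Cons map_words_add inner cube_def)
  qed (simp_all add: bd_diff map_words_diff)
qed

lemma integral_chain_map_int_chain:
  assumes f: "f \<in> carrier P \<rightarrow> carrier Q" and c: "c \<in> free_chains P n"
  shows "integral_chain_map P Q f n (int_chain P n c) = int_chain Q n (map_words f c)"
    and "integral_chain_map P Q f n \<in> hom (bar_group P integer_group n) (bar_group Q integer_group n)"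
proof -
  have B: "comm_group (bar_group Q integer_group n)" by (rule comm_group_bar_group) simp
  have ZZ: "comm_group integer_group" by simp
  have h: "(\<lambda>a. bar_single Q integer_group n a (map f xs)) \<in> hom integer_group (bar_group Q integer_group n)" for xs
    by (rule bar_single_hom) simp
  show hom: "integral_chain_map P Q f n \<in> hom (bar_group P integer_group n) (bar_group Q integer_group n)"
    unfolding integral_chain_map_def[abs_def]
    by (rule bar_extend_hom) (simp_all add: B h)
  have single: "integral_chain_map P Q f n (bar_single P integer_group n a xs) = bar_single Q integer_group n a (map f xs)"
    if "xs \<in> cube P n" for a xs
    unfolding integral_chain_map_def
    by (rule bar_extend_single[where f = "\<lambda>a xs. bar_single Q integer_group n a (map f xs)"])
      (simp_all add: B h that)
  have L: "integral_chain_map P Q f n \<circ> int_chain P n \<in> hom (free_Abelian_group (cube P n)) (bar_group Q integer_group n)"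
    unfolding int_chain_def[abs_def] by (intro hom_compose[OF chain_of_hom[OF ZZ] hom]) simp
  have "map_words f \<in> hom (free_Abelian_group (cube P n)) (free_Abelian_group (cube Q n))"
    unfolding map_words_def using map_cube[OF f] by (intro frag_extend_hom) auto
  then have R: "int_chain Q n \<circ> map_words f \<in> hom (free_Abelian_group (cube P n)) (bar_group Q integer_group n)"
    unfolding int_chain_def[abs_def] by (rule hom_compose[OF _ chain_of_hom[OF ZZ]]) simp
  have "(integral_chain_map P Q f n \<circ> int_chain P n) c = (int_chain Q n \<circ> map_words f) c"
    by (rule free_hom_eqI[OF comm_group.axioms(2)[OF B] L R])
      (use c in \<open>simp_all add: int_chain_def bar_single_eq_chain_of[symmetric] single free_chains_def\<close>)
  then show "integral_chain_map P Q f n (int_chain P n c) = int_chain Q n (map_words f c)" by simp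
qed

lemma integral_homology_map_cls:
  assumes P: "group P" and Q: "group Q" and f: "f \<in> hom P Q" and c: "c \<in> free_chains P n"
  shows "integral_homology_map P Q f n (cls P n c) = cls Q n (map_words f c)"
proof -
  have f': "f \<in> carrier P \<rightarrow> carrier Q" using f by (simp add: hom_def)
  interpret BP: comm_group "bar_group P integer_group n" by (rule comm_group_bar_group) simp
  interpret BQ: comm_group "bar_group Q integer_group n" by (rule comm_group_bar_group) simp
  have mP: "group_module P integer_group trivial_act" and mQ: "group_module Q integer_group trivial_act"
    using P Q by (auto intro!: group_module_trivial)
  have sub: "integral_chain_map P Q f n ` boundaries P integer_group trivial_act n \<subseteq> boundaries Q integer_group trivial_act n"
  proof clarify
    fix w assume "w \<in> boundaries P integer_group trivial_act n"
    then obtain u where u: "u \<in> carrier (bar_group P integer_group (Suc n))"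
      "w = bar_boundary P integer_group trivial_act n u" by (auto simp: boundaries_def)
    then obtain d where d: "d \<in> free_chains P (Suc n)" "u = int_chain P (Suc n) d" by (metis int_chain_surj)
    have "integral_chain_map P Q f n w = int_chain Q n (bd Q (map_words f d))"
      using u d P f f' by (simp add: int_chain_bd integral_chain_map_int_chain bd_closed map_words_bd)
    also have "\<dots> \<in> boundaries Q integer_group trivial_act n"
      using d Q f' by (simp add: int_chain_in_boundaries_iff bd_closed map_words_closed bd_in_free_boundaries)
    finally show "integral_chain_map P Q f n w \<in> boundaries Q integer_group trivial_act n" .
  qed
  show ?thesis
    unfolding integral_homology_map_def cls_def homology_class_def
    using BP.quot_map_rcos[OF BQ.is_group integral_chain_map_int_chain(2)[OF f' c]
       group_module.subgroup_boundaries[OF mP] group_module.subgroup_boundaries[OF mQ] sub int_chain_closed]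
    by (simp add: integral_chain_map_int_chain(1)[OF f' c])
qed


section \<open>The exterior square is the second homology of an abelian group\<close>

subsection \<open>Abelian extensions from symmetric cocycles\<close>

text \<open>
  The cocycle need not be normalized, so the neutral element and the inclusion of \<open>L\<close> are corrected
  by the value at \<open>(1, 1)\<close>.
\<close>

definition cocycle_extension :: "'b monoid \<Rightarrow> 'l monoid \<Rightarrow> ('b \<Rightarrow> 'b \<Rightarrow> 'l) \<Rightarrow> ('b \<times> 'l) monoid" where
  "cocycle_extension B L k =
     \<lparr>carrier = carrier B \<times> carrier L,
      monoid.mult = (\<lambda>(a, x) (b, y). (a \<otimes>\<^bsub>B\<^esub> b, x \<otimes>\<^bsub>L\<^esub> y \<otimes>\<^bsub>L\<^esub> k a b)),
      one = (\<one>\<^bsub>B\<^esub>, inv\<^bsub>L\<^esub> (k \<one>\<^bsub>B\<^esub> \<one>\<^bsub>B\<^esub>))\<rparr>"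

locale symmetric_cocycle = B: comm_group B + L: comm_group L
  for B :: "'b monoid" and L :: "'l monoid" and k :: "'b \<Rightarrow> 'b \<Rightarrow> 'l" +
  assumes k_closed [simp]: "a \<in> carrier B \<Longrightarrow> b \<in> carrier B \<Longrightarrow> k a b \<in> carrier L"
    and k_sym: "a \<in> carrier B \<Longrightarrow> b \<in> carrier B \<Longrightarrow> k a b = k b a"
    and k_cocycle: "\<lbrakk>a \<in> carrier B; b \<in> carrier B; c \<in> carrier B\<rbrakk>
       \<Longrightarrow> k a b \<otimes>\<^bsub>L\<^esub> k (a \<otimes>\<^bsub>B\<^esub> b) c = k b c \<otimes>\<^bsub>L\<^esub> k a (b \<otimes>\<^bsub>B\<^esub> c)"
begin

abbreviation "E \<equiv> cocycle_extension B L k"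

lemma E_simps:
  "carrier E = carrier B \<times> carrier L"
  "(a, x) \<otimes>\<^bsub>E\<^esub> (b, y) = (a \<otimes>\<^bsub>B\<^esub> b, x \<otimes>\<^bsub>L\<^esub> y \<otimes>\<^bsub>L\<^esub> k a b)"
  "\<one>\<^bsub>E\<^esub> = (\<one>\<^bsub>B\<^esub>, inv\<^bsub>L\<^esub> (k \<one>\<^bsub>B\<^esub> \<one>\<^bsub>B\<^esub>))"
  by (simp_all add: cocycle_extension_def)

lemma k_one: "a \<in> carrier B \<Longrightarrow> k \<one>\<^bsub>B\<^esub> a = k \<one>\<^bsub>B\<^esub> \<one>\<^bsub>B\<^esub>"
  using k_cocycle[of "\<one>\<^bsub>B\<^esub>" "\<one>\<^bsub>B\<^esub>" a] by simp

lemma comm_group_E: "comm_group E"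
proof (rule comm_groupI)
  fix X Y assume "X \<in> carrier E" "Y \<in> carrier E"
  then show "X \<otimes>\<^bsub>E\<^esub> Y \<in> carrier E" "X \<otimes>\<^bsub>E\<^esub> Y = Y \<otimes>\<^bsub>E\<^esub> X"
    by (auto simp: E_simps B.m_comm L.m_comm k_sym)
next
  fix X Y Z assume "X \<in> carrier E" "Y \<in> carrier E" "Z \<in> carrier E"
  then obtain a x b y c z where XYZ: "X = (a, x)" "Y = (b, y)" "Z = (c, z)"
    and abc: "a \<in> carrier B" "b \<in> carrier B" "c \<in> carrier B" and xyz: "x \<in> carrier L" "y \<in> carrier L" "z \<in> carrier L"
    by (auto simp: E_simps)
  have "x \<otimes>\<^bsub>L\<^esub> y \<otimes>\<^bsub>L\<^esub> k a b \<otimes>\<^bsub>L\<^esub> z \<otimes>\<^bsub>L\<^esub> k (a \<otimes>\<^bsub>B\<^esub> b) c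
      = x \<otimes>\<^bsub>L\<^esub> y \<otimes>\<^bsub>L\<^esub> z \<otimes>\<^bsub>L\<^esub> (k a b \<otimes>\<^bsub>L\<^esub> k (a \<otimes>\<^bsub>B\<^esub> b) c)"
    using abc xyz by (simp add: L.m_ac)
  also have "\<dots> = x \<otimes>\<^bsub>L\<^esub> (y \<otimes>\<^bsub>L\<^esub> z \<otimes>\<^bsub>L\<^esub> k b c) \<otimes>\<^bsub>L\<^esub> k a (b \<otimes>\<^bsub>B\<^esub> c)"
    using abc xyz by (simp add: k_cocycle L.m_ac)
  finally show "X \<otimes>\<^bsub>E\<^esub> Y \<otimes>\<^bsub>E\<^esub> Z = X \<otimes>\<^bsub>E\<^esub> (Y \<otimes>\<^bsub>E\<^esub> Z)"
    using abc by (simp add: XYZ E_simps B.m_assoc)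
next
  fix X assume "X \<in> carrier E"
  then obtain a x where X: "X = (a, x)" "a \<in> carrier B" "x \<in> carrier L" by (auto simp: E_simps)
  show "\<one>\<^bsub>E\<^esub> \<otimes>\<^bsub>E\<^esub> X = X"
    using X by (simp add: E_simps k_one[OF X(2)] L.m_comm[of _ x] L.m_assoc)
  show "\<exists>Y\<in>carrier E. Y \<otimes>\<^bsub>E\<^esub> X = \<one>\<^bsub>E\<^esub>"
  proof
    let ?Y = "(inv\<^bsub>B\<^esub> a, inv\<^bsub>L\<^esub> (k \<one>\<^bsub>B\<^esub> \<one>\<^bsub>B\<^esub>) \<otimes>\<^bsub>L\<^esub> (inv\<^bsub>L\<^esub> (x \<otimes>\<^bsub>L\<^esub> k (inv\<^bsub>B\<^esub> a) a)))"
    show "?Y \<in> carrier E" using X by (simp add: E_simps)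
    show "?Y \<otimes>\<^bsub>E\<^esub> X = \<one>\<^bsub>E\<^esub>" using X by (simp add: E_simps L.m_assoc)
  qed
qed (simp add: E_simps)

definition E_incl :: "'l \<Rightarrow> 'b \<times> 'l" where
  "E_incl x = (\<one>\<^bsub>B\<^esub>, x \<otimes>\<^bsub>L\<^esub> inv\<^bsub>L\<^esub> (k \<one>\<^bsub>B\<^esub> \<one>\<^bsub>B\<^esub>))"

lemma E_incl_hom: "E_incl \<in> hom L E"
proof (rule homI)
  fix x y assume xy: "x \<in> carrier L" "y \<in> carrier L"
  let ?k = "k \<one>\<^bsub>B\<^esub> \<one>\<^bsub>B\<^esub>"
  have "(x \<otimes>\<^bsub>L\<^esub> inv\<^bsub>L\<^esub> ?k) \<otimes>\<^bsub>L\<^esub> (y \<otimes>\<^bsub>L\<^esub> inv\<^bsub>L\<^esub> ?k) \<otimes>\<^bsub>L\<^esub> ?k = (x \<otimes>\<^bsub>L\<^esub> y \<otimes>\<^bsub>L\<^esub> inv\<^bsub>L\<^esub> ?k) \<otimes>\<^bsub>L\<^esub> (inv\<^bsub>L\<^esub> ?k \<otimes>\<^bsub>L\<^esub> ?k)"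
    using xy by (simp only: L.m_ac k_closed B.one_closed L.inv_closed L.m_closed)
  then show "E_incl (x \<otimes>\<^bsub>L\<^esub> y) = E_incl x \<otimes>\<^bsub>E\<^esub> E_incl y"
    using xy by (simp add: E_incl_def E_simps)
qed (simp add: E_incl_def E_simps)

lemma E_incl_eq_one: "x \<in> carrier L \<Longrightarrow> E_incl x = \<one>\<^bsub>E\<^esub> \<Longrightarrow> x = \<one>\<^bsub>L\<^esub>"
  by (simp add: E_incl_def E_simps)

lemma E_incl_mult:
  assumes "x \<in> carrier L" "b \<in> carrier B" "y \<in> carrier L"
  shows "E_incl x \<otimes>\<^bsub>E\<^esub> (b, y) = (b, x \<otimes>\<^bsub>L\<^esub> y)"
proof -
  let ?k = "k \<one>\<^bsub>B\<^esub> \<one>\<^bsub>B\<^esub>"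
  have "x \<otimes>\<^bsub>L\<^esub> inv\<^bsub>L\<^esub> ?k \<otimes>\<^bsub>L\<^esub> y \<otimes>\<^bsub>L\<^esub> ?k = x \<otimes>\<^bsub>L\<^esub> y \<otimes>\<^bsub>L\<^esub> (inv\<^bsub>L\<^esub> ?k \<otimes>\<^bsub>L\<^esub> ?k)"
    using assms by (simp only: L.m_ac k_closed B.one_closed L.inv_closed L.m_closed)
  then show ?thesis using assms by (simp add: E_incl_def E_simps k_one[OF assms(2)])
qed

end

subsection \<open>Surjectivity of the Pontryagin product\<close>

definition pontryagin :: "('m \<times> 'm \<Rightarrow>\<^sub>0 int) \<Rightarrow> ('m list \<Rightarrow>\<^sub>0 int)" where
  "pontryagin = frag_extend (\<lambda>(m, n). frag_of [m, n] - frag_of [n, m])"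

lemma pontryagin_of [simp]: "pontryagin (frag_of (m, n)) = frag_of [m, n] - frag_of [n, m]"
  by (simp add: pontryagin_def)

lemma pontryagin_diff: "pontryagin (a - b) = pontryagin a - pontryagin b"
  and pontryagin_add: "pontryagin (a + b) = pontryagin a + pontryagin b"
  and pontryagin_minus: "pontryagin (- a) = - pontryagin a"
  and pontryagin_zero [simp]: "pontryagin 0 = 0"
  by (simp_all add: pontryagin_def frag_extend_diff frag_extend_add frag_extend_minus)

lemma bd_2: "bd Q (frag_of [x, y]) = frag_of [y] - frag_of [x \<otimes>\<^bsub>Q\<^esub> y] + frag_of [x]"
  by (simp add: bd_Cons frag_extend_minus)

lemma bd_3: "bd Q (frag_of [x, y, z]) =
    frag_of [y, z] - frag_of [x \<otimes>\<^bsub>Q\<^esub> y, z] + frag_of [x, y \<otimes>\<^bsub>Q\<^esub> z] - frag_of [x, y]"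
  by (simp add: bd_Cons frag_extend_minus frag_extend_diff)

lemma bd_4: "bd Q (frag_of [x, y, z, w]) =
    frag_of [y, z, w] - frag_of [x \<otimes>\<^bsub>Q\<^esub> y, z, w] + frag_of [x, y \<otimes>\<^bsub>Q\<^esub> z, w] - frag_of [x, y, z \<otimes>\<^bsub>Q\<^esub> w]
      + frag_of [x, y, z]"
  by (simp add: bd_Cons frag_extend_minus frag_extend_diff)

lemma cube_1E: assumes "xs \<in> cube Q 1" obtains x where "xs = [x]" "x \<in> carrier Q"
  using assms by (auto simp: cube_def length_Suc_conv)

lemma cube_2E: assumes "xs \<in> cube Q 2" obtains x y where "xs = [x, y]" "x \<in> carrier Q" "y \<in> carrier Q"
  using assms by (auto simp: cube_def length_Suc_conv numeral_2_eq_2)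

lemma cube_3E:
  assumes "xs \<in> cube Q 3"
  obtains x y z where "xs = [x, y, z]" "x \<in> carrier Q" "y \<in> carrier Q" "z \<in> carrier Q"
  using assms by (auto simp: cube_def length_Suc_conv numeral_3_eq_3)

lemma cube_4E:
  assumes "xs \<in> cube Q 4"
  obtains x y z w where "xs = [x, y, z, w]" "x \<in> carrier Q" "y \<in> carrier Q" "z \<in> carrier Q" "w \<in> carrier Q"
  using assms by (auto simp: cube_def length_Suc_conv eval_nat_numeral)

lemma in_cube_1 [simp]: "[x] \<in> cube Q 1 \<longleftrightarrow> x \<in> carrier Q"
  and in_cube_Suc_0 [simp]: "[x] \<in> cube Q (Suc 0) \<longleftrightarrow> x \<in> carrier Q"
  and in_cube_2 [simp]: "[x, y] \<in> cube Q 2 \<longleftrightarrow> x \<in> carrier Q \<and> y \<in> carrier Q"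
  and in_cube_3 [simp]: "[x, y, z] \<in> cube Q 3 \<longleftrightarrow> x \<in> carrier Q \<and> y \<in> carrier Q \<and> z \<in> carrier Q"
  and in_cube_4 [simp]: "[x, y, z, w] \<in> cube Q 4 \<longleftrightarrow>
    x \<in> carrier Q \<and> y \<in> carrier Q \<and> z \<in> carrier Q \<and> w \<in> carrier Q"
  by (auto simp: cube_def)

lemma pontryagin_closed:
  assumes "Poly_Mapping.keys b \<subseteq> carrier M \<times> carrier M" shows "pontryagin b \<in> free_chains M 2"
  unfolding free_chains_def pontryagin_def mem_Collect_eq
  by (rule keys_extendI[OF assms]) (auto intro!: keys_diffI dest!: subsetD[OF keys_diff])

lemma pontryagin_cycle:
  assumes "comm_group M" "Poly_Mapping.keys b \<subseteq> carrier M \<times> carrier M"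
  shows "pontryagin b \<in> free_cycles M 2"
proof -
  interpret comm_group M by fact
  have "bd M (pontryagin b) = 0"
    using assms(2) by (rule frag_extend_cong_basis) (auto simp: pontryagin_diff bd_diff bd_2 m_comm)
  then show ?thesis using pontryagin_closed[OF assms(2)] by (simp add: free_cycles_def)
qed

text \<open>
  Let \<open>L\<close> be the group of 2-chains modulo boundaries and the chains \<open>[m|n] - [n|m]\<close>. Then \<open>[m|n]\<close>,
  as an element of \<open>L\<close>, is the universal symmetric cocycle. In the abelian extension of \<open>M\<close> by \<open>L\<close>
  that it defines, the section \<open>m \<mapsto> (m, 1)\<close> extends additively to the free abelian group on \<open>M\<close>, and
  the extended map sends \<open>\<partial>c\<close> to the class of \<open>c\<close> in \<open>L\<close>. Since \<open>L\<close> embeds into the extension, every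
  cycle \<open>c\<close> vanishes in \<open>L\<close>.
\<close>

lemma pontryagin_surj:
  assumes M: "comm_group M" and c: "c \<in> free_cycles M 2"
  obtains b where "Poly_Mapping.keys b \<subseteq> carrier M \<times> carrier M" "c - pontryagin b \<in> free_boundaries M 2"
proof -
  interpret M: comm_group M by fact
  let ?F = "free_Abelian_group (cube M 2)"
  interpret F: comm_group ?F by (rule abelian_free_Abelian_group)
  define S where "S = {u + pontryagin b | u b. u \<in> free_boundaries M 2 \<and> Poly_Mapping.keys b \<subseteq> carrier M \<times> carrier M}"
  have Smem: "u + pontryagin b \<in> S" if "u \<in> free_boundaries M 2" "Poly_Mapping.keys b \<subseteq> carrier M \<times> carrier M" for u b
    unfolding S_def using that by blast
  have S: "subgroup S ?F"
  proof (rule subgroup_free_Abelian_groupI)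
    show "S \<subseteq> {c. Poly_Mapping.keys c \<subseteq> cube M 2}"
    proof
      fix a assume "a \<in> S"
      then obtain u b where "a = u + pontryagin b" "u \<in> free_boundaries M 2"
        "Poly_Mapping.keys b \<subseteq> carrier M \<times> carrier M"
        unfolding S_def by blast
      then have "a \<in> free_chains M 2"
        using free_boundaries_subset[OF M.is_group, of 2] pontryagin_closed[of b M] by (auto intro: free_chains_add)
      then show "a \<in> {c. Poly_Mapping.keys c \<subseteq> cube M 2}" by (simp add: free_chains_def)
    qed
    show "0 \<in> S" using Smem[of 0 0] by (simp add: free_boundaries_zero)
    show "a + a' \<in> S" if aa: "a \<in> S" "a' \<in> S" for a a'
    proof -
      from aa obtain u b u' b' where *: "a = u + pontryagin b" "a' = u' + pontryagin b'"
        "u \<in> free_boundaries M 2" "u' \<in> free_boundaries M 2"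
        "Poly_Mapping.keys b \<subseteq> carrier M \<times> carrier M" "Poly_Mapping.keys b' \<subseteq> carrier M \<times> carrier M"
        unfolding S_def by blast
      have "a + a' = (u + u') + pontryagin (b + b')" by (simp add: * pontryagin_add)
      moreover have "(u + u') + pontryagin (b + b') \<in> S"
        by (rule Smem) (simp_all add: * free_boundaries_add keys_addI)
      ultimately show ?thesis by simp
    qed
    show "- a \<in> S" if "a \<in> S" for a
    proof -
      from that obtain u b where *: "a = u + pontryagin b" "u \<in> free_boundaries M 2"
        "Poly_Mapping.keys b \<subseteq> carrier M \<times> carrier M"
        unfolding S_def by blast
      then show ?thesis using Smem[of "- u" "- b"] by (simp add: free_boundaries_minus pontryagin_minus)
    qed
  qed
  let ?L = "?F Mod S"
  interpret L: comm_group ?L by (rule F.abelian_FactGroup[OF S])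
  let ?w = "\<lambda>c. S #>\<^bsub>?F\<^esub> c"
  have w: "?w \<in> hom ?F ?L" by (rule F.rcos_hom_Mod[OF F.subgroup_normal[OF S]])
  have w_eq: "?w c = ?w d" if "c - d \<in> S" "Poly_Mapping.keys c \<subseteq> cube M 2" "Poly_Mapping.keys d \<subseteq> cube M 2" for c d
    using F.rcos_eq_iff[OF S, of c d] that by simp
  note w_add = free_hom_add[OF w, symmetric]
  have k2: "Poly_Mapping.keys (frag_of [m, n]) \<subseteq> cube M 2" if "m \<in> carrier M" "n \<in> carrier M" for m n
    using that by simp
  interpret sc: symmetric_cocycle M ?L "\<lambda>m n. ?w (frag_of [m, n])"
  proof unfold_locales
    fix m n assume mn: "m \<in> carrier M" "n \<in> carrier M"
    show "?w (frag_of [m, n]) \<in> carrier ?L" using mn by (intro free_hom_closed[OF w]) simp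
    have "frag_of [m, n] - frag_of [n, m] \<in> S"
      using Smem[OF free_boundaries_zero, of "frag_of (m, n)"] mn by simp
    then show "?w (frag_of [m, n]) = ?w (frag_of [n, m])" using mn by (intro w_eq) simp_all
    fix k assume k: "k \<in> carrier M"
    have "bd M (- frag_of [m, n, k]) \<in> free_boundaries M 2"
      using mn k by (intro bd_in_free_boundaries free_chains_minus) (simp add: free_chains_of)
    then have "frag_of [m, n] + frag_of [m \<otimes>\<^bsub>M\<^esub> n, k] - (frag_of [n, k] + frag_of [m, n \<otimes>\<^bsub>M\<^esub> k]) \<in> S"
      using Smem[of "bd M (- frag_of [m, n, k])" 0] by (simp add: bd_minus bd_3 algebra_simps)
    then show "?w (frag_of [m, n]) \<otimes>\<^bsub>?L\<^esub> ?w (frag_of [m \<otimes>\<^bsub>M\<^esub> n, k])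
        = ?w (frag_of [n, k]) \<otimes>\<^bsub>?L\<^esub> ?w (frag_of [m, n \<otimes>\<^bsub>M\<^esub> k])"
      using mn k by (simp only: w_add k2 M.m_closed) (intro w_eq keys_addI, simp_all)
  qed
  interpret E: comm_group sc.E by (rule sc.comm_group_E)
  define \<Phi> where "\<Phi> = free_extend sc.E (\<lambda>xs. (hd xs, \<one>\<^bsub>?L\<^esub>))"
  have cl: "(hd xs, \<one>\<^bsub>?L\<^esub>) \<in> carrier sc.E" if "xs \<in> cube M 1" for xs
    using that L.one_closed by (elim cube_1E) (simp add: sc.E_simps)
  have \<Phi>: "\<Phi> \<in> hom (free_Abelian_group (cube M 1)) sc.E"
    unfolding \<Phi>_def using cl by (rule free_extend_hom[OF E.comm_group_axioms])
  have \<Phi>_of: "\<Phi> (frag_of [m]) = (m, \<one>\<^bsub>?L\<^esub>)" if "m \<in> carrier M" for m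
    unfolding \<Phi>_def using that cl[of "[m]"] by (simp add: free_extend_of[OF E.comm_group_axioms])
  have "bd M \<in> hom ?F (free_Abelian_group (cube M 1))"
    using bd_closed[OF M.is_group, of _ 1] by (intro homI) (auto simp: bd_add free_chains_def numeral_2_eq_2)
  then have L: "\<Phi> \<circ> bd M \<in> hom ?F sc.E" using \<Phi> by (rule hom_compose)
  have R: "sc.E_incl \<circ> ?w \<in> hom ?F sc.E" by (rule hom_compose[OF w sc.E_incl_hom])
  have "(\<Phi> \<circ> bd M) c = (sc.E_incl \<circ> ?w) c"
  proof (rule free_hom_eqI[OF E.is_group L R])
    fix xs assume "xs \<in> cube M 2"
    then obtain m n where mn: "xs = [m, n]" "m \<in> carrier M" "n \<in> carrier M" by (rule cube_2E)
    have wc: "?w (frag_of [m, n]) \<in> carrier ?L" using mn by (intro free_hom_closed[OF w]) simp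
    have "\<Phi> (bd M (frag_of xs)) = \<Phi> (frag_of [n] + frag_of [m] - frag_of [m \<otimes>\<^bsub>M\<^esub> n])"
      by (simp add: mn bd_2 algebra_simps)
    also have "\<dots> = (n, \<one>\<^bsub>?L\<^esub>) \<otimes>\<^bsub>sc.E\<^esub> (m, \<one>\<^bsub>?L\<^esub>) \<otimes>\<^bsub>sc.E\<^esub> inv\<^bsub>sc.E\<^esub> (m \<otimes>\<^bsub>M\<^esub> n, \<one>\<^bsub>?L\<^esub>)"
      using mn by (simp add: free_hom_diff[OF E.is_group \<Phi>] free_hom_add[OF \<Phi>] keys_addI \<Phi>_of)
    also have "(n, \<one>\<^bsub>?L\<^esub>) \<otimes>\<^bsub>sc.E\<^esub> (m, \<one>\<^bsub>?L\<^esub>) = sc.E_incl (?w (frag_of [m, n])) \<otimes>\<^bsub>sc.E\<^esub> (m \<otimes>\<^bsub>M\<^esub> n, \<one>\<^bsub>?L\<^esub>)"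
      using mn wc L.one_closed sc.k_sym[of m n]
      by (simp add: sc.E_incl_mult sc.E_simps M.m_comm del: one_FactGroup mult_FactGroup)
    also have "\<dots> \<otimes>\<^bsub>sc.E\<^esub> inv\<^bsub>sc.E\<^esub> (m \<otimes>\<^bsub>M\<^esub> n, \<one>\<^bsub>?L\<^esub>) = sc.E_incl (?w (frag_of [m, n]))"
    proof -
      have "(m \<otimes>\<^bsub>M\<^esub> n, \<one>\<^bsub>?L\<^esub>) \<in> carrier sc.E"
        using mn L.one_closed by (simp add: sc.E_simps(1) del: one_FactGroup)
      then show ?thesis
        using hom_in_carrier[OF sc.E_incl_hom wc] by (simp add: E.m_assoc del: one_FactGroup)
    qed
    finally show "(\<Phi> \<circ> bd M) (frag_of xs) = (sc.E_incl \<circ> ?w) (frag_of xs)" by (simp add: mn)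
  qed (use c in \<open>simp add: free_cycles_def free_chains_def\<close>)
  then have "sc.E_incl (?w c) = \<one>\<^bsub>sc.E\<^esub>"
    using c free_hom_zero[OF E.is_group \<Phi>] by (simp add: free_cycles_def)
  moreover have ck: "Poly_Mapping.keys c \<subseteq> cube M 2" using c by (simp add: free_cycles_def free_chains_def)
  ultimately have "?w c = \<one>\<^bsub>?L\<^esub>" using sc.E_incl_eq_one free_hom_closed[OF w ck] by blast
  then have "c \<in> S" using F.rcos_eq_iff[OF S, of c 0] ck F.coset_mult_one[of S] subgroup.subset[OF S] by simp
  then obtain u b where "c = u + pontryagin b" "u \<in> free_boundaries M 2"
    "Poly_Mapping.keys b \<subseteq> carrier M \<times> carrier M"
    unfolding S_def by blast
  then show ?thesis using that[of b] by simp
qed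


subsection \<open>Injectivity of the Pontryagin product\<close>

definition biadditive_form :: "('m \<Rightarrow> 'm \<Rightarrow> 'x \<Rightarrow>\<^sub>0 int) \<Rightarrow> ('m \<Rightarrow>\<^sub>0 int) \<Rightarrow> ('m \<Rightarrow>\<^sub>0 int) \<Rightarrow> ('x \<Rightarrow>\<^sub>0 int)" where
  "biadditive_form g a b = frag_extend (\<lambda>m. frag_extend (g m) b) a"

lemma biadditive_form_of [simp]: "biadditive_form g (frag_of m) (frag_of n) = g m n"
  by (simp add: biadditive_form_def)

lemma biadditive_form_left:
  "biadditive_form g (a + a') b = biadditive_form g a b + biadditive_form g a' b"
  "biadditive_form g (a - a') b = biadditive_form g a b - biadditive_form g a' b"
  "biadditive_form g 0 b = 0"
  by (simp_all add: biadditive_form_def frag_extend_add frag_extend_diff)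

lemma biadditive_form_right:
  "biadditive_form g a (b + b') = biadditive_form g a b + biadditive_form g a b'"
  "biadditive_form g a (b - b') = biadditive_form g a b - biadditive_form g a b'"
  "biadditive_form g a 0 = 0"
proof -
  have diff: "biadditive_form g a (b - b') = biadditive_form g a b - biadditive_form g a b'" for b b'
    by (rule frag_extend_cong_basis[of a UNIV])
      (auto simp: biadditive_form_def frag_extend_diff algebra_simps)
  show "biadditive_form g a (b - b') = biadditive_form g a b - biadditive_form g a b'" by (rule diff)
  show zero: "biadditive_form g a 0 = 0" using diff[of 0 0] by simp
  show "biadditive_form g a (b + b') = biadditive_form g a b + biadditive_form g a b'"
    using diff[of b "- b'"] diff[of 0 b'] zero by simp
qed

lemma biadditive_form_keys:
  assumes "Poly_Mapping.keys a \<subseteq> S" "Poly_Mapping.keys b \<subseteq> S"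
    "\<And>m n. m \<in> S \<Longrightarrow> n \<in> S \<Longrightarrow> Poly_Mapping.keys (g m n) \<subseteq> T"
  shows "Poly_Mapping.keys (biadditive_form g a b) \<subseteq> T"
  unfolding biadditive_form_def using assms by (intro keys_extendI[of a S] keys_extendI[of b S]) auto

lemma ext_square_kernel_subgroup:
  assumes "comm_group M" shows "subgroup (ext_square_kernel M) (free_Abelian_group (carrier M \<times> carrier M))"
proof -
  interpret M: comm_group M by fact
  show ?thesis
    unfolding ext_square_kernel_def
    by (rule group.generate_is_subgroup[OF group_free_Abelian_group])
      (auto simp: bilinear_relations_def intro!: keys_diffI dest!: subsetD[OF keys_diff])
qed

locale ext_square_group = M: comm_group M for M :: "'m monoid"
begin

abbreviation "F \<equiv> free_Abelian_group (carrier M \<times> carrier M)"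

sublocale F: comm_group F by (rule abelian_free_Abelian_group)

abbreviation "K \<equiv> ext_square_kernel M"

lemma subgroup_K: "subgroup K F" by (rule ext_square_kernel_subgroup) (rule M.comm_group_axioms)

sublocale L: comm_group "ext_square M"
  unfolding ext_square_def by (rule F.abelian_FactGroup[OF subgroup_K])

definition ext_class :: "('m \<times> 'm \<Rightarrow>\<^sub>0 int) \<Rightarrow> ('m \<times> 'm \<Rightarrow>\<^sub>0 int) set" where
  "ext_class b = K #>\<^bsub>F\<^esub> b"

lemma ext_class_hom: "ext_class \<in> hom F (ext_square M)"
  unfolding ext_class_def[abs_def] ext_square_def by (rule F.rcos_hom_Mod[OF F.subgroup_normal[OF subgroup_K]])

lemma carrier_ext_square: "carrier (ext_square M) = ext_class ` {b. Poly_Mapping.keys b \<subseteq> carrier M \<times> carrier M}"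
  by (auto simp: ext_square_def carrier_Mod ext_class_def[abs_def])

lemma ext_class_eq_iff:
  "Poly_Mapping.keys b \<subseteq> carrier M \<times> carrier M \<Longrightarrow> Poly_Mapping.keys c \<subseteq> carrier M \<times> carrier M \<Longrightarrow>
   ext_class b = ext_class c \<longleftrightarrow> b - c \<in> K"
  using F.rcos_eq_iff[OF subgroup_K, of b c] by (simp add: ext_class_def)

lemma K_generators:
  "\<lbrakk>m \<in> carrier M; m' \<in> carrier M; n \<in> carrier M\<rbrakk>
     \<Longrightarrow> frag_of (m \<otimes>\<^bsub>M\<^esub> m', n) - frag_of (m, n) - frag_of (m', n) \<in> K"
  "\<lbrakk>m \<in> carrier M; n \<in> carrier M; n' \<in> carrier M\<rbrakk>
     \<Longrightarrow> frag_of (m, n \<otimes>\<^bsub>M\<^esub> n') - frag_of (m, n) - frag_of (m, n') \<in> K"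
  "m \<in> carrier M \<Longrightarrow> frag_of (m, m) \<in> K"
  unfolding ext_square_kernel_def bilinear_relations_def by (blast intro: generate.incl)+

definition wedge :: "'m \<Rightarrow> 'm \<Rightarrow> ('m \<times> 'm \<Rightarrow>\<^sub>0 int) set" where
  "wedge m n = ext_class (frag_of (m, n))"

lemma wedge_closed: "m \<in> carrier M \<Longrightarrow> n \<in> carrier M \<Longrightarrow> wedge m n \<in> carrier (ext_square M)"
  unfolding wedge_def by (rule free_hom_closed[OF ext_class_hom]) simp

lemma wedge_left: "n \<in> carrier M \<Longrightarrow> (\<lambda>m. wedge m n) \<in> hom M (ext_square M)"
proof (rule homI)
  fix m m' assume "m \<in> carrier M" "m' \<in> carrier M" "n \<in> carrier M"
  then show "wedge (m \<otimes>\<^bsub>M\<^esub> m') n = wedge m n \<otimes>\<^bsub>ext_square M\<^esub> wedge m' n"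
    unfolding wedge_def free_hom_add[OF ext_class_hom, symmetric, of "frag_of (m, n)" "frag_of (m', n)", simplified]
    using K_generators(1)[of m m' n]
    by (subst free_hom_add[OF ext_class_hom, symmetric])
      (simp_all add: ext_class_eq_iff keys_addI diff_diff_eq)
qed (simp add: wedge_closed)

lemma wedge_right: "m \<in> carrier M \<Longrightarrow> wedge m \<in> hom M (ext_square M)"
proof (rule homI)
  fix n n' assume "m \<in> carrier M" "n' \<in> carrier M" "n \<in> carrier M"
  then show "wedge m (n \<otimes>\<^bsub>M\<^esub> n') = wedge m n \<otimes>\<^bsub>ext_square M\<^esub> wedge m n'"
    unfolding wedge_def
    using K_generators(2)[of m n n']
    by (subst free_hom_add[OF ext_class_hom, symmetric])
      (simp_all add: ext_class_eq_iff keys_addI diff_diff_eq)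
qed (simp add: wedge_closed)

lemma wedge_self: "m \<in> carrier M \<Longrightarrow> wedge m m = \<one>\<^bsub>ext_square M\<^esub>"
  using ext_class_eq_iff[of "frag_of (m, m)" 0] K_generators(3)[of m] free_hom_zero[OF L.is_group ext_class_hom]
  by (simp add: wedge_def)

lemma wedge_swap:
  assumes "m \<in> carrier M" "n \<in> carrier M" shows "wedge m n = inv\<^bsub>ext_square M\<^esub> wedge n m"
proof -
  have "\<one>\<^bsub>ext_square M\<^esub> = wedge (m \<otimes>\<^bsub>M\<^esub> n) (m \<otimes>\<^bsub>M\<^esub> n)" using assms by (simp add: wedge_self)
  also have "\<dots> = (wedge m m \<otimes>\<^bsub>ext_square M\<^esub> wedge n m) \<otimes>\<^bsub>ext_square M\<^esub> (wedge m n \<otimes>\<^bsub>ext_square M\<^esub> wedge n n)"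
    using assms by (simp add: hom_mult[OF wedge_left] hom_mult[OF wedge_right])
  also have "\<dots> = wedge m n \<otimes>\<^bsub>ext_square M\<^esub> wedge n m"
    using assms by (simp add: wedge_self wedge_closed L.m_comm)
  finally show ?thesis using assms L.inv_equality[of "wedge m n" "wedge n m"] by (simp add: wedge_closed)
qed

text \<open>
  A bilinear form on the free abelian group on \<open>M\<close> whose antisymmetrization is the wedge product. The
  choice of a linear order on \<open>M\<close> makes it possible without dividing by 2.
\<close>

definition half_wedge :: "('m \<times> 'm) set \<Rightarrow> ('m \<Rightarrow>\<^sub>0 int) \<Rightarrow> ('m \<Rightarrow>\<^sub>0 int) \<Rightarrow> ('m \<times> 'm \<Rightarrow>\<^sub>0 int)" where
  "half_wedge r = biadditive_form (\<lambda>m n. if (m, n) \<in> r \<and> m \<noteq> n then frag_of (m, n) else 0)"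

definition realize :: "('m \<Rightarrow>\<^sub>0 int) \<Rightarrow> 'm" where
  "realize = free_extend M (\<lambda>m. m)"

lemma realize_hom: "realize \<in> hom (free_Abelian_group (carrier M)) M"
  unfolding realize_def by (rule free_extend_hom[OF M.comm_group_axioms])

lemma realize_of [simp]: "m \<in> carrier M \<Longrightarrow> realize (frag_of m) = m"
  unfolding realize_def by (rule free_extend_of[OF M.comm_group_axioms])

lemma half_wedge_keys:
  assumes "Poly_Mapping.keys a \<subseteq> carrier M" "Poly_Mapping.keys b \<subseteq> carrier M"
  shows "Poly_Mapping.keys (half_wedge r a b) \<subseteq> carrier M \<times> carrier M"
  unfolding half_wedge_def by (rule biadditive_form_keys[OF assms]) auto

lemma half_wedge_simps:
  "half_wedge r (a + a') b = half_wedge r a b + half_wedge r a' b"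
  "half_wedge r (a - a') b = half_wedge r a b - half_wedge r a' b"
  "half_wedge r 0 b = 0"
  "half_wedge r a (b + b') = half_wedge r a b + half_wedge r a b'"
  "half_wedge r a (b - b') = half_wedge r a b - half_wedge r a b'"
  "half_wedge r a 0 = 0"
  by (simp_all add: half_wedge_def biadditive_form_left biadditive_form_right)

lemma half_wedge_of:
  "half_wedge r (frag_of m) (frag_of n) = (if (m, n) \<in> r \<and> m \<noteq> n then frag_of (m, n) else 0)"
  by (simp add: half_wedge_def)

lemma half_wedge_antisym:
  assumes r: "linear_order r" and a: "Poly_Mapping.keys a \<subseteq> carrier M" and b: "Poly_Mapping.keys b \<subseteq> carrier M"
  shows "ext_class (half_wedge r a b - half_wedge r b a) = wedge (realize a) (realize b)"
proof -
  let ?FM = "free_Abelian_group (carrier M)"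
  let ?f = "\<lambda>a b. half_wedge r a b - half_wedge r b a"
  have kf: "Poly_Mapping.keys (?f a b) \<subseteq> carrier M \<times> carrier M"
    if "Poly_Mapping.keys a \<subseteq> carrier M" "Poly_Mapping.keys b \<subseteq> carrier M" for a b
    using that by (intro keys_diffI half_wedge_keys)
  have fl: "(\<lambda>a. ext_class (?f a b)) \<in> hom ?FM (ext_square M)"
    if "Poly_Mapping.keys b \<subseteq> carrier M" for b
  proof -
    have "(\<lambda>a. ?f a b) \<in> hom ?FM F"
    proof (rule homI)
      fix a assume "a \<in> carrier ?FM"
      then show "?f a b \<in> carrier F" using kf[of a b] that by simp
    qed (simp add: half_wedge_simps)
    from hom_compose[OF this ext_class_hom] show ?thesis by (simp add: o_def)
  qed
  have fr: "(\<lambda>b. ext_class (?f a b)) \<in> hom ?FM (ext_square M)"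
    if "Poly_Mapping.keys a \<subseteq> carrier M" for a
  proof -
    have "(\<lambda>b. ?f a b) \<in> hom ?FM F"
    proof (rule homI)
      fix b assume "b \<in> carrier ?FM"
      then show "?f a b \<in> carrier F" using kf[of a b] that by simp
    qed (simp add: half_wedge_simps)
    from hom_compose[OF this ext_class_hom] show ?thesis by (simp add: o_def)
  qed
  have rb: "realize b \<in> carrier M" by (rule free_hom_closed[OF realize_hom b])
  have base: "ext_class (?f (frag_of m) (frag_of n)) = wedge m n" if "m \<in> carrier M" "n \<in> carrier M" for m n
  proof -
    have tot: "m = n \<or> (m, n) \<in> r \<or> (n, m) \<in> r"
      using r by (auto simp: linear_order_on_def total_on_def)
    have anti: "(m, n) \<in> r \<Longrightarrow> (n, m) \<in> r \<Longrightarrow> m = n"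
      using r by (auto simp: linear_order_on_def partial_order_on_def antisym_def)
    consider "m = n" | "m \<noteq> n" "(m, n) \<in> r" "(n, m) \<notin> r" | "m \<noteq> n" "(n, m) \<in> r" "(m, n) \<notin> r"
      using tot anti by blast
    then show ?thesis
    proof cases
      case 1
      then show ?thesis using that
        by (simp add: half_wedge_of wedge_self free_hom_zero[OF L.is_group ext_class_hom])
    next
      case 2
      then show ?thesis by (simp add: half_wedge_of wedge_def)
    next
      case 3
      then show ?thesis using that wedge_swap[of m n]
        by (simp add: half_wedge_of wedge_def free_hom_minus[OF L.is_group ext_class_hom])
    qed
  qed
  have step: "ext_class (?f (frag_of m) b) = wedge m (realize b)" if m: "m \<in> carrier M" for m
  proof -
    have "(wedge m \<circ> realize) \<in> hom ?FM (ext_square M)" by (rule hom_compose[OF realize_hom wedge_right[OF m]])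
    then show ?thesis
      using free_hom_eqI[OF L.is_group fr[of "frag_of m"] _ _ b, of "wedge m \<circ> realize"] m base by simp
  qed
  have "((\<lambda>m. wedge m (realize b)) \<circ> realize) \<in> hom ?FM (ext_square M)"
    by (rule hom_compose[OF realize_hom wedge_left[OF rb]])
  then show ?thesis
    using free_hom_eqI[OF L.is_group fl[OF b] _ _ a, of "(\<lambda>m. wedge m (realize b)) \<circ> realize"] step by simp
qed

text \<open>
  Let \<open>\<int>M\<close> be the free abelian group on \<open>M\<close>. The form \<open>half_wedge\<close> is a cocycle defining a central
  extension of \<open>\<int>M\<close> by \<open>\<Lambda>\<^sup>2(M)\<close> whose commutator map is the wedge product of the images in \<open>M\<close>. The
  preimage \<open>E\<close> of the kernel \<open>R\<close> of \<open>\<int>M \<rightarrow> M\<close> is therefore central, and the whole group is a central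
  extension of \<open>M\<close> by \<open>E\<close>. Evaluating its cocycle on chains gives a map \<open>\<Phi>\<close> from 2-chains to \<open>E\<close>
  that kills boundaries and sends \<open>[m|n] - [n|m]\<close> to the commutator of lifts of \<open>m\<close> and \<open>n\<close>, which
  is \<open>m \<and> n \<in> \<Lambda>\<^sup>2(M)\<close>. Hence the class of \<open>b\<close> can be read off from that of its Pontryagin product. In
  the proof, only the abelian group \<open>E\<close> is constructed.
\<close>

lemma pontryagin_inj:
  assumes b: "Poly_Mapping.keys b \<subseteq> carrier M \<times> carrier M" and bdry: "pontryagin b \<in> free_boundaries M 2"
  shows "b \<in> K"
proof -
  obtain r :: "('m \<times> 'm) set" where "well_order r" using well_order_on by blast
  then have r: "linear_order r" by (simp add: well_order_on_def)
  let ?FM = "free_Abelian_group (carrier M)"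
  interpret FM: comm_group ?FM by (rule abelian_free_Abelian_group)
  interpret rz: group_hom ?FM M realize
    by (simp add: group_hom_def group_hom_axioms_def M.is_group realize_hom)
  let ?R = "?FM\<lparr>carrier := kernel ?FM M realize\<rparr>"
  interpret RS: subgroup "kernel ?FM M realize" ?FM by (rule rz.subgroup_kernel)
  interpret R: comm_group ?R
    by (rule group.group_comm_groupI[OF RS.subgroup_is_group[OF FM.is_group]]) (simp add: add.commute)
  let ?f = "half_wedge r"
  let ?k = "\<lambda>a b. ext_class (?f a b)"
  have R_carrier: "a \<in> carrier ?R \<longleftrightarrow> Poly_Mapping.keys a \<subseteq> carrier M \<and> realize a = \<one>\<^bsub>M\<^esub>" for a
    by (auto simp: kernel_def)
  \<comment> \<open>Elements over \<open>R\<close> commute with everything, which here reads as symmetry of the form.\<close>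
  have sym: "ext_class (?f a b) = ext_class (?f b a)"
    if "Poly_Mapping.keys a \<subseteq> carrier M" "Poly_Mapping.keys b \<subseteq> carrier M" "realize b = \<one>\<^bsub>M\<^esub>" for a b
  proof -
    have ra: "realize a \<in> carrier M" by (rule free_hom_closed[OF realize_hom that(1)])
    have "ext_class (?f a b - ?f b a) = wedge (realize a) \<one>\<^bsub>M\<^esub>"
      using half_wedge_antisym[OF r that(1,2)] that(3) by simp
    also have "\<dots> = \<one>\<^bsub>ext_square M\<^esub>"
      using hom_one[OF wedge_right[OF ra] M.is_group L.is_group] .
    also have "\<dots> = ext_class 0" using free_hom_zero[OF L.is_group ext_class_hom] by simp
    finally show ?thesis
      using half_wedge_keys[OF that(1,2)] half_wedge_keys[OF that(2,1)] by (simp add: ext_class_eq_iff keys_diffI)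
  qed
  note cl_add = free_hom_add[OF ext_class_hom, symmetric]
  interpret sc: symmetric_cocycle ?R "ext_square M" ?k
  proof unfold_locales
    fix a b c assume a: "a \<in> carrier ?R" and b: "b \<in> carrier ?R"
    show "?k a b \<in> carrier (ext_square M)"
      using a b unfolding R_carrier by (intro free_hom_closed[OF ext_class_hom] half_wedge_keys) auto
    show "?k a b = ?k b a" using a b unfolding R_carrier by (intro sym) auto
    assume c: "c \<in> carrier ?R"
    show "?k a b \<otimes>\<^bsub>ext_square M\<^esub> ?k (a \<otimes>\<^bsub>?R\<^esub> b) c = ?k b c \<otimes>\<^bsub>ext_square M\<^esub> ?k a (b \<otimes>\<^bsub>?R\<^esub> c)"
    proof -
      have k: "Poly_Mapping.keys a \<subseteq> carrier M" "Poly_Mapping.keys b \<subseteq> carrier M" "Poly_Mapping.keys c \<subseteq> carrier M"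
        using a b c unfolding R_carrier by auto
      have "?f a b + ?f (a + b) c = ?f b c + ?f a (b + c)"
        by (simp add: half_wedge_simps algebra_simps)
      then show ?thesis
        using cl_add[OF half_wedge_keys[OF k(1,2)] half_wedge_keys[OF keys_addI[OF k(1,2)] k(3)]]
          cl_add[OF half_wedge_keys[OF k(2,3)] half_wedge_keys[OF k(1) keys_addI[OF k(2,3)]]] by simp
    qed
  qed
  interpret E: comm_group sc.E by (rule sc.comm_group_E)
  have E_mult: "(a, ext_class x) \<otimes>\<^bsub>sc.E\<^esub> (b, ext_class y) = (a + b, ext_class (x + y + ?f a b))"
    if "a \<in> carrier ?R" "b \<in> carrier ?R" "Poly_Mapping.keys x \<subseteq> carrier M \<times> carrier M"
      "Poly_Mapping.keys y \<subseteq> carrier M \<times> carrier M" for a b x y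
    using that unfolding R_carrier
    by (simp add: sc.E_simps free_hom_add[OF ext_class_hom] keys_addI half_wedge_keys)
  have E_one: "\<one>\<^bsub>sc.E\<^esub> = (0, ext_class 0)"
    using free_hom_zero[OF L.is_group ext_class_hom] by (simp add: sc.E_simps half_wedge_simps)
  \<comment> \<open>The cocycle \<open>s(m) s(n) s(mn)\<^sup>-\<^sup>1\<close> of the section \<open>s(m) = ([m], 1)\<close>.\<close>
  define P where "P m n = frag_of m + frag_of n - frag_of (m \<otimes>\<^bsub>M\<^esub> n)" for m n
  define x where "x m n = ?f (frag_of m) (frag_of n) - ?f (frag_of m + frag_of n) (frag_of (m \<otimes>\<^bsub>M\<^esub> n))" for m n
  have P: "P m n \<in> carrier ?R" if "m \<in> carrier M" "n \<in> carrier M" for m n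
    unfolding R_carrier P_def using that
    by (simp add: keys_addI keys_diffI free_hom_diff[OF M.is_group realize_hom] free_hom_add[OF realize_hom])
  have x: "Poly_Mapping.keys (x m n) \<subseteq> carrier M \<times> carrier M" if "m \<in> carrier M" "n \<in> carrier M" for m n
    unfolding x_def using that by (intro keys_diffI half_wedge_keys keys_addI) auto
  define c where "c xs = (P (hd xs) (hd (tl xs)), ext_class (x (hd xs) (hd (tl xs))))" for xs
  have cl: "c xs \<in> carrier sc.E" if "xs \<in> cube M 2" for xs
    using that by (elim cube_2E) (simp only: c_def sc.E_simps list.sel mem_Times_iff fst_conv snd_conv
        P free_hom_closed[OF ext_class_hom x])
  define \<Phi> where "\<Phi> = free_extend sc.E c"
  have \<Phi>: "\<Phi> \<in> hom (free_Abelian_group (cube M 2)) sc.E"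
    unfolding \<Phi>_def using cl by (rule free_extend_hom[OF E.comm_group_axioms])
  have \<Phi>_of: "\<Phi> (frag_of [m, n]) = (P m n, ext_class (x m n))" if "m \<in> carrier M" "n \<in> carrier M" for m n
    unfolding \<Phi>_def using that cl[of "[m, n]"] free_extend_of[OF E.comm_group_axioms, of c "[m, n]"] by (simp add: c_def)
  have k2: "Poly_Mapping.keys (frag_of [m, n]) \<subseteq> cube M 2" if "m \<in> carrier M" "n \<in> carrier M" for m n
    using that by simp
  have ff: "?f (frag_of m) (frag_of m) = 0" for m by (simp add: half_wedge_of)
  have \<Phi>_bd: "\<Phi> (bd M u) = \<one>\<^bsub>sc.E\<^esub>" if "u \<in> free_chains M 3" for u
  proof -
    have "bd M \<in> hom (free_Abelian_group (cube M 3)) (free_Abelian_group (cube M 2))"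
      using bd_closed[OF M.is_group, of _ 2] by (intro homI) (auto simp: bd_add free_chains_def numeral_3_eq_3)
    then have L: "\<Phi> \<circ> bd M \<in> hom (free_Abelian_group (cube M 3)) sc.E" using \<Phi> by (rule hom_compose)
    have R: "(\<lambda>_. \<one>\<^bsub>sc.E\<^esub>) \<in> hom (free_Abelian_group (cube M 3)) sc.E" by (intro homI) auto
    have "(\<Phi> \<circ> bd M) u = (\<lambda>_. \<one>\<^bsub>sc.E\<^esub>) u"
    proof (rule free_hom_eqI[OF E.is_group L R])
      fix xs assume "xs \<in> cube M 3"
      then obtain m n k where xs: "xs = [m, n, k]" and mnk: "m \<in> carrier M" "n \<in> carrier M" "k \<in> carrier M"
        by (rule cube_3E)
      let ?mn = "m \<otimes>\<^bsub>M\<^esub> n" and ?nk = "n \<otimes>\<^bsub>M\<^esub> k" and ?mnk = "m \<otimes>\<^bsub>M\<^esub> (n \<otimes>\<^bsub>M\<^esub> k)"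
      have as: "?mn \<otimes>\<^bsub>M\<^esub> k = ?mnk" using mnk by (simp add: M.m_assoc)
      have "P m n + P ?mn k = P n k + P m ?nk" by (simp add: P_def as)
      moreover have "ext_class (x m n + x ?mn k + ?f (P m n) (P ?mn k)) = ext_class (x n k + x m ?nk + ?f (P n k) (P m ?nk))"
      proof -
        have q: "x n k + x m ?nk + ?f (P n k) (P m ?nk) - (x m n + x ?mn k + ?f (P m n) (P ?mn k))
            = ?f (P n k) (frag_of m) - ?f (frag_of m) (P n k)"
          using ff by (simp add: x_def P_def as half_wedge_simps algebra_simps)
        have kP: "Poly_Mapping.keys (P n k) \<subseteq> carrier M" "realize (P n k) = \<one>\<^bsub>M\<^esub>"
          and km: "Poly_Mapping.keys (frag_of m) \<subseteq> carrier M"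
          using mnk P[of n k] unfolding R_carrier by simp_all
        have "ext_class (?f (P n k) (frag_of m)) = ext_class (?f (frag_of m) (P n k))"
          using kP(1) mnk(1) kP(2) by (intro sym[symmetric]) simp_all
        then have "?f (P n k) (frag_of m) - ?f (frag_of m) (P n k) \<in> K"
          using ext_class_eq_iff[OF half_wedge_keys[OF kP(1) km] half_wedge_keys[OF km kP(1)]] by simp
        then have "x n k + x m ?nk + ?f (P n k) (P m ?nk) - (x m n + x ?mn k + ?f (P m n) (P ?mn k)) \<in> K"
          by (simp add: q)
        moreover have "Poly_Mapping.keys (x a b + x c d + ?f (P a b) (P c d)) \<subseteq> carrier M \<times> carrier M"
          if "a \<in> carrier M" "b \<in> carrier M" "c \<in> carrier M" "d \<in> carrier M" for a b c d
          using that P[of a b] P[of c d] unfolding R_carrier by (intro keys_addI x half_wedge_keys) auto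
        ultimately show ?thesis using mnk by (intro ext_class_eq_iff[THEN iffD2, symmetric]) simp_all
      qed
      ultimately have eq: "\<Phi> (frag_of [m, n] + frag_of [?mn, k]) = \<Phi> (frag_of [n, k] + frag_of [m, ?nk])"
        using mnk E_mult[OF P P x x, of m n ?mn k m n ?mn k] E_mult[OF P P x x, of n k m ?nk n k m ?nk]
        by (simp add: free_hom_add[OF \<Phi>] \<Phi>_of)
      have "bd M (frag_of xs) = (frag_of [n, k] + frag_of [m, ?nk]) - (frag_of [m, n] + frag_of [?mn, k])"
        by (simp add: xs bd_3 algebra_simps)
      then have "\<Phi> (bd M (frag_of xs)) = \<Phi> (frag_of [n, k] + frag_of [m, ?nk]) \<otimes>\<^bsub>sc.E\<^esub> inv\<^bsub>sc.E\<^esub> \<Phi> (frag_of [n, k] + frag_of [m, ?nk])"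
        using mnk by (simp add: free_hom_diff[OF E.is_group \<Phi>] keys_addI eq)
      also have "\<dots> = \<one>\<^bsub>sc.E\<^esub>"
        using mnk by (intro E.r_inv free_hom_closed[OF \<Phi>]) (simp add: keys_addI)
      finally show "(\<Phi> \<circ> bd M) (frag_of xs) = \<one>\<^bsub>sc.E\<^esub>" by simp
    qed (use that in \<open>simp add: free_chains_def\<close>)
    then show ?thesis by simp
  qed
  have \<Phi>_pont: "\<Phi> (pontryagin b) = (0, ext_class b)"
  proof -
    have "pontryagin \<in> hom F (free_Abelian_group (cube M 2))"
      using pontryagin_closed[of _ M] by (intro homI) (auto simp: pontryagin_add free_chains_def)
    then have L: "\<Phi> \<circ> pontryagin \<in> hom F sc.E" using \<Phi> by (rule hom_compose)
    have E0: "(0, ext_class x) \<otimes>\<^bsub>sc.E\<^esub> (a, ext_class y) = (a, ext_class (x + y))"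
      if "a \<in> carrier ?R" "Poly_Mapping.keys x \<subseteq> carrier M \<times> carrier M"
      "Poly_Mapping.keys y \<subseteq> carrier M \<times> carrier M" for a x y
      using E_mult[of 0 a x y] that R.one_closed by (simp add: half_wedge_simps)
    have R: "(\<lambda>b. (0, ext_class b)) \<in> hom F sc.E"
    proof (rule homI)
      fix b assume "b \<in> carrier F"
      then show "(0, ext_class b) \<in> carrier sc.E"
        using free_hom_closed[OF ext_class_hom] R.one_closed by (simp add: sc.E_simps)
    qed (use E0 R.one_closed in simp)
    have "(\<Phi> \<circ> pontryagin) b = (\<lambda>b. (0, ext_class b)) b"
    proof (rule free_hom_eqI[OF E.is_group L R _ b], clarify)
      fix m n assume mn: "m \<in> carrier M" "n \<in> carrier M"
      have "ext_class (x m n) = ext_class (frag_of (m, n) + x n m)"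
      proof -
        have q: "x m n - x n m = ?f (frag_of m) (frag_of n) - ?f (frag_of n) (frag_of m)"
          using mn by (simp add: x_def M.m_comm add.commute)
        have "ext_class (x m n - x n m) = ext_class (frag_of (m, n))"
          using half_wedge_antisym[OF r, of "frag_of m" "frag_of n"] mn unfolding q by (simp add: wedge_def)
        then have "x m n - x n m - frag_of (m, n) \<in> K"
          using mn ext_class_eq_iff[OF keys_diffI[OF x x], of m n n m "frag_of (m, n)"] by simp
        then have "x m n - (frag_of (m, n) + x n m) \<in> K" by (simp add: algebra_simps)
        then show ?thesis using mn ext_class_eq_iff[OF x keys_addI[OF _ x], of m n "frag_of (m, n)" n m] by simp
      qed
      moreover have "P m n = P n m" using mn by (simp add: P_def M.m_comm)
      ultimately have c: "\<Phi> (frag_of [m, n]) = (0, ext_class (frag_of (m, n))) \<otimes>\<^bsub>sc.E\<^esub> \<Phi> (frag_of [n, m])"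
        using mn E0[OF P _ x, of n m "frag_of (m, n)" n m] by (simp add: \<Phi>_of)
      have "\<Phi> (pontryagin (frag_of (m, n))) = \<Phi> (frag_of [m, n]) \<otimes>\<^bsub>sc.E\<^esub> inv\<^bsub>sc.E\<^esub> \<Phi> (frag_of [n, m])"
        using mn by (simp add: free_hom_diff[OF E.is_group \<Phi>])
      also have "\<dots> = (0, ext_class (frag_of (m, n)))"
        unfolding c using mn free_hom_closed[OF \<Phi>, of "frag_of [n, m]"] free_hom_closed[OF R, of "frag_of (m, n)"]
        by (simp add: E.m_assoc)
      finally show "(\<Phi> \<circ> pontryagin) (frag_of (m, n)) = (0, ext_class (frag_of (m, n)))" by simp
    qed
    then show ?thesis by simp
  qed
  from bdry obtain u where u: "u \<in> free_chains M 3" "pontryagin b = bd M u"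
    by (auto simp: free_boundaries_def numeral_3_eq_3 numeral_2_eq_2)
  have "(0, ext_class b) = (0, ext_class 0)" using \<Phi>_pont \<Phi>_bd[OF u(1)] u(2) E_one by simp
  then show ?thesis using ext_class_eq_iff[of b 0] b by simp
qed

subsection \<open>The isomorphism\<close>

lemma pontryagin_K:
  assumes "b \<in> K" shows "pontryagin b \<in> free_boundaries M 2"
proof -
  have pt: "pontryagin \<in> hom F (free_Abelian_group (cube M 2))"
    using pontryagin_closed[of _ M] by (intro homI) (auto simp: pontryagin_add free_chains_def)
  have B: "subgroup (free_boundaries M 2) (free_Abelian_group (cube M 2))"
    using free_boundaries_subset[OF M.is_group, of 2]
    by (intro subgroup_free_Abelian_groupI)
      (auto simp: free_boundaries_zero free_boundaries_add free_boundaries_minus free_chains_def)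
  let ?S = "bilinear_relations M M \<union> {frag_of (m, m) | m. m \<in> carrier M}"
  have bd: "bd M (frag_of [x, y, z] - frag_of [x, z, y] + frag_of [z, x, y]) \<in> free_boundaries M 2"
    if "x \<in> carrier M" "y \<in> carrier M" "z \<in> carrier M" for x y z
    using that by (intro bd_in_free_boundaries free_chains_add free_chains_diff)
      (auto simp: numeral_3_eq_3[symmetric] intro!: free_chains_of)
  \<comment> \<open>The shuffle product of \<open>[x|y]\<close> and \<open>[z]\<close> bounds the defect of additivity.\<close>
  have shuffle: "pontryagin (frag_of (x \<otimes>\<^bsub>M\<^esub> y, z) - frag_of (x, z) - frag_of (y, z))
      = - bd M (frag_of [x, y, z] - frag_of [x, z, y] + frag_of [z, x, y])"
    if "x \<in> carrier M" "y \<in> carrier M" "z \<in> carrier M" for x y z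
    using that by (simp add: pontryagin_diff pontryagin_add bd_add bd_diff bd_3 M.m_comm algebra_simps)
  have swap: "pontryagin (frag_of (z, y) - frag_of (z', y') - frag_of (z'', y''))
     = - pontryagin (frag_of (y, z) - frag_of (y', z') - frag_of (y'', z''))" for z y z' y' z'' y'' :: 'm
    by (simp add: pontryagin_diff pontryagin_add algebra_simps)
  have "pontryagin ` generate F ?S \<subseteq> free_boundaries M 2"
  proof (rule F.hom_generate_subset[OF group_free_Abelian_group pt B])
    show "?S \<subseteq> carrier F"
      by (auto simp: bilinear_relations_def intro!: keys_diffI dest!: subsetD[OF keys_diff])
    have left: "pontryagin (frag_of (x \<otimes>\<^bsub>M\<^esub> y, z) - frag_of (x, z) - frag_of (y, z)) \<in> free_boundaries M 2"
      if "x \<in> carrier M" "y \<in> carrier M" "z \<in> carrier M" for x y z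
      unfolding shuffle[OF that] by (rule free_boundaries_minus[OF bd[OF that]])
    have right: "pontryagin (frag_of (z, x \<otimes>\<^bsub>M\<^esub> y) - frag_of (z, x) - frag_of (z, y)) \<in> free_boundaries M 2"
      if "x \<in> carrier M" "y \<in> carrier M" "z \<in> carrier M" for x y z
      using free_boundaries_minus[OF left[OF that]] by (subst swap)
    have "pontryagin x \<in> free_boundaries M 2" if "x \<in> bilinear_relations M M" for x
      using that left right unfolding bilinear_relations_def by blast
    then show "pontryagin ` ?S \<subseteq> free_boundaries M 2" by (auto simp: free_boundaries_zero)
  qed
  then show ?thesis using assms by (auto simp: ext_square_kernel_def)
qed

lemma cls_pontryagin_hom: "(\<lambda>b. cls M 2 (pontryagin b)) \<in> hom F (integral_homology M 2)"
proof (rule homI)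
  fix b assume b: "b \<in> carrier F"
  then have "pontryagin b \<in> free_cycles M 2" using pontryagin_cycle[OF M.comm_group_axioms] by simp
  then show "cls M 2 (pontryagin b) \<in> carrier (integral_homology M 2)"
    using carrier_integral_homology[OF M.is_group, of 1] by (simp add: numeral_2_eq_2)
next
  fix b c assume "b \<in> carrier F" "c \<in> carrier F"
  then show "cls M 2 (pontryagin (b \<otimes>\<^bsub>F\<^esub> c)) = cls M 2 (pontryagin b) \<otimes>\<^bsub>integral_homology M 2\<^esub> cls M 2 (pontryagin c)"
    using cls_mult[OF M.is_group, of "pontryagin b" 2 "pontryagin c"] pontryagin_closed[of _ M]
    by (simp add: pontryagin_add)
qed

lemma comm_group_H2: "comm_group (integral_homology M 2)"
  using comm_group_integral_homology[OF M.is_group, of 1] by (simp add: numeral_2_eq_2)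

lemma ext_square_to_H2_class:
  assumes "Poly_Mapping.keys b \<subseteq> carrier M \<times> carrier M"
  shows "ext_square_to_H2 M (ext_class b) = cls M 2 (pontryagin b)"
proof -
  interpret H: comm_group "integral_homology M 2" by (rule comm_group_H2)
  let ?g = "\<lambda>(m, n). homology_class M integer_group trivial_act 2
         (bar_single M integer_group 2 1 [m, n]
          \<otimes>\<^bsub>bar_group M integer_group 2\<^esub> bar_single M integer_group 2 (-1) [n, m])"
  have g: "?g (m, n) = cls M 2 (pontryagin (frag_of (m, n)))" if "m \<in> carrier M" "n \<in> carrier M" for m n
  proof -
    have "bar_single M integer_group 2 1 [m, n] \<otimes>\<^bsub>bar_group M integer_group 2\<^esub> bar_single M integer_group 2 (-1) [n, m]
      = int_chain M 2 (frag_of [m, n] - frag_of [n, m])"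
    proof -
      have "bar_single M integer_group 2 1 [m, n] = int_chain M 2 (frag_of [m, n])"
        by (simp add: int_chain_def bar_single_eq_chain_of)
      moreover have "bar_single M integer_group 2 (-1) [n, m] = int_chain M 2 (- frag_of [n, m])"
        by (simp add: int_chain_def bar_single_eq_chain_of) (simp add: chain_of_def)
      ultimately show ?thesis
        using int_chain_add[of M 2 "frag_of [m, n]" "- frag_of [n, m]"] by simp
    qed
    then show ?thesis by (simp add: cls_def)
  qed
  have gc: "?g x \<in> carrier (integral_homology M 2)" if "x \<in> carrier M \<times> carrier M" for x
    using that g free_hom_closed[OF cls_pontryagin_hom, of "frag_of x"] by (cases x) simp
  have h: "free_extend (integral_homology M 2) ?g \<in> hom F (integral_homology M 2)"
    using gc by (rule free_extend_hom[OF comm_group_H2])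
  have val: "free_extend (integral_homology M 2) ?g c = cls M 2 (pontryagin c)"
    if "Poly_Mapping.keys c \<subseteq> carrier M \<times> carrier M" for c
  proof (rule free_hom_eqI[OF H.is_group h cls_pontryagin_hom _ that])
    fix x assume x: "x \<in> carrier M \<times> carrier M"
    have "free_extend (integral_homology M 2) ?g (frag_of x) = ?g x"
      using gc[OF x] by (rule free_extend_of[OF comm_group_H2])
    then show "free_extend (integral_homology M 2) ?g (frag_of x) = cls M 2 (pontryagin (frag_of x))"
      using g x by (cases x) simp
  qed
  have one: "cls M 2 0 = \<one>\<^bsub>integral_homology M 2\<^esub>"
    using free_hom_zero[OF H.is_group cls_pontryagin_hom] by simp
  show ?thesis
    unfolding ext_square_to_H2_def ext_class_def val[OF assms, symmetric]
  proof (rule F.quot_lift_rcos[OF H.is_group h subgroup_K])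
    fix c assume c: "c \<in> K"
    then have k: "Poly_Mapping.keys c \<subseteq> carrier M \<times> carrier M" using subsetD[OF subgroup.subset[OF subgroup_K] c] by simp
    have "cls M 2 (pontryagin c) = cls M 2 0"
      using cls_eq_iff[OF M.is_group pontryagin_closed[OF k] free_chains_zero] pontryagin_K[OF c] by simp
    then show "free_extend (integral_homology M 2) ?g c = \<one>\<^bsub>integral_homology M 2\<^esub>"
      by (simp add: val[OF k] one)
  qed (use assms in simp)
qed

theorem ext_square_to_H2_iso: "ext_square_to_H2 M \<in> iso (ext_square M) (integral_homology M 2)"
proof -
  interpret H: comm_group "integral_homology M 2" by (rule comm_group_H2)
  have hom: "ext_square_to_H2 M \<in> hom (ext_square M) (integral_homology M 2)"
  proof (rule homI)
    fix X assume "X \<in> carrier (ext_square M)"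
    then show "ext_square_to_H2 M X \<in> carrier (integral_homology M 2)"
      using free_hom_closed[OF cls_pontryagin_hom] by (auto simp: carrier_ext_square ext_square_to_H2_class)
  next
    fix X Y assume "X \<in> carrier (ext_square M)" "Y \<in> carrier (ext_square M)"
    then obtain b c where bc: "X = ext_class b" "Y = ext_class c"
      "Poly_Mapping.keys b \<subseteq> carrier M \<times> carrier M" "Poly_Mapping.keys c \<subseteq> carrier M \<times> carrier M"
      by (auto simp: carrier_ext_square)
    then show "ext_square_to_H2 M (X \<otimes>\<^bsub>ext_square M\<^esub> Y)
        = ext_square_to_H2 M X \<otimes>\<^bsub>integral_homology M 2\<^esub> ext_square_to_H2 M Y"
      by (simp add: free_hom_add[OF ext_class_hom, symmetric] free_hom_add[OF cls_pontryagin_hom, symmetric]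
          ext_square_to_H2_class keys_addI)
  qed
  interpret p: group_hom "ext_square M" "integral_homology M 2" "ext_square_to_H2 M"
    using hom by (simp add: group_hom_def group_hom_axioms_def L.is_group H.is_group)
  have "inj_on (ext_square_to_H2 M) (carrier (ext_square M))"
    unfolding p.inj_on_one_iff
  proof (intro allI impI)
    fix X assume X: "X \<in> carrier (ext_square M)" "ext_square_to_H2 M X = \<one>\<^bsub>integral_homology M 2\<^esub>"
    then obtain b where b: "X = ext_class b" "Poly_Mapping.keys b \<subseteq> carrier M \<times> carrier M"
      by (auto simp: carrier_ext_square)
    then have "cls M 2 (pontryagin b) = cls M 2 0"
      using X(2) free_hom_zero[OF H.is_group cls_pontryagin_hom] by (simp add: ext_square_to_H2_class)
    then have "pontryagin b \<in> free_boundaries M 2"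
      using cls_eq_iff[OF M.is_group pontryagin_closed[OF b(2)] free_chains_zero] by simp
    then have "b \<in> K" using b(2) by (rule pontryagin_inj[rotated])
    then show "X = \<one>\<^bsub>ext_square M\<^esub>"
      using ext_class_eq_iff[of b 0] b free_hom_zero[OF L.is_group ext_class_hom] by simp
  qed
  moreover have "ext_square_to_H2 M ` carrier (ext_square M) = carrier (integral_homology M 2)"
  proof
    show "carrier (integral_homology M 2) \<subseteq> ext_square_to_H2 M ` carrier (ext_square M)"
    proof
      fix Z assume "Z \<in> carrier (integral_homology M 2)"
      then obtain c where c: "c \<in> free_cycles M 2" "Z = cls M 2 c"
        using carrier_integral_homology[OF M.is_group, of 1] by (auto simp: numeral_2_eq_2)
      obtain b where b: "Poly_Mapping.keys b \<subseteq> carrier M \<times> carrier M" "c - pontryagin b \<in> free_boundaries M 2"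
        by (rule pontryagin_surj[OF M.comm_group_axioms c(1)])
      then have "Z = ext_square_to_H2 M (ext_class b)"
        using cls_eq_iff[OF M.is_group free_cycles_chains[OF c(1)] pontryagin_closed[OF b(1)]] c(2)
        by (simp add: ext_square_to_H2_class)
      then show "Z \<in> ext_square_to_H2 M ` carrier (ext_square M)" using b by (auto simp: carrier_ext_square)
    qed
  qed (use p.hom_closed in auto)
  ultimately show ?thesis using hom by (simp add: iso_def bij_betw_def)
qed

end


section \<open>The relation module sequence\<close>

text \<open>
  The augmentation is the map induced by the map to a point; in this form its additivity is
  immediate.
\<close>

lemma augmentation_eq: "augmentation c = poly_mapping.lookup (frag_extend (\<lambda>_. frag_of ()) c) ()"
proof -
  have "poly_mapping.lookup (\<Sum>i\<in>A. frag_cmul (f i) (frag_of ())) () = (\<Sum>i\<in>A. f i)" if "finite A"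
    for f :: "'a \<Rightarrow> int" and A
    using that by (induction rule: finite_induct) (auto simp: lookup_add)
  then show ?thesis by (simp add: augmentation_def frag_extend_def)
qed

lemma augmentation_add: "augmentation (a + b) = augmentation a + augmentation b"
  and augmentation_diff: "augmentation (a - b) = augmentation a - augmentation b"
  and augmentation_minus: "augmentation (- a) = - augmentation a"
  and augmentation_zero [simp]: "augmentation 0 = 0"
  and augmentation_of [simp]: "augmentation (frag_of x) = 1"
  by (simp_all add: augmentation_eq frag_extend_add frag_extend_diff frag_extend_minus lookup_add lookup_minus)

lemma augmentation_frag_extend:
  assumes "\<And>x. augmentation (f x) = 1"
  shows "augmentation (frag_extend f c) = augmentation c"
  by (rule frag_extend_cong_basis[of c UNIV]) (auto simp: assms frag_extend_diff augmentation_diff)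

lemma group_ring_act_of [simp]: "group_ring_act E e (frag_of x) = frag_of (e \<otimes>\<^bsub>E\<^esub> x)"
  by (simp add: group_ring_act_def)

lemma group_ring_act_add: "group_ring_act E e (a + b) = group_ring_act E e a + group_ring_act E e b"
  and group_ring_act_diff: "group_ring_act E e (a - b) = group_ring_act E e a - group_ring_act E e b"
  and group_ring_act_zero [simp]: "group_ring_act E e 0 = 0"
  by (simp_all add: group_ring_act_def frag_extend_add frag_extend_diff)

lemma augmentation_group_ring_act [simp]: "augmentation (group_ring_act E e a) = augmentation a"
  unfolding group_ring_act_def by (rule augmentation_frag_extend) simp

lemma group_ring_act_keys:
  assumes "group E" "e \<in> carrier E" "Poly_Mapping.keys a \<subseteq> carrier E"
  shows "Poly_Mapping.keys (group_ring_act E e a) \<subseteq> carrier E"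
proof -
  interpret group E by fact
  show ?thesis unfolding group_ring_act_def by (rule keys_extendI[OF assms(3)]) (use assms in simp)
qed

lemma group_ring_act_mult:
  assumes "group E" "e \<in> carrier E" "f \<in> carrier E" "Poly_Mapping.keys a \<subseteq> carrier E"
  shows "group_ring_act E (e \<otimes>\<^bsub>E\<^esub> f) a = group_ring_act E e (group_ring_act E f a)"
proof -
  interpret group E by fact
  show ?thesis
    by (rule frag_extend_cong_basis[OF assms(4)]) (use assms in \<open>auto simp: group_ring_act_diff m_assoc\<close>)
qed

lemma group_ring_act_one:
  assumes "group E" "Poly_Mapping.keys a \<subseteq> carrier E"
  shows "group_ring_act E \<one>\<^bsub>E\<^esub> a = a"
proof -
  interpret group E by fact
  show ?thesis by (rule frag_extend_cong_basis[OF assms(2)]) (auto simp: group_ring_act_diff)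
qed

lemma group_module_group_ring:
  assumes "group Q" shows "group_module Q (free_Abelian_group (carrier Q)) (group_ring_act Q)"
proof -
  interpret Q: group Q by fact
  interpret F: comm_group "free_Abelian_group (carrier Q)" by (rule abelian_free_Abelian_group)
  show ?thesis
    by unfold_locales
      (use group_ring_act_keys[OF assms] in \<open>auto simp: group_ring_act_add group_ring_act_one[OF assms]
         group_ring_act_mult[OF assms] intro!: homI dest: subsetD\<close>)
qed

lemma augmentation_ideal_simps:
  "a \<in> carrier (augmentation_ideal E) \<longleftrightarrow> Poly_Mapping.keys a \<subseteq> carrier E \<and> augmentation a = 0"
  "a \<otimes>\<^bsub>augmentation_ideal E\<^esub> b = a + b"
  "\<one>\<^bsub>augmentation_ideal E\<^esub> = 0"
  by (simp_all add: augmentation_ideal_def)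

lemma comm_group_augmentation_ideal: "comm_group (augmentation_ideal E)"
  by (rule comm_groupI)
    (auto simp: augmentation_ideal_simps augmentation_add augmentation_minus keys_addI dest: subsetD
      intro!: bexI[of _ "- x" for x])

lemma augmentation_ideal_inv:
  assumes "a \<in> carrier (augmentation_ideal E)" shows "inv\<^bsub>augmentation_ideal E\<^esub> a = - a"
proof -
  interpret comm_group "augmentation_ideal E" by (rule comm_group_augmentation_ideal)
  show ?thesis
    by (rule inv_equality) (use assms in \<open>auto simp: augmentation_ideal_simps augmentation_minus\<close>)
qed

text \<open>
  A central extension \<open>\<pi> : G \<rightarrow> Q\<close>, a homomorphism \<open>p : E \<rightarrow> G\<close>, and a normalized section \<open>\<sigma>\<close> of
  \<open>\<pi> p\<close>. The relation module sequence considered is that of \<open>\<pi> p\<close>. Taking \<open>p\<close> to be a presentation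
  of \<open>G\<close> leads to \<open>\<delta>\<close>, and taking it to be the identity of \<open>G\<close> leads to \<open>\<beta>\<close>.
\<close>

locale central_relation =
  E: group E + G: group G + Q: group Q
  for E :: "'e monoid" and G :: "'g monoid" and Q :: "'q monoid" +
  fixes p :: "'e \<Rightarrow> 'g" and \<pi> :: "'g \<Rightarrow> 'q" and \<sigma> :: "'q \<Rightarrow> 'e"
  assumes p_hom: "p \<in> hom E G" and pi_hom: "\<pi> \<in> hom G Q"
    and central: "n \<in> kernel G Q \<pi> \<Longrightarrow> g \<in> carrier G \<Longrightarrow> n \<otimes>\<^bsub>G\<^esub> g = g \<otimes>\<^bsub>G\<^esub> n"
    and sec_closed [simp]: "q \<in> carrier Q \<Longrightarrow> \<sigma> q \<in> carrier E"
    and sec_proj [simp]: "q \<in> carrier Q \<Longrightarrow> \<pi> (p (\<sigma> q)) = q"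
    and sec_one [simp]: "\<sigma> \<one>\<^bsub>Q\<^esub> = \<one>\<^bsub>E\<^esub>"
begin

sublocale p: group_hom E G p
  by (simp add: group_hom_def group_hom_axioms_def p_hom E.is_group G.is_group)

sublocale pi: group_hom G Q \<pi>
  by (simp add: group_hom_def group_hom_axioms_def pi_hom Q.is_group G.is_group)

sublocale pp: group_hom E Q "\<pi> \<circ> p"
  using hom_compose[OF p_hom pi_hom]
  by (simp add: group_hom_def group_hom_axioms_def E.is_group Q.is_group)

abbreviation "N \<equiv> ext_kernel G Q \<pi>"
abbreviation "Ker \<equiv> kernel E Q (\<pi> \<circ> p)"
abbreviation "I \<equiv> augmentation_ideal E"
abbreviation "J \<equiv> coinvariants_kernel Ker I (group_ring_act E)"
abbreviation "T \<equiv> induced_aug_ideal E Q (\<pi> \<circ> p)"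
abbreviation "actT \<equiv> induced_aug_ideal_act E (\<pi> \<circ> p)"
abbreviation "projT \<equiv> induced_aug_ideal_proj (\<pi> \<circ> p)"
abbreviation "Rel \<equiv> relation_module E Q (\<pi> \<circ> p)"
abbreviation "incl \<equiv> relation_module_incl E Q (\<pi> \<circ> p)"

lemma N_simps:
  "n \<in> carrier N \<longleftrightarrow> n \<in> carrier G \<and> \<pi> n = \<one>\<^bsub>Q\<^esub>" "x \<otimes>\<^bsub>N\<^esub> y = x \<otimes>\<^bsub>G\<^esub> y" "\<one>\<^bsub>N\<^esub> = \<one>\<^bsub>G\<^esub>"
  by (auto simp: ext_kernel_def kernel_def)

lemma comm_group_N: "comm_group N"
proof -
  have "group N" unfolding ext_kernel_def by (rule subgroup.subgroup_is_group[OF pi.subgroup_kernel G.is_group])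
  then show ?thesis
    by (rule group.group_comm_groupI) (use central in \<open>auto simp: ext_kernel_def kernel_def\<close>)
qed

sublocale N: comm_group N by (rule comm_group_N)

lemma N_central: "n \<in> carrier N \<Longrightarrow> g \<in> carrier G \<Longrightarrow> g \<otimes>\<^bsub>G\<^esub> n = n \<otimes>\<^bsub>G\<^esub> g"
  using central by (simp add: N_simps kernel_def)

text \<open>
  Every element of \<open>G\<close> is uniquely of the form \<open>n sec(q)\<close> with \<open>n \<in> N\<close>; \<open>ncomp e\<close> is the factor \<open>n\<close>
  of \<open>p e\<close>.
\<close>

definition sec :: "'q \<Rightarrow> 'g" where "sec q = p (\<sigma> q)"

definition cocyc :: "'q \<Rightarrow> 'q \<Rightarrow> 'g" where
  "cocyc a b = sec a \<otimes>\<^bsub>G\<^esub> sec b \<otimes>\<^bsub>G\<^esub> inv\<^bsub>G\<^esub> sec (a \<otimes>\<^bsub>Q\<^esub> b)"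

definition ncomp :: "'e \<Rightarrow> 'g" where
  "ncomp e = p e \<otimes>\<^bsub>G\<^esub> inv\<^bsub>G\<^esub> sec (\<pi> (p e))"

lemma sec_simps [simp]: "q \<in> carrier Q \<Longrightarrow> sec q \<in> carrier G" "q \<in> carrier Q \<Longrightarrow> \<pi> (sec q) = q" "sec \<one>\<^bsub>Q\<^esub> = \<one>\<^bsub>G\<^esub>"
  by (simp_all add: sec_def)

lemma cocyc_closed [simp]: "a \<in> carrier Q \<Longrightarrow> b \<in> carrier Q \<Longrightarrow> cocyc a b \<in> carrier N"
  by (simp add: N_simps cocyc_def)

lemma ncomp_closed [simp]: "e \<in> carrier E \<Longrightarrow> ncomp e \<in> carrier N"
  by (simp add: N_simps ncomp_def)

lemma sec_mult: "a \<in> carrier Q \<Longrightarrow> b \<in> carrier Q \<Longrightarrow> sec a \<otimes>\<^bsub>G\<^esub> sec b = cocyc a b \<otimes>\<^bsub>G\<^esub> sec (a \<otimes>\<^bsub>Q\<^esub> b)"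
  by (simp add: cocyc_def G.m_assoc)

lemma ncomp_sec: "e \<in> carrier E \<Longrightarrow> p e = ncomp e \<otimes>\<^bsub>G\<^esub> sec (\<pi> (p e))"
  by (simp add: ncomp_def G.m_assoc)

lemma N_carrier_G: "n \<in> carrier N \<Longrightarrow> n \<in> carrier G"
  by (simp add: N_simps)

text \<open>Both sides are the factor in \<open>N\<close> of \<open>sec(a) sec(b) sec(c)\<close>, since \<open>N\<close> is central.\<close>

lemma cocyc_assoc:
  assumes "a \<in> carrier Q" "b \<in> carrier Q" "c \<in> carrier Q"
  shows "cocyc a b \<otimes>\<^bsub>N\<^esub> cocyc (a \<otimes>\<^bsub>Q\<^esub> b) c = cocyc b c \<otimes>\<^bsub>N\<^esub> cocyc a (b \<otimes>\<^bsub>Q\<^esub> c)"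
proof -
  note cl = assms Q.m_closed sec_simps(1) cocyc_closed[THEN N_carrier_G] G.m_closed
  have "cocyc a b \<otimes>\<^bsub>G\<^esub> cocyc (a \<otimes>\<^bsub>Q\<^esub> b) c \<otimes>\<^bsub>G\<^esub> sec (a \<otimes>\<^bsub>Q\<^esub> b \<otimes>\<^bsub>Q\<^esub> c) = cocyc a b \<otimes>\<^bsub>G\<^esub> (sec (a \<otimes>\<^bsub>Q\<^esub> b) \<otimes>\<^bsub>G\<^esub> sec c)"
    by (simp add: sec_mult G.m_assoc cl)
  also have "\<dots> = sec a \<otimes>\<^bsub>G\<^esub> sec b \<otimes>\<^bsub>G\<^esub> sec c" by (simp add: sec_mult G.m_assoc cl)
  also have "\<dots> = sec a \<otimes>\<^bsub>G\<^esub> (cocyc b c \<otimes>\<^bsub>G\<^esub> sec (b \<otimes>\<^bsub>Q\<^esub> c))" by (simp add: sec_mult[symmetric] G.m_assoc cl)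
  also have "\<dots> = cocyc b c \<otimes>\<^bsub>G\<^esub> (sec a \<otimes>\<^bsub>G\<^esub> sec (b \<otimes>\<^bsub>Q\<^esub> c))"
    using N_central[of "cocyc b c" "sec a"] by (simp add: G.m_assoc[symmetric] cl del: cocyc_closed) (simp add: cl)
  also have "\<dots> = cocyc b c \<otimes>\<^bsub>G\<^esub> cocyc a (b \<otimes>\<^bsub>Q\<^esub> c) \<otimes>\<^bsub>G\<^esub> sec (a \<otimes>\<^bsub>Q\<^esub> b \<otimes>\<^bsub>Q\<^esub> c)"
    by (simp add: sec_mult G.m_assoc Q.m_assoc cl)
  finally show ?thesis using assms by (simp add: N_simps(2) cl)
qed

lemma cocyc_one: "a \<in> carrier Q \<Longrightarrow> cocyc \<one>\<^bsub>Q\<^esub> a = \<one>\<^bsub>N\<^esub>" "a \<in> carrier Q \<Longrightarrow> cocyc a \<one>\<^bsub>Q\<^esub> = \<one>\<^bsub>N\<^esub>"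
  by (simp_all add: cocyc_def N_simps)

lemma ncomp_mult:
  assumes "e \<in> carrier E" "g \<in> carrier E"
  shows "ncomp (e \<otimes>\<^bsub>E\<^esub> g) = ncomp e \<otimes>\<^bsub>N\<^esub> ncomp g \<otimes>\<^bsub>N\<^esub> cocyc (\<pi> (p e)) (\<pi> (p g))"
proof -
  let ?e = "\<pi> (p e)" and ?g = "\<pi> (p g)"
  note cl = assms p.hom_closed pi.hom_closed sec_simps(1) cocyc_closed[THEN N_carrier_G]
    ncomp_closed[THEN N_carrier_G] Q.m_closed G.m_closed
  have "p (e \<otimes>\<^bsub>E\<^esub> g) = (ncomp e \<otimes>\<^bsub>G\<^esub> sec ?e) \<otimes>\<^bsub>G\<^esub> (ncomp g \<otimes>\<^bsub>G\<^esub> sec ?g)"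
    using assms by (simp add: ncomp_sec[symmetric])
  also have "\<dots> = ncomp e \<otimes>\<^bsub>G\<^esub> (sec ?e \<otimes>\<^bsub>G\<^esub> ncomp g) \<otimes>\<^bsub>G\<^esub> sec ?g" by (simp add: G.m_assoc cl)
  also have "\<dots> = ncomp e \<otimes>\<^bsub>G\<^esub> ncomp g \<otimes>\<^bsub>G\<^esub> (sec ?e \<otimes>\<^bsub>G\<^esub> sec ?g)"
    using N_central[of "ncomp g" "sec ?e"] assms by (simp add: G.m_assoc cl)
  also have "\<dots> = ncomp e \<otimes>\<^bsub>G\<^esub> ncomp g \<otimes>\<^bsub>G\<^esub> cocyc ?e ?g \<otimes>\<^bsub>G\<^esub> sec (?e \<otimes>\<^bsub>Q\<^esub> ?g)"
    by (simp add: sec_mult G.m_assoc cl)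
  finally have eq: "p (e \<otimes>\<^bsub>E\<^esub> g) = ncomp e \<otimes>\<^bsub>G\<^esub> ncomp g \<otimes>\<^bsub>G\<^esub> cocyc ?e ?g \<otimes>\<^bsub>G\<^esub> sec (?e \<otimes>\<^bsub>Q\<^esub> ?g)" .
  have "ncomp (e \<otimes>\<^bsub>E\<^esub> g) = p (e \<otimes>\<^bsub>E\<^esub> g) \<otimes>\<^bsub>G\<^esub> inv\<^bsub>G\<^esub> sec (?e \<otimes>\<^bsub>Q\<^esub> ?g)"
    using assms by (simp add: ncomp_def)
  also have "\<dots> = ncomp e \<otimes>\<^bsub>G\<^esub> ncomp g \<otimes>\<^bsub>G\<^esub> cocyc ?e ?g"
    unfolding eq using assms by (simp add: G.m_assoc cl)
  finally show ?thesis by (simp add: N_simps(2))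
qed

lemma ncomp_Ker: "k \<in> Ker \<Longrightarrow> ncomp k = p k"
  by (simp add: kernel_def ncomp_def)

subsection \<open>The middle term\<close>

sublocale I: comm_group I by (rule comm_group_augmentation_ideal)

lemma J_generators: "{group_ring_act E k a \<otimes>\<^bsub>I\<^esub> inv\<^bsub>I\<^esub> a | k a. k \<in> Ker \<and> a \<in> carrier I}
    = {group_ring_act E k a - a | k a. k \<in> Ker \<and> a \<in> carrier I}"
proof -
  have "group_ring_act E k a \<otimes>\<^bsub>I\<^esub> inv\<^bsub>I\<^esub> a = group_ring_act E k a - a" if "a \<in> carrier I" for k a
    using that by (simp add: augmentation_ideal_inv augmentation_ideal_simps(2))
  then show ?thesis by (auto; metis)
qed

lemma act_I: "e \<in> carrier E \<Longrightarrow> a \<in> carrier I \<Longrightarrow> group_ring_act E e a \<in> carrier I"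
  using group_ring_act_keys[OF E.is_group] by (simp add: augmentation_ideal_simps)

lemma diff_I: "a \<in> carrier I \<Longrightarrow> b \<in> carrier I \<Longrightarrow> a - b \<in> carrier I"
  by (simp add: augmentation_ideal_simps keys_diffI augmentation_diff)

lemma Ker_E: "k \<in> Ker \<Longrightarrow> k \<in> carrier E"
  by (simp add: kernel_def)

lemma J_gens_I: "{group_ring_act E k a - a | k a. k \<in> Ker \<and> a \<in> carrier I} \<subseteq> carrier I"
  using act_I diff_I Ker_E by blast

lemma J_def': "J = generate I {group_ring_act E k a - a | k a. k \<in> Ker \<and> a \<in> carrier I}"
  unfolding coinvariants_kernel_def J_generators ..

lemma subgroup_J: "subgroup J I"
  unfolding J_def' by (rule I.generate_is_subgroup[OF J_gens_I])

lemma J_gen: "k \<in> Ker \<Longrightarrow> a \<in> carrier I \<Longrightarrow> group_ring_act E k a - a \<in> J"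
  unfolding J_def' by (rule generate.incl) blast

lemma J_I: "j \<in> J \<Longrightarrow> j \<in> carrier I"
  using subgroup.subset[OF subgroup_J] by blast

lemma J_add: "a \<in> J \<Longrightarrow> b \<in> J \<Longrightarrow> a + b \<in> J"
  using subgroup.m_closed[OF subgroup_J] by (simp add: augmentation_ideal_simps)

lemma J_minus: "a \<in> J \<Longrightarrow> - a \<in> J"
  using subgroup.m_inv_closed[OF subgroup_J] augmentation_ideal_inv[OF J_I] by fastforce

lemma J_zero: "0 \<in> J"
  using subgroup.one_closed[OF subgroup_J] by (simp add: augmentation_ideal_simps)

lemma J_diff: "a \<in> J \<Longrightarrow> b \<in> J \<Longrightarrow> a - b \<in> J"
  using J_add[OF _ J_minus] by fastforce

lemma act_hom_I: "e \<in> carrier E \<Longrightarrow> group_ring_act E e \<in> hom I I"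
  by (rule homI) (auto simp: act_I augmentation_ideal_simps(2) group_ring_act_add)

text \<open>The kernel is normal in \<open>E\<close>: \<open>e (k - 1) a = (e k e\<^sup>-\<^sup>1 - 1) e a\<close>.\<close>

lemma act_J:
  assumes e: "e \<in> carrier E" and j: "j \<in> J"
  shows "group_ring_act E e j \<in> J"
proof -
  have "group_ring_act E e ` generate I {group_ring_act E k a - a | k a. k \<in> Ker \<and> a \<in> carrier I} \<subseteq> J"
  proof (rule I.hom_generate_subset[OF I.is_group act_hom_I[OF e] subgroup_J J_gens_I], safe)
    fix k a assume k: "k \<in> Ker" and a: "a \<in> carrier I"
    let ?k = "e \<otimes>\<^bsub>E\<^esub> k \<otimes>\<^bsub>E\<^esub> inv\<^bsub>E\<^esub> e"
    have kE: "k \<in> carrier E" using k by (rule Ker_E)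
    have k': "?k \<in> Ker"
      using k e kE by (simp add: kernel_def)
    have ak: "Poly_Mapping.keys a \<subseteq> carrier E" using a by (simp add: augmentation_ideal_simps)
    have "group_ring_act E ?k (group_ring_act E e a) = group_ring_act E (?k \<otimes>\<^bsub>E\<^esub> e) a"
      using group_ring_act_mult[OF E.is_group _ e ak, of ?k] e kE by simp
    also have "?k \<otimes>\<^bsub>E\<^esub> e = e \<otimes>\<^bsub>E\<^esub> k" using e kE by (simp add: E.m_assoc)
    also have "group_ring_act E (e \<otimes>\<^bsub>E\<^esub> k) a = group_ring_act E e (group_ring_act E k a)"
      by (rule group_ring_act_mult[OF E.is_group e kE ak])
    finally have "group_ring_act E e (group_ring_act E k a - a) = group_ring_act E ?k (group_ring_act E e a) - group_ring_act E e a"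
      by (simp add: group_ring_act_diff)
    then show "group_ring_act E e (group_ring_act E k a - a) \<in> J"
      using J_gen[OF k' act_I[OF e a]] by simp
  qed
  then show ?thesis using j unfolding J_def' by blast
qed

definition coset :: "('e \<Rightarrow>\<^sub>0 int) \<Rightarrow> ('e \<Rightarrow>\<^sub>0 int) set" where
  "coset a = J #>\<^bsub>I\<^esub> a"

lemma mem_coset: "x \<in> coset a \<longleftrightarrow> x - a \<in> J"
proof -
  have "x - a \<in> J \<Longrightarrow> \<exists>j\<in>J. x = j + a" by (rule bexI[of _ "x - a"]) auto
  then show ?thesis by (auto simp: coset_def r_coset_def augmentation_ideal_simps(2))
qed

lemma coset_eq_iff: "coset a = coset b \<longleftrightarrow> a - b \<in> J"
proof
  assume "coset a = coset b"
  then show "a - b \<in> J" using mem_coset[of a a] mem_coset[of a b] J_zero by simp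
next
  assume ab: "a - b \<in> J"
  show "coset a = coset b"
  proof (rule Set.set_eqI)
    fix x
    have "x - a \<in> J \<longleftrightarrow> x - b \<in> J"
      using J_add[OF _ ab, of "x - a"] J_diff[OF _ ab, of "x - b"] by (auto simp: algebra_simps)
    then show "x \<in> coset a \<longleftrightarrow> x \<in> coset b" by (simp add: mem_coset)
  qed
qed

lemma T_eq: "T = I Mod J"
  by (simp add: induced_aug_ideal_def coinvariants_def)

lemma carrier_T: "carrier T = coset ` carrier I"
  by (auto simp: T_eq carrier_Mod coset_def[abs_def])

sublocale T: comm_group T
  unfolding T_eq by (rule I.abelian_FactGroup[OF subgroup_J])

lemma coset_hom: "coset \<in> hom I T"
  unfolding coset_def[abs_def] T_eq by (rule I.rcos_hom_Mod[OF I.subgroup_normal[OF subgroup_J]])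

lemma coset_add: "a \<in> carrier I \<Longrightarrow> b \<in> carrier I \<Longrightarrow> coset (a + b) = coset a \<otimes>\<^bsub>T\<^esub> coset b"
  using hom_mult[OF coset_hom] by (simp add: augmentation_ideal_simps(2))

text \<open>
  Two preimages of an element of \<open>Q\<close> differ by an element of the kernel, so any single preimage
  determines the action on a coset of \<open>J\<close>.
\<close>

lemma actT_coset:
  assumes e: "e \<in> carrier E" and a: "a \<in> carrier I"
  shows "actT (\<pi> (p e)) (coset a) = coset (group_ring_act E e a)"
proof (rule Set.set_eqI)
  fix y
  show "y \<in> actT (\<pi> (p e)) (coset a) \<longleftrightarrow> y \<in> coset (group_ring_act E e a)"
  proof
    assume "y \<in> actT (\<pi> (p e)) (coset a)"
    then obtain f x where f: "f \<in> carrier E" "\<pi> (p f) = \<pi> (p e)" and x: "x - a \<in> J" and y: "y = group_ring_act E f x"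
      by (auto simp: induced_aug_ideal_act_def mem_coset)
    let ?k = "f \<otimes>\<^bsub>E\<^esub> inv\<^bsub>E\<^esub> e"
    have k: "?k \<in> Ker" using e f by (simp add: kernel_def)
    have "f = ?k \<otimes>\<^bsub>E\<^esub> e" using e f by (simp add: E.m_assoc)
    then have "group_ring_act E f a = group_ring_act E ?k (group_ring_act E e a)"
      using group_ring_act_mult[OF E.is_group, of ?k e a] e f a by (simp add: augmentation_ideal_simps)
    then have "group_ring_act E f a - group_ring_act E e a \<in> J"
      using J_gen[OF k act_I[OF e a]] by simp
    moreover have "y - group_ring_act E f a \<in> J" using act_J[OF f(1) x] by (simp add: y group_ring_act_diff)
    ultimately have "(y - group_ring_act E f a) + (group_ring_act E f a - group_ring_act E e a) \<in> J"
      by (intro J_add)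
    then show "y \<in> coset (group_ring_act E e a)" by (simp add: mem_coset)
  next
    assume "y \<in> coset (group_ring_act E e a)"
    then have y: "y - group_ring_act E e a \<in> J" by (simp add: mem_coset)
    have yk: "Poly_Mapping.keys y \<subseteq> carrier E"
    proof -
      have "y = (y - group_ring_act E e a) + group_ring_act E e a" by simp
      moreover have "Poly_Mapping.keys \<dots> \<subseteq> carrier E"
        using J_I[OF y] act_I[OF e a] by (intro keys_addI) (simp_all add: augmentation_ideal_simps)
      ultimately show ?thesis by simp
    qed
    let ?x = "group_ring_act E (inv\<^bsub>E\<^esub> e) y"
    have ak: "Poly_Mapping.keys a \<subseteq> carrier E" using a by (simp add: augmentation_ideal_simps)
    have "group_ring_act E (inv\<^bsub>E\<^esub> e) (group_ring_act E e a) = a"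
      using group_ring_act_mult[OF E.is_group _ e ak, of "inv\<^bsub>E\<^esub> e"] e group_ring_act_one[OF E.is_group ak] by simp
    then have "?x - a \<in> J" using act_J[OF _ y, of "inv\<^bsub>E\<^esub> e"] e by (simp add: group_ring_act_diff)
    moreover have "y = group_ring_act E e ?x"
      using group_ring_act_mult[OF E.is_group e _ yk, of "inv\<^bsub>E\<^esub> e"] e group_ring_act_one[OF E.is_group yk] by simp
    ultimately show "y \<in> actT (\<pi> (p e)) (coset a)"
      using e unfolding induced_aug_ideal_act_def mem_coset[symmetric] by auto
  qed
qed

lemma actT_sec:
  assumes "q \<in> carrier Q" "a \<in> carrier I"
  shows "actT q (coset a) = coset (group_ring_act E (\<sigma> q) a)"
  using actT_coset[of "\<sigma> q" a] assms by simp

lemma group_module_T: "group_module Q T actT"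
proof unfold_locales
  fix q assume q: "q \<in> carrier Q"
  show "actT q \<in> hom T T"
  proof (rule homI)
    fix X assume "X \<in> carrier T"
    then show "actT q X \<in> carrier T" using q act_I by (auto simp: carrier_T actT_sec)
  next
    fix X Y assume "X \<in> carrier T" "Y \<in> carrier T"
    then obtain a b where "X = coset a" "Y = coset b" "a \<in> carrier I" "b \<in> carrier I" by (auto simp: carrier_T)
    then show "actT q (X \<otimes>\<^bsub>T\<^esub> Y) = actT q X \<otimes>\<^bsub>T\<^esub> actT q Y"
      using q I.m_closed[of a b]
      by (simp add: coset_add[symmetric] actT_sec act_I group_ring_act_add augmentation_ideal_simps(2))
  qed
next
  fix X assume "X \<in> carrier T"
  then show "actT \<one>\<^bsub>Q\<^esub> X = X"
    by (auto simp: carrier_T actT_sec group_ring_act_one[OF E.is_group] augmentation_ideal_simps(1))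
next
  fix q r X assume q: "q \<in> carrier Q" "r \<in> carrier Q" and "X \<in> carrier T"
  then obtain a where a: "X = coset a" "a \<in> carrier I" by (auto simp: carrier_T)
  have "actT (\<pi> (p (\<sigma> q \<otimes>\<^bsub>E\<^esub> \<sigma> r))) X = coset (group_ring_act E (\<sigma> q \<otimes>\<^bsub>E\<^esub> \<sigma> r) a)"
    unfolding a(1) using q a(2) by (intro actT_coset) auto
  also have "\<dots> = actT q (actT r X)"
  proof -
    have "Poly_Mapping.keys a \<subseteq> carrier E" using a by (simp add: augmentation_ideal_simps)
    then show ?thesis using q a by (simp add: actT_sec act_I group_ring_act_mult[OF E.is_group])
  qed
  finally show "actT (q \<otimes>\<^bsub>Q\<^esub> r) X = actT q (actT r X)" using q by simp
qed

subsection \<open>Exactness\<close>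

definition push :: "('e \<Rightarrow>\<^sub>0 int) \<Rightarrow> ('q \<Rightarrow>\<^sub>0 int)" where
  "push = frag_extend (\<lambda>e. frag_of (\<pi> (p e)))"

lemma push_simps:
  "push (frag_of e) = frag_of (\<pi> (p e))" "push (a + b) = push a + push b" "push (a - b) = push a - push b" "push 0 = 0"
  by (simp_all add: push_def frag_extend_add frag_extend_diff)

lemma push_keys: "Poly_Mapping.keys a \<subseteq> carrier E \<Longrightarrow> Poly_Mapping.keys (push a) \<subseteq> carrier Q"
  unfolding push_def by (rule keys_extendI) auto

lemma push_act:
  assumes "e \<in> carrier E" "Poly_Mapping.keys a \<subseteq> carrier E"
  shows "push (group_ring_act E e a) = group_ring_act Q (\<pi> (p e)) (push a)"
  by (rule frag_extend_cong_basis[OF assms(2)]) (use assms in \<open>auto simp: push_simps group_ring_act_diff\<close>)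

lemma push_hom: "push \<in> hom I (free_Abelian_group (carrier Q))"
  by (rule homI) (use push_keys in \<open>auto simp: augmentation_ideal_simps push_simps\<close>)

lemma push_J: assumes "j \<in> J" shows "push j = 0"
proof -
  have "push j = \<one>\<^bsub>free_Abelian_group (carrier Q)\<^esub>"
  proof (rule I.hom_generate_one[OF group_free_Abelian_group push_hom J_gens_I])
    fix x assume "x \<in> {group_ring_act E k a - a | k a. k \<in> Ker \<and> a \<in> carrier I}"
    then obtain k a where x: "x = group_ring_act E k a - a" and k: "k \<in> Ker" and a: "a \<in> carrier I" by blast
    have "push x = group_ring_act Q \<one>\<^bsub>Q\<^esub> (push a) - push a"
      using k a push_act[OF Ker_E[OF k], of a] by (simp add: x push_simps kernel_def augmentation_ideal_simps)
    then show "push x = \<one>\<^bsub>free_Abelian_group (carrier Q)\<^esub>"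
      using a push_keys by (simp add: group_ring_act_one[OF Q.is_group] augmentation_ideal_simps)
  qed (use assms in \<open>simp add: J_def'[symmetric]\<close>)
  then show ?thesis by simp
qed

lemma projT_coset:
  assumes "a \<in> carrier I" shows "projT (coset a) = push a"
  unfolding induced_aug_ideal_proj_def o_def push_def[symmetric]
proof (rule quot_lift_eq)
  show "coset a \<noteq> {}" using mem_coset[of a a] J_zero by auto
  fix x assume "x \<in> coset a"
  then have "push (x - a) = 0" using push_J by (simp add: mem_coset)
  then show "push x = push a" by (simp add: push_simps)
qed

lemma projT_hom: "projT \<in> hom T (free_Abelian_group (carrier Q))"
proof (rule homI)
  fix X assume "X \<in> carrier T"
  then obtain a where a: "X = coset a" "a \<in> carrier I" by (auto simp: carrier_T)
  then show "projT X \<in> carrier (free_Abelian_group (carrier Q))"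
    using hom_in_carrier[OF push_hom a(2)] by (simp add: projT_coset)
next
  fix X Y assume "X \<in> carrier T" "Y \<in> carrier T"
  then obtain a b where "X = coset a" "Y = coset b" "a \<in> carrier I" "b \<in> carrier I" by (auto simp: carrier_T)
  then show "projT (X \<otimes>\<^bsub>T\<^esub> Y) = projT X \<otimes>\<^bsub>free_Abelian_group (carrier Q)\<^esub> projT Y"
    using I.m_closed[of a b] by (simp add: coset_add[symmetric] projT_coset push_simps augmentation_ideal_simps(2))
qed

lemma projT_act:
  assumes "q \<in> carrier Q" "X \<in> carrier T"
  shows "projT (actT q X) = group_ring_act Q q (projT X)"
proof -
  obtain a where a: "X = coset a" "a \<in> carrier I" using assms by (auto simp: carrier_T)
  then have "Poly_Mapping.keys a \<subseteq> carrier E" by (simp add: augmentation_ideal_simps)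
  then show ?thesis using assms(1) a by (simp add: actT_sec projT_coset act_I push_act)
qed

lemma projT_surj:
  assumes "Poly_Mapping.keys b \<subseteq> carrier Q" "augmentation b = 0"
  obtains X where "X \<in> carrier T" "projT X = b"
proof
  let ?a = "frag_extend (\<lambda>q. frag_of (\<sigma> q)) b"
  have a: "?a \<in> carrier I"
    unfolding augmentation_ideal_simps
    using assms by (auto simp: augmentation_frag_extend dest!: subsetD[OF keys_frag_extend])
  then show "coset ?a \<in> carrier T" by (simp add: carrier_T)
  have "push ?a = b"
    using assms(1) by (rule frag_extend_cong_basis) (auto simp: frag_extend_diff push_simps)
  then show "projT (coset ?a) = b" using a by (simp add: projT_coset)
qed

text \<open>
  The map from \<open>K\<^sub>a\<^sub>b\<close> to \<open>N\<close> induced by \<open>p\<close>, where \<open>K\<close> is the kernel of \<open>\<pi> p\<close>, extends to the middle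
  term of the relation module sequence by \<open>1 \<otimes> (e - 1) \<mapsto> ncomp e\<close>. The extension \<open>retr\<close> is additive,
  but equivariant only up to the cocycle; \<open>cocyc_sum q\<close> is \<open>r \<mapsto> cocyc q r\<close>, extended linearly to the
  group ring.
\<close>

definition retr0 :: "('e \<Rightarrow>\<^sub>0 int) \<Rightarrow> 'g" where
  "retr0 = free_extend N ncomp"

definition retr :: "('e \<Rightarrow>\<^sub>0 int) set \<Rightarrow> 'g" where
  "retr = quot_lift retr0"

definition cocyc_sum :: "'q \<Rightarrow> ('q \<Rightarrow>\<^sub>0 int) \<Rightarrow> 'g" where
  "cocyc_sum q = free_extend N (cocyc q)"

lemma retr0_hom: "retr0 \<in> hom (free_Abelian_group (carrier E)) N"
  unfolding retr0_def by (rule free_extend_hom[OF comm_group_N]) simp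

lemma retr0_of: "e \<in> carrier E \<Longrightarrow> retr0 (frag_of e) = ncomp e"
  unfolding retr0_def by (rule free_extend_of[OF comm_group_N]) simp

lemma cocyc_sum_hom: "q \<in> carrier Q \<Longrightarrow> cocyc_sum q \<in> hom (free_Abelian_group (carrier Q)) N"
  unfolding cocyc_sum_def by (rule free_extend_hom[OF comm_group_N]) simp

lemma cocyc_sum_of: "q \<in> carrier Q \<Longrightarrow> r \<in> carrier Q \<Longrightarrow> cocyc_sum q (frag_of r) = cocyc q r"
  unfolding cocyc_sum_def by (rule free_extend_of[OF comm_group_N]) simp

lemma cocyc_sum_closed:
  "q \<in> carrier Q \<Longrightarrow> Poly_Mapping.keys b \<subseteq> carrier Q \<Longrightarrow> cocyc_sum q b \<in> carrier N"
  using free_hom_closed[OF cocyc_sum_hom] .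

text \<open>
  The formula of \<open>ncomp_mult\<close>, extended linearly. On the augmentation ideal the first factor is
  trivial.
\<close>

lemma retr0_act:
  assumes e: "e \<in> carrier E" and a: "Poly_Mapping.keys a \<subseteq> carrier E"
  shows "retr0 (group_ring_act E e a) = ncomp e [^]\<^bsub>N\<^esub> augmentation a \<otimes>\<^bsub>N\<^esub> retr0 a \<otimes>\<^bsub>N\<^esub> cocyc_sum (\<pi> (p e)) (push a)"
proof -
  let ?FE = "free_Abelian_group (carrier E)"
  have pe: "\<pi> (p e) \<in> carrier Q" using e by simp
  have ga: "group_ring_act E e \<in> hom ?FE ?FE"
    by (rule homI) (use group_ring_act_keys[OF E.is_group e] in \<open>auto simp: group_ring_act_add\<close>)
  have L: "retr0 \<circ> group_ring_act E e \<in> hom ?FE N" by (rule hom_compose[OF ga retr0_hom])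
  have pu: "push \<in> hom ?FE (free_Abelian_group (carrier Q))"
    by (rule homI) (use push_keys in \<open>auto simp: push_simps\<close>)
  have h3: "cocyc_sum (\<pi> (p e)) \<circ> push \<in> hom ?FE N" by (rule hom_compose[OF pu cocyc_sum_hom[OF pe]])
  have R: "(\<lambda>a. ncomp e [^]\<^bsub>N\<^esub> augmentation a \<otimes>\<^bsub>N\<^esub> retr0 a \<otimes>\<^bsub>N\<^esub> (cocyc_sum (\<pi> (p e)) \<circ> push) a) \<in> hom ?FE N"
    by (rule homI)
      (use e free_hom_closed[OF retr0_hom] free_hom_closed[OF h3] in
        \<open>simp_all add: augmentation_add N.int_pow_mult free_hom_add[OF retr0_hom] free_hom_add[OF h3] N.m_ac del: o_apply\<close>)
  have "(retr0 \<circ> group_ring_act E e) a = ncomp e [^]\<^bsub>N\<^esub> augmentation a \<otimes>\<^bsub>N\<^esub> retr0 a \<otimes>\<^bsub>N\<^esub> (cocyc_sum (\<pi> (p e)) \<circ> push) a"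
    by (rule free_hom_eqI[OF N.is_group L R _ a])
      (use e in \<open>simp add: retr0_of ncomp_mult push_simps cocyc_sum_of\<close>)
  then show ?thesis by simp
qed

lemma cocyc_sum_one:
  assumes "Poly_Mapping.keys b \<subseteq> carrier Q" shows "cocyc_sum \<one>\<^bsub>Q\<^esub> b = \<one>\<^bsub>N\<^esub>"
proof -
  have "(\<lambda>_. \<one>\<^bsub>N\<^esub>) \<in> hom (free_Abelian_group (carrier Q)) N" by (rule homI) auto
  then show ?thesis
    using free_hom_eqI[OF N.is_group cocyc_sum_hom[OF Q.one_closed] _ _ assms]
    by (simp add: cocyc_sum_of cocyc_one)
qed

lemma retr0_hom_I: "retr0 \<in> hom I N"
  using retr0_hom by (auto simp: hom_def augmentation_ideal_simps Pi_iff)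

lemma retr0_J: assumes "j \<in> J" shows "retr0 j = \<one>\<^bsub>N\<^esub>"
proof (rule I.hom_generate_one[OF N.is_group retr0_hom_I J_gens_I])
  fix x assume "x \<in> {group_ring_act E k a - a | k a. k \<in> Ker \<and> a \<in> carrier I}"
  then obtain k a where x: "x = group_ring_act E k a - a" and k: "k \<in> Ker" and a: "a \<in> carrier I" by blast
  have ak: "Poly_Mapping.keys a \<subseteq> carrier E" "augmentation a = 0" using a by (simp_all add: augmentation_ideal_simps)
  have ra: "retr0 a \<in> carrier N" by (rule free_hom_closed[OF retr0_hom ak(1)])
  have "retr0 (group_ring_act E k a) = retr0 a"
    using retr0_act[OF Ker_E[OF k] ak(1)] ak(2) k ra
    by (simp add: kernel_def cocyc_sum_one push_keys[OF ak(1)])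
  then show "retr0 x = \<one>\<^bsub>N\<^esub>"
    using free_hom_diff[OF N.is_group retr0_hom group_ring_act_keys[OF E.is_group Ker_E[OF k] ak(1)] ak(1)] ra
    by (simp add: x)
qed (use assms in \<open>simp add: J_def'[symmetric]\<close>)

lemma retr_coset: "a \<in> carrier I \<Longrightarrow> retr (coset a) = retr0 a"
  unfolding retr_def coset_def by (rule I.quot_lift_rcos[OF N.is_group retr0_hom_I subgroup_J retr0_J])

lemma retr_hom: "retr \<in> hom T N"
  unfolding retr_def T_eq
  by (rule I.quot_lift_hom[OF N.is_group retr0_hom_I I.subgroup_normal[OF subgroup_J] retr0_J])

lemma retr_act:
  assumes "q \<in> carrier Q" "X \<in> carrier T"
  shows "retr (actT q X) = retr X \<otimes>\<^bsub>N\<^esub> cocyc_sum q (projT X)"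
proof -
  obtain a where a: "X = coset a" "a \<in> carrier I" using assms by (auto simp: carrier_T)
  then have ak: "Poly_Mapping.keys a \<subseteq> carrier E" "augmentation a = 0" by (simp_all add: augmentation_ideal_simps)
  show ?thesis
    using assms a retr0_act[of "\<sigma> q" a] ak free_hom_closed[OF retr0_hom ak(1)]
      cocyc_sum_closed[OF assms(1) push_keys[OF ak(1)]]
    by (simp add: actT_sec retr_coset act_I projT_coset)
qed

subsection \<open>The inclusion of the relation module\<close>

abbreviation "EK \<equiv> E\<lparr>carrier := Ker\<rparr>"
abbreviation "D \<equiv> derived EK Ker"

lemma group_EK: "group EK"
  by (rule subgroup.subgroup_is_group[OF pp.subgroup_kernel E.is_group])

sublocale EK: group EK by (rule group_EK)

lemma D_normal: "D \<lhd> EK" and D_subgroup: "subgroup D EK"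
proof -
  show "D \<lhd> EK" using EK.derived_self_is_normal by simp
  then show "subgroup D EK" by (rule normal_imp_subgroup)
qed

lemma Rel_eq: "Rel = EK Mod D"
  by (simp add: relation_module_def abelianization_def ext_kernel_def)

lemma Rel_carrier: "carrier Rel = (\<lambda>k. D #>\<^bsub>E\<^esub> k) ` Ker"
  by (auto simp: Rel_eq carrier_Mod)

lemma comm_group_Rel: "comm_group Rel"
  unfolding Rel_eq using EK.derived_quot_is_comm_group by simp

definition aug_of :: "'e \<Rightarrow> ('e \<Rightarrow>\<^sub>0 int)" where
  "aug_of k = frag_of k - frag_of \<one>\<^bsub>E\<^esub>"

lemma aug_of_I: "e \<in> carrier E \<Longrightarrow> aug_of e \<in> carrier I"
  by (simp add: aug_of_def augmentation_ideal_simps keys_diffI augmentation_diff)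

lemma aug_of_hom: "coset \<circ> aug_of \<in> hom EK T"
proof (rule homI)
  fix k assume "k \<in> carrier EK"
  then show "(coset \<circ> aug_of) k \<in> carrier T" using aug_of_I[OF Ker_E] by (auto simp: carrier_T)
next
  fix k l assume kl: "k \<in> carrier EK" "l \<in> carrier EK"
  then have k: "k \<in> Ker" "l \<in> Ker" "k \<in> carrier E" "l \<in> carrier E" using Ker_E by auto
  have "aug_of (k \<otimes>\<^bsub>E\<^esub> l) - (aug_of k + aug_of l) = group_ring_act E k (aug_of l) - aug_of l"
    using k(3,4) by (simp add: aug_of_def group_ring_act_diff)
  also have "\<dots> \<in> J" using k by (intro J_gen aug_of_I)
  finally have "coset (aug_of (k \<otimes>\<^bsub>E\<^esub> l)) = coset (aug_of k + aug_of l)" by (simp add: coset_eq_iff)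
  then show "(coset \<circ> aug_of) (k \<otimes>\<^bsub>EK\<^esub> l) = (coset \<circ> aug_of) k \<otimes>\<^bsub>T\<^esub> (coset \<circ> aug_of) l"
    using k by (simp add: coset_add aug_of_I)
qed

lemma hom_D:
  assumes H: "comm_group H" and f: "f \<in> hom EK H" and d: "d \<in> D"
  shows "f d = \<one>\<^bsub>H\<^esub>"
proof -
  interpret H: comm_group H by fact
  interpret f: group_hom EK H f
    using f by (simp add: group_hom_def group_hom_axioms_def group_EK H.is_group)
  show ?thesis
  proof (rule EK.hom_generate_one[OF H.is_group f _ _ d[unfolded derived_def]])
    show "derived_set EK Ker \<subseteq> carrier EK" using EK.derived_set_in_carrier[of Ker] by simp
    fix x assume "x \<in> derived_set EK Ker"
    then obtain h1 h2 where h: "h1 \<in> carrier EK" "h2 \<in> carrier EK"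
      "x = h1 \<otimes>\<^bsub>EK\<^esub> h2 \<otimes>\<^bsub>EK\<^esub> inv\<^bsub>EK\<^esub> h1 \<otimes>\<^bsub>EK\<^esub> inv\<^bsub>EK\<^esub> h2" by auto
    have "f x = f h1 \<otimes>\<^bsub>H\<^esub> f h2 \<otimes>\<^bsub>H\<^esub> inv\<^bsub>H\<^esub> f h1 \<otimes>\<^bsub>H\<^esub> inv\<^bsub>H\<^esub> f h2"
      unfolding h(3) using h(1,2) by (simp only: f.hom_mult f.hom_inv EK.m_closed EK.inv_closed)
    also have "\<dots> = (f h1 \<otimes>\<^bsub>H\<^esub> inv\<^bsub>H\<^esub> f h1) \<otimes>\<^bsub>H\<^esub> (f h2 \<otimes>\<^bsub>H\<^esub> inv\<^bsub>H\<^esub> f h2)"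
      using f.hom_closed[OF h(1)] f.hom_closed[OF h(2)] by (simp only: H.m_ac H.inv_closed H.m_closed)
    also have "\<dots> = \<one>\<^bsub>H\<^esub>" using f.hom_closed[OF h(1)] f.hom_closed[OF h(2)] by simp
    finally show "f x = \<one>\<^bsub>H\<^esub>" .
  qed
qed

lemma incl_rcos:
  assumes k: "k \<in> Ker" shows "incl (D #>\<^bsub>E\<^esub> k) = coset (aug_of k)"
proof (rule Set.set_eqI)
  fix y
  have incl: "incl (D #>\<^bsub>E\<^esub> k) = J <#>\<^bsub>I\<^esub> aug_of ` (D #>\<^bsub>E\<^esub> k)"
    unfolding relation_module_incl_def quot_map_def aug_of_def[abs_def] ..
  have same: "aug_of (d \<otimes>\<^bsub>E\<^esub> k) - aug_of k \<in> J" if d: "d \<in> D" for d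
  proof -
    have dK: "d \<in> Ker" using d subgroup.subset[OF D_subgroup] by auto
    have "coset (aug_of (d \<otimes>\<^bsub>E\<^esub> k)) = coset (aug_of d) \<otimes>\<^bsub>T\<^esub> coset (aug_of k)"
      using hom_mult[OF aug_of_hom, of d k] dK k by simp
    also have "coset (aug_of d) = \<one>\<^bsub>T\<^esub>" using hom_D[OF T.comm_group_axioms aug_of_hom d] by simp
    also have "\<one>\<^bsub>T\<^esub> \<otimes>\<^bsub>T\<^esub> coset (aug_of k) = coset (aug_of k)"
      using hom_in_carrier[OF coset_hom aug_of_I[OF Ker_E[OF k]]] by (rule T.l_one)
    finally show ?thesis by (simp only: coset_eq_iff)
  qed
  show "y \<in> incl (D #>\<^bsub>E\<^esub> k) \<longleftrightarrow> y \<in> coset (aug_of k)"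
  proof
    assume "y \<in> incl (D #>\<^bsub>E\<^esub> k)"
    then obtain j d where "j \<in> J" "d \<in> D" "y = j + aug_of (d \<otimes>\<^bsub>E\<^esub> k)"
      unfolding incl unfolding set_mult_def r_coset_def augmentation_ideal_simps(2) by blast
    then show "y \<in> coset (aug_of k)"
      using J_add[OF _ same, of j d] by (simp add: mem_coset algebra_simps)
  next
    assume "y \<in> coset (aug_of k)"
    then have "y - aug_of k \<in> J" by (simp add: mem_coset)
    moreover have "k \<in> D #>\<^bsub>E\<^esub> k" using EK.rcos_self[OF _ D_subgroup, of k] k by simp
    moreover have "y = (y - aug_of k) \<otimes>\<^bsub>I\<^esub> aug_of k" by (simp add: augmentation_ideal_simps(2))
    ultimately show "y \<in> incl (D #>\<^bsub>E\<^esub> k)" unfolding incl unfolding set_mult_def by blast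
  qed
qed

lemma p_hom_EK: "p \<in> hom EK N"
  using p_hom by (auto simp: hom_def N_simps kernel_def Pi_iff)

lemma quot_lift_p: "k \<in> Ker \<Longrightarrow> quot_lift p (D #>\<^bsub>E\<^esub> k) = p k"
  using EK.quot_lift_rcos[OF N.is_group p_hom_EK D_subgroup hom_D[OF comm_group_N p_hom_EK], of k] by simp

lemma incl_hom: "incl \<in> hom Rel T"
proof (rule homI)
  fix X assume "X \<in> carrier Rel"
  then show "incl X \<in> carrier T" using aug_of_I[OF Ker_E] by (auto simp: Rel_carrier incl_rcos carrier_T)
next
  fix X Y assume "X \<in> carrier Rel" "Y \<in> carrier Rel"
  then obtain k l where kl: "k \<in> Ker" "l \<in> Ker" "X = D #>\<^bsub>E\<^esub> k" "Y = D #>\<^bsub>E\<^esub> l" by (auto simp: Rel_carrier)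
  have kl': "k \<otimes>\<^bsub>E\<^esub> l \<in> Ker" using kl EK.m_closed[of k l] by simp
  have "X \<otimes>\<^bsub>Rel\<^esub> Y = D #>\<^bsub>E\<^esub> (k \<otimes>\<^bsub>E\<^esub> l)"
    using EK.Mod_mult[OF D_normal, of k l] kl by (simp add: Rel_eq)
  then show "incl (X \<otimes>\<^bsub>Rel\<^esub> Y) = incl X \<otimes>\<^bsub>T\<^esub> incl Y"
    using hom_mult[OF aug_of_hom, of k l] kl kl' by (simp add: incl_rcos)
qed

lemma retr_incl:
  assumes "X \<in> carrier Rel" shows "retr (incl X) = quot_lift p X"
proof -
  obtain k where k: "k \<in> Ker" "X = D #>\<^bsub>E\<^esub> k" using assms by (auto simp: Rel_carrier)
  have "retr0 (aug_of k) = ncomp k \<otimes>\<^bsub>N\<^esub> inv\<^bsub>N\<^esub> ncomp \<one>\<^bsub>E\<^esub>"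
    unfolding aug_of_def using Ker_E[OF k(1)] by (simp add: free_hom_diff[OF N.is_group retr0_hom] retr0_of)
  also have "ncomp \<one>\<^bsub>E\<^esub> = \<one>\<^bsub>N\<^esub>" by (simp add: ncomp_def N_simps)
  also have "ncomp k \<otimes>\<^bsub>N\<^esub> inv\<^bsub>N\<^esub> \<one>\<^bsub>N\<^esub> = p k"
    using ncomp_closed[OF Ker_E[OF k(1)]] by (simp add: ncomp_Ker[OF k(1)])
  finally show ?thesis using k by (simp add: incl_rcos retr_coset aug_of_I Ker_E quot_lift_p)
qed

text \<open>
  Exactness in the middle: modulo the coinvariant relations, \<open>e - 1\<close> splits into the part \<open>k - 1\<close> with
  \<open>k = e \<sigma>(e)\<^sup>-\<^sup>1\<close> in the kernel and a part that depends only on the image of \<open>e\<close>.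
\<close>

lemma projT_exact:
  assumes X: "X \<in> carrier T" "projT X = 0"
  obtains Y where "Y \<in> carrier Rel" "incl Y = X"
proof -
  let ?FE = "free_Abelian_group (carrier E)" and ?FQ = "free_Abelian_group (carrier Q)"
  obtain a where a: "X = coset a" "a \<in> carrier I" using X by (auto simp: carrier_T)
  then have ak: "Poly_Mapping.keys a \<subseteq> carrier E" "augmentation a = 0" by (simp_all add: augmentation_ideal_simps)
  define k where "k e = e \<otimes>\<^bsub>E\<^esub> inv\<^bsub>E\<^esub> \<sigma> (\<pi> (p e))" for e
  have k: "k e \<in> Ker" if "e \<in> carrier E" for e using that by (simp add: k_def kernel_def)
  define Y where "Y = free_extend Rel (\<lambda>e. D #>\<^bsub>E\<^esub> k e)"
  define Z where "Z = free_extend T (\<lambda>q. coset (aug_of (\<sigma> q)))"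
  have cl: "D #>\<^bsub>E\<^esub> k e \<in> carrier Rel" if "e \<in> carrier E" for e using k[OF that] by (auto simp: Rel_carrier)
  have cl2: "coset (aug_of e) \<in> carrier T" if "e \<in> carrier E" for e using aug_of_I[OF that] by (auto simp: carrier_T)
  have Y: "Y \<in> hom ?FE Rel" unfolding Y_def using cl by (rule free_extend_hom[OF comm_group_Rel])
  have Z: "Z \<in> hom ?FQ T" unfolding Z_def using cl2 by (intro free_extend_hom[OF T.comm_group_axioms]) simp
  have pu: "push \<in> hom ?FE ?FQ" by (rule homI) (use push_keys in \<open>auto simp: push_simps\<close>)
  have h1: "incl \<circ> Y \<in> hom ?FE T" by (rule hom_compose[OF Y incl_hom])
  have h2: "Z \<circ> push \<in> hom ?FE T" by (rule hom_compose[OF pu Z])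
  have R: "(\<lambda>a. (incl \<circ> Y) a \<otimes>\<^bsub>T\<^esub> (Z \<circ> push) a) \<in> hom ?FE T"
    by (rule hom_product[OF T.comm_group_axioms h1 h2])
  define aug0 where "aug0 a = a - frag_cmul (augmentation a) (frag_of \<one>\<^bsub>E\<^esub>)" for a
  have aug0_I: "aug0 a \<in> carrier I" if "Poly_Mapping.keys a \<subseteq> carrier E" for a
  proof -
    have "augmentation (frag_cmul m c) = m * augmentation c" for m and c :: "'e \<Rightarrow>\<^sub>0 int"
      by (simp add: augmentation_eq frag_extend_cmul)
    then show ?thesis
      using that unfolding augmentation_ideal_simps aug0_def
      by (intro conjI keys_diffI keys_cmulI) (simp_all add: augmentation_diff)
  qed
  have aug0_hom: "aug0 \<in> hom ?FE I"
    by (rule homI) (use aug0_I in \<open>auto simp: augmentation_ideal_simps(2) aug0_def augmentation_add frag_cmul_distrib\<close>)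
  have L: "coset \<circ> aug0 \<in> hom ?FE T" by (rule hom_compose[OF aug0_hom coset_hom])
  have "(coset \<circ> aug0) a = (\<lambda>a. (incl \<circ> Y) a \<otimes>\<^bsub>T\<^esub> (Z \<circ> push) a) a"
  proof (rule free_hom_eqI[OF T.is_group L R _ ak(1)])
    fix e assume e: "e \<in> carrier E"
    let ?s = "\<sigma> (\<pi> (p e))"
    have s: "?s \<in> carrier E" using e by simp
    have "k e \<otimes>\<^bsub>E\<^esub> ?s = e" using e s by (simp add: k_def E.m_assoc)
    then have "aug_of e - (aug_of (k e) + aug_of ?s) = group_ring_act E (k e) (aug_of ?s) - aug_of ?s"
      using Ker_E[OF k[OF e]] s by (simp add: aug_of_def group_ring_act_diff)
    also have "\<dots> \<in> J" by (rule J_gen[OF k[OF e] aug_of_I[OF s]])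
    finally have "coset (aug_of e) = coset (aug_of (k e)) \<otimes>\<^bsub>T\<^esub> coset (aug_of ?s)"
      using aug_of_I[OF Ker_E[OF k[OF e]]] aug_of_I[OF s] by (simp add: coset_eq_iff coset_add[symmetric])
    moreover have "Y (frag_of e) = D #>\<^bsub>E\<^esub> k e"
      unfolding Y_def using cl[OF e] by (intro free_extend_of[OF comm_group_Rel])
    moreover have "Z (frag_of (\<pi> (p e))) = coset (aug_of ?s)"
      unfolding Z_def using cl2[OF s] by (intro free_extend_of[OF T.comm_group_axioms])
    ultimately show "(coset \<circ> aug0) (frag_of e) = (incl \<circ> Y) (frag_of e) \<otimes>\<^bsub>T\<^esub> (Z \<circ> push) (frag_of e)"
      using k[OF e] by (simp add: incl_rcos push_simps aug0_def aug_of_def)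
  qed
  moreover have "aug0 a = a" using ak(2) by (simp add: aug0_def)
  moreover have "push a = 0" using X a by (simp add: projT_coset)
  ultimately have "X = incl (Y a)"
    using a free_hom_zero[OF T.is_group Z] hom_in_carrier[OF incl_hom free_hom_closed[OF Y ak(1)]] by simp
  then show ?thesis using that[OF free_hom_closed[OF Y ak(1)]] by simp
qed

end


section \<open>Dimension shifting\<close>

lemma coeff_chain_map_hom:
  assumes A: "group A" and B: "group B" and f: "f \<in> hom A B"
  shows "coeff_chain_map Q f n \<in> hom (bar_group Q A n) (bar_group Q B n)"
proof (rule homI)
  fix c assume c: "c \<in> carrier (bar_group Q A n)"
  have "{xs \<in> cube Q n. coeff_chain_map Q f n c xs \<noteq> \<one>\<^bsub>B\<^esub>} \<subseteq> {xs \<in> cube Q n. c xs \<noteq> \<one>\<^bsub>A\<^esub>}"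
    using hom_one[OF f A B] by (auto simp: coeff_chain_map_def)
  moreover have "finite {xs \<in> cube Q n. c xs \<noteq> \<one>\<^bsub>A\<^esub>}" using c A by (simp add: bar_carrier_iff)
  ultimately have "finite {xs \<in> cube Q n. coeff_chain_map Q f n c xs \<noteq> \<one>\<^bsub>B\<^esub>}" by (rule finite_subset)
  then show "coeff_chain_map Q f n c \<in> carrier (bar_group Q B n)"
    using c A B hom_in_carrier[OF f] by (auto simp: bar_carrier_iff coeff_chain_map_def)
next
  fix c d assume "c \<in> carrier (bar_group Q A n)" "d \<in> carrier (bar_group Q A n)"
  then show "coeff_chain_map Q f n (c \<otimes>\<^bsub>bar_group Q A n\<^esub> d)
      = coeff_chain_map Q f n c \<otimes>\<^bsub>bar_group Q B n\<^esub> coeff_chain_map Q f n d"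
    using A hom_mult[OF f] by (auto simp: bar_carrier_iff coeff_chain_map_def bar_mult intro!: restrict_ext)
qed

lemma coeff_chain_map_chain_of:
  assumes A: "group A" and B: "group B" and f: "f \<in> hom A B" and a: "a \<in> carrier A"
  shows "coeff_chain_map Q f n (chain_of Q A n a c) = chain_of Q B n (f a) c"
proof -
  interpret f: group_hom A B f using A B f by (simp add: group_hom_def group_hom_axioms_def)
  show ?thesis using a by (auto simp: coeff_chain_map_def chain_of_def f.hom_int_pow intro!: restrict_ext)
qed

lemma coeff_chain_map_single:
  assumes A: "group A" and B: "group B" and f: "f \<in> hom A B" and a: "a \<in> carrier A"
  shows "coeff_chain_map Q f n (bar_single Q A n a xs) = bar_single Q B n (f a) xs"
  using assms hom_in_carrier[OF f a] by (simp add: bar_single_eq_chain_of coeff_chain_map_chain_of)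

text \<open>Choosing the neutral element over the neutral element keeps the support finite.\<close>

lemma coeff_chain_map_lift:
  assumes A: "group A" and B: "group B" and f: "f \<in> hom A B"
    and c: "c \<in> carrier (bar_group Q B n)" and surj: "\<And>xs. xs \<in> cube Q n \<Longrightarrow> \<exists>a\<in>carrier A. f a = c xs"
  obtains d where "d \<in> carrier (bar_group Q A n)" "coeff_chain_map Q f n d = c"
proof -
  interpret A: group A by fact
  define d where "d = (\<lambda>xs\<in>cube Q n. if c xs = \<one>\<^bsub>B\<^esub> then \<one>\<^bsub>A\<^esub> else SOME a. a \<in> carrier A \<and> f a = c xs)"
  have some: "(SOME a. a \<in> carrier A \<and> f a = c xs) \<in> carrier A \<and> f (SOME a. a \<in> carrier A \<and> f a = c xs) = c xs"
    if "xs \<in> cube Q n" for xs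
    by (rule someI_ex) (use surj[OF that] in blast)
  have "{xs \<in> cube Q n. d xs \<noteq> \<one>\<^bsub>A\<^esub>} \<subseteq> {xs \<in> cube Q n. c xs \<noteq> \<one>\<^bsub>B\<^esub>}" by (auto simp: d_def)
  moreover have "finite {xs \<in> cube Q n. c xs \<noteq> \<one>\<^bsub>B\<^esub>}" using c B by (simp add: bar_carrier_iff)
  ultimately have "finite {xs \<in> cube Q n. d xs \<noteq> \<one>\<^bsub>A\<^esub>}" by (rule finite_subset)
  then have "d \<in> carrier (bar_group Q A n)" using some A by (auto simp: bar_carrier_iff d_def)
  moreover have "coeff_chain_map Q f n d = c"
    using c B some hom_one[OF f A B]
    by (intro extensionalityI[of _ "cube Q n"]) (auto simp: bar_carrier_iff coeff_chain_map_def d_def)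
  ultimately show ?thesis by (rule that)
qed

lemma coeff_chain_map_id:
  "group A \<Longrightarrow> c \<in> carrier (bar_group Q A n) \<Longrightarrow> coeff_chain_map Q (\<lambda>x. x) n c = c"
  by (rule extensionalityI[of _ "cube Q n"]) (auto simp: bar_carrier_iff coeff_chain_map_def)

lemma coeff_chain_map_boundary:
  assumes A: "group_module Q A actA" and B: "group_module Q B actB" and f: "f \<in> hom A B"
    and equiv: "\<And>q a. q \<in> carrier Q \<Longrightarrow> a \<in> carrier A \<Longrightarrow> f (actA q a) = actB q (f a)"
    and c: "c \<in> carrier (bar_group Q A (Suc n))"
  shows "coeff_chain_map Q f n (bar_boundary Q A actA n c) = bar_boundary Q B actB n (coeff_chain_map Q f (Suc n) c)"
proof -
  interpret A: group_module Q A actA by fact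
  interpret B: group_module Q B actB by fact
  note m = coeff_chain_map_hom[OF A.group_A B.group_A f]
  interpret BB: comm_group "bar_group Q B n" by (rule B.comm_group_bar)
  have L: "coeff_chain_map Q f n \<circ> bar_boundary Q A actA n \<in> hom (bar_group Q A (Suc n)) (bar_group Q B n)"
    by (rule hom_compose[OF A.boundary_hom m])
  have R: "bar_boundary Q B actB n \<circ> coeff_chain_map Q f (Suc n) \<in> hom (bar_group Q A (Suc n)) (bar_group Q B n)"
    by (rule hom_compose[OF m B.boundary_hom])
  have "(coeff_chain_map Q f n \<circ> bar_boundary Q A actA n) c = (bar_boundary Q B actB n \<circ> coeff_chain_map Q f (Suc n)) c"
  proof (rule bar_hom_eqI[OF A.comm_group_A BB.is_group L R _ c])
    fix a xs assume a: "a \<in> carrier A" and "xs \<in> cube Q (Suc n)"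
    then obtain y ys where ys: "xs = y # ys" "y \<in> carrier Q" "ys \<in> cube Q n" by (metis cube_SucE)
    have a': "actA (inv\<^bsub>Q\<^esub> y) a \<in> carrier A" using a ys by (simp add: A.act_closed)
    have fa: "f a \<in> carrier B" using hom_in_carrier[OF f a] .
    show "(coeff_chain_map Q f n \<circ> bar_boundary Q A actA n) (bar_single Q A (Suc n) a xs)
        = (bar_boundary Q B actB n \<circ> coeff_chain_map Q f (Suc n)) (bar_single Q A (Suc n) a xs)"
      using a a' fa ys hom_mult[OF m bar_single_closed[OF A.group_A a'] chain_of_closed[OF A.group_A a]] equiv[OF _ a]
      by (simp add: A.boundary_single B.boundary_single coeff_chain_map_single[OF A.group_A B.group_A f]
          coeff_chain_map_chain_of[OF A.group_A B.group_A f])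
  qed
  then show ?thesis by simp
qed

lemma augmentation_hom: "augmentation \<in> hom (free_Abelian_group S) integer_group"
  by (rule homI) (auto simp: augmentation_add)

context central_relation
begin

abbreviation "ZQ \<equiv> free_Abelian_group (carrier Q)"

lemma gm_N: "group_module Q N trivial_act"
  by (rule group_module_trivial[OF Q.is_group comm_group_N])

lemma gm_int: "group_module Q integer_group trivial_act"
  by (rule group_module_trivial[OF Q.is_group]) simp

lemmas gm_ZQ = group_module_group_ring[OF Q.is_group]

sublocale barN: comm_group "bar_group Q N n" for n
  by (rule comm_group_bar_group[OF comm_group_N])

sublocale modN: group_module Q N trivial_act by (rule gm_N)

text \<open>
  Formulas on chains for the two connecting homomorphisms: \<open>shift_once\<close> is
  \<open>b [x|x\<^sub>1|\<dots>] \<mapsto> c(x\<inverse>, b) [x\<^sub>1|\<dots>]\<close> with coefficients \<open>b\<close> in the group ring, for the relation module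
  sequence, and \<open>shift_twice\<close> is \<open>[x|y|x\<^sub>1|\<dots>] \<mapsto> c(y\<inverse>, x\<inverse>) [x\<^sub>1|\<dots>]\<close> with integral coefficients, for
  both sequences together.
\<close>

definition shift_once :: "nat \<Rightarrow> ('q list \<Rightarrow> ('q \<Rightarrow>\<^sub>0 int)) \<Rightarrow> ('q list \<Rightarrow> 'g)" where
  "shift_once n c = gfinprod (bar_group Q N n)
     (\<lambda>xs. bar_single Q N n (cocyc_sum (inv\<^bsub>Q\<^esub> hd xs) (c xs)) (tl xs)) (cube Q (Suc n))"

definition shift_twice :: "nat \<Rightarrow> ('q list \<Rightarrow> int) \<Rightarrow> ('q list \<Rightarrow> 'g)" where
  "shift_twice n c = gfinprod (bar_group Q N n)
     (\<lambda>xs. bar_single Q N n (cocyc (inv\<^bsub>Q\<^esub> (xs ! 1)) (inv\<^bsub>Q\<^esub> (xs ! 0)) [^]\<^bsub>N\<^esub> c xs) (drop 2 xs)) (cube Q (Suc (Suc n)))"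

lemma shift_once_aux:
  assumes "xs \<in> cube Q (Suc n)"
  shows "(\<lambda>b. bar_single Q N n (cocyc_sum (inv\<^bsub>Q\<^esub> hd xs) b) (tl xs)) \<in> hom ZQ (bar_group Q N n)"
proof -
  have "inv\<^bsub>Q\<^esub> hd xs \<in> carrier Q" using assms by (auto elim: cube_SucE)
  from hom_compose[OF cocyc_sum_hom[OF this] bar_single_hom[OF comm_group_N]] show ?thesis by (simp add: o_def)
qed

lemma shift_once_hom: "shift_once n \<in> hom (bar_group Q ZQ (Suc n)) (bar_group Q N n)"
  unfolding shift_once_def[abs_def]
  by (rule bar_extend_hom[OF group_free_Abelian_group barN.comm_group_axioms shift_once_aux])

lemma shift_once_single:
  assumes "Poly_Mapping.keys b \<subseteq> carrier Q" "x \<in> carrier Q" "xs \<in> cube Q n"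
  shows "shift_once n (bar_single Q ZQ (Suc n) b (x # xs)) = bar_single Q N n (cocyc_sum (inv\<^bsub>Q\<^esub> x) b) xs"
proof -
  have "shift_once n (bar_single Q ZQ (Suc n) b (x # xs)) = bar_single Q N n (cocyc_sum (inv\<^bsub>Q\<^esub> hd (x # xs)) b) (tl (x # xs))"
    unfolding shift_once_def
    by (rule bar_extend_single[OF group_free_Abelian_group barN.comm_group_axioms shift_once_aux]) (use assms in auto)
  then show ?thesis by simp
qed

lemma shift_twice_aux:
  assumes "xs \<in> cube Q (Suc (Suc n))"
  shows "(\<lambda>k. bar_single Q N n (cocyc (inv\<^bsub>Q\<^esub> (xs ! 1)) (inv\<^bsub>Q\<^esub> (xs ! 0)) [^]\<^bsub>N\<^esub> k) (drop 2 xs))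
    \<in> hom integer_group (bar_group Q N n)"
proof -
  obtain x y ys where "xs = x # y # ys" "x \<in> carrier Q" "y \<in> carrier Q" using assms by (metis cube_SucE)
  then have c: "cocyc (inv\<^bsub>Q\<^esub> (xs ! 1)) (inv\<^bsub>Q\<^esub> (xs ! 0)) \<in> carrier N" by simp
  have "(\<lambda>k. cocyc (inv\<^bsub>Q\<^esub> (xs ! 1)) (inv\<^bsub>Q\<^esub> (xs ! 0)) [^]\<^bsub>N\<^esub> (k::int)) \<in> hom integer_group N"
    by (rule homI) (use c in \<open>simp_all add: N.int_pow_mult\<close>)
  from hom_compose[OF this bar_single_hom[OF comm_group_N]] show ?thesis by (simp add: o_def)
qed

lemma shift_twice_hom: "shift_twice n \<in> hom (bar_group Q integer_group (Suc (Suc n))) (bar_group Q N n)"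
  unfolding shift_twice_def[abs_def]
  by (rule bar_extend_hom[OF group_integer_group barN.comm_group_axioms shift_twice_aux])

lemma shift_twice_single:
  assumes "x \<in> carrier Q" "y \<in> carrier Q" "xs \<in> cube Q n"
  shows "shift_twice n (bar_single Q integer_group (Suc (Suc n)) k (x # y # xs))
    = bar_single Q N n (cocyc (inv\<^bsub>Q\<^esub> y) (inv\<^bsub>Q\<^esub> x) [^]\<^bsub>N\<^esub> k) xs"
proof -
  have "shift_twice n (bar_single Q integer_group (Suc (Suc n)) k (x # y # xs))
    = bar_single Q N n (cocyc (inv\<^bsub>Q\<^esub> ((x # y # xs) ! 1)) (inv\<^bsub>Q\<^esub> ((x # y # xs) ! 0)) [^]\<^bsub>N\<^esub> k) (drop 2 (x # y # xs))"
    unfolding shift_twice_def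
    by (rule bar_extend_single[OF group_integer_group barN.comm_group_axioms shift_twice_aux]) (use assms in auto)
  then show ?thesis by simp
qed

text \<open>
  The boundary involves the action only in the first face, so the failure of \<open>retr\<close> to commute with
  it is the failure of equivariance in that face.
\<close>

lemma retr_boundary:
  assumes "y \<in> carrier (bar_group Q T (Suc n))"
  shows "coeff_chain_map Q retr n (bar_boundary Q T actT n y) =
    bar_boundary Q N trivial_act n (coeff_chain_map Q retr (Suc n) y)
      \<otimes>\<^bsub>bar_group Q N n\<^esub> shift_once n (coeff_chain_map Q projT (Suc n) y)"
proof -
  interpret TM: group_module Q T actT by (rule group_module_T)
  have m: "coeff_chain_map Q retr n \<in> hom (bar_group Q T n) (bar_group Q N n)" for n
    by (rule coeff_chain_map_hom[OF T.is_group N.is_group retr_hom])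
  have pr: "coeff_chain_map Q projT (Suc n) \<in> hom (bar_group Q T (Suc n)) (bar_group Q ZQ (Suc n))"
    by (rule coeff_chain_map_hom[OF T.is_group group_free_Abelian_group projT_hom])
  have L: "coeff_chain_map Q retr n \<circ> bar_boundary Q T actT n \<in> hom (bar_group Q T (Suc n)) (bar_group Q N n)"
    by (rule hom_compose[OF TM.boundary_hom m])
  have R1: "bar_boundary Q N trivial_act n \<circ> coeff_chain_map Q retr (Suc n) \<in> hom (bar_group Q T (Suc n)) (bar_group Q N n)"
    by (rule hom_compose[OF m modN.boundary_hom])
  have R2: "shift_once n \<circ> coeff_chain_map Q projT (Suc n) \<in> hom (bar_group Q T (Suc n)) (bar_group Q N n)"
    by (rule hom_compose[OF pr shift_once_hom])
  let ?r1 = "bar_boundary Q N trivial_act n \<circ> coeff_chain_map Q retr (Suc n)"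
  let ?r2 = "shift_once n \<circ> coeff_chain_map Q projT (Suc n)"
  have R: "(\<lambda>y. ?r1 y \<otimes>\<^bsub>bar_group Q N n\<^esub> ?r2 y) \<in> hom (bar_group Q T (Suc n)) (bar_group Q N n)"
    by (rule hom_product[OF barN.comm_group_axioms R1 R2])
  have "(coeff_chain_map Q retr n \<circ> bar_boundary Q T actT n) y = (\<lambda>y. ?r1 y \<otimes>\<^bsub>bar_group Q N n\<^esub> ?r2 y) y"
  proof (rule bar_hom_eqI[OF T.comm_group_axioms barN.is_group L R _ assms])
    fix X xs assume X: "X \<in> carrier T" and "xs \<in> cube Q (Suc n)"
    then obtain x ys where xs: "xs = x # ys" "x \<in> carrier Q" "ys \<in> cube Q n" by (metis cube_SucE)
    have X': "actT (inv\<^bsub>Q\<^esub> x) X \<in> carrier T" using X xs by (intro TM.act_closed) simp_all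
    have rX: "retr X \<in> carrier N" using hom_in_carrier[OF retr_hom X] .
    have pX: "Poly_Mapping.keys (projT X) \<subseteq> carrier Q" using hom_in_carrier[OF projT_hom X] by simp
    have cX: "cocyc_sum (inv\<^bsub>Q\<^esub> x) (projT X) \<in> carrier N" using xs pX by (simp add: cocyc_sum_closed)
    let ?S = "\<lambda>a. bar_single Q N n a ys" and ?C = "\<lambda>a. chain_of Q N n a (inner_faces Q x ys)"
    have cl: "?S a \<in> carrier (bar_group Q N n)" "?C a \<in> carrier (bar_group Q N n)" if "a \<in> carrier N" for a
      using that by (simp_all add: bar_single_closed chain_of_closed)
    have "(coeff_chain_map Q retr n \<circ> bar_boundary Q T actT n) (bar_single Q T (Suc n) X xs)
        = coeff_chain_map Q retr n (bar_single Q T n (actT (inv\<^bsub>Q\<^esub> x) X) ys \<otimes>\<^bsub>bar_group Q T n\<^esub> chain_of Q T n X (inner_faces Q x ys))"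
      using TM.boundary_single[OF X xs(2,3)] by (simp add: xs(1))
    also have "\<dots> = ?S (retr (actT (inv\<^bsub>Q\<^esub> x) X)) \<otimes>\<^bsub>bar_group Q N n\<^esub> ?C (retr X)"
      using hom_mult[OF m bar_single_closed[OF T.is_group X'] chain_of_closed[OF T.is_group X]]
      by (simp add: coeff_chain_map_single[OF T.is_group N.is_group retr_hom X']
          coeff_chain_map_chain_of[OF T.is_group N.is_group retr_hom X])
    also have "retr (actT (inv\<^bsub>Q\<^esub> x) X) = retr X \<otimes>\<^bsub>N\<^esub> cocyc_sum (inv\<^bsub>Q\<^esub> x) (projT X)"
      using X xs by (intro retr_act) simp_all
    also have "?S (retr X \<otimes>\<^bsub>N\<^esub> cocyc_sum (inv\<^bsub>Q\<^esub> x) (projT X)) = ?S (retr X) \<otimes>\<^bsub>bar_group Q N n\<^esub> ?S (cocyc_sum (inv\<^bsub>Q\<^esub> x) (projT X))"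
      using hom_mult[OF bar_single_hom[OF comm_group_N] rX cX] .
    also have "\<dots> \<otimes>\<^bsub>bar_group Q N n\<^esub> ?C (retr X) = (?S (retr X) \<otimes>\<^bsub>bar_group Q N n\<^esub> ?C (retr X)) \<otimes>\<^bsub>bar_group Q N n\<^esub> ?S (cocyc_sum (inv\<^bsub>Q\<^esub> x) (projT X))"
      using rX cX by (simp add: cl barN.m_ac)
    also have "?S (cocyc_sum (inv\<^bsub>Q\<^esub> x) (projT X)) = ?r2 (bar_single Q T (Suc n) X xs)"
      using shift_once_single[OF pX xs(2,3)] by (simp add: xs(1) coeff_chain_map_single[OF T.is_group group_free_Abelian_group projT_hom X])
    also have "?S (retr X) \<otimes>\<^bsub>bar_group Q N n\<^esub> ?C (retr X) = ?r1 (bar_single Q T (Suc n) X xs)"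
      using modN.boundary_single[OF rX xs(2,3)]
      by (simp add: xs(1) coeff_chain_map_single[OF T.is_group N.is_group retr_hom X] trivial_act_def)
    finally show "(coeff_chain_map Q retr n \<circ> bar_boundary Q T actT n) (bar_single Q T (Suc n) X xs)
        = ?r1 (bar_single Q T (Suc n) X xs) \<otimes>\<^bsub>bar_group Q N n\<^esub> ?r2 (bar_single Q T (Suc n) X xs)" .
  qed
  then show ?thesis by simp
qed

text \<open>The cocycle identity, extended linearly in the last variable.\<close>

lemma cocyc_sum_act:
  assumes q: "q \<in> carrier Q" "r \<in> carrier Q" and b: "Poly_Mapping.keys b \<subseteq> carrier Q"
  shows "cocyc_sum q (group_ring_act Q r b) \<otimes>\<^bsub>N\<^esub> cocyc_sum r b
    = cocyc q r [^]\<^bsub>N\<^esub> augmentation b \<otimes>\<^bsub>N\<^esub> cocyc_sum (q \<otimes>\<^bsub>Q\<^esub> r) b"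
proof -
  have ga: "group_ring_act Q r \<in> hom ZQ ZQ"
    by (rule homI) (use group_ring_act_keys[OF Q.is_group q(2)] in \<open>auto simp: group_ring_act_add\<close>)
  have h1: "cocyc_sum q \<circ> group_ring_act Q r \<in> hom ZQ N" by (rule hom_compose[OF ga cocyc_sum_hom[OF q(1)]])
  note h2 = cocyc_sum_hom[OF q(2)] and h3 = cocyc_sum_hom[OF Q.m_closed[OF q]]
  have L: "(\<lambda>b. (cocyc_sum q \<circ> group_ring_act Q r) b \<otimes>\<^bsub>N\<^esub> cocyc_sum r b) \<in> hom ZQ N"
    by (rule hom_product[OF comm_group_N h1 h2])
  have R: "(\<lambda>b. cocyc q r [^]\<^bsub>N\<^esub> augmentation b \<otimes>\<^bsub>N\<^esub> cocyc_sum (q \<otimes>\<^bsub>Q\<^esub> r) b) \<in> hom ZQ N"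
    by (rule homI) (use q free_hom_closed[OF h3] in
        \<open>simp_all add: free_hom_add[OF h3] augmentation_add N.int_pow_mult N.m_ac\<close>)
  have "(\<lambda>b. (cocyc_sum q \<circ> group_ring_act Q r) b \<otimes>\<^bsub>N\<^esub> cocyc_sum r b) b
      = (\<lambda>b. cocyc q r [^]\<^bsub>N\<^esub> augmentation b \<otimes>\<^bsub>N\<^esub> cocyc_sum (q \<otimes>\<^bsub>Q\<^esub> r) b) b"
  proof (rule free_hom_eqI[OF N.is_group L R _ b])
    fix x assume x: "x \<in> carrier Q"
    then show "(cocyc_sum q \<circ> group_ring_act Q r) (frag_of x) \<otimes>\<^bsub>N\<^esub> cocyc_sum r (frag_of x)
        = cocyc q r [^]\<^bsub>N\<^esub> augmentation (frag_of x) \<otimes>\<^bsub>N\<^esub> cocyc_sum (q \<otimes>\<^bsub>Q\<^esub> r) (frag_of x)"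
      using q cocyc_assoc[OF q x] by (simp add: cocyc_sum_of N.m_comm)
  qed
  then show ?thesis by simp
qed

lemma shift_once_chain_of_Cons:
  assumes b: "Poly_Mapping.keys b \<subseteq> carrier Q" and x: "x \<in> carrier Q" and c: "c \<in> free_chains Q n"
  shows "shift_once n (chain_of Q ZQ (Suc n) b (frag_extend (\<lambda>xs. frag_of (x # xs)) c))
    = chain_of Q N n (cocyc_sum (inv\<^bsub>Q\<^esub> x) b) c"
proof -
  have ZQ: "comm_group ZQ" by (rule abelian_free_Abelian_group)
  have b': "b \<in> carrier ZQ" using b by simp
  have cb: "cocyc_sum (inv\<^bsub>Q\<^esub> x) b \<in> carrier N" using x b by (simp add: cocyc_sum_closed)
  have 1: "frag_extend (\<lambda>xs. frag_of (x # xs)) \<in> hom (free_Abelian_group (cube Q n)) (free_Abelian_group (cube Q (Suc n)))"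
    by (rule frag_extend_hom) (use x in auto)
  have L: "shift_once n \<circ> (chain_of Q ZQ (Suc n) b \<circ> frag_extend (\<lambda>xs. frag_of (x # xs))) \<in> hom (free_Abelian_group (cube Q n)) (bar_group Q N n)"
    by (intro hom_compose[OF hom_compose[OF 1 chain_of_hom[OF ZQ b']] shift_once_hom])
  have "(shift_once n \<circ> (chain_of Q ZQ (Suc n) b \<circ> frag_extend (\<lambda>xs. frag_of (x # xs)))) c = chain_of Q N n (cocyc_sum (inv\<^bsub>Q\<^esub> x) b) c"
    by (rule free_hom_eqI[OF barN.is_group L chain_of_hom[OF comm_group_N cb]])
      (use c b' cb shift_once_single[OF b x] in
        \<open>simp_all add: bar_single_eq_chain_of[OF N.is_group, symmetric] bar_single_eq_chain_of[OF group_free_Abelian_group, symmetric] free_chains_def\<close>)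
  then show ?thesis by simp
qed

text \<open>
  Up to the boundary of \<open>shift_once\<close>, the first formula applied to the boundary of a chain over the
  group ring only depends on the augmentation of that chain. The first face contributes
  \<open>c(y\<inverse>, x\<inverse> b)\<close>, the second one \<open>c((xy)\<inverse>, b)\<close>, and the boundary of \<open>shift_once\<close> contributes
  \<open>c(x\<inverse>, b)\<close>; their combination is given by the cocycle identity.
\<close>

lemma shift_once_boundary:
  assumes "y \<in> carrier (bar_group Q ZQ (Suc (Suc n)))"
  shows "shift_once n (bar_boundary Q ZQ (group_ring_act Q) (Suc n) y)
      \<otimes>\<^bsub>bar_group Q N n\<^esub> bar_boundary Q N trivial_act n (shift_once (Suc n) y)
    = shift_twice n (coeff_chain_map Q augmentation (Suc (Suc n)) y)"
proof -
  have ZQ: "comm_group ZQ" by (rule abelian_free_Abelian_group)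
  interpret Z: group_module Q ZQ "group_ring_act Q" by (rule gm_ZQ)
  interpret B1: comm_group "bar_group Q ZQ (Suc n)" by (rule Z.comm_group_bar)
  have L1: "shift_once n \<circ> bar_boundary Q ZQ (group_ring_act Q) (Suc n) \<in> hom (bar_group Q ZQ (Suc (Suc n))) (bar_group Q N n)"
    by (rule hom_compose[OF Z.boundary_hom shift_once_hom])
  have L2: "bar_boundary Q N trivial_act n \<circ> shift_once (Suc n) \<in> hom (bar_group Q ZQ (Suc (Suc n))) (bar_group Q N n)"
    by (rule hom_compose[OF shift_once_hom modN.boundary_hom])
  let ?l1 = "shift_once n \<circ> bar_boundary Q ZQ (group_ring_act Q) (Suc n)"
  let ?l2 = "bar_boundary Q N trivial_act n \<circ> shift_once (Suc n)"
  have L: "(\<lambda>y. ?l1 y \<otimes>\<^bsub>bar_group Q N n\<^esub> ?l2 y) \<in> hom (bar_group Q ZQ (Suc (Suc n))) (bar_group Q N n)"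
    by (rule hom_product[OF barN.comm_group_axioms L1 L2])
  note au = coeff_chain_map_hom[OF group_free_Abelian_group group_integer_group augmentation_hom]
  have R: "shift_twice n \<circ> coeff_chain_map Q augmentation (Suc (Suc n)) \<in> hom (bar_group Q ZQ (Suc (Suc n))) (bar_group Q N n)"
    by (rule hom_compose[OF au shift_twice_hom])
  have "(\<lambda>y. ?l1 y \<otimes>\<^bsub>bar_group Q N n\<^esub> ?l2 y) y = (shift_twice n \<circ> coeff_chain_map Q augmentation (Suc (Suc n))) y"
  proof (rule bar_hom_eqI[OF ZQ barN.is_group L R _ assms])
    fix b xs assume b: "b \<in> carrier ZQ" and "xs \<in> cube Q (Suc (Suc n))"
    then obtain x y ys where xs: "xs = x # y # ys" and Q: "x \<in> carrier Q" "y \<in> carrier Q" "ys \<in> cube Q n"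
      by (metis cube_SucE)
    let ?b = "group_ring_act Q (inv\<^bsub>Q\<^esub> x) b"
    have bk: "Poly_Mapping.keys b \<subseteq> carrier Q" using b by simp
    have b'k: "Poly_Mapping.keys ?b \<subseteq> carrier Q" using group_ring_act_keys[OF Q.is_group _ bk] Q by simp
    let ?e = "inner_faces Q y ys"
    have e: "?e \<in> free_chains Q n" using inner_faces_keys[OF Q.is_group Q(2,3)] by (simp add: free_chains_def)
    let ?k = "frag_extend (\<lambda>xs. frag_of (x # xs)) ?e"
    let ?S = "\<lambda>a. bar_single Q N n a ys" and ?C = "\<lambda>a. chain_of Q N n a ?e"
    let ?c1 = "cocyc_sum (inv\<^bsub>Q\<^esub> y) ?b" and ?c2 = "cocyc_sum (inv\<^bsub>Q\<^esub> (x \<otimes>\<^bsub>Q\<^esub> y)) b" and ?c3 = "cocyc_sum (inv\<^bsub>Q\<^esub> x) b"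
    have c: "?c1 \<in> carrier N" "?c2 \<in> carrier N" "?c3 \<in> carrier N"
      using Q bk b'k by (simp_all add: cocyc_sum_closed)
    have cl: "?S a \<in> carrier (bar_group Q N n)" "?C a \<in> carrier (bar_group Q N n)" if "a \<in> carrier N" for a
      using that by (simp_all add: bar_single_closed chain_of_closed)
    interpret g: group_hom "bar_group Q ZQ (Suc n)" "bar_group Q N n" "shift_once n"
      using shift_once_hom by (simp add: group_hom_def group_hom_axioms_def B1.is_group)
    have "chain_of Q ZQ (Suc n) b (- frag_of ((x \<otimes>\<^bsub>Q\<^esub> y) # ys) - ?k)
       = inv\<^bsub>bar_group Q ZQ (Suc n)\<^esub> (bar_single Q ZQ (Suc n) b ((x \<otimes>\<^bsub>Q\<^esub> y) # ys) \<otimes>\<^bsub>bar_group Q ZQ (Suc n)\<^esub> chain_of Q ZQ (Suc n) b ?k)"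
      using b free_hom_minus[OF B1.is_group chain_of_hom[OF ZQ b, of Q "Suc n" UNIV], of "frag_of ((x \<otimes>\<^bsub>Q\<^esub> y) # ys) + ?k"]
      by (simp add: bar_single_eq_chain_of chain_of_add)
    then have "?l1 (bar_single Q ZQ (Suc (Suc n)) b xs) = shift_once n (bar_single Q ZQ (Suc n) ?b (y # ys) \<otimes>\<^bsub>bar_group Q ZQ (Suc n)\<^esub>
        inv\<^bsub>bar_group Q ZQ (Suc n)\<^esub> (bar_single Q ZQ (Suc n) b ((x \<otimes>\<^bsub>Q\<^esub> y) # ys) \<otimes>\<^bsub>bar_group Q ZQ (Suc n)\<^esub> chain_of Q ZQ (Suc n) b ?k))"
      using Z.boundary_single[OF b Q(1), of "y # ys" "Suc n"] Q by (simp add: xs)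
    also have "\<dots> = shift_once n (bar_single Q ZQ (Suc n) ?b (y # ys)) \<otimes>\<^bsub>bar_group Q N n\<^esub>
        inv\<^bsub>bar_group Q N n\<^esub> (shift_once n (bar_single Q ZQ (Suc n) b ((x \<otimes>\<^bsub>Q\<^esub> y) # ys)) \<otimes>\<^bsub>bar_group Q N n\<^esub> shift_once n (chain_of Q ZQ (Suc n) b ?k))"
      using bar_single_closed[OF group_free_Abelian_group, of b "carrier Q"] b b'k
      by (simp add: bar_single_closed chain_of_closed)
    also have "\<dots> = ?S ?c1 \<otimes>\<^bsub>bar_group Q N n\<^esub> inv\<^bsub>bar_group Q N n\<^esub> (?S ?c2 \<otimes>\<^bsub>bar_group Q N n\<^esub> ?C ?c3)"
      using Q bk b'k e by (simp add: shift_once_single shift_once_chain_of_Cons)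
    finally have 1: "?l1 (bar_single Q ZQ (Suc (Suc n)) b xs) = ?S ?c1 \<otimes>\<^bsub>bar_group Q N n\<^esub> inv\<^bsub>bar_group Q N n\<^esub> (?S ?c2 \<otimes>\<^bsub>bar_group Q N n\<^esub> ?C ?c3)" .
    have 2: "?l2 (bar_single Q ZQ (Suc (Suc n)) b xs) = ?S ?c3 \<otimes>\<^bsub>bar_group Q N n\<^esub> ?C ?c3"
      using Q shift_once_single[OF bk Q(1), of "y # ys" "Suc n"] modN.boundary_single[OF c(3) Q(2,3)]
      by (simp add: xs trivial_act_def)
    have "?S ?c1 \<otimes>\<^bsub>bar_group Q N n\<^esub> ?S ?c3 = ?S (?c1 \<otimes>\<^bsub>N\<^esub> ?c3)"
      by (rule hom_mult[OF bar_single_hom[OF comm_group_N] c(1,3), symmetric])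
    also have "?c1 \<otimes>\<^bsub>N\<^esub> ?c3 = cocyc (inv\<^bsub>Q\<^esub> y) (inv\<^bsub>Q\<^esub> x) [^]\<^bsub>N\<^esub> augmentation b \<otimes>\<^bsub>N\<^esub> ?c2"
      using cocyc_sum_act[of "inv\<^bsub>Q\<^esub> y" "inv\<^bsub>Q\<^esub> x" b] Q bk by (simp add: Q.inv_mult_group)
    also have "?S \<dots> = ?S (cocyc (inv\<^bsub>Q\<^esub> y) (inv\<^bsub>Q\<^esub> x) [^]\<^bsub>N\<^esub> augmentation b) \<otimes>\<^bsub>bar_group Q N n\<^esub> ?S ?c2"
      using Q c by (intro hom_mult[OF bar_single_hom[OF comm_group_N]]) simp_all
    finally have 3: "?S ?c1 \<otimes>\<^bsub>bar_group Q N n\<^esub> ?S ?c3 = ?S (cocyc (inv\<^bsub>Q\<^esub> y) (inv\<^bsub>Q\<^esub> x) [^]\<^bsub>N\<^esub> augmentation b) \<otimes>\<^bsub>bar_group Q N n\<^esub> ?S ?c2" .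
    let ?S4 = "?S (cocyc (inv\<^bsub>Q\<^esub> y) (inv\<^bsub>Q\<^esub> x) [^]\<^bsub>N\<^esub> augmentation b)"
    have S4: "?S4 \<in> carrier (bar_group Q N n)" using Q by (intro cl) simp
    have "?l1 (bar_single Q ZQ (Suc (Suc n)) b xs) \<otimes>\<^bsub>bar_group Q N n\<^esub> ?l2 (bar_single Q ZQ (Suc (Suc n)) b xs)
       = (?S ?c1 \<otimes>\<^bsub>bar_group Q N n\<^esub> ?S ?c3) \<otimes>\<^bsub>bar_group Q N n\<^esub> (inv\<^bsub>bar_group Q N n\<^esub> (?S ?c2 \<otimes>\<^bsub>bar_group Q N n\<^esub> ?C ?c3) \<otimes>\<^bsub>bar_group Q N n\<^esub> ?C ?c3)"
      unfolding 1 2 using c by (simp only: barN.m_ac cl barN.m_closed barN.inv_closed)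
    also have "inv\<^bsub>bar_group Q N n\<^esub> (?S ?c2 \<otimes>\<^bsub>bar_group Q N n\<^esub> ?C ?c3) \<otimes>\<^bsub>bar_group Q N n\<^esub> ?C ?c3 = inv\<^bsub>bar_group Q N n\<^esub> ?S ?c2"
      using c by (simp add: cl barN.inv_mult barN.m_assoc)
    also have "(?S ?c1 \<otimes>\<^bsub>bar_group Q N n\<^esub> ?S ?c3) \<otimes>\<^bsub>bar_group Q N n\<^esub> inv\<^bsub>bar_group Q N n\<^esub> ?S ?c2 = ?S4"
      unfolding 3 using c S4 by (simp add: cl barN.m_assoc)
    also have "?S4 = (shift_twice n \<circ> coeff_chain_map Q augmentation (Suc (Suc n))) (bar_single Q ZQ (Suc (Suc n)) b xs)"
      using Q shift_twice_single[OF Q] by (simp add: xs coeff_chain_map_single[OF group_free_Abelian_group group_integer_group augmentation_hom b])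
    finally show "?l1 (bar_single Q ZQ (Suc (Suc n)) b xs) \<otimes>\<^bsub>bar_group Q N n\<^esub> ?l2 (bar_single Q ZQ (Suc (Suc n)) b xs)
       = (shift_twice n \<circ> coeff_chain_map Q augmentation (Suc (Suc n))) (bar_single Q ZQ (Suc (Suc n)) b xs)" .
  qed
  then show ?thesis by simp
qed

text \<open>
  Lift a bounding chain to the group ring and apply \<open>shift_once_boundary\<close> to the boundary of the
  lift, whose own boundary is zero.
\<close>

lemma shift_twice_free_boundary:
  assumes "u \<in> free_boundaries Q (Suc (Suc n))"
  shows "shift_twice n (int_chain Q (Suc (Suc n)) u) \<in> boundaries Q N trivial_act n"
proof -
  interpret Z: group_module Q ZQ "group_ring_act Q" by (rule gm_ZQ)
  obtain v where v: "v \<in> free_chains Q (Suc (Suc (Suc n)))" "u = bd Q v" using assms by (auto simp: free_boundaries_def)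
  let ?d = "bar_boundary Q ZQ (group_ring_act Q)"
  obtain y where y: "y \<in> carrier (bar_group Q ZQ (Suc (Suc (Suc n))))"
    "coeff_chain_map Q augmentation (Suc (Suc (Suc n))) y = int_chain Q (Suc (Suc (Suc n))) v"
  proof (rule coeff_chain_map_lift[OF group_free_Abelian_group group_integer_group augmentation_hom int_chain_closed])
    fix xs
    have "augmentation (frag_cmul m (frag_of \<one>\<^bsub>Q\<^esub>)) = m" for m
      by (simp add: augmentation_eq frag_extend_cmul)
    then show "\<exists>a\<in>carrier ZQ. augmentation a = int_chain Q (Suc (Suc (Suc n))) v xs"
      by (intro bexI[of _ "frag_cmul (int_chain Q (Suc (Suc (Suc n))) v xs) (frag_of \<one>\<^bsub>Q\<^esub>)"]) (auto intro!: keys_cmulI)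
  qed
  have "coeff_chain_map Q augmentation (Suc (Suc n)) (?d (Suc (Suc n)) y)
      = bar_boundary Q integer_group trivial_act (Suc (Suc n)) (coeff_chain_map Q augmentation (Suc (Suc (Suc n))) y)"
    by (rule coeff_chain_map_boundary[OF gm_ZQ gm_int augmentation_hom _ y(1)]) (simp add: trivial_act_def)
  also have "\<dots> = int_chain Q (Suc (Suc n)) u"
    unfolding y(2) v(2) by (rule int_chain_bd[OF Q.is_group v(1)])
  finally have u: "coeff_chain_map Q augmentation (Suc (Suc n)) (?d (Suc (Suc n)) y) = int_chain Q (Suc (Suc n)) u" .
  have dy: "?d (Suc (Suc n)) y \<in> carrier (bar_group Q ZQ (Suc (Suc n)))" by (rule Z.boundary_closed[OF y(1)])
  have gy: "shift_once (Suc n) (?d (Suc (Suc n)) y) \<in> carrier (bar_group Q N (Suc n))" by (rule hom_in_carrier[OF shift_once_hom dy])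
  have one: "shift_once n (?d (Suc n) (?d (Suc (Suc n)) y)) = \<one>\<^bsub>bar_group Q N n\<^esub>"
    unfolding Z.boundary_boundary[OF y(1)]
    by (rule hom_one[OF shift_once_hom comm_group.axioms(2)[OF Z.comm_group_bar] barN.is_group])
  have "shift_twice n (int_chain Q (Suc (Suc n)) u) = bar_boundary Q N trivial_act n (shift_once (Suc n) (?d (Suc (Suc n)) y))"
    using shift_once_boundary[OF dy] modN.boundary_closed[OF gy] unfolding one u by simp
  then show ?thesis using gy by (simp add: boundaries_def)
qed

text \<open>
  Let \<open>y'\<close> be a lift of the cycle to the group ring and \<open>y\<close> a lift of \<open>\<partial>y'\<close> to the middle term of
  the relation module sequence. The value of the connecting homomorphisms is the element \<open>w\<close> that
  maps to \<open>\<partial>y\<close>, and \<open>p\<close> sends it to \<open>retr (\<partial>y)\<close>, because \<open>retr\<close> extends \<open>p\<close>. By \<open>retr_boundary\<close> this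
  is homologous to \<open>shift_once (\<partial>y')\<close>, which by \<open>shift_once_boundary\<close> is homologous to the claimed
  value.
\<close>

lemma dimension_shift_value:
  assumes z: "z \<in> free_cycles Q (Suc (Suc n))"
    and w: "w \<in> dimension_shift E Q (\<pi> \<circ> p) n (cls Q (Suc (Suc n)) z)"
  shows "coeff_chain_map Q (quot_lift p) n w \<in> boundaries Q N trivial_act n #>\<^bsub>bar_group Q N n\<^esub> shift_twice n (int_chain Q (Suc (Suc n)) z)"
proof -
  interpret Z: group_module Q ZQ "group_ring_act Q" by (rule gm_ZQ)
  interpret BI: comm_group "bar_group Q integer_group (Suc (Suc n))" by (rule comm_group_bar_group) simp
  let ?d = "bar_boundary Q ZQ (group_ring_act Q)"
  let ?dN = "bar_boundary Q N trivial_act n"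
  from w obtain y y' u where wc: "w \<in> carrier (bar_group Q Rel n)" and y: "y \<in> carrier (bar_group Q T (Suc n))"
    and wy: "coeff_chain_map Q incl n w = bar_boundary Q T actT n y"
    and uc: "u \<in> carrier (bar_group Q (augmentation_ideal Q) (Suc n))" and yu: "coeff_chain_map Q projT (Suc n) y = u"
    and y': "y' \<in> carrier (bar_group Q ZQ (Suc (Suc n)))" and y'Z: "coeff_chain_map Q augmentation (Suc (Suc n)) y' \<in> cls Q (Suc (Suc n)) z"
    and u: "coeff_chain_map Q (\<lambda>x. x) (Suc n) u = ?d (Suc n) y'"
    by (auto simp: dimension_shift_def connecting_def)
  have "coeff_chain_map Q (\<lambda>x. x) (Suc n) u = u"
    by (rule coeff_chain_map_id[OF comm_group.axioms(2)[OF comm_group_augmentation_ideal] uc])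
  then have u': "coeff_chain_map Q projT (Suc n) y = ?d (Suc n) y'" using u yu by simp
  have "coeff_chain_map Q (quot_lift p) n w = coeff_chain_map Q retr n (coeff_chain_map Q incl n w)"
    using wc comm_group.axioms(2)[OF comm_group_Rel] retr_incl
    by (auto simp: coeff_chain_map_def bar_carrier_iff intro!: restrict_ext)
  also have "\<dots> = ?dN (coeff_chain_map Q retr (Suc n) y) \<otimes>\<^bsub>bar_group Q N n\<^esub> shift_once n (?d (Suc n) y')"
    unfolding wy retr_boundary[OF y] u' ..
  finally have 1: "coeff_chain_map Q (quot_lift p) n w
      = ?dN (coeff_chain_map Q retr (Suc n) y) \<otimes>\<^bsub>bar_group Q N n\<^esub> shift_once n (?d (Suc n) y')" .
  have a: "?dN (coeff_chain_map Q retr (Suc n) y) \<in> boundaries Q N trivial_act n"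
    using hom_in_carrier[OF coeff_chain_map_hom[OF T.is_group N.is_group retr_hom] y] by (simp add: boundaries_def)
  have gy: "shift_once (Suc n) y' \<in> carrier (bar_group Q N (Suc n))" by (rule hom_in_carrier[OF shift_once_hom y'])
  have b: "?dN (shift_once (Suc n) y') \<in> boundaries Q N trivial_act n" using gy by (simp add: boundaries_def)
  obtain v where v: "v \<in> free_chains Q (Suc (Suc n))" "coeff_chain_map Q augmentation (Suc (Suc n)) y' = int_chain Q (Suc (Suc n)) v"
    "v - z \<in> free_boundaries Q (Suc (Suc n))"
    using y'Z mem_cls_iff[OF Q.is_group free_cycles_chains[OF z]] by auto
  have gi: "shift_twice n (int_chain Q (Suc (Suc n)) c) \<in> carrier (bar_group Q N n)" for c
    by (rule hom_in_carrier[OF shift_twice_hom int_chain_closed])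
  have "int_chain Q (Suc (Suc n)) v = int_chain Q (Suc (Suc n)) (v - z) \<otimes>\<^bsub>bar_group Q integer_group (Suc (Suc n))\<^esub> int_chain Q (Suc (Suc n)) z"
    using int_chain_add[of Q "Suc (Suc n)" "v - z" z] by simp
  then have gv: "shift_twice n (int_chain Q (Suc (Suc n)) v)
      = shift_twice n (int_chain Q (Suc (Suc n)) (v - z)) \<otimes>\<^bsub>bar_group Q N n\<^esub> shift_twice n (int_chain Q (Suc (Suc n)) z)"
    using hom_mult[OF shift_twice_hom int_chain_closed int_chain_closed, of n "v - z" z] by simp
  have c: "shift_twice n (int_chain Q (Suc (Suc n)) (v - z)) \<in> boundaries Q N trivial_act n"
    by (rule shift_twice_free_boundary[OF v(3)])
  interpret S: subgroup "boundaries Q N trivial_act n" "bar_group Q N n" by (rule modN.subgroup_boundaries)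
  have gd: "shift_once n (?d (Suc n) y') \<in> carrier (bar_group Q N n)"
    by (rule hom_in_carrier[OF shift_once_hom Z.boundary_closed[OF y']])
  have "shift_once n (?d (Suc n) y') = shift_twice n (int_chain Q (Suc (Suc n)) v) \<otimes>\<^bsub>bar_group Q N n\<^esub> inv\<^bsub>bar_group Q N n\<^esub> ?dN (shift_once (Suc n) y')"
    unfolding v(2)[symmetric] shift_once_boundary[OF y', symmetric] using gd S.mem_carrier[OF b] by (simp add: barN.m_assoc)
  then have "coeff_chain_map Q (quot_lift p) n w
     = (?dN (coeff_chain_map Q retr (Suc n) y) \<otimes>\<^bsub>bar_group Q N n\<^esub> (shift_twice n (int_chain Q (Suc (Suc n)) (v - z)) \<otimes>\<^bsub>bar_group Q N n\<^esub> inv\<^bsub>bar_group Q N n\<^esub> ?dN (shift_once (Suc n) y')))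
       \<otimes>\<^bsub>bar_group Q N n\<^esub> shift_twice n (int_chain Q (Suc (Suc n)) z)"
    unfolding 1 gv using S.mem_carrier[OF a] S.mem_carrier[OF b] gi by (simp add: barN.m_ac)
  moreover have "?dN (coeff_chain_map Q retr (Suc n) y) \<otimes>\<^bsub>bar_group Q N n\<^esub> (shift_twice n (int_chain Q (Suc (Suc n)) (v - z)) \<otimes>\<^bsub>bar_group Q N n\<^esub> inv\<^bsub>bar_group Q N n\<^esub> ?dN (shift_once (Suc n) y'))
      \<in> boundaries Q N trivial_act n"
    using a b c by (intro S.m_closed S.m_inv_closed)
  ultimately show ?thesis by (auto simp: r_coset_def)
qed

text \<open>
  The lifts required by the snake lemma exist by the exactness of the two coefficient sequences.
  This matters because \<open>connecting\<close> is the set of all values obtained from such lifts.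
\<close>

lemma dimension_shift_nonempty:
  assumes z: "z \<in> free_cycles Q (Suc (Suc n))"
  shows "dimension_shift E Q (\<pi> \<circ> p) n (cls Q (Suc (Suc n)) z) \<noteq> {}"
proof -
  interpret Z: group_module Q ZQ "group_ring_act Q" by (rule gm_ZQ)
  interpret TM: group_module Q T actT by (rule group_module_T)
  let ?d = "bar_boundary Q ZQ (group_ring_act Q)"
  let ?IQ = "augmentation_ideal Q"
  have IQ: "group ?IQ" using comm_group.axioms(2)[OF comm_group_augmentation_ideal] .
  obtain y where y: "y \<in> carrier (bar_group Q ZQ (Suc (Suc n)))"
    "coeff_chain_map Q augmentation (Suc (Suc n)) y = int_chain Q (Suc (Suc n)) z"
  proof (rule coeff_chain_map_lift[OF group_free_Abelian_group group_integer_group augmentation_hom int_chain_closed])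
    fix xs
    have "augmentation (frag_cmul m (frag_of \<one>\<^bsub>Q\<^esub>)) = m" for m
      by (simp add: augmentation_eq frag_extend_cmul)
    then show "\<exists>a\<in>carrier ZQ. augmentation a = int_chain Q (Suc (Suc n)) z xs"
      by (intro bexI[of _ "frag_cmul (int_chain Q (Suc (Suc n)) z xs) (frag_of \<one>\<^bsub>Q\<^esub>)"]) (auto intro!: keys_cmulI)
  qed
  define u where "u = ?d (Suc n) y"
  have uc: "u \<in> carrier (bar_group Q ZQ (Suc n))" unfolding u_def by (rule Z.boundary_closed[OF y(1)])
  have "coeff_chain_map Q augmentation (Suc n) u = bar_boundary Q integer_group trivial_act (Suc n) (int_chain Q (Suc (Suc n)) z)"
    unfolding u_def y(2)[symmetric]
    by (rule coeff_chain_map_boundary[OF gm_ZQ gm_int augmentation_hom _ y(1)]) (simp add: trivial_act_def)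
  also have "\<dots> = int_chain Q (Suc n) 0"
    using int_chain_bd[OF Q.is_group free_cycles_chains[OF z]] z by (simp add: free_cycles_def)
  finally have aug_u: "coeff_chain_map Q augmentation (Suc n) u = int_chain Q (Suc n) 0" .
  have aug: "augmentation (u xs) = 0" if "xs \<in> cube Q (Suc n)" for xs
    using fun_cong[OF aug_u, of xs] that by (simp add: coeff_chain_map_def int_chain_eq)
  have ku: "Poly_Mapping.keys (u xs) \<subseteq> carrier Q" if "xs \<in> cube Q (Suc n)" for xs
    using uc that by (simp add: bar_carrier_iff)
  have uI: "u \<in> carrier (bar_group Q ?IQ (Suc n))"
    using uc aug ku IQ by (auto simp: bar_carrier_iff augmentation_ideal_simps(1,3) simp del: carrier_free_Abelian_group_iff)
  have uu: "coeff_chain_map Q (\<lambda>x. x) (Suc n) u = u"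
    by (rule coeff_chain_map_id[OF group_free_Abelian_group uc])
  have uZ: "u \<in> connecting Q ?IQ (\<lambda>x. x) ZQ (group_ring_act Q) augmentation (Suc n) (cls Q (Suc (Suc n)) z)"
  proof -
    have "coeff_chain_map Q augmentation (Suc (Suc n)) y \<in> cls Q (Suc (Suc n)) z"
      unfolding y(2) using mem_cls_iff[OF Q.is_group free_cycles_chains[OF z]] free_cycles_chains[OF z]
      by (auto intro!: bexI[of _ z] simp: free_boundaries_zero)
    then show ?thesis using uI y(1) uu unfolding connecting_def u_def by blast
  qed
  obtain v where v: "v \<in> carrier (bar_group Q T (Suc n))" "coeff_chain_map Q projT (Suc n) v = u"
  proof (rule coeff_chain_map_lift[OF T.is_group group_free_Abelian_group projT_hom uc])
    fix xs assume "xs \<in> cube Q (Suc n)"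
    then show "\<exists>X\<in>carrier T. projT X = u xs" using projT_surj[OF ku aug] by blast
  qed
  let ?dv = "bar_boundary Q T actT n v"
  have dv: "?dv \<in> carrier (bar_group Q T n)" by (rule TM.boundary_closed[OF v(1)])
  have "coeff_chain_map Q projT n ?dv = ?d n u"
    using coeff_chain_map_boundary[OF group_module_T gm_ZQ projT_hom _ v(1)] projT_act unfolding v(2) by blast
  also have "\<dots> = \<one>\<^bsub>bar_group Q ZQ n\<^esub>" unfolding u_def by (rule Z.boundary_boundary[OF y(1)])
  finally have proj_dv: "coeff_chain_map Q projT n ?dv = \<one>\<^bsub>bar_group Q ZQ n\<^esub>" .
  have p0: "projT (?dv xs) = 0" if "xs \<in> cube Q n" for xs
    using fun_cong[OF proj_dv, of xs] that by (simp add: coeff_chain_map_def bar_one)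
  obtain w where w: "w \<in> carrier (bar_group Q Rel n)" "coeff_chain_map Q incl n w = ?dv"
  proof (rule coeff_chain_map_lift[OF comm_group.axioms(2)[OF comm_group_Rel] T.is_group incl_hom dv])
    fix xs assume xs: "xs \<in> cube Q n"
    then have "?dv xs \<in> carrier T" using dv by (simp add: bar_carrier_iff T.is_group)
    then show "\<exists>Y\<in>carrier Rel. incl Y = ?dv xs" using projT_exact[OF _ p0[OF xs]] by blast
  qed
  have "w \<in> connecting Q Rel incl T actT projT n
      (connecting Q ?IQ (\<lambda>x. x) ZQ (group_ring_act Q) augmentation (Suc n) (cls Q (Suc (Suc n)) z))"
    using w v uZ unfolding connecting_def[of _ Rel] by blast
  then have "w \<in> dimension_shift E Q (\<pi> \<circ> p) n (cls Q (Suc (Suc n)) z)"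
    by (simp add: dimension_shift_def)
  then show ?thesis by blast
qed

text \<open>
  A nonempty set of representatives inside one homology class is enough, since the identifications
  of \<open>H\<^sub>0\<close> and \<open>H\<^sub>1\<close> take the common value of a map on the representatives.
\<close>

lemma coeff_homology_dimension_shift:
  assumes z: "z \<in> free_cycles Q (Suc (Suc n))"
  defines "Y \<equiv> coeff_homology_map Q N trivial_act (quot_lift p) n (dimension_shift E Q (\<pi> \<circ> p) n (cls Q (Suc (Suc n)) z))"
  shows "Y \<noteq> {}"
    and "Y \<subseteq> boundaries Q N trivial_act n #>\<^bsub>bar_group Q N n\<^esub> shift_twice n (int_chain Q (Suc (Suc n)) z)"
proof -
  interpret S: subgroup "boundaries Q N trivial_act n" "bar_group Q N n" by (rule modN.subgroup_boundaries)
  show "Y \<noteq> {}"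
    using dimension_shift_nonempty[OF z] S.one_closed
    unfolding Y_def coeff_homology_map_def quot_map_def set_mult_def by blast
  have g: "shift_twice n (int_chain Q (Suc (Suc n)) z) \<in> carrier (bar_group Q N n)"
    by (rule hom_in_carrier[OF shift_twice_hom int_chain_closed])
  show "Y \<subseteq> boundaries Q N trivial_act n #>\<^bsub>bar_group Q N n\<^esub> shift_twice n (int_chain Q (Suc (Suc n)) z)"
  proof
    fix x assume "x \<in> Y"
    then obtain b w where b: "b \<in> boundaries Q N trivial_act n" and w: "w \<in> dimension_shift E Q (\<pi> \<circ> p) n (cls Q (Suc (Suc n)) z)"
      and x: "x = b \<otimes>\<^bsub>bar_group Q N n\<^esub> coeff_chain_map Q (quot_lift p) n w"
      unfolding Y_def coeff_homology_map_def quot_map_def set_mult_def by blast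
    obtain b' where b': "b' \<in> boundaries Q N trivial_act n"
      "coeff_chain_map Q (quot_lift p) n w = b' \<otimes>\<^bsub>bar_group Q N n\<^esub> shift_twice n (int_chain Q (Suc (Suc n)) z)"
      using dimension_shift_value[OF z w] unfolding r_coset_def by blast
    have "x = (b \<otimes>\<^bsub>bar_group Q N n\<^esub> b') \<otimes>\<^bsub>bar_group Q N n\<^esub> shift_twice n (int_chain Q (Suc (Suc n)) z)"
      using x b b' g by (simp add: barN.m_assoc)
    moreover have "b \<otimes>\<^bsub>bar_group Q N n\<^esub> b' \<in> boundaries Q N trivial_act n" using b b' by (intro S.m_closed)
    ultimately show "x \<in> boundaries Q N trivial_act n #>\<^bsub>bar_group Q N n\<^esub> shift_twice n (int_chain Q (Suc (Suc n)) z)"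
      unfolding r_coset_def by blast
  qed
qed

end


section \<open>Tensor products\<close>

locale tensor_groups = A: comm_group A + B: comm_group B for A :: "'a monoid" and B :: "'b monoid"
begin

abbreviation "FT \<equiv> free_Abelian_group (carrier A \<times> carrier B)"

sublocale FT: comm_group FT by (rule abelian_free_Abelian_group)

lemma bilinear_relations_closed: "bilinear_relations A B \<subseteq> carrier FT"
  by (auto simp: bilinear_relations_def intro!: keys_diffI dest!: subsetD[OF keys_diff])

lemma subgroup_tensor_kernel: "subgroup (tensor_kernel A B) FT"
  unfolding tensor_kernel_def by (rule FT.generate_is_subgroup[OF bilinear_relations_closed])

sublocale T: comm_group "tensor A B"
  unfolding tensor_def by (rule FT.abelian_FactGroup[OF subgroup_tensor_kernel])

definition tclass :: "('a \<times> 'b \<Rightarrow>\<^sub>0 int) \<Rightarrow> ('a \<times> 'b \<Rightarrow>\<^sub>0 int) set" where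
  "tclass c = tensor_kernel A B #>\<^bsub>FT\<^esub> c"

lemma tclass_hom: "tclass \<in> hom FT (tensor A B)"
  unfolding tclass_def[abs_def] tensor_def
  by (rule FT.rcos_hom_Mod[OF FT.subgroup_normal[OF subgroup_tensor_kernel]])

lemma carrier_tensor: "carrier (tensor A B) = tclass ` {c. Poly_Mapping.keys c \<subseteq> carrier A \<times> carrier B}"
  by (auto simp: tensor_def carrier_Mod tclass_def[abs_def])

lemma pure_tensor_eq: "pure_tensor A B a b = tclass (frag_of (a, b))"
  by (simp add: pure_tensor_def tclass_def)

lemma pure_tensor_closed: "a \<in> carrier A \<Longrightarrow> b \<in> carrier B \<Longrightarrow> pure_tensor A B a b \<in> carrier (tensor A B)"
  unfolding pure_tensor_eq by (rule free_hom_closed[OF tclass_hom]) simp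

lemma tclass_eq:
  "Poly_Mapping.keys c \<subseteq> carrier A \<times> carrier B \<Longrightarrow> Poly_Mapping.keys d \<subseteq> carrier A \<times> carrier B \<Longrightarrow>
   c - d \<in> tensor_kernel A B \<Longrightarrow> tclass c = tclass d"
  using FT.rcos_eq_iff[OF subgroup_tensor_kernel, of c d] by (simp add: tclass_def)

lemma pure_tensor_left:
  assumes b: "b \<in> carrier B" shows "(\<lambda>a. pure_tensor A B a b) \<in> hom A (tensor A B)"
proof (rule homI)
  fix a a' assume a: "a \<in> carrier A" "a' \<in> carrier A"
  have "frag_of (a \<otimes>\<^bsub>A\<^esub> a', b) - frag_of (a, b) - frag_of (a', b) \<in> tensor_kernel A B"
    unfolding tensor_kernel_def bilinear_relations_def using a b by (blast intro: generate.incl)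
  then have "tclass (frag_of (a \<otimes>\<^bsub>A\<^esub> a', b)) = tclass (frag_of (a, b) + frag_of (a', b))"
    using a b by (intro tclass_eq keys_addI) (simp_all add: diff_diff_eq)
  then show "pure_tensor A B (a \<otimes>\<^bsub>A\<^esub> a') b = pure_tensor A B a b \<otimes>\<^bsub>tensor A B\<^esub> pure_tensor A B a' b"
    using a b by (simp add: pure_tensor_eq free_hom_add[OF tclass_hom])
qed (use b in \<open>simp add: pure_tensor_closed\<close>)

lemma pure_tensor_right:
  assumes a: "a \<in> carrier A" shows "pure_tensor A B a \<in> hom B (tensor A B)"
proof (rule homI)
  fix b b' assume b: "b \<in> carrier B" "b' \<in> carrier B"
  have "frag_of (a, b \<otimes>\<^bsub>B\<^esub> b') - frag_of (a, b) - frag_of (a, b') \<in> tensor_kernel A B"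
    unfolding tensor_kernel_def bilinear_relations_def using a b by (blast intro: generate.incl)
  then have "tclass (frag_of (a, b \<otimes>\<^bsub>B\<^esub> b')) = tclass (frag_of (a, b) + frag_of (a, b'))"
    using a b by (intro tclass_eq keys_addI) (simp_all add: diff_diff_eq)
  then show "pure_tensor A B a (b \<otimes>\<^bsub>B\<^esub> b') = pure_tensor A B a b \<otimes>\<^bsub>tensor A B\<^esub> pure_tensor A B a b'"
    using a b by (simp add: pure_tensor_eq free_hom_add[OF tclass_hom])
qed (use a in \<open>simp add: pure_tensor_closed\<close>)

lemma tensor_hom_eqI:
  assumes H: "group H" and f: "f \<in> hom (tensor A B) H" and g: "g \<in> hom (tensor A B) H"
    and eq: "\<And>a b. a \<in> carrier A \<Longrightarrow> b \<in> carrier B \<Longrightarrow> f (pure_tensor A B a b) = g (pure_tensor A B a b)"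
    and X: "X \<in> carrier (tensor A B)"
  shows "f X = g X"
proof -
  obtain c where c: "X = tclass c" "Poly_Mapping.keys c \<subseteq> carrier A \<times> carrier B" using X by (auto simp: carrier_tensor)
  have "(f \<circ> tclass) c = (g \<circ> tclass) c"
    by (rule free_hom_eqI[OF H hom_compose[OF tclass_hom f] hom_compose[OF tclass_hom g] _ c(2)])
      (use eq in \<open>auto simp: pure_tensor_eq[symmetric]\<close>)
  then show ?thesis using c by simp
qed

lemma
  assumes H: "comm_group H"
    and left: "\<And>b. b \<in> carrier B \<Longrightarrow> (\<lambda>a. \<phi> a b) \<in> hom A H" and right: "\<And>a. a \<in> carrier A \<Longrightarrow> \<phi> a \<in> hom B H"
  shows tensor_lift_hom: "tensor_lift H \<phi> \<in> hom (tensor A B) H"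
    and tensor_lift_pure: "\<And>a b. a \<in> carrier A \<Longrightarrow> b \<in> carrier B \<Longrightarrow> tensor_lift H \<phi> (pure_tensor A B a b) = \<phi> a b"
proof -
  interpret H: comm_group H by fact
  let ?f = "free_extend H (\<lambda>(a, b). \<phi> a b)"
  have cl: "\<phi> a b \<in> carrier H" if "a \<in> carrier A" "b \<in> carrier B" for a b
    using hom_in_carrier[OF right[OF that(1)] that(2)] .
  have f: "?f \<in> hom FT H" by (rule free_extend_hom[OF H]) (use cl in auto)
  have f_of: "?f (frag_of (a, b)) = \<phi> a b" if "a \<in> carrier A" "b \<in> carrier B" for a b
    using free_extend_of[OF H, of "\<lambda>(a, b). \<phi> a b" "(a, b)"] cl that by simp
  have ker: "?f x = \<one>\<^bsub>H\<^esub>" if "x \<in> tensor_kernel A B" for x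
  proof (rule FT.hom_generate_one[OF H.is_group f bilinear_relations_closed _ that[unfolded tensor_kernel_def]])
    fix r assume "r \<in> bilinear_relations A B"
    then consider a a' b where "a \<in> carrier A" "a' \<in> carrier A" "b \<in> carrier B"
        "r = frag_of (a \<otimes>\<^bsub>A\<^esub> a', b) - frag_of (a, b) - frag_of (a', b)"
      | a b b' where "a \<in> carrier A" "b \<in> carrier B" "b' \<in> carrier B"
        "r = frag_of (a, b \<otimes>\<^bsub>B\<^esub> b') - frag_of (a, b) - frag_of (a, b')"
      unfolding bilinear_relations_def by blast
    then show "?f r = \<one>\<^bsub>H\<^esub>"
    proof cases
      case 1
      then have "?f r = \<phi> (a \<otimes>\<^bsub>A\<^esub> a') b \<otimes>\<^bsub>H\<^esub> inv\<^bsub>H\<^esub> \<phi> a b \<otimes>\<^bsub>H\<^esub> inv\<^bsub>H\<^esub> \<phi> a' b"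
        by (simp add: free_hom_diff[OF H.is_group f] keys_diffI f_of)
      also have "\<phi> (a \<otimes>\<^bsub>A\<^esub> a') b = \<phi> a' b \<otimes>\<^bsub>H\<^esub> \<phi> a b" using 1 hom_mult[OF left] cl by (simp add: H.m_comm)
      finally show ?thesis using 1 cl by (simp add: H.m_assoc)
    next
      case 2
      then have "?f r = \<phi> a (b \<otimes>\<^bsub>B\<^esub> b') \<otimes>\<^bsub>H\<^esub> inv\<^bsub>H\<^esub> \<phi> a b \<otimes>\<^bsub>H\<^esub> inv\<^bsub>H\<^esub> \<phi> a b'"
        by (simp add: free_hom_diff[OF H.is_group f] keys_diffI f_of)
      also have "\<phi> a (b \<otimes>\<^bsub>B\<^esub> b') = \<phi> a b' \<otimes>\<^bsub>H\<^esub> \<phi> a b" using 2 hom_mult[OF right] cl by (simp add: H.m_comm)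
      finally show ?thesis using 2 cl by (simp add: H.m_assoc)
    qed
  qed
  show "tensor_lift H \<phi> \<in> hom (tensor A B) H"
    unfolding tensor_lift_def tensor_def
    by (rule FT.quot_lift_hom[OF H.is_group f FT.subgroup_normal[OF subgroup_tensor_kernel] ker])
  show "tensor_lift H \<phi> (pure_tensor A B a b) = \<phi> a b" if "a \<in> carrier A" "b \<in> carrier B" for a b
    unfolding tensor_lift_def pure_tensor_def
    using FT.quot_lift_rcos[OF H.is_group f subgroup_tensor_kernel ker, of "frag_of (a, b)"] that f_of by simp
qed

end

lemma
  assumes "comm_group A" "comm_group B" "comm_group A'" "comm_group B'" and f: "f \<in> hom A A'" and g: "g \<in> hom B B'"
  shows tensor_map_hom: "tensor_map A' B' f g \<in> hom (tensor A B) (tensor A' B')"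
    and tensor_map_pure: "\<And>a b. a \<in> carrier A \<Longrightarrow> b \<in> carrier B \<Longrightarrow>
      tensor_map A' B' f g (pure_tensor A B a b) = pure_tensor A' B' (f a) (g b)"
proof -
  interpret S: tensor_groups A B using assms by (simp add: tensor_groups_def)
  interpret S': tensor_groups A' B' using assms by (simp add: tensor_groups_def)
  have l: "(\<lambda>a. pure_tensor A' B' (f a) (g b)) \<in> hom A (tensor A' B')" if "b \<in> carrier B" for b
    using hom_compose[OF f S'.pure_tensor_left[OF hom_in_carrier[OF g that]]] by (simp add: o_def)
  have r: "(\<lambda>b. pure_tensor A' B' (f a) (g b)) \<in> hom B (tensor A' B')" if "a \<in> carrier A" for a
    using hom_compose[OF g S'.pure_tensor_right[OF hom_in_carrier[OF f that]]] by (simp add: o_def)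
  show "tensor_map A' B' f g \<in> hom (tensor A B) (tensor A' B')"
    unfolding tensor_map_def by (rule S.tensor_lift_hom[OF S'.T.comm_group_axioms l r])
  show "tensor_map A' B' f g (pure_tensor A B a b) = pure_tensor A' B' (f a) (g b)"
    if "a \<in> carrier A" "b \<in> carrier B" for a b
    unfolding tensor_map_def by (rule S.tensor_lift_pure[OF S'.T.comm_group_axioms l r that])
qed

lemma (in comm_group) gfinprod_reindex:
  assumes "inj_on g A" "\<And>x. x \<in> A \<Longrightarrow> f (g x) \<in> carrier G"
  shows "gfinprod G f (g ` A) = gfinprod G (\<lambda>x. f (g x)) A"
proof -
  have "{y \<in> g ` A. f y \<noteq> \<one>} = g ` {x \<in> A. f (g x) \<noteq> \<one>}" by auto
  moreover have inj: "inj_on g {x \<in> A. f (g x) \<noteq> \<one>}" by (rule inj_on_subset[OF assms(1)]) auto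
  ultimately show ?thesis
    using assms(2) by (simp add: gfinprod_def finite_image_iff[OF inj]) (intro impI finprod_reindex; auto)
qed

lemma abelianization_facts:
  assumes "group Q"
  shows "comm_group (abelianization Q)"
    and "carrier (abelianization Q) = (\<lambda>x. derived Q (carrier Q) #>\<^bsub>Q\<^esub> x) ` carrier Q"
    and "(\<lambda>x. derived Q (carrier Q) #>\<^bsub>Q\<^esub> x) \<in> hom Q (abelianization Q)"
proof -
  interpret Q: group Q by fact
  show "comm_group (abelianization Q)" unfolding abelianization_def by (rule Q.derived_quot_is_comm_group)
  show "carrier (abelianization Q) = (\<lambda>x. derived Q (carrier Q) #>\<^bsub>Q\<^esub> x) ` carrier Q"
    by (simp add: abelianization_def carrier_Mod)
  show "(\<lambda>x. derived Q (carrier Q) #>\<^bsub>Q\<^esub> x) \<in> hom Q (abelianization Q)"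
    unfolding abelianization_def by (rule Q.rcos_hom_Mod[OF Q.derived_self_is_normal])
qed

lemma hom_derived_one:
  assumes Q: "group Q" and H: "comm_group H" and f: "f \<in> hom Q H" and d: "d \<in> derived Q (carrier Q)"
  shows "f d = \<one>\<^bsub>H\<^esub>"
proof -
  interpret Q: group Q by fact
  interpret H: comm_group H by fact
  interpret f: group_hom Q H f using f by (simp add: group_hom_def group_hom_axioms_def Q H.is_group)
  have "f ` derived Q (carrier Q) = derived H (f ` carrier Q)" by (rule f.derived_img[symmetric]) simp
  also have "\<dots> \<subseteq> derived H (carrier H)" by (rule H.mono_derived) (use f.hom_closed in auto)
  also have "\<dots> = {\<one>\<^bsub>H\<^esub>}" by (rule H.derived_eq_singleton) simp
  finally show ?thesis using d by blast
qed

section \<open>The first homology with trivial coefficients\<close>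

locale trivial_coefficients = Q: group Q + N: comm_group N for Q :: "'q monoid" and N :: "'n monoid"
begin

abbreviation "Qab \<equiv> abelianization Q"
abbreviation "ab x \<equiv> derived Q (carrier Q) #>\<^bsub>Q\<^esub> x"

sublocale M: group_module Q N trivial_act by (rule group_module_trivial[OF Q.is_group N.comm_group_axioms])

sublocale T: tensor_groups Qab N
  using abelianization_facts(1)[OF Q.is_group] by (simp add: tensor_groups_def N.comm_group_axioms)

lemma ab_hom: "(\<lambda>x. ab x) \<in> hom Q Qab"
  by (rule abelianization_facts(3)[OF Q.is_group])

lemma ab_closed: "x \<in> carrier Q \<Longrightarrow> ab x \<in> carrier Qab"
  using hom_in_carrier[OF ab_hom] by simp

text \<open>
  The map \<open>n [x] \<mapsto> x \<otimes> n\<close> on chains. It vanishes on the boundary of \<open>n [x|y]\<close> as \<open>x \<mapsto> x \<otimes> n\<close> is a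
  homomorphism.
\<close>

definition H1_value :: "('q list \<Rightarrow> 'n) \<Rightarrow> (('q set \<times> 'n) \<Rightarrow>\<^sub>0 int) set" where
  "H1_value c = gfinprod (tensor Qab N) (\<lambda>x. pure_tensor Qab N (ab x) (c [x])) (carrier Q)"

lemma H1_value_eq:
  assumes "c \<in> carrier (bar_group Q N 1)"
  shows "H1_value c = gfinprod (tensor Qab N) (\<lambda>xs. pure_tensor Qab N (ab (hd xs)) (c xs)) (cube Q 1)"
proof -
  have cube: "cube Q 1 = (\<lambda>x. [x]) ` carrier Q"
  proof
    show "cube Q 1 \<subseteq> (\<lambda>x. [x]) ` carrier Q"
    proof
      fix xs assume "xs \<in> cube Q 1"
      then show "xs \<in> (\<lambda>x. [x]) ` carrier Q" by (rule cube_1E) simp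
    qed
  qed auto
  have cl: "c [x] \<in> carrier N" if "x \<in> carrier Q" for x using assms that by (simp add: bar_carrier_iff)
  show ?thesis
    unfolding cube H1_value_def
    using T.T.gfinprod_reindex[of "\<lambda>x. [x]" "carrier Q" "\<lambda>xs. pure_tensor Qab N (ab (hd xs)) (c xs)"] cl
    by (simp add: inj_on_def T.pure_tensor_closed ab_closed)
qed

lemma H1_value_aux: "xs \<in> cube Q 1 \<Longrightarrow> (\<lambda>a. pure_tensor Qab N (ab (hd xs)) a) \<in> hom N (tensor Qab N)"
  by (elim cube_1E) (simp add: T.pure_tensor_right ab_closed)

lemma H1_value_hom: "H1_value \<in> hom (bar_group Q N 1) (tensor Qab N)"
proof -
  have h: "(\<lambda>c. gfinprod (tensor Qab N) (\<lambda>xs. pure_tensor Qab N (ab (hd xs)) (c xs)) (cube Q 1))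
      \<in> hom (bar_group Q N 1) (tensor Qab N)" (is "?g \<in> _")
    by (rule bar_extend_hom[OF N.is_group T.T.comm_group_axioms H1_value_aux])
  interpret B: comm_group "bar_group Q N 1" by (rule M.comm_group_bar)
  show ?thesis
  proof (rule homI)
    fix c assume "c \<in> carrier (bar_group Q N 1)"
    then show "H1_value c \<in> carrier (tensor Qab N)" using hom_in_carrier[OF h] by (subst H1_value_eq)
  next
    fix c d assume cd: "c \<in> carrier (bar_group Q N 1)" "d \<in> carrier (bar_group Q N 1)"
    show "H1_value (c \<otimes>\<^bsub>bar_group Q N 1\<^esub> d) = H1_value c \<otimes>\<^bsub>tensor Qab N\<^esub> H1_value d"
      unfolding H1_value_eq[OF cd(1)] H1_value_eq[OF cd(2)] H1_value_eq[OF B.m_closed[OF cd]] by (rule hom_mult[OF h cd])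
  qed
qed

lemma H1_value_single:
  assumes "a \<in> carrier N" "x \<in> carrier Q"
  shows "H1_value (bar_single Q N 1 a [x]) = pure_tensor Qab N (ab x) a"
proof -
  have "H1_value (bar_single Q N 1 a [x]) = pure_tensor Qab N (ab (hd [x])) a"
    unfolding H1_value_eq[OF bar_single_closed[OF N.is_group assms(1)]]
    by (rule bar_extend_single[OF N.is_group T.T.comm_group_axioms H1_value_aux]) (use assms in auto)
  then show ?thesis by simp
qed

lemma H1_value_boundaries:
  assumes "b \<in> boundaries Q N trivial_act 1" shows "H1_value b = \<one>\<^bsub>tensor Qab N\<^esub>"
proof -
  interpret B: comm_group "bar_group Q N 1" by (rule M.comm_group_bar)
  interpret h: group_hom "bar_group Q N 1" "tensor Qab N" H1_value
    using H1_value_hom M.comm_group_bar by (simp add: group_hom_def group_hom_axioms_def comm_group.axioms(2) T.T.is_group)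
  obtain u where u: "u \<in> carrier (bar_group Q N 2)" "b = bar_boundary Q N trivial_act 1 u"
    using assms by (auto simp: boundaries_def numeral_2_eq_2)
  have bh: "bar_boundary Q N trivial_act 1 \<in> hom (bar_group Q N 2) (bar_group Q N 1)"
    using M.boundary_hom[of 1] by (simp add: numeral_2_eq_2)
  have "(H1_value \<circ> bar_boundary Q N trivial_act 1) u = (\<lambda>_. \<one>\<^bsub>tensor Qab N\<^esub>) u"
  proof (rule bar_hom_eqI[OF N.comm_group_axioms T.T.is_group hom_compose[OF bh H1_value_hom] _ _ u(1)])
    fix a xs assume a: "a \<in> carrier N" and "xs \<in> cube Q 2"
    then obtain x y where xy: "xs = [x, y]" "x \<in> carrier Q" "y \<in> carrier Q" by (metis cube_2E)
    let ?p = "\<lambda>x. pure_tensor Qab N (ab x) a"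
    have p: "?p x \<in> carrier (tensor Qab N)" if "x \<in> carrier Q" for x
      using that a by (simp add: T.pure_tensor_closed ab_closed)
    have pm: "?p (x \<otimes>\<^bsub>Q\<^esub> y) = ?p x \<otimes>\<^bsub>tensor Qab N\<^esub> ?p y"
      using xy hom_mult[OF T.pure_tensor_left[OF a] ab_closed ab_closed] hom_mult[OF ab_hom, of x y] by simp
    let ?S = "\<lambda>x. bar_single Q N 1 a [x]"
    have S: "?S x \<in> carrier (bar_group Q N 1)" for x by (rule bar_single_closed[OF N.is_group a])
    note ch = chain_of_hom[OF N.comm_group_axioms a, of Q 1 UNIV]
    have "bar_boundary Q N trivial_act 1 (bar_single Q N 2 a xs) = ?S y \<otimes>\<^bsub>bar_group Q N 1\<^esub> chain_of Q N 1 a (frag_of [x] - frag_of [x \<otimes>\<^bsub>Q\<^esub> y])"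
      using M.boundary_single[OF a, of x "[y]" 1] xy
      by (simp add: numeral_2_eq_2 trivial_act_def frag_extend_minus)
    also have "chain_of Q N 1 a (frag_of [x] - frag_of [x \<otimes>\<^bsub>Q\<^esub> y]) = ?S x \<otimes>\<^bsub>bar_group Q N 1\<^esub> inv\<^bsub>bar_group Q N 1\<^esub> ?S (x \<otimes>\<^bsub>Q\<^esub> y)"
      unfolding bar_single_eq_chain_of[OF N.is_group a] by (rule free_hom_diff[OF comm_group.axioms(2)[OF M.comm_group_bar] ch]) auto
    finally have "H1_value (bar_boundary Q N trivial_act 1 (bar_single Q N 2 a xs))
        = ?p y \<otimes>\<^bsub>tensor Qab N\<^esub> (?p x \<otimes>\<^bsub>tensor Qab N\<^esub> inv\<^bsub>tensor Qab N\<^esub> ?p (x \<otimes>\<^bsub>Q\<^esub> y))"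
      using S xy a by (simp only: h.hom_mult h.hom_inv B.m_closed B.inv_closed H1_value_single Q.m_closed)
    also have "\<dots> = (?p x \<otimes>\<^bsub>tensor Qab N\<^esub> ?p y) \<otimes>\<^bsub>tensor Qab N\<^esub> inv\<^bsub>tensor Qab N\<^esub> ?p (x \<otimes>\<^bsub>Q\<^esub> y)"
      using p xy by (simp only: T.T.m_ac T.T.inv_closed T.T.m_closed Q.m_closed)
    also have "\<dots> = \<one>\<^bsub>tensor Qab N\<^esub>"
      unfolding pm[symmetric] using p xy by simp
    finally show "(H1_value \<circ> bar_boundary Q N trivial_act 1) (bar_single Q N 2 a xs) = \<one>\<^bsub>tensor Qab N\<^esub>" by simp
  qed (auto intro!: homI)
  then show ?thesis using u by simp
qed

lemma H1_trivial_eq: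
  assumes c: "c \<in> carrier (bar_group Q N 1)" and Y: "Y \<noteq> {}" "Y \<subseteq> boundaries Q N trivial_act 1 #>\<^bsub>bar_group Q N 1\<^esub> c"
  shows "H1_trivial Q N Y = H1_value c"
  unfolding H1_trivial_def H1_value_def[abs_def, symmetric]
proof (rule quot_lift_eq[OF Y(1)])
  fix x assume "x \<in> Y"
  then obtain b where b: "b \<in> boundaries Q N trivial_act 1" "x = b \<otimes>\<^bsub>bar_group Q N 1\<^esub> c"
    using Y(2) by (auto simp: r_coset_def)
  have "b \<in> carrier (bar_group Q N 1)" using b subgroup.mem_carrier[OF M.subgroup_boundaries] by blast
  then show "H1_value x = H1_value c"
    using b c hom_mult[OF H1_value_hom] H1_value_boundaries hom_in_carrier[OF H1_value_hom c] by simp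
qed

lemma H0_trivial_eq:
  assumes c: "c \<in> carrier (bar_group Q N 0)" and Y: "Y \<noteq> {}" "Y \<subseteq> boundaries Q N trivial_act 0 #>\<^bsub>bar_group Q N 0\<^esub> c"
  shows "H0_trivial Y = c []"
  unfolding H0_trivial_def
proof (rule quot_lift_eq[OF Y(1)])
  interpret B: comm_group "bar_group Q N 0" by (rule M.comm_group_bar)
  have ev: "(\<lambda>c. c []) \<in> hom (bar_group Q N 0) N"
    by (rule homI) (auto simp: bar_carrier_iff bar_mult)
  fix x assume "x \<in> Y"
  then obtain b where b: "b \<in> boundaries Q N trivial_act 0" "x = b \<otimes>\<^bsub>bar_group Q N 0\<^esub> c"
    using Y(2) by (auto simp: r_coset_def)
  then obtain u where u: "u \<in> carrier (bar_group Q N (Suc 0))" "b = bar_boundary Q N trivial_act 0 u"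
    by (auto simp: boundaries_def)
  have "((\<lambda>c. c []) \<circ> bar_boundary Q N trivial_act 0) u = (\<lambda>_. \<one>\<^bsub>N\<^esub>) u"
  proof (rule bar_hom_eqI[OF N.comm_group_axioms N.is_group hom_compose[OF M.boundary_hom ev] _ _ u(1)])
    fix a xs assume a: "a \<in> carrier N" and "xs \<in> cube Q (Suc 0)"
    then obtain x where x: "xs = [x]" "x \<in> carrier Q" using cube_1E[of xs Q] by auto
    have "a [^]\<^bsub>N\<^esub> (- 1 :: int) = inv\<^bsub>N\<^esub> a" using a by (simp add: N.int_pow_neg)
    then show "((\<lambda>c. c []) \<circ> bar_boundary Q N trivial_act 0) (bar_single Q N (Suc 0) a xs) = \<one>\<^bsub>N\<^esub>"
      using M.boundary_single[OF a x(2), of "[]" 0] a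
      by (simp add: x trivial_act_def bar_mult bar_single_def chain_of_def)
  qed (auto intro!: homI)
  then have "b [] = \<one>\<^bsub>N\<^esub>" using u by simp
  then show "x [] = c []" using b c by (simp add: bar_mult bar_carrier_iff)
qed

end


section \<open>Infinite cyclic groups\<close>

locale infinite_cyclic_group =
  fixes C :: "'c monoid" and t :: 'c
  assumes infinite_cyclic: "infinite_cyclic C t"
begin

sublocale group C
  using infinite_cyclic by (simp add: infinite_cyclic_def)

lemma t [simp]: "t \<in> carrier C"
  using infinite_cyclic by (simp add: infinite_cyclic_def)

lemma carrier_eq: "carrier C = {t [^]\<^bsub>C\<^esub> (k :: int) | k. k \<in> UNIV}"
  using infinite_cyclic generate_pow[OF t] by (simp add: infinite_cyclic_def)

sublocale comm_group C
proof (rule group_comm_groupI)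
  fix x y assume "x \<in> carrier C" "y \<in> carrier C"
  then obtain k l :: int where "x = t [^]\<^bsub>C\<^esub> k" "y = t [^]\<^bsub>C\<^esub> l" by (auto simp: carrier_eq)
  then show "x \<otimes>\<^bsub>C\<^esub> y = y \<otimes>\<^bsub>C\<^esub> x" by (simp add: int_pow_mult[symmetric] add.commute)
qed

abbreviation "clog \<equiv> cyclic_log C t"

lemma pow_inject: "t [^]\<^bsub>C\<^esub> (k :: int) = t [^]\<^bsub>C\<^esub> (l :: int) \<longleftrightarrow> k = l"
proof -
  have "infinite (carrier (subgroup_generated C {t}))"
    using infinite_cyclic by (simp add: infinite_cyclic_def carrier_subgroup_generated)
  then show ?thesis using infinite_cyclic_subgroup_int[OF t] by blast
qed

lemma log_pow [simp]: "clog (t [^]\<^bsub>C\<^esub> (k :: int)) = k"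
  unfolding cyclic_log_def by (rule the_equality) (simp_all add: pow_inject)

lemma pow_log [simp]: "c \<in> carrier C \<Longrightarrow> t [^]\<^bsub>C\<^esub> clog c = c"
  by (auto simp: carrier_eq)

lemma log_mult [simp]:
  assumes "c \<in> carrier C" "d \<in> carrier C" shows "clog (c \<otimes>\<^bsub>C\<^esub> d) = clog c + clog d"
proof -
  have "c \<otimes>\<^bsub>C\<^esub> d = t [^]\<^bsub>C\<^esub> (clog c + clog d)" using assms by (simp add: int_pow_mult)
  then show ?thesis by simp
qed

lemma log_one [simp]: "clog \<one>\<^bsub>C\<^esub> = 0"
  using log_pow[of 0] by simp

lemma
  fixes X :: "'g monoid" and N :: "'n monoid"
  assumes "group X" "comm_group N" and \<gamma>: "\<gamma> \<in> hom X C"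
  shows tensor_proj_hom: "tensor_proj C t \<gamma> N \<in> hom (tensor (abelianization X) N) N"
    and tensor_proj_pure: "\<And>x n. x \<in> carrier X \<Longrightarrow> n \<in> carrier N \<Longrightarrow>
      tensor_proj C t \<gamma> N (pure_tensor (abelianization X) N (derived X (carrier X) #>\<^bsub>X\<^esub> x) n) = n [^]\<^bsub>N\<^esub> clog (\<gamma> x)"
proof -
  interpret N: comm_group N by fact
  interpret X: trivial_coefficients X N using assms by (simp add: trivial_coefficients_def)
  interpret CN: tensor_groups C N by (simp add: tensor_groups_def comm_group_axioms N.comm_group_axioms)
  have one: "\<gamma> d = \<one>\<^bsub>C\<^esub>" if "d \<in> derived X (carrier X)" for d
    by (rule hom_derived_one[OF X.Q.is_group comm_group_axioms \<gamma> that])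
  have g: "quot_lift \<gamma> \<in> hom (abelianization X) C"
    unfolding abelianization_def by (rule X.Q.quot_lift_hom[OF is_group \<gamma> X.Q.derived_self_is_normal one])
  have i: "(\<lambda>n. n) \<in> hom N N" by (rule homI) auto
  have l: "(\<lambda>c. n [^]\<^bsub>N\<^esub> clog c) \<in> hom C N" if "n \<in> carrier N" for n
    by (rule homI) (use that in \<open>auto simp: N.int_pow_mult\<close>)
  have r: "(\<lambda>n. n [^]\<^bsub>N\<^esub> clog c) \<in> hom N N" for c
    by (rule homI) (auto simp: N.int_pow_distrib)
  note m = tensor_map_hom[OF X.T.A.comm_group_axioms N.comm_group_axioms comm_group_axioms N.comm_group_axioms g i]
  note mp = tensor_map_pure[OF X.T.A.comm_group_axioms N.comm_group_axioms comm_group_axioms N.comm_group_axioms g i]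
  show "tensor_proj C t \<gamma> N \<in> hom (tensor (abelianization X) N) N"
    unfolding tensor_proj_def
    by (rule Group.hom_compose[OF m CN.tensor_lift_hom[OF N.comm_group_axioms l r]])
  fix x n assume x: "x \<in> carrier X" and n: "n \<in> carrier N"
  have "quot_lift \<gamma> (X.ab x) = \<gamma> x"
    by (rule X.Q.quot_lift_rcos[OF is_group \<gamma> normal_imp_subgroup[OF X.Q.derived_self_is_normal] one x])
  then show "tensor_proj C t \<gamma> N (pure_tensor (abelianization X) N (X.ab x) n) = n [^]\<^bsub>N\<^esub> clog (\<gamma> x)"
    unfolding tensor_proj_def
    using mp[OF X.ab_closed[OF x] n] CN.tensor_lift_pure[OF N.comm_group_axioms l r, of "\<gamma> x" n]
      hom_in_carrier[OF \<gamma> x] n by simp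
qed

end

section \<open>The maps \<open>\<beta>\<close> and \<open>\<delta>\<close> on representatives\<close>

context central_relation
begin

lemma shift_twice_int_chain_hom:
  "(\<lambda>c. shift_twice n (int_chain Q (Suc (Suc n)) c)) \<in> hom (free_Abelian_group S) (bar_group Q N n)"
proof -
  have "int_chain Q (Suc (Suc n)) \<in> hom (free_Abelian_group S) (bar_group Q integer_group (Suc (Suc n)))"
    unfolding int_chain_def[abs_def] by (rule chain_of_hom) auto
  from hom_compose[OF this shift_twice_hom] show ?thesis by (simp add: o_def)
qed

lemma shift_twice_int_chain_of:
  assumes "x \<in> carrier Q" "y \<in> carrier Q" "xs \<in> cube Q n"
  shows "shift_twice n (int_chain Q (Suc (Suc n)) (frag_of (x # y # xs))) = bar_single Q N n (cocyc (inv\<^bsub>Q\<^esub> y) (inv\<^bsub>Q\<^esub> x)) xs"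
proof -
  have "int_chain Q (Suc (Suc n)) (frag_of (x # y # xs)) = bar_single Q integer_group (Suc (Suc n)) 1 (x # y # xs)"
    by (simp add: int_chain_def bar_single_eq_chain_of)
  then show ?thesis using shift_twice_single[OF assms, of 1] assms by (simp add: N.int_pow_1)
qed

text \<open>
  The evaluation of the cocycle on integral 2-chains, which is \<open>\<beta>\<close> on cycles. The inverses stem
  from the conversion of left modules into right modules in the bar complex.
\<close>

definition cocyc_val :: "('q list \<Rightarrow>\<^sub>0 int) \<Rightarrow> 'g" where
  "cocyc_val = free_extend N (\<lambda>xs. cocyc (inv\<^bsub>Q\<^esub> (xs ! 1)) (inv\<^bsub>Q\<^esub> (xs ! 0)))"

lemma cocyc_val_hom: "cocyc_val \<in> hom (free_Abelian_group (cube Q 2)) N"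
  unfolding cocyc_val_def
proof (rule free_extend_hom[OF comm_group_N])
  fix xs assume "xs \<in> cube Q 2"
  then show "cocyc (inv\<^bsub>Q\<^esub> (xs ! 1)) (inv\<^bsub>Q\<^esub> (xs ! 0)) \<in> carrier N" by (rule cube_2E) simp
qed

lemma cocyc_val_of:
  "x \<in> carrier Q \<Longrightarrow> y \<in> carrier Q \<Longrightarrow> cocyc_val (frag_of [x, y]) = cocyc (inv\<^bsub>Q\<^esub> y) (inv\<^bsub>Q\<^esub> x)"
  unfolding cocyc_val_def
  using free_extend_of[OF comm_group_N, of "\<lambda>xs. cocyc (inv\<^bsub>Q\<^esub> (xs ! 1)) (inv\<^bsub>Q\<^esub> (xs ! 0))" "[x, y]"] by simp

sublocale tc: trivial_coefficients Q N
  by (simp add: trivial_coefficients_def Q.is_group comm_group_N)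

lemma H0_dimension_shift:
  assumes z: "z \<in> free_cycles Q 2"
  shows "H0_trivial (coeff_homology_map Q N trivial_act (quot_lift p) 0 (dimension_shift E Q (\<pi> \<circ> p) 0 (cls Q 2 z)))
    = cocyc_val z"
proof -
  have two: "Suc (Suc 0) = 2" by simp
  have g: "shift_twice 0 (int_chain Q 2 z) \<in> carrier (bar_group Q N 0)"
    using hom_in_carrier[OF shift_twice_hom[of 0] int_chain_closed] unfolding two .
  note Y = coeff_homology_dimension_shift[of z 0, unfolded two, OF z]
  have "H0_trivial (coeff_homology_map Q N trivial_act (quot_lift p) 0 (dimension_shift E Q (\<pi> \<circ> p) 0 (cls Q 2 z)))
    = shift_twice 0 (int_chain Q 2 z) []"
    by (rule tc.H0_trivial_eq[OF g Y])
  also have "\<dots> = cocyc_val z"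
  proof -
    have ev: "(\<lambda>c. c []) \<in> hom (bar_group Q N 0) N"
      by (rule homI) (auto simp: bar_carrier_iff bar_mult)
    have L: "(\<lambda>c. c []) \<circ> (\<lambda>c. shift_twice 0 (int_chain Q 2 c)) \<in> hom (free_Abelian_group (cube Q 2)) N"
      using hom_compose[OF shift_twice_int_chain_hom[of 0 "cube Q 2", unfolded two] ev] .
    have "((\<lambda>c. c []) \<circ> (\<lambda>c. shift_twice 0 (int_chain Q 2 c))) z = cocyc_val z"
    proof (rule free_hom_eqI[OF N.is_group L cocyc_val_hom])
      fix xs assume "xs \<in> cube Q 2"
      then obtain x y where xy: "xs = [x, y]" "x \<in> carrier Q" "y \<in> carrier Q" by (rule cube_2E)
      then show "((\<lambda>c. c []) \<circ> (\<lambda>c. shift_twice 0 (int_chain Q 2 c))) (frag_of xs) = cocyc_val (frag_of xs)"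
        using shift_twice_int_chain_of[of x y "[]" 0, unfolded two] by (simp add: cocyc_val_of bar_single_def)
    qed (use z in \<open>simp add: free_cycles_def free_chains_def\<close>)
    then show ?thesis by simp
  qed
  finally show ?thesis .
qed

lemma pi_surj: "x \<in> carrier Q \<Longrightarrow> \<exists>g\<in>carrier G. \<pi> g = x"
  by (rule bexI[of _ "sec x"]) auto

text \<open>The evaluation of \<open>c \<union> \<tau>\<close> on integral 3-chains, for a homomorphism \<open>\<tau>\<close> to the integers.\<close>

definition cap_val :: "('q \<Rightarrow> int) \<Rightarrow> ('q list \<Rightarrow>\<^sub>0 int) \<Rightarrow> 'g" where
  "cap_val \<tau> = free_extend N (\<lambda>xs. cocyc (inv\<^bsub>Q\<^esub> (xs ! 1)) (inv\<^bsub>Q\<^esub> (xs ! 0)) [^]\<^bsub>N\<^esub> \<tau> (xs ! 2))"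

lemma cap_val_hom: "cap_val \<tau> \<in> hom (free_Abelian_group (cube Q 3)) N"
  unfolding cap_val_def
proof (rule free_extend_hom[OF comm_group_N])
  fix xs assume "xs \<in> cube Q 3"
  then show "cocyc (inv\<^bsub>Q\<^esub> (xs ! 1)) (inv\<^bsub>Q\<^esub> (xs ! 0)) [^]\<^bsub>N\<^esub> \<tau> (xs ! 2) \<in> carrier N" by (rule cube_3E) simp
qed

lemma cap_val_of:
  assumes "x \<in> carrier Q" "y \<in> carrier Q"
  shows "cap_val \<tau> (frag_of [x, y, w]) = cocyc (inv\<^bsub>Q\<^esub> y) (inv\<^bsub>Q\<^esub> x) [^]\<^bsub>N\<^esub> \<tau> w"
  unfolding cap_val_def
  using free_extend_of[OF comm_group_N, of "\<lambda>xs. cocyc (inv\<^bsub>Q\<^esub> (xs ! 1)) (inv\<^bsub>Q\<^esub> (xs ! 0)) [^]\<^bsub>N\<^esub> \<tau> (xs ! 2)" "[x, y, w]"] assms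
  by (simp add: numeral_2_eq_2)

text \<open>
  The inverse of \<open>G\<^sub>a\<^sub>b \<otimes> N \<rightarrow> Q\<^sub>a\<^sub>b \<otimes> N\<close> in the definition of \<open>\<delta>\<close> disappears, since the projection to \<open>N\<close>
  factors through \<open>Q\<^sub>a\<^sub>b \<otimes> N\<close>.
\<close>

lemma tensor_proj_delta:
  assumes C: "infinite_cyclic C t" and \<gamma>: "\<gamma> \<in> hom Q C" and z: "z \<in> free_cycles Q 3"
  shows "tensor_proj C t (\<lambda>g. \<gamma> (\<pi> g)) N (delta_map E p G Q \<pi> (cls Q 3 z)) = cap_val (\<lambda>w. cyclic_log C t (\<gamma> w)) z"
proof -
  interpret C: infinite_cyclic_group C t by unfold_locales (rule C)
  interpret GN: trivial_coefficients G N by (simp add: trivial_coefficients_def G.is_group comm_group_N)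
  have three: "Suc (Suc 1) = 3" by simp
  let ?Gab = "abelianization G" and ?Qab = "abelianization Q"
  let ?m = "tensor_map ?Qab N (abelianization_map Q \<pi>) (\<lambda>n. n)"
  let ?PG = "tensor_proj C t (\<lambda>g. \<gamma> (\<pi> g)) N" and ?PQ = "tensor_proj C t \<gamma> N"
  have \<gamma>\<pi>: "(\<lambda>g. \<gamma> (\<pi> g)) \<in> hom G C" using hom_compose[OF pi_hom \<gamma>] by (simp add: o_def)
  have img: "\<pi> ` derived G (carrier G) \<subseteq> derived Q (carrier Q)"
  proof -
    have "\<pi> ` derived G (carrier G) = derived Q (\<pi> ` carrier G)" by (rule pi.derived_img[symmetric]) simp
    also have "\<dots> \<subseteq> derived Q (carrier Q)" by (rule Q.mono_derived) (use pi.hom_closed in auto)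
    finally show ?thesis .
  qed
  have ab: "abelianization_map Q \<pi> (GN.ab g) = tc.ab (\<pi> g)" if "g \<in> carrier G" for g
    unfolding abelianization_map_def
    by (rule G.quot_map_rcos[OF Q.is_group pi_hom normal_imp_subgroup[OF G.derived_self_is_normal]
        normal_imp_subgroup[OF Q.derived_self_is_normal] img that])
  have abh: "abelianization_map Q \<pi> \<in> hom ?Gab ?Qab"
  proof (rule homI)
    fix X assume "X \<in> carrier ?Gab"
    then show "abelianization_map Q \<pi> X \<in> carrier ?Qab"
      using abelianization_facts(2)[OF G.is_group] ab tc.ab_closed by auto
  next
    fix X Y assume "X \<in> carrier ?Gab" "Y \<in> carrier ?Gab"
    then obtain g h where gh: "g \<in> carrier G" "h \<in> carrier G" "X = GN.ab g" "Y = GN.ab h"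
      using abelianization_facts(2)[OF G.is_group] by auto
    then show "abelianization_map Q \<pi> (X \<otimes>\<^bsub>?Gab\<^esub> Y) = abelianization_map Q \<pi> X \<otimes>\<^bsub>?Qab\<^esub> abelianization_map Q \<pi> Y"
      using hom_mult[OF GN.ab_hom, of g h] hom_mult[OF tc.ab_hom, of "\<pi> g" "\<pi> h"] ab[of "g \<otimes>\<^bsub>G\<^esub> h"] ab by simp
  qed
  have i: "(\<lambda>n. n) \<in> hom N N" by (rule homI) auto
  note m = tensor_map_hom[OF GN.T.A.comm_group_axioms comm_group_N tc.T.A.comm_group_axioms comm_group_N abh i]
  note mp = tensor_map_pure[OF GN.T.A.comm_group_axioms comm_group_N tc.T.A.comm_group_axioms comm_group_N abh i]
  note PQ = C.tensor_proj_hom[OF Q.is_group comm_group_N \<gamma>] and PG = C.tensor_proj_hom[OF G.is_group comm_group_N \<gamma>\<pi>]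
  note PQp = C.tensor_proj_pure[OF Q.is_group comm_group_N \<gamma>] and PGp = C.tensor_proj_pure[OF G.is_group comm_group_N \<gamma>\<pi>]
  have factor: "?PG X = ?PQ (?m X)" if X: "X \<in> carrier (tensor ?Gab N)" for X
  proof -
    have "?PG X = (?PQ \<circ> ?m) X"
    proof (rule GN.T.tensor_hom_eqI[OF N.is_group PG hom_compose[OF m PQ] _ X])
      fix A n assume "A \<in> carrier ?Gab" and n: "n \<in> carrier N"
      then obtain g where g: "A = GN.ab g" "g \<in> carrier G" using abelianization_facts(2)[OF G.is_group] by auto
      show "?PG (pure_tensor ?Gab N A n) = (?PQ \<circ> ?m) (pure_tensor ?Gab N A n)"
        using g n mp[OF GN.ab_closed[OF g(2)] n] PGp[OF g(2) n] PQp[of "\<pi> g" n] ab[OF g(2)] by simp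
    qed
    then show ?thesis by simp
  qed
  have surj: "Y \<in> ?m ` carrier (tensor ?Gab N)" if Y: "Y \<in> carrier (tensor ?Qab N)" for Y
  proof -
    obtain c where c: "Y = tc.T.tclass c" "Poly_Mapping.keys c \<subseteq> carrier ?Qab \<times> carrier N"
      using Y by (auto simp: tc.T.carrier_tensor)
    interpret m: group_hom "tensor ?Gab N" "tensor ?Qab N" ?m
      using m by (simp add: group_hom_def group_hom_axioms_def GN.T.T.is_group tc.T.T.is_group)
    interpret im: subgroup "?m ` carrier (tensor ?Gab N)" "tensor ?Qab N" by (rule m.img_is_subgroup)
    have "tc.T.tclass c \<in> ?m ` carrier (tensor ?Gab N)"
      using c(2)
    proof (rule free_Abelian_group_induct)
      show "tc.T.tclass 0 \<in> ?m ` carrier (tensor ?Gab N)"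
        using free_hom_zero[OF tc.T.T.is_group tc.T.tclass_hom] im.one_closed by simp
    next
      fix x y assume "Poly_Mapping.keys x \<subseteq> carrier ?Qab \<times> carrier N" "Poly_Mapping.keys y \<subseteq> carrier ?Qab \<times> carrier N"
        "tc.T.tclass x \<in> ?m ` carrier (tensor ?Gab N)" "tc.T.tclass y \<in> ?m ` carrier (tensor ?Gab N)"
      then show "tc.T.tclass (x - y) \<in> ?m ` carrier (tensor ?Gab N)"
        by (simp only: free_hom_diff[OF tc.T.T.is_group tc.T.tclass_hom] im.m_closed im.m_inv_closed)
    next
      fix a assume "a \<in> carrier ?Qab \<times> carrier N"
      then obtain x n where a: "a = (tc.ab x, n)" "x \<in> carrier Q" "n \<in> carrier N"
        using abelianization_facts(2)[OF Q.is_group] by auto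
      then obtain g where g: "g \<in> carrier G" "\<pi> g = x" using pi_surj by blast
      have "tc.T.tclass (frag_of a) = ?m (pure_tensor ?Gab N (GN.ab g) n)"
        using mp[OF GN.ab_closed[OF g(1)] a(3)] ab[OF g(1)] g by (simp add: a tc.T.pure_tensor_eq)
      then show "tc.T.tclass (frag_of a) \<in> ?m ` carrier (tensor ?Gab N)"
        using GN.T.pure_tensor_closed[OF GN.ab_closed[OF g(1)] a(3)] by blast
    qed
    then show ?thesis using c by simp
  qed
  let ?Y = "coeff_homology_map Q N trivial_act (quot_lift p) 1 (dimension_shift E Q (\<pi> \<circ> p) 1 (cls Q 3 z))"
  have g: "shift_twice 1 (int_chain Q 3 z) \<in> carrier (bar_group Q N 1)"
    using hom_in_carrier[OF shift_twice_hom[of 1] int_chain_closed] unfolding three .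
  note Y = coeff_homology_dimension_shift[of z 1, unfolded three, OF z]
  have H: "H1_trivial Q N ?Y = tc.H1_value (shift_twice 1 (int_chain Q 3 z))"
    by (rule tc.H1_trivial_eq[OF g Y])
  have hc: "tc.H1_value (shift_twice 1 (int_chain Q 3 z)) \<in> carrier (tensor ?Qab N)" by (rule hom_in_carrier[OF tc.H1_value_hom g])
  have "delta_map E p G Q \<pi> (cls Q 3 z) = inv_into (carrier (tensor ?Gab N)) ?m (tc.H1_value (shift_twice 1 (int_chain Q 3 z)))"
    by (simp add: delta_map_def H[symmetric] del: One_nat_def)
  then have "?PG (delta_map E p G Q \<pi> (cls Q 3 z)) = ?PQ (tc.H1_value (shift_twice 1 (int_chain Q 3 z)))"
    using factor[OF inv_into_into[OF surj[OF hc]]] f_inv_into_f[OF surj[OF hc]] by simp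
  also have "\<dots> = cap_val (\<lambda>w. cyclic_log C t (\<gamma> w)) z"
  proof -
    have L: "?PQ \<circ> (tc.H1_value \<circ> (\<lambda>c. shift_twice 1 (int_chain Q 3 c))) \<in> hom (free_Abelian_group (cube Q 3)) N"
      by (rule hom_compose[OF hom_compose[OF shift_twice_int_chain_hom[of 1 "cube Q 3", unfolded three] tc.H1_value_hom] PQ])
    have "(?PQ \<circ> (tc.H1_value \<circ> (\<lambda>c. shift_twice 1 (int_chain Q 3 c)))) z = cap_val (\<lambda>w. cyclic_log C t (\<gamma> w)) z"
    proof (rule free_hom_eqI[OF N.is_group L cap_val_hom])
      fix xs assume "xs \<in> cube Q 3"
      then obtain x y w where xs: "xs = [x, y, w]" and Q: "x \<in> carrier Q" "y \<in> carrier Q" "w \<in> carrier Q"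
        by (rule cube_3E)
      have c: "cocyc (inv\<^bsub>Q\<^esub> y) (inv\<^bsub>Q\<^esub> x) \<in> carrier N" using Q by simp
      have "shift_twice 1 (int_chain Q 3 (frag_of xs)) = bar_single Q N 1 (cocyc (inv\<^bsub>Q\<^esub> y) (inv\<^bsub>Q\<^esub> x)) [w]"
        using shift_twice_int_chain_of[of x y "[w]" 1, unfolded three] Q by (simp add: xs)
      then show "(?PQ \<circ> (tc.H1_value \<circ> (\<lambda>c. shift_twice 1 (int_chain Q 3 c)))) (frag_of xs) = cap_val (\<lambda>w. cyclic_log C t (\<gamma> w)) (frag_of xs)"
        using tc.H1_value_single[OF c Q(3)] PQp[OF Q(3) c] cap_val_of[OF Q(1,2)] by (simp add: xs)
    qed (use z in \<open>simp add: free_cycles_def free_chains_def\<close>)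
    then show ?thesis by simp
  qed
  finally show ?thesis .
qed

end

text \<open>The cap product with the class of a homomorphism \<open>\<tau>\<close> to the integers.\<close>

definition cap :: "('q \<Rightarrow> int) \<Rightarrow> ('q list \<Rightarrow>\<^sub>0 int) \<Rightarrow> ('q list \<Rightarrow>\<^sub>0 int)" where
  "cap \<tau> = frag_extend (\<lambda>xs. frag_cmul (\<tau> (last xs)) (frag_of (butlast xs)))"

lemma cap_simps:
  "cap \<tau> (frag_of xs) = frag_cmul (\<tau> (last xs)) (frag_of (butlast xs))"
  "cap \<tau> (a + b) = cap \<tau> a + cap \<tau> b" "cap \<tau> (a - b) = cap \<tau> a - cap \<tau> b" "cap \<tau> 0 = 0"
  by (simp_all add: cap_def frag_extend_add frag_extend_diff)

text \<open>
  Removing the last letter commutes with all faces but the last two of \<open>[x|y|w]\<close>. These contribute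
  \<open>\<tau>(yw) [x] - \<tau>(y) [x] = \<tau>(w) [x]\<close>, which is what the last face of \<open>\<tau>(w) [x|y]\<close> requires.
\<close>

lemma cap_cycle:
  assumes Q: "group Q" and \<tau>: "\<And>x y. x \<in> carrier Q \<Longrightarrow> y \<in> carrier Q \<Longrightarrow> \<tau> (x \<otimes>\<^bsub>Q\<^esub> y) = \<tau> x + \<tau> y"
    and z: "z \<in> free_cycles Q 3"
  shows "cap \<tau> z \<in> free_cycles Q 2"
proof -
  have zk: "Poly_Mapping.keys z \<subseteq> cube Q 3" using z by (simp add: free_cycles_def free_chains_def)
  have "bd Q (cap \<tau> z) = cap \<tau> (bd Q z)"
    using zk
  proof (rule frag_extend_cong_basis)
    fix xs assume "xs \<in> cube Q 3"
    then obtain x y w where xs: "xs = [x, y, w]" and m: "x \<in> carrier Q" "y \<in> carrier Q" "w \<in> carrier Q"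
      by (rule cube_3E)
    then show "bd Q (cap \<tau> (frag_of xs)) = cap \<tau> (bd Q (frag_of xs))"
      by (simp add: bd_2 bd_3 bd_cmul cap_simps \<tau> frag_cmul_distrib frag_cmul_distrib2 frag_cmul_diff_distrib[symmetric]
         algebra_simps frag_extend_diff)
       (simp add: poly_mapping_eq_iff fun_eq_iff lookup_add lookup_minus algebra_simps)
  qed (simp_all add: cap_simps bd_diff)
  moreover have "Poly_Mapping.keys (cap \<tau> z) \<subseteq> cube Q 2"
    unfolding cap_def using zk
  proof (rule keys_extendI)
    fix xs assume "xs \<in> cube Q 3"
    then show "Poly_Mapping.keys (frag_cmul (\<tau> (last xs)) (frag_of (butlast xs))) \<subseteq> cube Q 2"
      by (elim cube_3E) (auto intro!: keys_cmulI)
  qed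
  ultimately show ?thesis using z by (simp add: free_cycles_def free_chains_def cap_simps)
qed

text \<open>On a word \<open>[x|y|w]\<close>, both composites are \<open>\<tau>(w)\<close> times the value of the cocycle on \<open>[x|y]\<close>.\<close>

lemma (in central_relation) beta_cap:
  assumes C: "infinite_cyclic C t" and \<gamma>: "\<gamma> \<in> hom Q C" and z: "z \<in> free_cycles Q 3"
  shows "beta_map G Q \<pi> (cls Q 2 (cap (\<lambda>w. cyclic_log C t (\<gamma> w)) z))
    = tensor_proj C t (\<lambda>g. \<gamma> (\<pi> g)) N (delta_map E p G Q \<pi> (cls Q 3 z))"
proof -
  interpret C: infinite_cyclic_group C t by unfold_locales (rule C)
  let ?\<tau> = "\<lambda>w. cyclic_log C t (\<gamma> w)"
  have \<tau>: "?\<tau> (x \<otimes>\<^bsub>Q\<^esub> y) = ?\<tau> x + ?\<tau> y" if "x \<in> carrier Q" "y \<in> carrier Q" for x y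
    using that hom_mult[OF \<gamma>] hom_in_carrier[OF \<gamma>] by simp
  have cz: "cap ?\<tau> z \<in> free_cycles Q 2" by (rule cap_cycle[OF Q.is_group \<tau> z])
  \<comment> \<open>The identity of \<open>G\<close> as presentation, with the section of \<open>\<pi>\<close> induced by \<open>\<sigma>\<close>; the two cocycles agree.\<close>
  interpret b: central_relation G G Q "\<lambda>n. n" \<pi> "\<lambda>q. p (\<sigma> q)"
    by unfold_locales (use central pi_hom in \<open>auto intro!: homI\<close>)
  have bc: "b.cocyc = cocyc" by (simp add: fun_eq_iff b.cocyc_def cocyc_def b.sec_def sec_def)
  have "beta_map G Q \<pi> (cls Q 2 (cap ?\<tau> z)) = b.cocyc_val (cap ?\<tau> z)"
    using b.H0_dimension_shift[OF cz] by (simp add: beta_map_def o_def)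
  also have "b.cocyc_val = cocyc_val" by (simp add: b.cocyc_val_def cocyc_val_def bc)
  also have "cocyc_val (cap ?\<tau> z) = cap_val ?\<tau> z"
  proof -
    have "cap ?\<tau> \<in> hom (free_Abelian_group (cube Q 3)) (free_Abelian_group (cube Q 2))"
      unfolding cap_def
    proof (rule frag_extend_hom)
      fix xs assume "xs \<in> cube Q 3"
      then show "Poly_Mapping.keys (frag_cmul (?\<tau> (last xs)) (frag_of (butlast xs))) \<subseteq> cube Q 2"
        by (elim cube_3E) (auto intro!: keys_cmulI)
    qed
    then have L: "cocyc_val \<circ> cap ?\<tau> \<in> hom (free_Abelian_group (cube Q 3)) N" by (rule hom_compose[OF _ cocyc_val_hom])
    have "(cocyc_val \<circ> cap ?\<tau>) z = cap_val ?\<tau> z"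
    proof (rule free_hom_eqI[OF N.is_group L cap_val_hom])
      fix xs assume "xs \<in> cube Q 3"
      then obtain x y w where xs: "xs = [x, y, w]" and m: "x \<in> carrier Q" "y \<in> carrier Q" "w \<in> carrier Q"
        by (rule cube_3E)
      then show "(cocyc_val \<circ> cap ?\<tau>) (frag_of xs) = cap_val ?\<tau> (frag_of xs)"
        by (simp add: cap_simps cap_val_of free_hom_cmul[OF N.is_group cocyc_val_hom] cocyc_val_of)
    qed (use z in \<open>simp add: free_cycles_def free_chains_def\<close>)
    then show ?thesis by simp
  qed
  also have "\<dots> = tensor_proj C t (\<lambda>g. \<gamma> (\<pi> g)) N (delta_map E p G Q \<pi> (cls Q 3 z))"
    by (rule tensor_proj_delta[OF C \<gamma> z, symmetric])
  finally show ?thesis .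
qed


section \<open>Signed sums over intervals of integers\<close>

text \<open>The sum of \<open>f\<close> over \<open>1, \<dots>, k\<close>, continued to negative \<open>k\<close> so that it is additive in \<open>k\<close>.\<close>

definition ssum :: "int \<Rightarrow> (int \<Rightarrow> 'a :: ab_group_add) \<Rightarrow> 'a" where
  "ssum k f = sum f {1..k} - sum f {k+1..0}"

lemma ssum_0 [simp]: "ssum 0 f = 0"
  by (simp add: ssum_def)

lemma ssum_step: "ssum (k + 1) f = ssum k f + f (k + 1)"
proof (cases "k \<ge> 0")
  case True
  then have "{1..k + 1} = insert (k + 1) {1..k}" "k + 1 \<notin> {1..k}" by auto
  then show ?thesis using True by (simp add: ssum_def add.commute)
next
  case False
  then have "{k + 1..0} = insert (k + 1) {k + 1 + 1..0}" "k + 1 \<notin> {k + 1 + 1..0}" by auto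
  then show ?thesis using False by (simp add: ssum_def)
qed

lemma ssum_add: "ssum (k + l) f = ssum k f + ssum l (\<lambda>j. f (j + k))"
proof (induction l rule: int_induct[where k = 0])
  case (step1 i)
  then show ?case
    using ssum_step[of "k + i" f] ssum_step[of i "\<lambda>j. f (j + k)"] by (simp add: add_ac)
next
  case (step2 i)
  then show ?case
    using ssum_step[of "k + (i - 1)" f] ssum_step[of "i - 1" "\<lambda>j. f (j + k)"] by (simp add: algebra_simps)
qed simp

lemma ssum_arith:
  "ssum k (\<lambda>j. f j + g j) = ssum k f + ssum k g"
  "ssum k (\<lambda>j. f j - g j) = ssum k f - ssum k g"
  "ssum k (\<lambda>j. - f j) = - ssum k f"
  by (simp_all add: ssum_def sum.distrib sum_subtractf sum_negf)

lemma ssum_additive: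
  assumes "\<And>a b. h (a - b) = h a - h b"
  shows "h (ssum k f) = ssum k (\<lambda>j. h (f j))"
proof -
  have zero: "h 0 = 0" using assms[of 0 0] by simp
  have minus: "h (- a) = - h a" for a using assms[of 0 a] zero by simp
  have add: "h (a + b) = h a + h b" for a b using assms[of a "- b"] minus by simp
  have "h (sum f I) = (\<Sum>j\<in>I. h (f j))" for I
    by (induction I rule: infinite_finite_induct) (simp_all add: zero add)
  then show ?thesis by (simp add: ssum_def assms)
qed

lemma ssum_const: "ssum k (\<lambda>_. a) = frag_cmul k a"
proof (induction k rule: int_induct[where k = 0])
  case (step1 i) then show ?case using ssum_step[of i "\<lambda>_. a"] by (simp add: frag_cmul_distrib)
next
  case (step2 i) then show ?case
    using ssum_step[of "i - 1" "\<lambda>_. a"] by (simp add: frag_cmul_diff_distrib algebra_simps)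
qed simp

text \<open>Both sides are \<open>ssum (n + m) f - ssum n f - ssum m f\<close>, which is symmetric in \<open>m\<close> and \<open>n\<close>.\<close>

lemma ssum_shift: "ssum n (\<lambda>j. f (j + m)) - ssum n f = ssum m (\<lambda>j. f (j + n) - f j)"
  using ssum_add[of n m f] ssum_add[of m n f] by (simp add: ssum_arith add.commute algebra_simps)

lemma ssum_closed:
  assumes "\<And>j. f j \<in> free_chains Q n" shows "ssum k f \<in> free_chains Q n"
proof -
  have "sum f I \<in> free_chains Q n" for I
    by (induction I rule: infinite_finite_induct) (simp_all add: assms free_chains_zero free_chains_add)
  then show ?thesis by (simp add: ssum_def free_chains_diff)
qed

section \<open>Semidirect products with an infinite cyclic group\<close>

lemma (in group_module) group_semidirect_product: "group (semidirect_product A Q act)"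
proof (rule groupI)
  fix x y assume "x \<in> carrier (semidirect_product A Q act)" "y \<in> carrier (semidirect_product A Q act)"
  then show "x \<otimes>\<^bsub>semidirect_product A Q act\<^esub> y \<in> carrier (semidirect_product A Q act)"
    by (auto simp: semidirect_product_def act_closed)
next
  fix x y z assume "x \<in> carrier (semidirect_product A Q act)" "y \<in> carrier (semidirect_product A Q act)"
    "z \<in> carrier (semidirect_product A Q act)"
  then show "x \<otimes>\<^bsub>semidirect_product A Q act\<^esub> y \<otimes>\<^bsub>semidirect_product A Q act\<^esub> z
      = x \<otimes>\<^bsub>semidirect_product A Q act\<^esub> (y \<otimes>\<^bsub>semidirect_product A Q act\<^esub> z)"
    by (auto simp: semidirect_product_def act_closed act_mult hom_mult[OF act_hom] A.m_assoc Q.m_assoc)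
next
  fix x assume x: "x \<in> carrier (semidirect_product A Q act)"
  then obtain a q where aq: "x = (a, q)" "a \<in> carrier A" "q \<in> carrier Q" by (auto simp: semidirect_product_def)
  show "\<one>\<^bsub>semidirect_product A Q act\<^esub> \<otimes>\<^bsub>semidirect_product A Q act\<^esub> x = x"
    using aq by (simp add: semidirect_product_def act_one)
  show "\<exists>y\<in>carrier (semidirect_product A Q act). y \<otimes>\<^bsub>semidirect_product A Q act\<^esub> x = \<one>\<^bsub>semidirect_product A Q act\<^esub>"
    using aq by (intro bexI[of _ "(inv\<^bsub>A\<^esub> (act (inv\<^bsub>Q\<^esub> q) a), inv\<^bsub>Q\<^esub> q)"])
      (simp_all add: semidirect_product_def act_closed)
qed (simp add: semidirect_product_def)

locale cyclic_module =
  cyc: infinite_cyclic_group C t + group_module C M act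
  for C :: "'c monoid" and t :: 'c and M :: "'m monoid" and act :: "'c \<Rightarrow> 'm \<Rightarrow> 'm"
begin

abbreviation "SD \<equiv> semidirect_product M C act"

sublocale SD: group SD by (rule group_semidirect_product)

definition T :: "int \<Rightarrow> 'm \<Rightarrow> 'm" where "T k m = act (t [^]\<^bsub>C\<^esub> k) m"

definition deg :: "'m \<times> 'c \<Rightarrow> int" where "deg x = cyc.clog (snd x)"

lemma T_closed [simp]: "m \<in> carrier M \<Longrightarrow> T k m \<in> carrier M"
  by (simp add: T_def act_closed)

lemma T_mult [simp]: "m \<in> carrier M \<Longrightarrow> n \<in> carrier M \<Longrightarrow> T k (m \<otimes>\<^bsub>M\<^esub> n) = T k m \<otimes>\<^bsub>M\<^esub> T k n"
  using hom_mult[OF act_hom, of "t [^]\<^bsub>C\<^esub> k" m n] by (simp add: T_def)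

lemma T_T [simp]: "m \<in> carrier M \<Longrightarrow> T k (T l m) = T (k + l) m"
  by (simp add: T_def act_mult[symmetric] cyc.int_pow_mult)

lemma T_hom: "T k \<in> hom M M"
  by (rule homI) auto

lemma act_eq_T: "c \<in> carrier C \<Longrightarrow> act c m = T (cyc.clog c) m"
  by (simp add: T_def)

lemma SD_carrier: "x \<in> carrier SD \<longleftrightarrow> fst x \<in> carrier M \<and> snd x \<in> carrier C"
  by (cases x) (simp add: semidirect_product_def)

lemma SD_mult: "x \<in> carrier SD \<Longrightarrow> x \<otimes>\<^bsub>SD\<^esub> y = (fst x \<otimes>\<^bsub>M\<^esub> T (deg x) (fst y), snd x \<otimes>\<^bsub>C\<^esub> snd y)"
  by (cases x; cases y) (simp add: semidirect_product_def T_def deg_def)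

lemma deg_mult [simp]: "x \<in> carrier SD \<Longrightarrow> y \<in> carrier SD \<Longrightarrow> deg (x \<otimes>\<^bsub>SD\<^esub> y) = deg x + deg y"
  by (simp add: SD_mult) (simp add: deg_def SD_carrier)

lemma snd_hom: "snd \<in> hom SD C"
  by (rule homI) (simp_all add: SD_carrier SD_mult)

definition incM :: "'m \<Rightarrow> 'm \<times> 'c" where "incM m = (m, \<one>\<^bsub>C\<^esub>)"
definition incC :: "int \<Rightarrow> 'm \<times> 'c" where "incC k = (\<one>\<^bsub>M\<^esub>, t [^]\<^bsub>C\<^esub> k)"

lemma inc_closed [simp]: "m \<in> carrier M \<Longrightarrow> incM m \<in> carrier SD" "incC k \<in> carrier SD"
  by (simp_all add: incM_def incC_def SD_carrier)

lemma inc_simps [simp]: "fst (incM m) = m" "deg (incM m) = 0" "deg (incC k) = k"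
  by (simp_all add: incM_def incC_def deg_def)

lemma T_0 [simp]: "m \<in> carrier M \<Longrightarrow> T 0 m = m"
  by (simp add: T_def act_one)

lemma T_one [simp]: "T k \<one>\<^bsub>M\<^esub> = \<one>\<^bsub>M\<^esub>"
  using hom_one[OF T_hom group_A group_A] .

lemma incM_mult: "m \<in> carrier M \<Longrightarrow> n \<in> carrier M \<Longrightarrow> incM m \<otimes>\<^bsub>SD\<^esub> incM n = incM (m \<otimes>\<^bsub>M\<^esub> n)"
  by (simp add: SD_mult) (simp add: incM_def)

lemma incM_hom: "incM \<in> hom M SD"
  by (rule homI) (simp_all add: incM_mult)

text \<open>
  Both sides are \<open>(t\<^sup>k m, t\<^sup>k\<^sup>+\<^sup>l)\<close> for \<open>x = (m, t\<^sup>l)\<close>. These are the squares that a prism has over its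
  edges.
\<close>

lemma incC_swap:
  assumes "x \<in> carrier SD" shows "incC k \<otimes>\<^bsub>SD\<^esub> x = incM (T k (fst x)) \<otimes>\<^bsub>SD\<^esub> incC (k + deg x)"
proof -
  have "t [^]\<^bsub>C\<^esub> (k + deg x) = t [^]\<^bsub>C\<^esub> k \<otimes>\<^bsub>C\<^esub> snd x"
    using assms by (simp add: cyc.int_pow_mult deg_def SD_carrier)
  moreover have f: "fst x \<in> carrier M" "snd x \<in> carrier C" using assms by (simp_all add: SD_carrier)
  ultimately show ?thesis
    unfolding SD_mult[OF inc_closed(2)] SD_mult[OF inc_closed(1)[OF T_closed[OF f(1)]]]
    by (simp add: incM_def incC_def deg_def)
qed

subsection \<open>The Wang map\<close>

text \<open>
  A word \<open>[x\<^sub>1|\<dots>|x\<^sub>n]\<close> stands for a simplex with vertices \<open>v\<^sub>0, \<dots>, v\<^sub>n\<close> such that \<open>v\<^sub>i = v\<^sub>i\<^sub>-\<^sub>1 x\<^sub>i\<close>. When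
  the \<open>C\<close>-component of \<open>v\<^sub>n\<close> is \<open>t\<^sup>e\<close>, that of \<open>v\<^sub>i\<close> is \<open>t\<^sup>e\<close> divided by those of \<open>x\<^sub>i\<^sub>+\<^sub>1, \<dots>, x\<^sub>n\<close>. The map
  \<open>(m, c) \<mapsto> m\<close> is equivariant for the left multiplication by \<open>M\<close>; applied to the vertices, it turns
  the simplex into the word \<open>rho e [x\<^sub>1|\<dots>|x\<^sub>n]\<close> in \<open>M\<close>.
\<close>

fun rho :: "int \<Rightarrow> ('m \<times> 'c) list \<Rightarrow> 'm list" where
  "rho e [] = []"
| "rho e (x # xs) = T (e - deg x - sum_list (map deg xs)) (fst x) # rho e xs"

definition rho_chain :: "int \<Rightarrow> (('m \<times> 'c) list \<Rightarrow>\<^sub>0 int) \<Rightarrow> ('m list \<Rightarrow>\<^sub>0 int)" where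
  "rho_chain e = frag_extend (\<lambda>xs. frag_of (rho e xs))"

lemma rho_chain_simps:
  "rho_chain e (frag_of xs) = frag_of (rho e xs)" "rho_chain e (a + b) = rho_chain e a + rho_chain e b"
  "rho_chain e (a - b) = rho_chain e a - rho_chain e b" "rho_chain e 0 = 0"
  by (simp_all add: rho_chain_def frag_extend_add frag_extend_diff)

lemma rho_cube: "xs \<in> cube SD n \<Longrightarrow> rho e xs \<in> cube M n"
proof (induction n arbitrary: xs)
  case (Suc n)
  then show ?case by (auto simp: SD_carrier elim!: cube_SucE)
qed simp

lemma rho_chain_closed: "c \<in> free_chains SD n \<Longrightarrow> rho_chain e c \<in> free_chains M n"
  unfolding free_chains_def rho_chain_def mem_Collect_eq by (rule keys_extendI) (auto dest: rho_cube[of _ n e])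

lemma map_T_rho: "xs \<in> cube SD n \<Longrightarrow> map (T k) (rho e xs) = rho (e + k) xs"
proof (induction n arbitrary: xs)
  case (Suc n)
  then show ?case by (auto simp: SD_carrier algebra_simps elim!: cube_SucE)
qed simp

text \<open>
  Among the faces, the last one is the only one that removes the last vertex and thereby changes
  the exponent \<open>e\<close>.
\<close>

lemma bd_rho_2:
  assumes "x \<in> carrier SD" "y \<in> carrier SD"
  shows "bd M (frag_of (rho e [x, y])) = frag_of (rho e [y]) - frag_of (rho e [x \<otimes>\<^bsub>SD\<^esub> y]) + frag_of (rho (e - deg y) [x])"
  using assms by (simp add: bd_2 SD_mult[of x y, THEN arg_cong[where f = fst]] SD_carrier algebra_simps)

lemma bd_rho_3:
  assumes "x \<in> carrier SD" "y \<in> carrier SD" "w \<in> carrier SD"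
  shows "bd M (frag_of (rho e [x, y, w])) = frag_of (rho e [y, w]) - frag_of (rho e [x \<otimes>\<^bsub>SD\<^esub> y, w])
    + frag_of (rho e [x, y \<otimes>\<^bsub>SD\<^esub> w]) - frag_of (rho (e - deg w) [x, y])"
  using assms by (simp add: bd_3 SD_mult[of x y, THEN arg_cong[where f = fst]]
      SD_mult[of y w, THEN arg_cong[where f = fst]] SD_carrier algebra_simps)

text \<open>
  A formula for the connecting map of the Wang sequence. Dropping the last letter \<open>w\<close> of a word
  moves the last vertex from \<open>1\<close> to \<open>t\<^sup>-\<^sup>k\<close> with \<open>k = deg w\<close>, and \<open>1 - t\<^sup>-\<^sup>k = (t - 1) (t\<^sup>-\<^sup>1 + \<dots> + t\<^sup>-\<^sup>k)\<close>.
  The second factor becomes the sum over the positions \<open>t\<^sup>-\<^sup>j\<close> of the last vertex.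
\<close>

definition wang :: "(('m \<times> 'c) list \<Rightarrow>\<^sub>0 int) \<Rightarrow> ('m list \<Rightarrow>\<^sub>0 int)" where
  "wang = frag_extend (\<lambda>xs. ssum (deg (last xs)) (\<lambda>j. frag_of (rho (- j) (butlast xs))))"

lemma wang_simps:
  "wang (frag_of xs) = ssum (deg (last xs)) (\<lambda>j. frag_of (rho (- j) (butlast xs)))"
  "wang (a + b) = wang a + wang b" "wang (a - b) = wang a - wang b" "wang 0 = 0"
  by (simp_all add: wang_def frag_extend_add frag_extend_diff)

lemma wang_closed: "c \<in> free_chains SD (Suc n) \<Longrightarrow> wang c \<in> free_chains M n"
  unfolding free_chains_def wang_def mem_Collect_eq
proof (rule keys_extendI)
  fix xs assume xs: "xs \<in> cube SD (Suc n)"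
  then have "butlast xs \<in> cube SD n" by (auto simp: cube_def dest: in_set_butlastD)
  then have "ssum (deg (last xs)) (\<lambda>j. frag_of (rho (- j) (butlast xs))) \<in> free_chains M n"
    by (intro ssum_closed free_chains_of rho_cube)
  then show "Poly_Mapping.keys (ssum (deg (last xs)) (\<lambda>j. frag_of (rho (- j) (butlast xs)))) \<subseteq> cube M n"
    by (simp add: free_chains_def)
qed

lemma bd_ssum: "bd Q (ssum k f) = ssum k (\<lambda>j. bd Q (f j))"
  by (rule ssum_additive) (rule bd_diff)

text \<open>
  The last face shifts the range of summation by the degree of the letter next to the last one, and
  additivity of \<open>ssum\<close> in the number of terms compensates for it.
\<close>

lemma bd_wang_3:
  assumes "c \<in> free_chains SD 3" shows "bd M (wang c) = wang (bd SD c)"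
proof -
  have "Poly_Mapping.keys c \<subseteq> cube SD 3" using assms by (simp add: free_chains_def)
  then show ?thesis
  proof (rule frag_extend_cong_basis)
    fix xs assume "xs \<in> cube SD 3"
    then obtain x y w where xs: "xs = [x, y, w]" and Q: "x \<in> carrier SD" "y \<in> carrier SD" "w \<in> carrier SD"
      by (rule cube_3E)
    let ?g = "\<lambda>x j. frag_of (rho (- j) [x])"
    have "wang (bd SD (frag_of xs)) = ssum (deg w) (?g y) - ssum (deg w) (?g (x \<otimes>\<^bsub>SD\<^esub> y)) + ssum (deg y + deg w) (?g x) - ssum (deg y) (?g x)"
      using Q by (simp add: xs bd_3 wang_simps)
    also have "\<dots> = ssum (deg w) (\<lambda>j. bd M (frag_of (rho (- j) [x, y])))"
      unfolding bd_rho_2[OF Q(1,2)] ssum_arith ssum_add by (simp add: algebra_simps)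
    also have "\<dots> = bd M (wang (frag_of xs))" by (simp add: xs wang_simps bd_ssum)
    finally show "bd M (wang (frag_of xs)) = wang (bd SD (frag_of xs))" by simp
  qed (simp_all add: bd_diff wang_simps)
qed

lemma bd_wang_4:
  assumes "c \<in> free_chains SD 4" shows "bd M (wang c) = wang (bd SD c)"
proof -
  have "Poly_Mapping.keys c \<subseteq> cube SD 4" using assms by (simp add: free_chains_def)
  then show ?thesis
  proof (rule frag_extend_cong_basis)
    fix xs assume "xs \<in> cube SD 4"
    then obtain x y w v where xs: "xs = [x, y, w, v]"
      and Q: "x \<in> carrier SD" "y \<in> carrier SD" "w \<in> carrier SD" "v \<in> carrier SD"
      by (rule cube_4E)
    let ?g = "\<lambda>x y j. frag_of (rho (- j) [x, y])"
    have "wang (bd SD (frag_of xs)) = ssum (deg v) (?g y w) - ssum (deg v) (?g (x \<otimes>\<^bsub>SD\<^esub> y) w)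
        + ssum (deg v) (?g x (y \<otimes>\<^bsub>SD\<^esub> w)) - ssum (deg w + deg v) (?g x y) + ssum (deg w) (?g x y)"
      using Q by (simp add: xs bd_4 wang_simps)
    also have "\<dots> = ssum (deg v) (\<lambda>j. bd M (frag_of (rho (- j) [x, y, w])))"
      unfolding bd_rho_3[OF Q(1-3)] ssum_arith ssum_add by (simp add: algebra_simps)
    also have "\<dots> = bd M (wang (frag_of xs))" by (simp add: xs wang_simps bd_ssum)
    finally show "bd M (wang (frag_of xs)) = wang (bd SD (frag_of xs))" by simp
  qed (simp_all add: bd_diff wang_simps)
qed

lemma wang_cycle: "z \<in> free_cycles SD 3 \<Longrightarrow> wang z \<in> free_cycles M 2"
  using wang_closed[of z 2] bd_wang_3[of z] by (simp add: free_cycles_def wang_simps numeral_3_eq_3)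

lemma wang_boundary: "u \<in> free_boundaries SD 3 \<Longrightarrow> wang u \<in> free_boundaries M 2"
proof -
  assume "u \<in> free_boundaries SD 3"
  then obtain v where v: "v \<in> free_chains SD 4" "u = bd SD v" by (auto simp: free_boundaries_def)
  then have "wang v \<in> free_chains M (Suc 2)" using wang_closed[of v 3] by simp
  then show "wang u \<in> free_boundaries M 2" using bd_wang_4[OF v(1)] v(2) bd_in_free_boundaries by metis
qed

lemma map_words_ssum: "map_words f (ssum k g) = ssum k (\<lambda>j. map_words f (g j))"
  by (rule ssum_additive) (rule map_words_diff)

text \<open>
  The next map of the Wang sequence, \<open>t - 1\<close>, kills the class of \<open>wang z\<close>. In terms of sums, for a
  last letter of degree \<open>k\<close>, \<open>T m - 1\<close> applied to a sum over \<open>k\<close> positions is a sum over \<open>- m\<close>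
  positions of differences between positions \<open>k\<close> apart (\<open>ssum_shift\<close>); such a difference is the
  defect of \<open>rho_chain\<close> as a chain map, by \<open>bd_rho_3\<close>.
\<close>

lemma wang_invariant:
  assumes z: "z \<in> free_cycles SD 3"
  shows "map_words (T m) (wang z) - wang z \<in> free_boundaries M 2"
proof -
  have zc: "z \<in> free_chains SD 3" by (rule free_cycles_chains[OF z])
  then have "Poly_Mapping.keys z \<subseteq> cube SD 3" by (simp add: free_chains_def)
  then have "map_words (T m) (wang z) - wang z
      = ssum (- m) (\<lambda>j. rho_chain (- j) (bd SD z) - bd M (rho_chain (- j) z))"
  proof (rule frag_extend_cong_basis)
    fix xs assume "xs \<in> cube SD 3"
    then obtain x y w where xs: "xs = [x, y, w]" and Q: "x \<in> carrier SD" "y \<in> carrier SD" "w \<in> carrier SD"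
      by (rule cube_3E)
    let ?g = "\<lambda>j. frag_of (rho (- j) [x, y])"
    have map: "map (T m) (rho (- j) [x, y]) = rho (- (j + - m)) [x, y]" for j
      using map_T_rho[of "[x, y]" 2 m "- j"] Q by simp
    have "map_words (T m) (wang (frag_of xs)) - wang (frag_of xs) = ssum (deg w) (\<lambda>j. ?g (j + - m)) - ssum (deg w) ?g"
      by (simp add: xs wang_simps map_words_ssum map del: rho.simps)
    also have "\<dots> = ssum (- m) (\<lambda>j. ?g (j + deg w) - ?g j)" by (rule ssum_shift)
    also have "\<dots> = ssum (- m) (\<lambda>j. rho_chain (- j) (bd SD (frag_of xs)) - bd M (rho_chain (- j) (frag_of xs)))"
      unfolding xs bd_3 rho_chain_simps bd_rho_3[OF Q] by (simp add: algebra_simps del: rho.simps)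
    finally show "map_words (T m) (wang (frag_of xs)) - wang (frag_of xs)
      = ssum (- m) (\<lambda>j. rho_chain (- j) (bd SD (frag_of xs)) - bd M (rho_chain (- j) (frag_of xs)))" .
  qed (simp_all add: bd_diff wang_simps map_words_diff rho_chain_simps ssum_arith algebra_simps)
  also have "\<dots> = bd M (ssum (- m) (\<lambda>j. - rho_chain (- j) z))"
    using z by (simp add: free_cycles_def rho_chain_simps bd_ssum bd_minus)
  also have "\<dots> \<in> free_boundaries M 2"
    using rho_chain_closed[OF zc] by (intro bd_in_free_boundaries ssum_closed free_chains_minus) (simp add: numeral_3_eq_3 numeral_2_eq_2)
  finally show ?thesis .
qed

subsection \<open>The prism homotopy\<close>

text \<open>
  The prism between a simplex of \<open>M \<rtimes> C\<close> with vertices \<open>(m\<^sub>i, c\<^sub>i)\<close> and the simplex with vertices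
  \<open>(m\<^sub>i, 1)\<close>, for words with one and two letters, with \<open>t\<^sup>e\<close> as the \<open>C\<close>-component of the last vertex.
  The edge from \<open>(m\<^sub>i, 1)\<close> to \<open>(m\<^sub>i, c\<^sub>i)\<close> is the letter \<open>c\<^sub>i\<close>.
\<close>

fun prism :: "int \<Rightarrow> ('m \<times> 'c) list \<Rightarrow> (('m \<times> 'c) list \<Rightarrow>\<^sub>0 int)" where
  "prism e [x] = frag_of [incC (e - deg x), x] - frag_of [incM (T (e - deg x) (fst x)), incC e]"
| "prism e [x, y] = frag_of [incC (e - deg x - deg y), x, y]
     - frag_of [incM (T (e - deg x - deg y) (fst x)), incC (e - deg y), y]
     + frag_of [incM (T (e - deg x - deg y) (fst x)), incM (T (e - deg y) (fst y)), incC e]"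
| "prism e xs = 0"

definition prism_chain :: "int \<Rightarrow> (('m \<times> 'c) list \<Rightarrow>\<^sub>0 int) \<Rightarrow> (('m \<times> 'c) list \<Rightarrow>\<^sub>0 int)" where
  "prism_chain e = frag_extend (prism e)"

lemma prism_chain_simps:
  "prism_chain e (frag_of xs) = prism e xs" "prism_chain e (a + b) = prism_chain e a + prism_chain e b"
  "prism_chain e (a - b) = prism_chain e a - prism_chain e b" "prism_chain e 0 = 0"
  by (simp_all add: prism_chain_def frag_extend_add frag_extend_diff)

lemma prism_closed:
  "x \<in> carrier SD \<Longrightarrow> y \<in> carrier SD \<Longrightarrow> prism e [x, y] \<in> free_chains SD 3"
proof -
  assume xy: "x \<in> carrier SD" "y \<in> carrier SD"
  then have "fst x \<in> carrier M" "fst y \<in> carrier M" by (simp_all add: SD_carrier)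
  then show ?thesis using xy by (auto intro!: free_chains_add free_chains_diff free_chains_of)
qed

text \<open>
  The usual boundary of a prism: its two ends and the prisms over the faces, the last of which has
  a different last vertex.
\<close>

lemma bd_prism:
  assumes "x \<in> carrier SD" "y \<in> carrier SD"
  shows "bd SD (prism e [x, y]) = frag_of [x, y] - frag_of (map incM (rho e [x, y]))
    - (prism e [y] - prism e [x \<otimes>\<^bsub>SD\<^esub> y] + prism (e - deg y) [x])"
proof -
  let ?n1 = "T (e - (deg x + deg y)) (fst x)" and ?n2 = "T (e - deg y) (fst y)"
  have f: "fst x \<in> carrier M" "fst y \<in> carrier M" using assms by (simp_all add: SD_carrier)
  have s1: "incC (e - (deg x + deg y)) \<otimes>\<^bsub>SD\<^esub> x = incM ?n1 \<otimes>\<^bsub>SD\<^esub> incC (e - deg y)"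
    using incC_swap[OF assms(1), of "e - (deg x + deg y)"] by simp
  have s2: "incC (e - deg y) \<otimes>\<^bsub>SD\<^esub> y = incM ?n2 \<otimes>\<^bsub>SD\<^esub> incC e"
    using incC_swap[OF assms(2), of "e - deg y"] by simp
  have n: "T (e - (deg x + deg y)) (fst (x \<otimes>\<^bsub>SD\<^esub> y)) = ?n1 \<otimes>\<^bsub>M\<^esub> ?n2"
    using assms f by (simp add: SD_mult diff_diff_eq)
  show ?thesis
    using assms f by (simp add: bd_add bd_diff bd_3 s1 s2 n incM_mult diff_diff_eq add.commute[of "deg y"])
qed

text \<open>
  For a last letter of degree \<open>k\<close>, the prisms over \<open>[x|y]\<close> with last vertex at \<open>t\<^sup>-\<^sup>1, \<dots>, t\<^sup>-\<^sup>k\<close> all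
  have \<open>[x|y]\<close> at one end, which gives the cap product, and the words that form the Wang map at the
  other end.
\<close>

lemma cap_wang:
  assumes z: "z \<in> free_cycles SD 3"
  shows "cap deg z - map_words incM (wang z) \<in> free_boundaries SD 2"
proof -
  define V where "V = frag_extend (\<lambda>xs. ssum (deg (last xs)) (\<lambda>j. prism (- j) (butlast xs)))"
  have V: "V (frag_of xs) = ssum (deg (last xs)) (\<lambda>j. prism (- j) (butlast xs))"
    "V (a + b) = V a + V b" "V (a - b) = V a - V b" "V 0 = 0" for xs a b
    by (simp_all add: V_def frag_extend_add frag_extend_diff)
  have zk: "Poly_Mapping.keys z \<subseteq> cube SD 3" using z by (simp add: free_cycles_def free_chains_def)
  then have "cap deg z - map_words incM (wang z) = bd SD (V z) + V (bd SD z)"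
  proof (rule frag_extend_cong_basis)
    fix xs assume "xs \<in> cube SD 3"
    then obtain x y w where xs: "xs = [x, y, w]" and Q: "x \<in> carrier SD" "y \<in> carrier SD" "w \<in> carrier SD"
      by (rule cube_3E)
    let ?P = "\<lambda>x j. prism (- j) [x]"
    have "V (bd SD (frag_of xs)) = ssum (deg w) (?P y) - ssum (deg w) (?P (x \<otimes>\<^bsub>SD\<^esub> y)) + ssum (deg y + deg w) (?P x) - ssum (deg y) (?P x)"
      using Q by (simp add: xs bd_3 V del: prism.simps)
    also have "\<dots> = ssum (deg w) (\<lambda>j. ?P y j - ?P (x \<otimes>\<^bsub>SD\<^esub> y) j + prism (- j - deg y) [x])"
      unfolding ssum_arith ssum_add by (simp add: algebra_simps del: prism.simps)
    finally have Vbd: "V (bd SD (frag_of xs)) = \<dots>" .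
    have "bd SD (V (frag_of xs)) = ssum (deg w) (\<lambda>j. bd SD (prism (- j) [x, y]))"
      by (simp add: xs V bd_ssum del: prism.simps)
    then have "bd SD (V (frag_of xs)) + V (bd SD (frag_of xs))
        = ssum (deg w) (\<lambda>j. frag_of [x, y] - frag_of (map incM (rho (- j) [x, y])))"
      unfolding Vbd bd_prism[OF Q(1,2)] ssum_arith by (simp add: algebra_simps del: prism.simps rho.simps)
    also have "\<dots> = cap deg (frag_of xs) - map_words incM (wang (frag_of xs))"
      by (simp add: xs cap_simps wang_simps map_words_ssum ssum_arith ssum_const del: rho.simps)
    finally show "cap deg (frag_of xs) - map_words incM (wang (frag_of xs)) = bd SD (V (frag_of xs)) + V (bd SD (frag_of xs))" ..
  qed (simp_all add: V cap_simps bd_diff wang_simps map_words_diff)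
  also have "\<dots> = bd SD (V z)" using z by (simp add: free_cycles_def V)
  also have "\<dots> \<in> free_boundaries SD 2"
  proof (rule bd_in_free_boundaries)
    have "Poly_Mapping.keys (V z) \<subseteq> cube SD 3"
      unfolding V_def using zk
    proof (rule keys_extendI)
      fix xs assume "xs \<in> cube SD 3"
      then obtain x y w where xs: "xs = [x, y, w]" and Q: "x \<in> carrier SD" "y \<in> carrier SD" "w \<in> carrier SD"
        by (rule cube_3E)
      have "ssum (deg w) (\<lambda>j. prism (- j) [x, y]) \<in> free_chains SD 3"
        using Q by (intro ssum_closed prism_closed)
      then show "Poly_Mapping.keys (ssum (deg (last xs)) (\<lambda>j. prism (- j) (butlast xs))) \<subseteq> cube SD 3"
        by (simp add: xs free_chains_def del: prism.simps)
    qed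
    then show "V z \<in> free_chains SD (Suc 2)" by (simp add: free_chains_def numeral_3_eq_3 numeral_2_eq_2)
  qed
  finally show ?thesis .
qed

text \<open>
  Conjugation by \<open>t\<close> is the identity on the homology of \<open>M \<rtimes> C\<close>. The prism over a simplex of \<open>M\<close>
  whose vertices have been moved to the coset of \<open>t\<^sup>m\<close> is a homotopy, as its ends are words in \<open>M\<close>
  that differ by the action of \<open>t\<^sup>m\<close>.
\<close>

lemma incM_T_homologous:
  assumes z: "z \<in> free_cycles M 2"
  shows "map_words incM (map_words (T m) z) - map_words incM z \<in> free_boundaries SD 2"
proof -
  let ?i = "map_words incM"
  have zk: "Poly_Mapping.keys z \<subseteq> cube M 2" using z by (simp add: free_cycles_def free_chains_def)
  then have "?i (map_words (T m) z) - ?i z = - bd SD (prism_chain m (?i z)) - prism_chain m (?i (bd M z))"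
  proof (rule frag_extend_cong_basis)
    fix xs assume "xs \<in> cube M 2"
    then obtain a b where xs: "xs = [a, b]" and ab: "a \<in> carrier M" "b \<in> carrier M" by (rule cube_2E)
    have "bd SD (prism m [incM a, incM b]) = frag_of [incM a, incM b] - frag_of (map incM [T m a, T m b])
      - (prism m [incM b] - prism m [incM (a \<otimes>\<^bsub>M\<^esub> b)] + prism m [incM a])"
      using bd_prism[of "incM a" "incM b" m] ab by (simp add: incM_mult del: prism.simps)
    then show "?i (map_words (T m) (frag_of xs)) - ?i (frag_of xs)
        = - bd SD (prism_chain m (?i (frag_of xs))) - prism_chain m (?i (bd M (frag_of xs)))"
      by (simp add: xs bd_2 map_words_diff map_words_add prism_chain_simps del: prism.simps)
  qed (simp_all add: bd_diff map_words_diff prism_chain_simps)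
  also have "\<dots> = bd SD (- prism_chain m (?i z))"
    using z by (simp add: free_cycles_def prism_chain_simps bd_minus)
  also have "\<dots> \<in> free_boundaries SD 2"
  proof (rule bd_in_free_boundaries, rule free_chains_minus)
    have "?i z \<in> free_chains SD 2"
      using map_words_closed[of incM M SD z 2] z by (auto simp: free_cycles_def)
    then have "Poly_Mapping.keys (?i z) \<subseteq> cube SD 2" by (simp add: free_chains_def)
    then have "Poly_Mapping.keys (prism_chain m (?i z)) \<subseteq> cube SD 3"
      unfolding prism_chain_def
    proof (rule keys_extendI)
      fix xs assume "xs \<in> cube SD 2"
      then obtain x y where "xs = [x, y]" "x \<in> carrier SD" "y \<in> carrier SD" by (rule cube_2E)
      then show "Poly_Mapping.keys (prism m xs) \<subseteq> cube SD 3"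
        using prism_closed[of x y m] by (simp add: free_chains_def del: prism.simps)
    qed
    then show "prism_chain m (?i z) \<in> free_chains SD (Suc 2)" by (simp add: free_chains_def numeral_3_eq_3 numeral_2_eq_2)
  qed
  finally show ?thesis .
qed

end


section \<open>The first homology of an infinite cyclic group\<close>

locale cyclic_coefficients =
  cyc: infinite_cyclic_group C t + group_module C A act
  for C :: "'c monoid" and t :: 'c and A :: "'a monoid" and act :: "'c \<Rightarrow> 'a \<Rightarrow> 'a"
begin

text \<open>
  The Fox derivative \<open>1 + t + \<dots> + t\<^sup>k\<^sup>-\<^sup>1\<close> of \<open>t\<^sup>k\<close>, with \<open>t\<close> replaced by its inverse because the
  coefficients are regarded as right modules through inverses.
\<close>

definition fox :: "int \<Rightarrow> ('c \<Rightarrow>\<^sub>0 int)" where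
  "fox k = ssum k (\<lambda>j. frag_of (t [^]\<^bsub>C\<^esub> (1 - j)))"

definition ring_act :: "'a \<Rightarrow> ('c \<Rightarrow>\<^sub>0 int) \<Rightarrow> 'a" where
  "ring_act a = free_extend A (\<lambda>c. act c a)"

lemma fox_keys: "Poly_Mapping.keys (fox k) \<subseteq> carrier C"
proof -
  have "Poly_Mapping.keys (sum (\<lambda>j. frag_of (t [^]\<^bsub>C\<^esub> (1 - j))) I) \<subseteq> carrier C" for I :: "int set"
    by (rule order_trans[OF keys_sum]) auto
  then show ?thesis by (simp add: fox_def ssum_def keys_diffI)
qed

lemma fox_one: "fox 1 = frag_of \<one>\<^bsub>C\<^esub>"
  using ssum_step[of 0 "\<lambda>j. frag_of (t [^]\<^bsub>C\<^esub> (1 - j))"] by (simp add: fox_def)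

text \<open>The product rule for Fox derivatives. It is the reason why \<open>fox_chain_boundaries\<close> holds.\<close>

lemma fox_add: "fox (k + l) = fox k + frag_extend (\<lambda>c. frag_of (c \<otimes>\<^bsub>C\<^esub> t [^]\<^bsub>C\<^esub> (- k))) (fox l)"
proof -
  have "frag_extend (\<lambda>c. frag_of (c \<otimes>\<^bsub>C\<^esub> t [^]\<^bsub>C\<^esub> (- k))) (fox l)
      = ssum l (\<lambda>j. frag_of (t [^]\<^bsub>C\<^esub> (1 - j) \<otimes>\<^bsub>C\<^esub> t [^]\<^bsub>C\<^esub> (- k)))"
    unfolding fox_def by (subst ssum_additive[where h = "frag_extend _"]) (simp_all add: frag_extend_diff)
  also have "\<dots> = ssum l (\<lambda>j. frag_of (t [^]\<^bsub>C\<^esub> (1 - (j + k))))"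
    by (simp add: cyc.int_pow_mult[symmetric] algebra_simps)
  finally show ?thesis by (simp add: fox_def ssum_add)
qed

lemma ring_act_hom: "a \<in> carrier A \<Longrightarrow> ring_act a \<in> hom (free_Abelian_group (carrier C)) A"
  unfolding ring_act_def by (rule free_extend_hom[OF comm_group_A]) (rule act_closed)

lemma ring_act_of: "a \<in> carrier A \<Longrightarrow> c \<in> carrier C \<Longrightarrow> ring_act a (frag_of c) = act c a"
  unfolding ring_act_def by (rule free_extend_of[OF comm_group_A]) (rule act_closed)

lemma ring_act_hom_coeff:
  assumes v: "Poly_Mapping.keys v \<subseteq> carrier C" shows "(\<lambda>a. ring_act a v) \<in> hom A A"
proof (rule homI)
  fix a assume "a \<in> carrier A"
  then show "ring_act a v \<in> carrier A" by (rule free_hom_closed[OF ring_act_hom v])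
next
  fix a b assume ab: "a \<in> carrier A" "b \<in> carrier A"
  have R: "(\<lambda>v. ring_act a v \<otimes>\<^bsub>A\<^esub> ring_act b v) \<in> hom (free_Abelian_group (carrier C)) A"
    by (rule hom_product[OF comm_group_A ring_act_hom[OF ab(1)] ring_act_hom[OF ab(2)]])
  show "ring_act (a \<otimes>\<^bsub>A\<^esub> b) v = ring_act a v \<otimes>\<^bsub>A\<^esub> ring_act b v"
    using ab free_hom_eqI[OF group_A ring_act_hom R _ v, of "a \<otimes>\<^bsub>A\<^esub> b"]
    by (simp add: ring_act_of hom_mult[OF act_hom])
qed

lemma ring_act_act:
  assumes a: "a \<in> carrier A" and d: "d \<in> carrier C" and v: "Poly_Mapping.keys v \<subseteq> carrier C"
  shows "ring_act (act d a) v = ring_act a (frag_extend (\<lambda>c. frag_of (c \<otimes>\<^bsub>C\<^esub> d)) v)"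
proof -
  have "frag_extend (\<lambda>c. frag_of (c \<otimes>\<^bsub>C\<^esub> d)) \<in> hom (free_Abelian_group (carrier C)) (free_Abelian_group (carrier C))"
    by (rule frag_extend_hom) (use d in simp)
  from hom_compose[OF this ring_act_hom[OF a]]
  have R: "ring_act a \<circ> frag_extend (\<lambda>c. frag_of (c \<otimes>\<^bsub>C\<^esub> d)) \<in> hom (free_Abelian_group (carrier C)) A" .
  have "ring_act (act d a) v = (ring_act a \<circ> frag_extend (\<lambda>c. frag_of (c \<otimes>\<^bsub>C\<^esub> d))) v"
    by (rule free_hom_eqI[OF group_A ring_act_hom[OF act_closed[OF d a]] R _ v])
      (use a d in \<open>simp add: ring_act_of act_closed act_mult\<close>)
  then show ?thesis by simp
qed

definition fox_chain :: "('c list \<Rightarrow> 'a) \<Rightarrow> 'a" where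
  "fox_chain c = gfinprod A (\<lambda>xs. ring_act (c xs) (fox (cyc.clog (hd xs)))) (cube C 1)"

lemma fox_chain_hom: "fox_chain \<in> hom (bar_group C A 1) A"
  unfolding fox_chain_def[abs_def]
  by (rule bar_extend_hom[OF group_A comm_group_A ring_act_hom_coeff[OF fox_keys]])

lemma fox_chain_single:
  assumes "a \<in> carrier A" "c \<in> carrier C"
  shows "fox_chain (bar_single C A 1 a [c]) = ring_act a (fox (cyc.clog c))"
proof -
  have "fox_chain (bar_single C A 1 a [c]) = ring_act a (fox (cyc.clog (hd [c])))"
    unfolding fox_chain_def
    by (rule bar_extend_single[OF group_A comm_group_A ring_act_hom_coeff[OF fox_keys]]) (use assms in auto)
  then show ?thesis by simp
qed

lemma fox_chain_boundaries:
  assumes "b \<in> boundaries C A act 1" shows "fox_chain b = \<one>\<^bsub>A\<^esub>"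
proof -
  interpret B: comm_group "bar_group C A 1" by (rule comm_group_bar)
  interpret h: group_hom "bar_group C A 1" A fox_chain
    using fox_chain_hom by (simp add: group_hom_def group_hom_axioms_def B.is_group group_A del: One_nat_def)
  obtain u where u: "u \<in> carrier (bar_group C A 2)" "b = bar_boundary C A act 1 u"
    using assms by (auto simp: boundaries_def numeral_2_eq_2)
  have bh: "bar_boundary C A act 1 \<in> hom (bar_group C A 2) (bar_group C A 1)"
    using boundary_hom[of 1] by (simp add: numeral_2_eq_2)
  have "(fox_chain \<circ> bar_boundary C A act 1) u = (\<lambda>_. \<one>\<^bsub>A\<^esub>) u"
  proof (rule bar_hom_eqI[OF comm_group_A group_A hom_compose[OF bh fox_chain_hom] _ _ u(1)])
    fix a xs assume a: "a \<in> carrier A" and "xs \<in> cube C 2"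
    then obtain x y where xy: "xs = [x, y]" "x \<in> carrier C" "y \<in> carrier C" by (metis cube_2E)
    let ?a = "act (inv\<^bsub>C\<^esub> x) a"
    let ?r = "\<lambda>a c. ring_act a (fox (cyc.clog c))"
    have a': "?a \<in> carrier A" using a xy by (simp add: act_closed)
    have r: "?r a c \<in> carrier A" if "a \<in> carrier A" for a c by (rule free_hom_closed[OF ring_act_hom[OF that] fox_keys])
    have S: "bar_single C A 1 b [c] \<in> carrier (bar_group C A 1)" if "b \<in> carrier A" for b c
      using that by (rule bar_single_closed[OF group_A])
    note ch = chain_of_hom[OF comm_group_A a, of C 1 UNIV]
    have xk: "inv\<^bsub>C\<^esub> x = t [^]\<^bsub>C\<^esub> (- cyc.clog x)"
      using xy by (simp add: cyc.int_pow_neg)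
    have "bar_boundary C A act 1 (bar_single C A 2 a xs) = bar_single C A 1 ?a [y] \<otimes>\<^bsub>bar_group C A 1\<^esub> chain_of C A 1 a (frag_of [x] - frag_of [x \<otimes>\<^bsub>C\<^esub> y])"
      using boundary_single[OF a, of x "[y]" 1] xy by (simp add: numeral_2_eq_2 frag_extend_minus)
    also have "chain_of C A 1 a (frag_of [x] - frag_of [x \<otimes>\<^bsub>C\<^esub> y]) = bar_single C A 1 a [x] \<otimes>\<^bsub>bar_group C A 1\<^esub> inv\<^bsub>bar_group C A 1\<^esub> bar_single C A 1 a [x \<otimes>\<^bsub>C\<^esub> y]"
      unfolding bar_single_eq_chain_of[OF group_A a] by (rule free_hom_diff[OF B.is_group ch]) auto
    finally have "fox_chain (bar_boundary C A act 1 (bar_single C A 2 a xs))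
        = ?r ?a y \<otimes>\<^bsub>A\<^esub> (?r a x \<otimes>\<^bsub>A\<^esub> inv\<^bsub>A\<^esub> ?r a (x \<otimes>\<^bsub>C\<^esub> y))"
      using S a a' xy by (simp only: h.hom_mult h.hom_inv B.m_closed B.inv_closed fox_chain_single cyc.m_closed)
    also have "?r a (x \<otimes>\<^bsub>C\<^esub> y) = ?r a x \<otimes>\<^bsub>A\<^esub> ?r ?a y"
    proof -
      have k: "Poly_Mapping.keys (frag_extend (\<lambda>c. frag_of (c \<otimes>\<^bsub>C\<^esub> inv\<^bsub>C\<^esub> x)) (fox (cyc.clog y))) \<subseteq> carrier C"
        by (rule keys_extendI[OF fox_keys]) (use xy in simp)
      show ?thesis
        using xy a free_hom_add[OF ring_act_hom[OF a] fox_keys k, of "cyc.clog x"]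
        by (simp add: fox_add ring_act_act fox_keys xk)
    qed
    also have "?r ?a y \<otimes>\<^bsub>A\<^esub> (?r a x \<otimes>\<^bsub>A\<^esub> inv\<^bsub>A\<^esub> (?r a x \<otimes>\<^bsub>A\<^esub> ?r ?a y)) = (?r a x \<otimes>\<^bsub>A\<^esub> ?r ?a y) \<otimes>\<^bsub>A\<^esub> inv\<^bsub>A\<^esub> (?r a x \<otimes>\<^bsub>A\<^esub> ?r ?a y)"
      using r[OF a] r[OF a'] by (simp only: A.m_ac A.inv_closed A.m_closed)
    also have "\<dots> = \<one>\<^bsub>A\<^esub>" using r[OF a] r[OF a'] by simp
    finally show "(fox_chain \<circ> bar_boundary C A act 1) (bar_single C A 2 a xs) = \<one>\<^bsub>A\<^esub>" by simp
  qed (auto intro!: homI)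
  then show ?thesis using u by simp
qed

text \<open>
  The map \<open>fox_chain\<close>, \<open>a [t\<^sup>k] \<mapsto> fox(k) a\<close>, kills boundaries and sends \<open>a [t]\<close> back to \<open>a\<close>, so the
  class of \<open>a [t]\<close> determines \<open>a\<close>.
\<close>

lemma H1_cyclic_to_invariants_eq:
  assumes "a \<in> invariants C A act"
  shows "H1_cyclic_to_invariants C t A act (homology_class C A act 1 (bar_single C A 1 a [t])) = a"
  unfolding H1_cyclic_to_invariants_def
proof (rule inv_into_f_f[OF inj_onI assms])
  fix a b assume "a \<in> invariants C A act" "b \<in> invariants C A act"
    and eq: "homology_class C A act 1 (bar_single C A 1 a [t]) = homology_class C A act 1 (bar_single C A 1 b [t])"
  then have ab: "a \<in> carrier A" "b \<in> carrier A" by (simp_all add: invariants_def)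
  interpret B: comm_group "bar_group C A 1" by (rule comm_group_bar)
  interpret h: group_hom "bar_group C A 1" A fox_chain
    using fox_chain_hom by (simp add: group_hom_def group_hom_axioms_def B.is_group group_A del: One_nat_def)
  have S: "bar_single C A 1 c [t] \<in> carrier (bar_group C A 1)" if "c \<in> carrier A" for c
    using that by (rule bar_single_closed[OF group_A])
  have "cyc.clog t = 1" using cyc.log_pow[of 1] by (simp add: cyc.int_pow_1)
  then have D: "fox_chain (bar_single C A 1 c [t]) = c" if "c \<in> carrier A" for c
    using that by (simp add: fox_chain_single[unfolded One_nat_def] fox_one ring_act_of act_one)
  have "bar_single C A 1 a [t] \<otimes>\<^bsub>bar_group C A 1\<^esub> inv\<^bsub>bar_group C A 1\<^esub> bar_single C A 1 b [t] \<in> boundaries C A act 1"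
    using eq homology_class_eq_iff[OF S[OF ab(1)] S[OF ab(2)]] by simp
  from fox_chain_boundaries[OF this] have "a \<otimes>\<^bsub>A\<^esub> inv\<^bsub>A\<^esub> b = \<one>\<^bsub>A\<^esub>"
    using S[OF ab(1)] S[OF ab(2)] by (simp only: h.hom_mult h.hom_inv B.inv_closed D[OF ab(1)] D[OF ab(2)])
  then show "a = b" using ab A.inv_equality[of a "inv\<^bsub>A\<^esub> b"] by simp
qed

lemma invariant_cycle:
  assumes "a \<in> invariants C A act" shows "bar_single C A 1 a [t] \<in> cycles C A act 1"
proof -
  have a: "a \<in> carrier A" "act (inv\<^bsub>C\<^esub> t) a = a" using assms by (auto simp: invariants_def)
  interpret B: comm_group "bar_group C A 0" by (rule comm_group_bar)
  have c: "chain_of C A 0 a d \<in> carrier (bar_group C A 0)" for d by (rule chain_of_closed[OF group_A a(1)])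
  have "bar_boundary C A act 0 (bar_single C A (Suc 0) a [t])
      = chain_of C A 0 a (frag_of []) \<otimes>\<^bsub>bar_group C A 0\<^esub> chain_of C A 0 a (- frag_of [])"
    using boundary_single[OF a(1) cyc.t, of "[]" 0] a by (simp add: bar_single_eq_chain_of[OF group_A])
  also have "\<dots> = \<one>\<^bsub>bar_group C A 0\<^esub>"
    by (simp add: chain_of_add[OF group_A a(1), symmetric] chain_of_zero[OF group_A])
  finally show ?thesis
    using bar_single_closed[OF group_A a(1), of C 1 "[t]"] by (simp add: cycles_def kernel_def)
qed

end

section \<open>Exterior squares of modules\<close>

context cyclic_module
begin

sublocale ext: ext_square_group M
  by (simp add: ext_square_group_def comm_group_A)

abbreviation "LM \<equiv> ext_square M"
abbreviation "actL \<equiv> ext_square_act M act"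

definition act_pairs :: "'c \<Rightarrow> ('m \<times> 'm \<Rightarrow>\<^sub>0 int) \<Rightarrow> ('m \<times> 'm \<Rightarrow>\<^sub>0 int)" where
  "act_pairs c = frag_extend (\<lambda>(m, n). frag_of (act c m, act c n))"

lemma act_pairs_simps [simp]: "act_pairs c (frag_of (m, n)) = frag_of (act c m, act c n)"
  "act_pairs c (a + b) = act_pairs c a + act_pairs c b" "act_pairs c (a - b) = act_pairs c a - act_pairs c b"
  by (simp_all add: act_pairs_def frag_extend_add frag_extend_diff)

lemma act_pairs_hom: "c \<in> carrier C \<Longrightarrow> act_pairs c \<in> hom ext.F ext.F"
  unfolding act_pairs_def by (rule frag_extend_hom) (auto simp: act_closed)

lemma act_pairs_keys:
  "c \<in> carrier C \<Longrightarrow> Poly_Mapping.keys b \<subseteq> carrier M \<times> carrier M \<Longrightarrow> Poly_Mapping.keys (act_pairs c b) \<subseteq> carrier M \<times> carrier M"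
  using free_hom_closed[OF act_pairs_hom] by simp

lemma act_pairs_K:
  assumes c: "c \<in> carrier C" shows "act_pairs c ` ext.K \<subseteq> ext.K"
  unfolding ext_square_kernel_def[of M]
proof (rule ext.F.hom_generate_subset[OF group_free_Abelian_group act_pairs_hom[OF c]])
  show "subgroup (generate ext.F (bilinear_relations M M \<union> {frag_of (m, m) |m. m \<in> carrier M})) ext.F"
    using ext.subgroup_K unfolding ext_square_kernel_def .
  show "bilinear_relations M M \<union> {frag_of (m, m) |m. m \<in> carrier M} \<subseteq> carrier ext.F"
    by (auto simp: bilinear_relations_def intro!: keys_diffI dest!: subsetD[OF keys_diff])
  have "act_pairs c x \<in> ext.K" if "x \<in> bilinear_relations M M \<union> {frag_of (m, m) |m. m \<in> carrier M}" for x
    using that c ext.K_generators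
    by (auto simp: bilinear_relations_def hom_mult[OF act_hom] act_closed)
  then show "act_pairs c ` (bilinear_relations M M \<union> {frag_of (m, m) |m. m \<in> carrier M})
      \<subseteq> generate ext.F (bilinear_relations M M \<union> {frag_of (m, m) |m. m \<in> carrier M})"
    unfolding ext_square_kernel_def by blast
qed

lemma actL_class:
  assumes "c \<in> carrier C" "Poly_Mapping.keys b \<subseteq> carrier M \<times> carrier M"
  shows "actL c (ext.ext_class b) = ext.ext_class (act_pairs c b)"
  unfolding ext_square_act_def ext.ext_class_def act_pairs_def[symmetric]
  by (rule ext.F.quot_map_rcos[OF group_free_Abelian_group act_pairs_hom[OF assms(1)] ext.subgroup_K ext.subgroup_K act_pairs_K[OF assms(1)]])
    (use assms in simp)

lemma act_pairs_mult:
  assumes "c \<in> carrier C" "d \<in> carrier C" "Poly_Mapping.keys b \<subseteq> carrier M \<times> carrier M"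
  shows "act_pairs (c \<otimes>\<^bsub>C\<^esub> d) b = act_pairs c (act_pairs d b)"
  by (rule frag_extend_cong_basis[OF assms(3)]) (use assms in \<open>auto simp: act_mult\<close>)

lemma act_pairs_one:
  assumes "Poly_Mapping.keys b \<subseteq> carrier M \<times> carrier M" shows "act_pairs \<one>\<^bsub>C\<^esub> b = b"
  by (rule frag_extend_cong_basis[OF assms(1)]) (use assms in \<open>auto simp: act_one\<close>)

lemma group_module_ext_square: "group_module C LM actL"
proof unfold_locales
  fix c assume c: "c \<in> carrier C"
  show "actL c \<in> hom LM LM"
  proof (rule homI)
    fix X assume "X \<in> carrier LM"
    then show "actL c X \<in> carrier LM" using c by (auto simp: ext.carrier_ext_square actL_class act_pairs_keys)
  next
    fix X Y assume "X \<in> carrier LM" "Y \<in> carrier LM"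
    then obtain a b where ab: "X = ext.ext_class a" "Y = ext.ext_class b"
      "Poly_Mapping.keys a \<subseteq> carrier M \<times> carrier M" "Poly_Mapping.keys b \<subseteq> carrier M \<times> carrier M"
      by (auto simp: ext.carrier_ext_square)
    then show "actL c (X \<otimes>\<^bsub>LM\<^esub> Y) = actL c X \<otimes>\<^bsub>LM\<^esub> actL c Y"
      using c by (simp add: free_hom_add[OF ext.ext_class_hom, symmetric] actL_class act_pairs_keys keys_addI)
  qed
next
  fix X assume "X \<in> carrier LM"
  then show "actL \<one>\<^bsub>C\<^esub> X = X" by (auto simp: ext.carrier_ext_square actL_class act_pairs_one)
next
  fix c d X assume "c \<in> carrier C" "d \<in> carrier C" "X \<in> carrier LM"
  then show "actL (c \<otimes>\<^bsub>C\<^esub> d) X = actL c (actL d X)"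
    by (auto simp: ext.carrier_ext_square actL_class act_pairs_mult act_pairs_keys)
qed

sublocale L: cyclic_coefficients C t LM actL
  using group_module_ext_square cyc.infinite_cyclic_group_axioms by (simp add: cyclic_coefficients_def)

lemma map_act: "c \<in> carrier C \<Longrightarrow> act c = T (cyc.clog c)"
  by (simp add: fun_eq_iff act_eq_T)

lemma pontryagin_act_pairs:
  assumes "c \<in> carrier C" "Poly_Mapping.keys b \<subseteq> carrier M \<times> carrier M"
  shows "pontryagin (act_pairs c b) = map_words (act c) (pontryagin b)"
  by (rule frag_extend_cong_basis[OF assms(2)]) (auto simp: pontryagin_diff map_words_diff)

abbreviation "H2M \<equiv> integral_homology M 2"
abbreviation "P \<equiv> ext_square_to_H2 M"

sublocale H2M: comm_group H2M by (rule ext.comm_group_H2)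

sublocale H2SD: comm_group "integral_homology SD 2"
  using comm_group_integral_homology[OF SD.is_group, of 1] by (simp add: numeral_2_eq_2)

lemma P_hom: "P \<in> hom LM H2M" and P_inj: "inj_on P (carrier LM)" and P_surj: "P ` carrier LM = carrier H2M"
  using ext.ext_square_to_H2_iso by (auto simp: iso_def bij_betw_def)

lemma carrier_H2M: "carrier H2M = cls M 2 ` free_cycles M 2"
  using carrier_integral_homology[OF group_A, of 1] by (simp add: numeral_2_eq_2)

lemma P_actL:
  assumes c: "c \<in> carrier C" and X: "X \<in> carrier LM"
  shows "P (actL c X) = integral_homology_map M M (act c) 2 (P X)"
proof -
  obtain b where b: "X = ext.ext_class b" "Poly_Mapping.keys b \<subseteq> carrier M \<times> carrier M"
    using X by (auto simp: ext.carrier_ext_square)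
  show ?thesis
    using b c by (simp add: actL_class act_pairs_keys ext.ext_square_to_H2_class pontryagin_act_pairs
        integral_homology_map_cls[OF group_A group_A act_hom] pontryagin_closed)
qed

lemma homology_incM_hom: "integral_homology_map M SD incM 2 \<in> hom H2M (integral_homology SD 2)"
proof (rule homI)
  have i: "incM \<in> carrier M \<rightarrow> carrier SD" by simp
  fix X assume "X \<in> carrier H2M"
  then obtain c where c: "X = cls M 2 c" "c \<in> free_cycles M 2" by (auto simp: carrier_H2M)
  then have "map_words incM c \<in> free_cycles SD 2"
    using map_words_closed[OF i, of c 2] map_words_bd[OF incM_hom group_A, of c 1]
    by (simp add: free_cycles_def numeral_2_eq_2)
  then show "integral_homology_map M SD incM 2 X \<in> carrier (integral_homology SD 2)"
    using c carrier_integral_homology[OF SD.is_group, of 1]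
    by (auto simp: integral_homology_map_cls[OF group_A SD.is_group incM_hom] free_cycles_chains numeral_2_eq_2)
next
  have i: "incM \<in> carrier M \<rightarrow> carrier SD" by simp
  fix X Y assume "X \<in> carrier H2M" "Y \<in> carrier H2M"
  then obtain c d where "X = cls M 2 c" "c \<in> free_chains M 2" "Y = cls M 2 d" "d \<in> free_chains M 2"
    by (auto simp: carrier_H2M free_cycles_chains)
  then show "integral_homology_map M SD incM 2 (X \<otimes>\<^bsub>H2M\<^esub> Y)
      = integral_homology_map M SD incM 2 X \<otimes>\<^bsub>integral_homology SD 2\<^esub> integral_homology_map M SD incM 2 Y"
    by (simp add: cls_mult[OF group_A] cls_mult[OF SD.is_group] free_chains_add map_words_add map_words_closed[OF i]
        integral_homology_map_cls[OF group_A SD.is_group incM_hom])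
qed

text \<open>
  The induced map on coinvariants exists because \<open>C\<close> acts trivially on the image of \<open>H\<^sub>2(M)\<close> in
  \<open>H\<^sub>2(M \<rtimes> C)\<close>, by \<open>incM_T_homologous\<close>.
\<close>

lemma coinvariants_to_H2_eq:
  assumes X: "X \<in> carrier LM"
  shows "coinvariants_to_H2 M C act (to_coinvariants (carrier C) LM actL X) = integral_homology_map M SD incM 2 (P X)"
proof -
  let ?f = "\<lambda>c. integral_homology_map M M (act c) 2"
  let ?SL = "{actL c a \<otimes>\<^bsub>LM\<^esub> inv\<^bsub>LM\<^esub> a | c a. c \<in> carrier C \<and> a \<in> carrier LM}"
  let ?SH = "{?f c a \<otimes>\<^bsub>H2M\<^esub> inv\<^bsub>H2M\<^esub> a | c a. c \<in> carrier C \<and> a \<in> carrier H2M}"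
  let ?KL = "coinvariants_kernel (carrier C) LM actL"
  let ?KH = "coinvariants_kernel (carrier C) H2M ?f"
  interpret P: group_hom LM H2M P
    using P_hom by (simp add: group_hom_def group_hom_axioms_def L.group_A H2M.is_group)
  interpret i: group_hom H2M "integral_homology SD 2" "integral_homology_map M SD incM 2"
    using homology_incM_hom by (simp add: group_hom_def group_hom_axioms_def H2SD.is_group H2M.is_group)
  have SL: "?SL \<subseteq> carrier LM" by (auto simp: L.act_closed)
  have f_closed: "?f c Z \<in> carrier H2M" if c: "c \<in> carrier C" and Z: "Z \<in> carrier H2M" for c Z
  proof -
    obtain Y where Y: "Y \<in> carrier LM" "Z = P Y" using Z P_surj by auto
    show ?thesis
      using P.hom_closed[OF L.act_closed[OF c Y(1)]] unfolding P_actL[OF c Y(1)] Y(2) .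
  qed
  have SH: "?SH \<subseteq> carrier H2M" using f_closed by auto
  have KL: "subgroup ?KL LM" unfolding coinvariants_kernel_def by (rule ext.L.generate_is_subgroup[OF SL])
  have KH: "subgroup ?KH H2M" unfolding coinvariants_kernel_def by (rule H2M.generate_is_subgroup[OF SH])
  have PK: "P ` ?KL \<subseteq> ?KH"
    unfolding coinvariants_kernel_def[of _ LM]
  proof (rule ext.L.hom_generate_subset[OF H2M.is_group P_hom KH SL], safe)
    fix c a assume c: "c \<in> carrier C" and a: "a \<in> carrier LM"
    then have "P (actL c a \<otimes>\<^bsub>LM\<^esub> inv\<^bsub>LM\<^esub> a) = ?f c (P a) \<otimes>\<^bsub>H2M\<^esub> inv\<^bsub>H2M\<^esub> P a"
      by (simp add: L.act_closed P_actL)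
    then show "P (actL c a \<otimes>\<^bsub>LM\<^esub> inv\<^bsub>LM\<^esub> a) \<in> ?KH"
      unfolding coinvariants_kernel_def using c P.hom_closed[OF a] by (intro generate.incl) blast
  qed
  have iK: "integral_homology_map M SD incM 2 Z = \<one>\<^bsub>integral_homology SD 2\<^esub>" if "Z \<in> ?KH" for Z
  proof (rule H2M.hom_generate_one[OF H2SD.is_group homology_incM_hom SH _ that[unfolded coinvariants_kernel_def]])
    fix Y assume "Y \<in> ?SH"
    then obtain c Z where c: "c \<in> carrier C" "Z \<in> carrier H2M" "Y = ?f c Z \<otimes>\<^bsub>H2M\<^esub> inv\<^bsub>H2M\<^esub> Z" by blast
    then obtain d where d: "Z = cls M 2 d" "d \<in> free_cycles M 2" by (auto simp: carrier_H2M)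
    have dc: "d \<in> free_chains M 2" "map_words (act c) d \<in> free_chains M 2"
      using d(2) map_words_closed[of "act c" M M d 2] act_closed[OF c(1)] by (auto simp: free_cycles_chains)
    have i: "incM \<in> carrier M \<rightarrow> carrier SD" by simp
    have "integral_homology_map M SD incM 2 (?f c Z) = cls SD 2 (map_words incM (map_words (act c) d))"
      using dc by (simp add: d(1) integral_homology_map_cls[OF group_A group_A act_hom[OF c(1)]]
          integral_homology_map_cls[OF group_A SD.is_group incM_hom])
    also have "\<dots> = cls SD 2 (map_words incM d)"
      using cls_eq_iff[OF SD.is_group map_words_closed[OF i dc(2)] map_words_closed[OF i dc(1)]]
        incM_T_homologous[OF d(2), of "cyc.clog c"] map_act[OF c(1)] by simp
    also have "\<dots> = integral_homology_map M SD incM 2 Z"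
      using dc by (simp add: d(1) integral_homology_map_cls[OF group_A SD.is_group incM_hom])
    finally show "integral_homology_map M SD incM 2 Y = \<one>\<^bsub>integral_homology SD 2\<^esub>"
      using c(2) f_closed[OF c(1,2)] i.hom_closed[OF c(2)] unfolding c(3) by simp
  qed
  have "quot_map H2M ?KH P (to_coinvariants (carrier C) LM actL X) = ?KH #>\<^bsub>H2M\<^esub> P X"
    unfolding to_coinvariants_def by (rule ext.L.quot_map_rcos[OF H2M.is_group P_hom KL KH PK X])
  moreover have "quot_lift (integral_homology_map M SD incM 2) (?KH #>\<^bsub>H2M\<^esub> P X) = integral_homology_map M SD incM 2 (P X)"
    by (rule H2M.quot_lift_rcos[OF H2SD.is_group homology_incM_hom KH iK P.hom_closed[OF X]])
  ultimately show ?thesis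
    by (simp add: coinvariants_to_H2_def incM_def[abs_def, symmetric])
qed

subsection \<open>The map on the third homology\<close>

definition ext_of_cycle :: "('m list \<Rightarrow>\<^sub>0 int) \<Rightarrow> ('m \<times> 'm \<Rightarrow>\<^sub>0 int) set" where
  "ext_of_cycle c = inv_into (carrier LM) P (cls M 2 c)"

lemma ext_of_cycle:
  assumes "c \<in> free_cycles M 2"
  shows "ext_of_cycle c \<in> carrier LM" "P (ext_of_cycle c) = cls M 2 c"
proof -
  have "cls M 2 c \<in> P ` carrier LM" using assms by (simp add: P_surj carrier_H2M)
  then show "ext_of_cycle c \<in> carrier LM" "P (ext_of_cycle c) = cls M 2 c"
    unfolding ext_of_cycle_def by (rule inv_into_into, rule f_inv_into_f)
qed

lemma ext_of_cycle_invariant: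
  assumes z: "z \<in> free_cycles SD 3"
  shows "ext_of_cycle (wang z) \<in> invariants C LM actL"
proof -
  let ?c = "wang z"
  have c: "?c \<in> free_cycles M 2" by (rule wang_cycle[OF z])
  note e = ext_of_cycle[OF c]
  have "actL g (ext_of_cycle ?c) = ext_of_cycle ?c" if g: "g \<in> carrier C" for g
  proof (rule inj_onD[OF P_inj _ L.act_closed[OF g e(1)] e(1)])
    have "map_words (act g) ?c \<in> free_chains M 2"
      using map_words_closed[of "act g" M M ?c 2] act_closed[OF g] c by (auto simp: free_cycles_chains)
    then show "P (actL g (ext_of_cycle ?c)) = P (ext_of_cycle ?c)"
      using wang_invariant[OF z, of "cyc.clog g"] free_cycles_chains[OF c]
      unfolding P_actL[OF g e(1)] e(2) integral_homology_map_cls[OF group_A group_A act_hom[OF g] free_cycles_chains[OF c]]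
        map_act[OF g, symmetric] by (simp only: cls_eq_iff[OF group_A])
  qed
  then show ?thesis using e(1) by (simp add: invariants_def)
qed

lemma ext_of_cycle_add:
  assumes "c \<in> free_cycles M 2" "d \<in> free_cycles M 2"
  shows "ext_of_cycle (c + d) = ext_of_cycle c \<otimes>\<^bsub>LM\<^esub> ext_of_cycle d"
proof (rule inj_onD[OF P_inj])
  note cd = free_cycles_add[OF assms]
  show "P (ext_of_cycle (c + d)) = P (ext_of_cycle c \<otimes>\<^bsub>LM\<^esub> ext_of_cycle d)"
    using assms cd by (simp add: hom_mult[OF P_hom] ext_of_cycle cls_mult[OF group_A] free_cycles_chains)
qed (use assms free_cycles_add[OF assms] in \<open>simp_all add: ext_of_cycle\<close>)

text \<open>
  The homomorphism \<open>h\<close> sends the class of a cycle \<open>z\<close> to \<open>a [t]\<close>, where \<open>a \<in> \<Lambda>\<^sup>2(M)\<^sup>C\<close> corresponds to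
  the class of \<open>wang z\<close>. The prescribed composite maps it to the image of that class under
  \<open>M \<rightarrow> M \<rtimes> C\<close>, which is the class of \<open>cap deg z\<close>.
\<close>

theorem wang_homomorphism:
  obtains \<alpha> h where "\<alpha> \<in> hom (integral_homology SD 3) (integral_homology SD 2)"
    "h \<in> hom (integral_homology SD 3) (homology C LM actL 1)"
    "\<And>z. z \<in> carrier (integral_homology SD 3) \<Longrightarrow>
      \<alpha> z = coinvariants_to_H2 M C act (to_coinvariants (carrier C) LM actL (H1_cyclic_to_invariants C t LM actL (h z)))"
    "\<And>z. z \<in> free_cycles SD 3 \<Longrightarrow> \<alpha> (cls SD 3 z) = cls SD 2 (cap deg z)"
proof -
  have three: "Suc 2 = 3" by simp
  let ?S = "\<lambda>a. bar_single C LM 1 a [t]"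
  let ?cl = "homology_class C LM actL 1"
  let ?\<phi> = "\<lambda>z. ?cl (?S (ext_of_cycle (wang z)))"
  have S: "?S a \<in> carrier (bar_group C LM 1)" if "a \<in> carrier LM" for a
    using that by (rule bar_single_closed[OF L.group_A])
  note ec = ext_of_cycle(1)[OF wang_cycle]
  note hom_ex = integral_homology_hom_exists[OF SD.is_group, of 2, unfolded three]
  have diff: "wang c - wang d \<in> free_boundaries M 2"
    if "c \<in> free_cycles SD 3" "d \<in> free_cycles SD 3" "c - d \<in> free_boundaries SD 3" for c d
    using wang_boundary[OF that(3)] by (simp add: wang_simps)
  have clsM: "cls M 2 (wang c) = cls M 2 (wang d)"
    if "c \<in> free_cycles SD 3" "d \<in> free_cycles SD 3" "c - d \<in> free_boundaries SD 3" for c d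
    using diff[OF that] wang_cycle[OF that(1)] wang_cycle[OF that(2)]
    by (simp add: cls_eq_iff[OF group_A] free_cycles_chains)
  obtain h where h: "h \<in> hom (integral_homology SD 3) (homology C LM actL 1)"
    "\<And>c. c \<in> free_cycles SD 3 \<Longrightarrow> h (cls SD 3 c) = ?\<phi> c"
  proof (rule hom_ex[of ?\<phi> "homology C LM actL 1"])
    fix c assume c: "c \<in> free_cycles SD 3"
    show "?\<phi> c \<in> carrier (homology C LM actL 1)"
      unfolding L.carrier_homology by (rule imageI[OF L.invariant_cycle[OF ext_of_cycle_invariant[OF c]]])
    fix d assume d: "d \<in> free_cycles SD 3"
    show "?\<phi> (c + d) = ?\<phi> c \<otimes>\<^bsub>homology C LM actL 1\<^esub> ?\<phi> d"
      unfolding L.homology_class_mult[OF S[OF ec[OF c]] S[OF ec[OF d]]] wang_simps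
        ext_of_cycle_add[OF wang_cycle[OF c] wang_cycle[OF d]]
        hom_mult[OF bar_single_hom[OF L.comm_group_A] ec[OF c] ec[OF d]] ..
    assume "c - d \<in> free_boundaries SD 3"
    then show "?\<phi> c = ?\<phi> d" using clsM[OF c d] by (simp add: ext_of_cycle_def)
  qed blast
  let ?\<psi> = "\<lambda>z. integral_homology_map M SD incM 2 (cls M 2 (wang z))"
  have cM: "cls M 2 (wang c) \<in> carrier H2M" if "c \<in> free_cycles SD 3" for c
    using wang_cycle[OF that] by (simp add: carrier_H2M)
  obtain \<alpha> where \<alpha>: "\<alpha> \<in> hom (integral_homology SD 3) (integral_homology SD 2)"
    "\<And>c. c \<in> free_cycles SD 3 \<Longrightarrow> \<alpha> (cls SD 3 c) = ?\<psi> c"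
  proof (rule hom_ex[of ?\<psi> "integral_homology SD 2"])
    fix c assume c: "c \<in> free_cycles SD 3"
    show "?\<psi> c \<in> carrier (integral_homology SD 2)" by (rule hom_in_carrier[OF homology_incM_hom cM[OF c]])
    fix d assume d: "d \<in> free_cycles SD 3"
    show "?\<psi> (c + d) = ?\<psi> c \<otimes>\<^bsub>integral_homology SD 2\<^esub> ?\<psi> d"
      unfolding hom_mult[OF homology_incM_hom cM[OF c] cM[OF d], symmetric]
      using wang_cycle[OF c] wang_cycle[OF d] by (simp add: cls_mult[OF group_A] wang_simps free_cycles_chains)
    assume "c - d \<in> free_boundaries SD 3"
    then show "?\<psi> c = ?\<psi> d" using clsM[OF c d] by simp
  qed blast
  show ?thesis
  proof (rule that[OF \<alpha>(1) h(1)])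
    fix Z assume "Z \<in> carrier (integral_homology SD 3)"
    then obtain z where z: "z \<in> free_cycles SD 3" "Z = cls SD 3 z"
      using carrier_integral_homology[OF SD.is_group, of 2, unfolded three] by auto
    show "\<alpha> Z = coinvariants_to_H2 M C act (to_coinvariants (carrier C) LM actL (H1_cyclic_to_invariants C t LM actL (h Z)))"
      unfolding z(2) h(2)[OF z(1)] \<alpha>(2)[OF z(1)] L.H1_cyclic_to_invariants_eq[OF ext_of_cycle_invariant[OF z(1)]]
        coinvariants_to_H2_eq[OF ec[OF z(1)]] ext_of_cycle(2)[OF wang_cycle[OF z(1)]] ..
  next
    fix z assume z: "z \<in> free_cycles SD 3"
    have i: "incM \<in> carrier M \<rightarrow> carrier SD" by simp
    have \<tau>: "cap deg z \<in> free_cycles SD 2" by (rule cap_cycle[OF SD.is_group deg_mult z])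
    have w: "wang z \<in> free_chains M 2" by (rule free_cycles_chains[OF wang_cycle[OF z]])
    have "cls SD 2 (cap deg z) = cls SD 2 (map_words incM (wang z))"
      using cls_eq_iff[OF SD.is_group free_cycles_chains[OF \<tau>] map_words_closed[OF i w]] cap_wang[OF z] by simp
    then show "\<alpha> (cls SD 3 z) = cls SD 2 (cap deg z)"
      using w by (simp add: \<alpha>(2)[OF z] integral_homology_map_cls[OF group_A SD.is_group incM_hom])
  qed
qed

end

section \<open>The commutative square\<close>

theorem proposition3p1:
  fixes C :: "'c monoid" and t :: 'c
    and M :: "'m monoid" and act :: "'c \<Rightarrow> 'm \<Rightarrow> 'm"
    and Q :: "('m \<times> 'c) monoid"
    and G :: "'g monoid" and \<pi> :: "'g \<Rightarrow> 'm \<times> 'c"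
    and F :: "'f monoid" and p :: "'f \<Rightarrow> 'g"
  assumes C: "infinite_cyclic C t"
    and M: "group_module C M act"
    and Q: "Q = semidirect_product M C act"
    and G: "stem_extension G Q \<pi>"
    and F: "free_group F" "p \<in> epi F G"
  shows "\<exists>\<alpha> \<in> hom (integral_homology Q 3) (integral_homology Q 2).
           (\<exists>h \<in> hom (integral_homology Q 3) (homology C (ext_square M) (ext_square_act M act) 1).
              \<forall>z \<in> carrier (integral_homology Q 3).
                \<alpha> z =
                  coinvariants_to_H2 M C act
                    (to_coinvariants (carrier C) (ext_square M) (ext_square_act M act)
                      (H1_cyclic_to_invariants C t (ext_square M) (ext_square_act M act) (h z)))) \<and>
           (\<forall>z \<in> carrier (integral_homology Q 3).
              beta_map G Q \<pi> (\<alpha> z) =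
                tensor_proj C t (\<lambda>g. snd (\<pi> g)) (ext_kernel G Q \<pi>) (delta_map F p G Q \<pi> z))"
proof -
  interpret cyclic_module C t M act
    using C M by (simp add: cyclic_module_def infinite_cyclic_group_def)
  have gG: "group G" and \<pi>: "\<pi> \<in> hom G Q" "\<pi> ` carrier G = carrier Q"
    and central: "\<And>n g. n \<in> kernel G Q \<pi> \<Longrightarrow> g \<in> carrier G \<Longrightarrow> n \<otimes>\<^bsub>G\<^esub> g = g \<otimes>\<^bsub>G\<^esub> n"
    using G by (auto simp: stem_extension_def epi_def)
  have gF: "group F" using F(1) by (simp add: free_group_def)
  have p: "p \<in> hom F G" "p ` carrier F = carrier G" using F(2) by (auto simp: epi_def)
  \<comment> \<open>A section with \<open>\<sigma> 1 = 1\<close>, so that its cocycle is normalized; through \<open>p\<close> it also serves for \<open>G \<rightarrow> Q\<close>.\<close>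
  define \<sigma> where "\<sigma> q = (if q = \<one>\<^bsub>Q\<^esub> then \<one>\<^bsub>F\<^esub> else SOME e. e \<in> carrier F \<and> \<pi> (p e) = q)" for q
  interpret F: group F by (rule gF)
  interpret G: group G by (rule gG)
  have gQ: "group Q" unfolding Q by (rule SD.is_group)
  have \<sigma>: "\<sigma> q \<in> carrier F \<and> \<pi> (p (\<sigma> q)) = q" if "q \<in> carrier Q" for q
  proof (cases "q = \<one>\<^bsub>Q\<^esub>")
    case True
    then show ?thesis using hom_one[OF p(1) gF gG] hom_one[OF \<pi>(1) gG gQ] by (simp add: \<sigma>_def)
  next
    case False
    have "\<exists>e. e \<in> carrier F \<and> \<pi> (p e) = q"
      using that \<pi>(2) p(2) by (metis (no_types, lifting) imageE)
    then have "(SOME e. e \<in> carrier F \<and> \<pi> (p e) = q) \<in> carrier F \<and> \<pi> (p (SOME e. e \<in> carrier F \<and> \<pi> (p e) = q)) = q"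
      by (rule someI_ex)
    then show ?thesis using False by (simp add: \<sigma>_def)
  qed
  interpret R: central_relation F G Q p \<pi> \<sigma>
    by (intro central_relation.intro central_relation_axioms.intro gF gG gQ p(1) \<pi>(1) central)
      (use \<sigma> in \<open>auto simp: \<sigma>_def\<close>)
  obtain \<alpha> h where \<alpha>: "\<alpha> \<in> hom (integral_homology SD 3) (integral_homology SD 2)"
    and h: "h \<in> hom (integral_homology SD 3) (homology C LM actL 1)"
    and \<alpha>h: "\<And>z. z \<in> carrier (integral_homology SD 3) \<Longrightarrow>
      \<alpha> z = coinvariants_to_H2 M C act (to_coinvariants (carrier C) LM actL (H1_cyclic_to_invariants C t LM actL (h z)))"
    and \<alpha>cap: "\<And>z. z \<in> free_cycles SD 3 \<Longrightarrow> \<alpha> (cls SD 3 z) = cls SD 2 (cap deg z)"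
    by (rule wang_homomorphism) blast
  have three: "Suc 2 = 3" by simp
  have \<gamma>: "snd \<in> hom Q C" unfolding Q by (rule snd_hom)
  have deg: "deg = (\<lambda>w. cyclic_log C t (snd w))" by (simp add: fun_eq_iff deg_def)
  have "beta_map G Q \<pi> (\<alpha> Z) = tensor_proj C t (\<lambda>g. snd (\<pi> g)) (ext_kernel G Q \<pi>) (delta_map F p G Q \<pi> Z)"
    if Z: "Z \<in> carrier (integral_homology Q 3)" for Z
  proof -
    obtain z where z: "z \<in> free_cycles Q 3" "Z = cls Q 3 z"
      using Z carrier_integral_homology[OF gQ, of 2, unfolded three] by auto
    have "\<alpha> Z = cls Q 2 (cap (\<lambda>w. cyclic_log C t (snd w)) z)"
      using \<alpha>cap z unfolding Q deg by simp
    then show ?thesis using R.beta_cap[OF C \<gamma> z(1)] by (simp add: z(2))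
  qed
  then show ?thesis using \<alpha> h \<alpha>h unfolding Q by blast
qed

end
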